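(* Let $\beta\in(1/2,1)$ and $0\le\zeta\le n/2$. There is a constant $C>0$ such that for every $f\in\mathcal S'(\mathbb R^n)$ and every $r>0$, $$r^{\zeta}\bigl\|e^{-r^{2\beta}(-\triangle)^\beta}f\bigr\|_{L^\infty(\mathbb R^n)}\le C\sup_{x_0\in\mathbb R^n}\left(r^{-n}\int_0^{r^{2\beta}}\int_{|x-x_0|\le r}s^{\frac{\zeta-\beta}{\beta}}\bigl|e^{-s(-\triangle)^\beta}f(x)\bigr|^2\,dx\,ds\right)^{1/2};$$ that is, $BMO^{-\zeta}(\mathbb R^n)\hookrightarrow\dot B^{-\zeta}_{\infty,\infty}(\mathbb R^n)$ (continuous embedding).
   Context: $e^{-t(-\triangle)^\beta}f=K_t^\beta*f$ with $\widehat{K_t^\beta}(\xi)=e^{-t|\xi|^{2\beta}}$. For $\beta\in(1/2,1)$ and $0\le\zeta\le n/2$, $BMO^{-\zeta}(\mathbb R^n)$ is the set of $f$ (tempered distributions) with $$\|f\|^2_{BMO^{-\zeta}(\mathbb R^n)}=\sup_{x\in\mathbb R^n,\,r\in(0,\infty)}r^{-n}\int_0^{r^{2\beta}}\int_{|y-x|<r}t^{\frac{\zeta-\beta}{\beta}}\bigl|e^{-t(-\triangle)^\beta}f(y)\bigr|^2\,dy\,dt<\infty.$$ Homogeneous Besov space: with $\phi\in C_0^\infty$ supported in $\{1/2\le|\xi|\le2\}$, $\sum_{j\in\mathbb Z}\phi(2^{-j}\xi)=1$ for $\xi\neq0$, $\widehat{\triangle_jf}(\xi)=\phi(2^{-j}\xi)\widehat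 f(\xi)$, one sets $\|f\|_{\dot B^s_{\infty,\infty}(\mathbb{R}^n)}=\sup_{j\in\mathbb Z}2^{sj}\|\triangle_jf\|_{L^\infty}$ and $\dot B^s_{\infty,\infty}(\mathbb R^n)=\{f\in\mathcal S'(\mathbb R^n):\|f\|_{\dot B^s_{\infty,\infty}}<\infty\}$.
   Formalization: "Every f in S'" is read as every f in S' for which the convolution K_t^β * f exists for all t>0 (K_t^β(x-·)f is an integrable distribution for every x); it does not exist for all of S', e.g. f=|x|^2, since K_t^β decays only like |x|^{-n-2β}. *)

theory Defs
  imports "HOL-Probability.Essential_Supremum"
begin

section \<open>Smooth, test and Schwartz functions\<close>

primrec iter_deriv :: "'a::euclidean_space list \<Rightarrow> ('a \<Rightarrow> complex) \<Rightarrow> 'a \<Rightarrow> complex" where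
  "iter_deriv [] f = f"
| "iter_deriv (v # vs) f = (\<lambda>x. frechet_derivative (iter_deriv vs f) (at x) v)"

text \<open>Lists of basis vectors play the role of multi-indices \<open>\<alpha>\<close> with \<open>|\<alpha>| \<le> m\<close>.\<close>
definition multi_indices :: "nat \<Rightarrow> 'a::euclidean_space list set" where
  "multi_indices m = {vs. set vs \<subseteq> Basis \<and> length vs \<le> m}"

definition smooth :: "('a::euclidean_space \<Rightarrow> complex) \<Rightarrow> bool" where
  "smooth f \<longleftrightarrow> (\<forall>m. \<forall>vs\<in>multi_indices m. \<forall>x. iter_deriv vs f differentiable (at x))"

definition test_fun :: "('a::euclidean_space \<Rightarrow> complex) \<Rightarrow> bool" where
  "test_fun f \<longleftrightarrow> smooth f \<and> bounded {x. f x \<noteq> 0}"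

definition schwartz :: "('a::euclidean_space \<Rightarrow> complex) \<Rightarrow> bool" where
  "schwartz f \<longleftrightarrow> smooth f \<and>
     (\<forall>N. \<forall>vs\<in>multi_indices N. \<exists>M. \<forall>x. (1 + norm x) ^ N * norm (iter_deriv vs f x) \<le> M)"

definition schwartz_norm :: "nat \<Rightarrow> ('a::euclidean_space \<Rightarrow> complex) \<Rightarrow> real" where
  "schwartz_norm N f =
     (SUP (x, vs)\<in>UNIV \<times> multi_indices N. (1 + norm x) ^ N * norm (iter_deriv vs f x))"

definition C_norm :: "nat \<Rightarrow> ('a::euclidean_space \<Rightarrow> complex) \<Rightarrow> real" where
  "C_norm m f = (SUP (x, vs)\<in>UNIV \<times> multi_indices m. norm (iter_deriv vs f x))"

section \<open>Tempered distributions\<close>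

text \<open>A tempered distribution is represented by a functional on all functions; only its values
  on Schwartz functions are meaningful, and only these are ever used.\<close>
type_synonym 'a functional = "('a \<Rightarrow> complex) \<Rightarrow> complex"

definition tempered :: "'a::euclidean_space functional \<Rightarrow> bool" where
  "tempered T \<longleftrightarrow>
     (\<forall>\<psi> \<theta>. schwartz \<psi> \<longrightarrow> schwartz \<theta> \<longrightarrow> T (\<lambda>x. \<psi> x + \<theta> x) = T \<psi> + T \<theta>) \<and>
     (\<forall>c \<psi>. schwartz \<psi> \<longrightarrow> T (\<lambda>x. c * \<psi> x) = c * T \<psi>) \<and>
     (\<exists>C N. \<forall>\<psi>. schwartz \<psi> \<longrightarrow> norm (T \<psi>) \<le> C * schwartz_norm N \<psi>)"

definition dist_mult :: "('a \<Rightarrow> complex) \<Rightarrow> 'a functional \<Rightarrow> 'a functional" where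
  "dist_mult h T = (\<lambda>\<psi>. T (\<lambda>x. h x * \<psi> x))"

definition fourier :: "('a::euclidean_space \<Rightarrow> complex) \<Rightarrow> 'a \<Rightarrow> complex" where
  "fourier g \<xi> = (LINT x|lborel. cis (- (x \<bullet> \<xi>)) * g x)"

definition inv_fourier :: "('a::euclidean_space \<Rightarrow> complex) \<Rightarrow> 'a \<Rightarrow> complex" where
  "inv_fourier g x = (LINT \<xi>|lborel. cis (x \<bullet> \<xi>) * g \<xi>) / (2 * pi) ^ DIM('a)"

definition dist_fourier :: "'a::euclidean_space functional \<Rightarrow> 'a functional" where
  "dist_fourier T = (\<lambda>\<psi>. T (fourier \<psi>))"

definition dist_inv_fourier :: "'a::euclidean_space functional \<Rightarrow> 'a functional" where
  "dist_inv_fourier T = (\<lambda>\<psi>. T (inv_fourier \<psi>))"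

definition Linf_norm :: "('a::euclidean_space \<Rightarrow> complex) \<Rightarrow> ennreal" where
  "Linf_norm g = esssup lborel (\<lambda>x. ennreal (norm (g x)))"

text \<open>The value is \<open>\<infinity>\<close> if \<open>T\<close> is not given by a bounded function. Candidates \<open>g\<close> that are not
  essentially bounded contribute \<open>\<infinity>\<close> to the infimum, so integrability of \<open>g x * \<psi> x\<close> is
  automatic for all candidates that matter.\<close>
definition dist_Linf_norm :: "'a::euclidean_space functional \<Rightarrow> ennreal" where
  "dist_Linf_norm T =
     (INF g\<in>{g \<in> borel_measurable lborel. \<forall>\<psi>. schwartz \<psi> \<longrightarrow> T \<psi> = (LINT x|lborel. g x * \<psi> x)}.
        Linf_norm g)"

section \<open>Convolution of a tempered distribution with a smooth function\<close>

text \<open>Schwartz's integrable distributions (the dual of the space of smooth functions all of whose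
  derivatives vanish at infinity); they have a total mass, obtained by testing
  against any sequence of test functions converging boundedly to \<open>1\<close>.\<close>
definition integrable_dist :: "'a::euclidean_space functional \<Rightarrow> bool" where
  "integrable_dist T \<longleftrightarrow> (\<exists>C m. \<forall>\<eta>. test_fun \<eta> \<longrightarrow> norm (T \<eta>) \<le> C * C_norm m \<eta>)"

definition approx_unit :: "(nat \<Rightarrow> 'a::euclidean_space \<Rightarrow> complex) \<Rightarrow> bool" where
  "approx_unit \<eta> \<longleftrightarrow>
     (\<forall>k. test_fun (\<eta> k)) \<and>
     (\<forall>R. \<forall>\<^sub>F k in sequentially. \<forall>x\<in>cball 0 R. \<eta> k x = 1) \<and>
     (\<forall>m. \<exists>M. \<forall>k. C_norm m (\<eta> k) \<le> M)"

definition dist_total :: "'a::euclidean_space functional \<Rightarrow> complex" where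
  "dist_total T = (THE L. \<forall>\<eta>. approx_unit \<eta> \<longrightarrow> (\<lambda>k. T (\<eta> k)) \<longlonglongrightarrow> L)"

text \<open>\<open>(h * T)(x) = \<langle>T, h(x - \<cdot>)\<rangle>\<close>. For \<open>h\<close> not a Schwartz function this is the total mass of the
  product \<open>h(x - \<cdot>) T\<close>, which makes sense only if that product is integrable.\<close>
definition convolvable :: "('a::euclidean_space \<Rightarrow> complex) \<Rightarrow> 'a functional \<Rightarrow> bool" where
  "convolvable h T \<longleftrightarrow> (\<forall>x. integrable_dist (dist_mult (\<lambda>y. h (x - y)) T))"

definition dist_conv :: "('a::euclidean_space \<Rightarrow> complex) \<Rightarrow> 'a functional \<Rightarrow> 'a \<Rightarrow> complex" where
  "dist_conv h T x = dist_total (dist_mult (\<lambda>y. h (x - y)) T)"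

section \<open>Fractional heat semigroup, BMO and Besov norms\<close>

definition heat_kernel :: "real \<Rightarrow> real \<Rightarrow> 'a::euclidean_space \<Rightarrow> complex" where
  "heat_kernel \<beta> t = inv_fourier (\<lambda>\<xi>. complex_of_real (exp (- t * norm \<xi> powr (2 * \<beta>))))"

text \<open>The symbol \<open>exp (- t |\<xi>|^(2\<beta>))\<close> is not smooth at the origin, so the kernel decays only
  polynomially and the convolution does not exist for every tempered distribution
  (e.g. it does not for polynomials of degree 2).\<close>
definition heat_defined :: "real \<Rightarrow> 'a::euclidean_space functional \<Rightarrow> bool" where
  "heat_defined \<beta> f \<longleftrightarrow> (\<forall>t>0. convolvable (heat_kernel \<beta> t) f)"

definition frac_heat :: "real \<Rightarrow> real \<Rightarrow> 'a::euclidean_space functional \<Rightarrow> 'a \<Rightarrow> complex" where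
  "frac_heat \<beta> t f = dist_conv (heat_kernel \<beta> t) f"

definition ennsqrt :: "ennreal \<Rightarrow> ennreal" where
  "ennsqrt a = (if a = \<infinity> then \<infinity> else ennreal (sqrt (enn2real a)))"

definition bmo_norm :: "real \<Rightarrow> real \<Rightarrow> 'a::euclidean_space functional \<Rightarrow> ennreal" where
  "bmo_norm \<beta> \<zeta> f = ennsqrt (SUP (x, r)\<in>UNIV \<times> {0<..}.
     ennreal (r powr - real DIM('a)) *
     (\<integral>\<^sup>+ t \<in> {0<..<r powr (2 * \<beta>)}. (\<integral>\<^sup>+ y \<in> ball x r.
        ennreal (t powr ((\<zeta> - \<beta>) / \<beta>) * (norm (frac_heat \<beta> t f y))\<^sup>2) \<partial>lborel) \<partial>lborel))"

definition bmo_space :: "real \<Rightarrow> real \<Rightarrow> 'a::euclidean_space functional set" where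
  "bmo_space \<beta> \<zeta> = {f. tempered f \<and> heat_defined \<beta> f \<and> bmo_norm \<beta> \<zeta> f < \<infinity>}"

definition dyadic_partition :: "('a::euclidean_space \<Rightarrow> complex) \<Rightarrow> bool" where
  "dyadic_partition \<phi> \<longleftrightarrow>
     smooth \<phi> \<and> (\<forall>\<xi>. \<phi> \<xi> \<noteq> 0 \<longrightarrow> 1 / 2 \<le> norm \<xi> \<and> norm \<xi> \<le> 2) \<and>
     (\<forall>\<xi>. \<xi> \<noteq> 0 \<longrightarrow> ((\<lambda>j::int. \<phi> ((2 powi (- j)) *\<^sub>R \<xi>)) has_sum 1) UNIV)"

definition dyadic_block ::
  "('a::euclidean_space \<Rightarrow> complex) \<Rightarrow> int \<Rightarrow> 'a functional \<Rightarrow> 'a functional" where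
  "dyadic_block \<phi> j f =
     dist_inv_fourier (dist_mult (\<lambda>\<xi>. \<phi> ((2 powi (- j)) *\<^sub>R \<xi>)) (dist_fourier f))"

definition besov_norm ::
  "('a::euclidean_space \<Rightarrow> complex) \<Rightarrow> real \<Rightarrow> 'a functional \<Rightarrow> ennreal" where
  "besov_norm \<phi> s f = (SUP j::int. ennreal (2 powr (s * real_of_int j)) * dist_Linf_norm (dyadic_block \<phi> j f))"

definition besov_space ::
  "('a::euclidean_space \<Rightarrow> complex) \<Rightarrow> real \<Rightarrow> 'a functional set" where
  "besov_space \<phi> s = {f. tempered f \<and> besov_norm \<phi> s f < \<infinity>}"

end

theory Submission
  imports Defs "HOL-Probability.Probability"
begin

text \<open>
  Write \<open>K t\<close> for the heat kernel, \<open>n\<close> for the dimension and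
  \<open>w x = (1 + norm x) powr - (n + 2 * \<beta>)\<close>.

  \<^bold>\<open>The kernel.\<close> Let \<open>N\<close> be the one-sided stable law, whose Laplace transform is
  \<open>exp (- \<nu> powr \<beta>)\<close>; it arises as a weak limit of rescaled sums of independent Sibuya variables
  (\<open>stable_exists\<close>). Substituting \<open>\<nu> = t powr (1 / \<beta>) * (norm \<xi>)\<^sup>2\<close> shows that \<open>K t\<close> is a mixture
  of Gaussians over \<open>N\<close> (\<open>heat_kernel_eq_kern\<close>). Hence \<open>K t\<close> is a smooth probability density with
  \<open>K s * K t = K (s + t)\<close>. Comparing the mixture pointwise with exponentials, whose integrals are
  known, gives \<open>c * w \<le> K 1\<close> and \<open>|\<partial>\<^sup>\<alpha> (K t)| \<le> C * w\<close> for all orders of differentiation.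

  \<^bold>\<open>The distribution.\<close> By hypothesis the product of \<open>f\<close> with \<open>K 1\<close> is an integrable distribution.
  Because \<open>K 1\<close> is bounded below by \<open>w\<close>, one can divide by it: \<open>|f h|\<close> is bounded by the
  supremum of finitely many \<open>|\<partial>\<^sup>\<alpha> h| / w\<close> (\<open>f_bound_ex\<close>), and a gliding hump argument shows that the
  part of \<open>h\<close> far away from the origin contributes little (\<open>f_tail\<close>). So \<open>f\<close> extends to all
  smooth \<open>h\<close> of decay \<open>w\<close>; the extension \<open>mass h\<close> is the total mass of the product of \<open>h\<close> and \<open>f\<close>,
  and the heat extension of \<open>f\<close> is \<open>u s y = mass (\<lambda>z. K s (z - y))\<close>. Approximating integrals by sums,
  then using duality to see that \<open>|u s| * w\<close> is integrable, one obtains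
  \<open>\<integral>y. \<theta> y * u s y = mass (\<theta> * K s)\<close> for measurable \<open>\<theta>\<close> of decay \<open>w\<close> (\<open>pairing\<close>). With \<open>\<theta>\<close>
  a translate of \<open>K (t - s)\<close> this is the semigroup law \<open>u t = K (t - s) * u s\<close>.

  \<^bold>\<open>The pointwise estimate.\<close> Put \<open>t = r powr (2 * \<beta>)\<close>. By Jensen's inequality \<open>|u t x|\<^sup>2\<close> is at most
  the average of \<open>|u s|\<^sup>2\<close> against \<open>K (t - s) (x - y)\<close>. For \<open>t / 4 < s < t / 2\<close> that kernel is
  dominated by an integrable superposition of normalised indicators of balls of radius \<open>r\<close>
  (\<open>kern_average\<close>), so integration over these \<open>s\<close> with the weight \<open>s powr (\<zeta> / \<beta> - 1)\<close> leaves
  the local energies of the right-hand side (\<open>energy_estimate\<close>).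

  \<^bold>\<open>The Besov norm.\<close> For \<open>r = 1 / 2 ^ j\<close> the multiplier \<open>\<phi> (r * \<xi>)\<close> is the product of the heat symbol
  at time \<open>r powr (2 * \<beta>)\<close> and of a dilate of the test function \<open>\<phi> \<xi> * exp (norm \<xi> powr (2 * \<beta>))\<close>.
  So the block \<open>\<Delta>\<^sub>j f\<close> is the convolution of \<open>u (r powr (2 * \<beta>))\<close> with an integrable kernel whose
  integral norm is the same for all \<open>j\<close>, and the pointwise estimate at the scale \<open>r\<close> finishes the proof.
\<close>

section \<open>Partial derivatives\<close>

definition pd :: "'a::euclidean_space \<Rightarrow> ('a \<Rightarrow> complex) \<Rightarrow> 'a \<Rightarrow> complex" where
  "pd b f x = frechet_derivative f (at x) b"

lemma pd_eq:
  assumes "(f has_derivative D) (at x)"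
  shows "pd b f x = D b"
  using frechet_derivative_at[OF assms] by (simp add: pd_def)

text \<open>Second-order Taylor bounds survive integration, so this criterion yields the derivatives of
  all integrals with a parameter below: mixtures, convolutions and Fourier transforms.\<close>
lemma has_derivative_quadratic_remainder:
  fixes f :: "'a::real_normed_vector \<Rightarrow> 'b::real_normed_vector"
  assumes D: "bounded_linear D"
    and le: "\<And>y. y \<in> S \<Longrightarrow> norm (f y - f z - D (y - z)) \<le> C * (norm (y - z))\<^sup>2"
  shows "(f has_derivative D) (at z within S)"
  unfolding has_derivative_within_alt
proof (intro conjI allI impI D)
  fix e :: real assume e: "0 < e"
  have "norm (f y - f z - D (y - z)) \<le> e * norm (y - z)" if y: "y \<in> S" "norm (y - z) < e / (\<bar>C\<bar> + 1)" for y
  proof -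
    have "norm (f y - f z - D (y - z)) \<le> C * norm (y - z) * norm (y - z)"
      using le[OF y(1)] by (simp add: power2_eq_square mult.assoc)
    also have "C * norm (y - z) \<le> (\<bar>C\<bar> + 1) * (e / (\<bar>C\<bar> + 1))"
      using y e by (intro mult_mono) auto
    also have "\<dots> = e" by simp
    finally show ?thesis by (simp add: mult_right_mono)
  qed
  then show "\<exists>d>0. \<forall>y\<in>S. norm (y - z) < d \<longrightarrow> norm (f y - f z - D (y - z)) \<le> e * norm (y - z)"
    using e by (intro exI[of _ "e / (\<bar>C\<bar> + 1)"]) auto
qed

lemma pd_eq_coefficient:
  fixes f :: "'a::euclidean_space \<Rightarrow> complex"
  assumes "(f has_derivative (\<lambda>h. \<Sum>c\<in>Basis. of_real (h \<bullet> c) * d c)) (at x)" "b \<in> Basis"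
  shows "pd b f x = d b"
proof -
  have "pd b f x = (\<Sum>c\<in>Basis. of_real (b \<bullet> c) * d c)" by (rule pd_eq[OF assms(1)])
  also have "\<dots> = (\<Sum>c\<in>Basis. if c = b then d c else 0)"
    using assms(2) by (intro sum.cong) (auto simp: inner_Basis)
  finally show ?thesis using assms(2) by simp
qed

lemma pd_cong_open:
  assumes "open U" "x \<in> U" "\<And>y. y \<in> U \<Longrightarrow> f y = g y"
  shows "pd b f x = pd b g x"
proof -
  have "(f has_derivative D) (at x) \<longleftrightarrow> (g has_derivative D) (at x)" for D
    using has_derivative_transform_within_open[OF _ assms(1,2)] assms(3) by metis
  then show ?thesis
    by (simp add: pd_def frechet_derivative_def)
qed

lemma differentiable_cong_open:
  assumes "f differentiable (at x)" "open U" "x \<in> U" "\<And>y. y \<in> U \<Longrightarrow> f y = g y"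
  shows "g differentiable (at x)"
  using assms has_derivative_transform_within_open[OF _ assms(2,3)]
  unfolding differentiable_def by metis

lemma differentiable_has_derivative_pd:
  assumes "f differentiable (at x)"
  shows "(f has_derivative (\<lambda>h. \<Sum>b\<in>Basis. of_real (h \<bullet> b) * pd b f x)) (at x)"
proof -
  have *: "(f has_derivative frechet_derivative f (at x)) (at x)"
    using assms by (simp add: frechet_derivative_works)
  interpret linear "frechet_derivative f (at x)"
    using * by (rule has_derivative_linear)
  have "frechet_derivative f (at x) h = (\<Sum>b\<in>Basis. of_real (h \<bullet> b) * pd b f x)" for h
  proof -
    have "frechet_derivative f (at x) h = frechet_derivative f (at x) (\<Sum>b\<in>Basis. (h \<bullet> b) *\<^sub>R b)"
      by (simp add: euclidean_representation)
    also have "\<dots> = (\<Sum>b\<in>Basis. of_real (h \<bullet> b) * pd b f x)"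
      by (simp add: sum scale pd_def scaleR_conv_of_real)
    finally show ?thesis .
  qed
  then have "frechet_derivative f (at x) = (\<lambda>h. \<Sum>b\<in>Basis. of_real (h \<bullet> b) * pd b f x)"
    by (rule ext)
  with * show ?thesis by simp
qed

lemma pd_add:
  assumes "f differentiable (at x)" "g differentiable (at x)"
  shows "pd b (\<lambda>x. f x + g x) x = pd b f x + pd b g x"
  using assms unfolding frechet_derivative_works
  by (subst pd_eq[OF has_derivative_add[of f _ _ g]]) (auto simp: pd_def)

lemma pd_mult:
  assumes "f differentiable (at x)" "g differentiable (at x)"
  shows "pd b (\<lambda>x. f x * g x) x = pd b f x * g x + f x * pd b g x"
  using assms unfolding frechet_derivative_works
  by (subst pd_eq[OF has_derivative_mult[of f _ x _ g]]) (auto simp: pd_def)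

lemma pd_const [simp]: "pd b (\<lambda>x. c) = (\<lambda>x. 0)"
  by (rule ext) (subst pd_eq[of _ "\<lambda>_. 0"], auto)

lemma pd_cmult:
  assumes "f differentiable (at x)"
  shows "pd b (\<lambda>x. c * f x) x = c * pd b f x"
  using pd_mult[of "\<lambda>_. c" x f b] assms by simp

lemma pd_inverse:
  assumes "f differentiable (at x)" "f x \<noteq> 0"
  shows "pd b (\<lambda>x. inverse (f x)) x = - (pd b f x * (inverse (f x) * inverse (f x)))"
  using pd_eq[OF Deriv.has_derivative_inverse[OF assms(2) assms(1)[unfolded frechet_derivative_works]]]
  by (simp add: pd_def mult_ac)

lemma pd_exp:
  assumes "f differentiable (at x)"
  shows "pd b (\<lambda>x. exp (f x)) x = exp (f x) * pd b f x"
proof -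
  have "(exp has_derivative (\<lambda>h. exp (f x) * h)) (at (f x))"
    using DERIV_exp[of "f x"] by (simp add: has_field_derivative_def)
  from pd_eq[OF has_derivative_compose[OF assms[unfolded frechet_derivative_works] this]]
  show ?thesis by (simp add: pd_def)
qed

lemma differentiable_exp:
  fixes f :: "'a::euclidean_space \<Rightarrow> complex"
  assumes "f differentiable (at x)"
  shows "(\<lambda>x. exp (f x)) differentiable (at x)"
proof -
  have "(exp has_derivative (\<lambda>h. exp (f x) * h)) (at (f x))"
    using DERIV_exp[of "f x"] by (simp add: has_field_derivative_def)
  then show ?thesis
    using assms has_derivative_compose unfolding differentiable_def by blast
qed

lemma affine_has_derivative:
  assumes "(f has_derivative D) (at (c *\<^sub>R x + v))"
  shows "((\<lambda>x. f (c *\<^sub>R x + v)) has_derivative (\<lambda>h. D (c *\<^sub>R h))) (at x)"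
proof -
  have "((\<lambda>x. c *\<^sub>R x + v) has_derivative (\<lambda>h. c *\<^sub>R h)) (at x)"
    by (auto intro!: derivative_eq_intros)
  from has_derivative_compose[OF this assms] show ?thesis .
qed

lemma pd_affine:
  assumes "f differentiable (at (c *\<^sub>R x + v))"
  shows "pd b (\<lambda>x. f (c *\<^sub>R x + v)) x = of_real c * pd b f (c *\<^sub>R x + v)"
proof -
  have *: "(f has_derivative frechet_derivative f (at (c *\<^sub>R x + v))) (at (c *\<^sub>R x + v))"
    using assms by (simp add: frechet_derivative_works)
  show ?thesis
    using linear_scale[OF has_derivative_linear[OF *]]
    by (subst pd_eq[OF affine_has_derivative[OF *]]) (simp add: pd_def scaleR_conv_of_real)
qed

section \<open>Iterated differentiability and smooth functions\<close>

text \<open>Differentiability of order \<open>m\<close> in a recursive form that suits induction. The open set is a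
  parameter because powers of \<open>norm \<xi>\<close> are smooth only away from the origin.\<close>
primrec cm_on :: "nat \<Rightarrow> 'a::euclidean_space set \<Rightarrow> ('a \<Rightarrow> complex) \<Rightarrow> bool" where
  "cm_on 0 U f = True"
| "cm_on (Suc m) U f = ((\<forall>x\<in>U. f differentiable (at x)) \<and> (\<forall>b\<in>Basis. cm_on m U (pd b f)))"

lemma cm_on_SucD: "cm_on (Suc m) U f \<Longrightarrow> cm_on m U f"
  by (induction m arbitrary: f) auto

lemma cm_on_cong_open:
  assumes "open U" "\<And>x. x \<in> U \<Longrightarrow> f x = g x" "cm_on m U f"
  shows "cm_on m U g"
  using assms(2,3)
proof (induction m arbitrary: f g)
  case (Suc m)
  have "cm_on m U (pd b g)" if "b \<in> Basis" for b
  proof (rule Suc.IH[of "pd b f"])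
    show "pd b f x = pd b g x" if "x \<in> U" for x
      using pd_cong_open[OF assms(1) that] Suc.prems(1) by blast
  qed (use Suc.prems that in auto)
  moreover have "g differentiable (at x)" if "x \<in> U" for x
    using differentiable_cong_open[OF _ assms(1) that, of f] Suc.prems that by auto
  ultimately show ?case by auto
qed auto

lemma cm_on_UN:
  assumes "\<And>x. x \<in> V \<Longrightarrow> \<exists>U. x \<in> U \<and> cm_on m U f"
  shows "cm_on m V f"
  using assms
proof (induction m arbitrary: f)
  case (Suc m)
  then show ?case
    by (metis cm_on.simps(2))
qed auto

lemma cm_on_subset: "cm_on m U f \<Longrightarrow> V \<subseteq> U \<Longrightarrow> cm_on m V f"
  by (induction m arbitrary: f) auto

lemma cm_on_const: "cm_on m U (\<lambda>_. c)"
  by (induction m arbitrary: c) auto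

lemma cm_on_add:
  assumes "open U" "cm_on m U f" "cm_on m U g"
  shows "cm_on m U (\<lambda>x. f x + g x)"
  using assms(2,3)
proof (induction m arbitrary: f g)
  case (Suc m)
  have "cm_on m U (pd b (\<lambda>x. f x + g x))" if "b \<in> Basis" for b
    by (rule cm_on_cong_open[OF assms(1) _ Suc.IH[of "pd b f" "pd b g"]])
      (use Suc.prems that in \<open>auto simp: pd_add\<close>)
  then show ?case using Suc.prems by auto
qed auto

lemma cm_on_mult:
  assumes "open U" "cm_on m U f" "cm_on m U g"
  shows "cm_on m U (\<lambda>x. f x * g x)"
  using assms(2,3)
proof (induction m arbitrary: f g)
  case (Suc m)
  have "cm_on m U (pd b (\<lambda>x. f x * g x))" if "b \<in> Basis" for b
    by (rule cm_on_cong_open[OF assms(1) _ cm_on_add[OF assms(1)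
          Suc.IH[of "pd b f" g] Suc.IH[of f "pd b g"]]])
      (use Suc.prems that cm_on_SucD[OF Suc.prems(1)] cm_on_SucD[OF Suc.prems(2)] in \<open>auto simp: pd_mult\<close>)
  then show ?case using Suc.prems by auto
qed auto

lemma cm_on_inverse:
  assumes "open U" "cm_on m U f" "\<And>x. x \<in> U \<Longrightarrow> f x \<noteq> 0"
  shows "cm_on m U (\<lambda>x. inverse (f x))"
  using assms(2)
proof (induction m)
  case (Suc m)
  have 1: "cm_on m U (\<lambda>x. inverse (f x))"
    using Suc.IH Suc.prems cm_on_SucD by blast
  have "cm_on m U (pd b (\<lambda>x. inverse (f x)))" if "b \<in> Basis" for b
    by (rule cm_on_cong_open[OF assms(1) _ cm_on_mult[OF assms(1) cm_on_const[of m U "-1"] cm_on_mult[OF assms(1) _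
         cm_on_mult[OF assms(1) 1 1], of "pd b f"]]])
      (use Suc.prems that assms(3) in \<open>auto simp: pd_inverse\<close>)
  then show ?case using Suc.prems assms(3) by (auto intro!: differentiable_inverse)
qed auto

lemma cm_on_exp:
  assumes "open U" "cm_on m U f"
  shows "cm_on m U (\<lambda>x. exp (f x))"
  using assms(2)
proof (induction m)
  case (Suc m)
  have 1: "cm_on m U (\<lambda>x. exp (f x))"
    using Suc.IH Suc.prems cm_on_SucD by blast
  have "cm_on m U (pd b (\<lambda>x. exp (f x)))" if "b \<in> Basis" for b
    by (rule cm_on_cong_open[OF assms(1) _ cm_on_mult[OF assms(1) 1, of "pd b f"]])
      (use Suc.prems that in \<open>auto simp: pd_exp\<close>)
  then show ?case using Suc.prems by (auto intro!: differentiable_exp)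
qed auto

lemma inner_has_derivative_complex:
  "((\<lambda>x. complex_of_real (x \<bullet> v)) has_derivative (\<lambda>h. complex_of_real (h \<bullet> v))) (at x)"
  by (auto intro!: derivative_eq_intros)

lemma cm_on_inner: "cm_on m U (\<lambda>x. complex_of_real (x \<bullet> v))"
proof (cases m)
  case (Suc k)
  have "pd b (\<lambda>x. complex_of_real (x \<bullet> v)) = (\<lambda>x. complex_of_real (b \<bullet> v))" for b
    by (rule ext) (rule pd_eq[OF inner_has_derivative_complex])
  then show ?thesis
    using inner_has_derivative_complex[of v] Suc by (auto simp: cm_on_const differentiable_def)
qed auto

lemma cm_on_affine:
  assumes "cm_on m UNIV f"
  shows "cm_on m UNIV (\<lambda>x. f (c *\<^sub>R x + v))"
  using assms
proof (induction m arbitrary: f)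
  case (Suc m)
  have "cm_on m UNIV (pd b (\<lambda>x. f (c *\<^sub>R x + v)))" if "b \<in> Basis" for b
    by (rule cm_on_cong_open[OF open_UNIV _ cm_on_mult[OF open_UNIV cm_on_const[of m UNIV "of_real c"]
       Suc.IH[of "pd b f"]]])
      (use Suc.prems that in \<open>auto simp: pd_affine\<close>)
  moreover have "(\<lambda>x. f (c *\<^sub>R x + v)) differentiable (at x)" for x
    using affine_has_derivative[of f _ c x v] Suc.prems unfolding differentiable_def by (metis UNIV_I cm_on.simps(2) differentiable_def)
  ultimately show ?case by auto
qed auto

lemma iter_deriv_append: "iter_deriv (us @ vs) f = iter_deriv us (iter_deriv vs f)"
  by (induction us) auto

lemma iter_deriv_snoc: "iter_deriv (vs @ [b]) f = iter_deriv vs (pd b f)"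
  by (simp add: iter_deriv_append pd_def[abs_def])

lemma cm_on_iff_iter_deriv:
  "cm_on m UNIV f \<longleftrightarrow> (\<forall>vs x. set vs \<subseteq> Basis \<and> length vs < m \<longrightarrow> iter_deriv vs f differentiable (at x))"
proof (induction m arbitrary: f)
  case (Suc m)
  have "(\<forall>vs x. set vs \<subseteq> Basis \<and> length vs < Suc m \<longrightarrow> iter_deriv vs f differentiable (at x)) \<longleftrightarrow>
     (\<forall>x. f differentiable (at x)) \<and>
     (\<forall>b\<in>Basis. \<forall>vs x. set vs \<subseteq> Basis \<and> length vs < m \<longrightarrow> iter_deriv (vs @ [b]) f differentiable (at x))"
    (is "?L \<longleftrightarrow> ?R")
  proof
    assume L: ?L
    have "f differentiable (at x)" for x
      using L[rule_format, of "[]"] by simp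
    then show ?R using L by auto
  next
    assume R: ?R
    show ?L
    proof (intro allI impI)
      fix vs x assume vs: "set vs \<subseteq> (Basis :: 'a set) \<and> length vs < Suc m"
      show "iter_deriv vs f differentiable (at x)"
        using R vs by (cases vs rule: rev_cases) auto
    qed
  qed
  then show ?case
    using Suc.IH by (simp add: iter_deriv_snoc)
qed auto

lemma smooth_iff_cm_on: "smooth f \<longleftrightarrow> (\<forall>m. cm_on m UNIV f)"
  unfolding smooth_def cm_on_iff_iter_deriv multi_indices_def
  by (auto simp: less_Suc_eq_le)

lemma smooth_differentiable: "smooth f \<Longrightarrow> f differentiable (at x)"
  unfolding smooth_iff_cm_on by (metis cm_on.simps(2) UNIV_I)

lemma smooth_pd: "smooth f \<Longrightarrow> b \<in> Basis \<Longrightarrow> smooth (pd b f)"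
  unfolding smooth_iff_cm_on by (metis cm_on.simps(2))

lemma smooth_continuous_on: "smooth f \<Longrightarrow> continuous_on S f"
  by (meson continuous_at_imp_continuous_on differentiable_imp_continuous_within smooth_differentiable)

lemma smooth_measurable: "smooth f \<Longrightarrow> f \<in> borel_measurable borel"
  using smooth_continuous_on borel_measurable_continuous_onI by blast

lemma smooth_add: "smooth f \<Longrightarrow> smooth g \<Longrightarrow> smooth (\<lambda>x. f x + g x)"
  by (simp add: smooth_iff_cm_on cm_on_add)

lemma smooth_mult: "smooth f \<Longrightarrow> smooth g \<Longrightarrow> smooth (\<lambda>x. f x * g x)"
  by (simp add: smooth_iff_cm_on cm_on_mult)

lemma smooth_const: "smooth (\<lambda>x. c)"
  by (simp add: smooth_iff_cm_on cm_on_const)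

lemma smooth_cmult: "smooth f \<Longrightarrow> smooth (\<lambda>x. c * f x)"
  by (simp add: smooth_mult smooth_const)

lemma smooth_diff: "smooth f \<Longrightarrow> smooth g \<Longrightarrow> smooth (\<lambda>x. f x - g x)"
  using smooth_add[of f "\<lambda>x. -1 * g x"] smooth_cmult[of g "-1"] by simp

lemma smooth_inverse: "smooth f \<Longrightarrow> (\<And>x. f x \<noteq> 0) \<Longrightarrow> smooth (\<lambda>x. inverse (f x))"
  by (simp add: smooth_iff_cm_on cm_on_inverse)

lemma smooth_inner: "smooth (\<lambda>x. complex_of_real (x \<bullet> v))"
  by (simp add: smooth_iff_cm_on cm_on_inner)

lemma smooth_affine: "smooth f \<Longrightarrow> smooth (\<lambda>x. f (c *\<^sub>R x + v))"
  by (simp add: smooth_iff_cm_on cm_on_affine)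

lemma smooth_local:
  assumes "\<And>x. \<exists>U g. open U \<and> x \<in> U \<and> smooth g \<and> (\<forall>y\<in>U. g y = f y)"
  shows "smooth f"
  unfolding smooth_iff_cm_on
proof
  fix m
  show "cm_on m UNIV f"
  proof (rule cm_on_UN)
    fix x
    obtain U g where "open U" "x \<in> U" "smooth g" "\<forall>y\<in>U. g y = f y"
      using assms by blast
    then show "\<exists>U. x \<in> U \<and> cm_on m U f"
      using cm_on_cong_open[of U g f m] cm_on_subset[of m UNIV g U] by (auto simp: smooth_iff_cm_on)
  qed
qed

text \<open>For functions such as convolutions, whose derivatives are again of the same form.\<close>
lemma smooth_coinduct:
  assumes "P f" "\<And>g x. P g \<Longrightarrow> g differentiable (at x)" "\<And>g b. P g \<Longrightarrow> b \<in> Basis \<Longrightarrow> P (pd b g)"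
  shows "smooth f"
proof -
  have "cm_on m UNIV g" if "P g" for m g
    using that by (induction m arbitrary: g) (auto intro: assms)
  then show ?thesis using assms(1) by (auto simp: smooth_iff_cm_on)
qed

section \<open>Weighted bounds for all derivatives up to a given order\<close>

text \<open>One predicate for all the seminorms in use: \<open>w = 1\<close> gives the \<open>C^m\<close> norm, inverse powers of
  \<open>1 + norm x\<close> with natural exponents give the Schwartz seminorms, and the exponent \<open>n + 2 * \<beta>\<close>
  describes the heat kernel.\<close>
primrec dbound :: "nat \<Rightarrow> real \<Rightarrow> ('a::euclidean_space \<Rightarrow> real) \<Rightarrow> ('a \<Rightarrow> complex) \<Rightarrow> bool" where
  "dbound 0 A w f = (\<forall>x. norm (f x) \<le> A * w x)"
| "dbound (Suc m) A w f = ((\<forall>x. norm (f x) \<le> A * w x) \<and> (\<forall>b\<in>Basis. dbound m A w (pd b f)))"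

lemma dbound_bound: "dbound m A w f \<Longrightarrow> norm (f x) \<le> A * w x"
  by (cases m) auto

lemma dbound_pd: "dbound (Suc m) A w f \<Longrightarrow> b \<in> Basis \<Longrightarrow> dbound m A w (pd b f)"
  by auto

lemma dbound_SucD: "dbound (Suc m) A w f \<Longrightarrow> dbound m A w f"
  by (induction m arbitrary: f) auto

lemma dbound_mono_order: "dbound m A w f \<Longrightarrow> k \<le> m \<Longrightarrow> dbound k A w f"
proof (induction m)
  case (Suc m)
  then show ?case by (metis le_Suc_eq dbound_SucD)
qed auto

lemma dbound_mono:
  assumes "dbound m A w f" "\<And>x. A * w x \<le> B * v x"
  shows "dbound m B v f"
  using assms(1) by (induction m arbitrary: f) (auto intro: order_trans[OF _ assms(2)])

lemma dbound_Suc_exI: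
  assumes w: "\<And>x. 0 \<le> w x" and 0: "\<exists>A. \<forall>x. norm (f x) \<le> A * w x"
    and pd: "\<And>b. b \<in> Basis \<Longrightarrow> \<exists>A. dbound m A w (pd b f)"
  shows "\<exists>A. dbound (Suc m) A w f"
proof -
  obtain A where A: "\<And>x. norm (f x) \<le> A * w x" using 0 by blast
  obtain B where B: "\<And>b. b \<in> Basis \<Longrightarrow> dbound m (B b) w (pd b f)" using pd by metis
  let ?C = "\<bar>A\<bar> + (\<Sum>b\<in>Basis. \<bar>B b\<bar>)"
  have "dbound m ?C w (pd b f)" if "b \<in> Basis" for b
  proof (rule dbound_mono[OF B[OF that]])
    have "\<bar>B b\<bar> \<le> (\<Sum>b\<in>Basis. \<bar>B b\<bar>)" using that by (intro member_le_sum) auto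
    then have "B b \<le> ?C" using abs_ge_self[of "B b"] by (simp add: add_increasing)
    then show "B b * w x \<le> ?C * w x" for x using w by (rule mult_right_mono)
  qed
  moreover have "norm (f x) \<le> ?C * w x" for x
  proof -
    have "A \<le> ?C" using abs_ge_self[of A] by (simp add: add_increasing2 sum_nonneg)
    then show ?thesis using A[of x] mult_right_mono[OF _ w, of A ?C x] by linarith
  qed
  ultimately show ?thesis by (intro exI[of _ ?C]) auto
qed

lemma dbound_iff_iter_deriv:
  "dbound m A w f \<longleftrightarrow> (\<forall>vs\<in>multi_indices m. \<forall>x. norm (iter_deriv vs f x) \<le> A * w x)"
proof (induction m arbitrary: f)
  case (Suc m)
  have "(\<forall>vs\<in>multi_indices (Suc m). \<forall>x. norm (iter_deriv vs f x) \<le> A * w x) \<longleftrightarrow>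
     (\<forall>x. norm (f x) \<le> A * w x) \<and>
     (\<forall>b\<in>Basis. \<forall>vs\<in>multi_indices m. \<forall>x. norm (iter_deriv (vs @ [b]) f x) \<le> A * w x)"
    (is "?L \<longleftrightarrow> ?R")
  proof
    assume L: ?L
    have "norm (f x) \<le> A * w x" for x
      using L[rule_format, of "[]"] by (simp add: multi_indices_def)
    then show ?R using L by (auto simp: multi_indices_def)
  next
    assume R: ?R
    show ?L
    proof (intro ballI allI)
      fix vs x assume vs: "vs \<in> (multi_indices (Suc m) :: 'a list set)"
      show "norm (iter_deriv vs f x) \<le> A * w x"
        using R vs by (cases vs rule: rev_cases) (auto simp: multi_indices_def)
    qed
  qed
  then show ?case
    using Suc.IH by (simp add: iter_deriv_snoc)
qed (auto simp: multi_indices_def)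

text \<open>Being pointwise, the bounds do not deteriorate when functions with disjoint supports are added.\<close>
lemma dbound_local:
  assumes "\<And>x. \<exists>U g. open U \<and> x \<in> U \<and> (\<forall>y\<in>U. g y = f y) \<and> dbound m A w g"
  shows "dbound m A w f"
  using assms
proof (induction m arbitrary: f)
  case (Suc m)
  have 1: "norm (f x) \<le> A * w x" for x
    using Suc.prems[of x] dbound_bound by metis
  have 2: "dbound m A w (pd b f)" if b: "b \<in> Basis" for b
  proof (rule Suc.IH)
    fix x
    obtain U g where *: "open U" "x \<in> U" "\<forall>y\<in>U. g y = f y" "dbound (Suc m) A w g"
      using Suc.prems[of x] by blast
    show "\<exists>U g. open U \<and> x \<in> U \<and> (\<forall>y\<in>U. g y = pd b f y) \<and> dbound m A w g"
      using * b pd_cong_open[of U _ g f] by (intro exI[of _ U] exI[of _ "pd b g"]) auto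
  qed
  show ?case using 1 2 by auto
qed (metis dbound_bound dbound.simps(1))

lemma dbound_zero: "(\<And>x. 0 \<le> A * w x) \<Longrightarrow> dbound m A w (\<lambda>_. 0)"
  by (induction m) auto

lemma dbound_vanish_open:
  assumes "dbound m A w f" "open U" "\<And>x. x \<in> U \<Longrightarrow> f x = 0"
  shows "dbound m A (\<lambda>x. if x \<in> U then 0 else w x) f"
  using assms(1,3)
proof (induction m arbitrary: f)
  case (Suc m)
  have "pd b f x = 0" if "x \<in> U" for b x
    using pd_cong_open[OF assms(2) that, of f "\<lambda>_. 0" b] Suc.prems(2) by simp
  then show ?case using Suc by auto
qed auto

lemma dbound_add:
  assumes "smooth f" "smooth g" "dbound m A w f" "dbound m B w g"
  shows "dbound m (A + B) w (\<lambda>x. f x + g x)"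
  using assms
proof (induction m arbitrary: f g)
  case 0
  then show ?case by (auto simp: distrib_right intro!: norm_triangle_le add_mono)
next
  case (Suc m)
  have "pd b (\<lambda>x. f x + g x) = (\<lambda>x. pd b f x + pd b g x)" for b
    by (rule ext) (simp add: pd_add smooth_differentiable Suc.prems)
  then show ?case
    using Suc by (auto simp: distrib_right smooth_pd intro!: norm_triangle_le add_mono)
qed

text \<open>The factor \<open>2 ^ m\<close> counts the terms of the Leibniz formula.\<close>
lemma dbound_mult:
  assumes "smooth f" "smooth g" "dbound m A v f" "dbound m B w g"
  shows "dbound m (2 ^ m * A * B) (\<lambda>x. v x * w x) (\<lambda>x. f x * g x)"
  using assms
proof (induction m arbitrary: f g)
  case 0
  have "norm (f x) * norm (g x) \<le> (A * v x) * (B * w x)" for x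
    using 0 by (intro mult_mono) (auto intro: order_trans[OF norm_ge_zero] simp del: zero_le_mult_iff)
  then show ?case by (auto simp: norm_mult mult_ac)
next
  case (Suc m)
  have 0: "norm (f x) * norm (g x) \<le> (A * v x) * (B * w x)" 
    and nn: "0 \<le> (A * v x) * (B * w x)" for x
    using dbound_bound[OF Suc.prems(3), of x] dbound_bound[OF Suc.prems(4), of x]
      order_trans[OF norm_ge_zero dbound_bound[OF Suc.prems(3), of x]]
      order_trans[OF norm_ge_zero dbound_bound[OF Suc.prems(4), of x]]
    by (auto intro!: mult_mono simp: mult_nonneg_nonneg simp del: zero_le_mult_iff mult_nonneg_nonneg)
       (metis mult_nonneg_nonneg)
  have "1 * ((A * v x) * (B * w x)) \<le> 2 ^ Suc m * ((A * v x) * (B * w x))" for x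
    by (rule mult_right_mono[OF one_le_power nn]) simp
  then have 1: "norm (f x) * norm (g x) \<le> 2 ^ Suc m * A * B * (v x * w x)" for x
    using 0[of x] by (smt (verit) mult.commute mult.left_commute mult_1)
  have "pd b (\<lambda>x. f x * g x) = (\<lambda>x. pd b f x * g x + f x * pd b g x)" for b
    by (rule ext) (simp add: pd_mult smooth_differentiable Suc.prems)
  moreover have "dbound m (2 ^ m * A * B + 2 ^ m * A * B) (\<lambda>x. v x * w x) (\<lambda>x. pd b f x * g x + f x * pd b g x)"
    if b: "b \<in> Basis" for b
    using Suc.prems b dbound_SucD[OF Suc.prems(3)] dbound_SucD[OF Suc.prems(4)]
    by (intro dbound_add smooth_mult smooth_pd Suc.IH) auto
  moreover have "2 ^ m * A * B + 2 ^ m * A * B = 2 ^ Suc m * A * B" by simp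
  ultimately show ?case using 1 by (simp only: dbound.simps norm_mult) blast
qed

lemma dbound_const: "dbound m (norm c) (\<lambda>_. 1) (\<lambda>_. c)"
  by (cases m) (auto intro!: dbound_zero)

lemma dbound_cmult:
  assumes "smooth f" "dbound m A w f"
  shows "dbound m (norm c * A) w (\<lambda>x. c * f x)"
  using assms
proof (induction m arbitrary: f)
  case 0
  then show ?case by (auto simp: norm_mult mult.assoc intro!: mult_left_mono)
next
  case (Suc m)
  have "pd b (\<lambda>x. c * f x) = (\<lambda>x. c * pd b f x)" for b
    by (rule ext) (simp add: pd_cmult smooth_differentiable Suc.prems)
  then show ?case
    using Suc by (auto simp: norm_mult smooth_pd mult.assoc intro!: mult_left_mono)
qed

lemma dbound_diff:
  assumes "smooth f" "smooth g" "dbound m A w f" "dbound m B w g"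
  shows "dbound m (A + B) w (\<lambda>x. f x - g x)"
  using dbound_add[OF assms(1) smooth_cmult[OF assms(2), of "-1"] assms(3) dbound_cmult[OF assms(2,4), of "-1"]]
  by simp

lemma dbound_affine:
  assumes "smooth f" "dbound m A w f"
  shows "dbound m (max 1 \<bar>c\<bar> ^ m * A) (\<lambda>x. w (c *\<^sub>R x + v)) (\<lambda>x. f (c *\<^sub>R x + v))"
  using assms
proof (induction m arbitrary: f)
  case (Suc m)
  have nn: "0 \<le> A * w x" for x
    using dbound_bound[OF Suc.prems(2), of x] norm_ge_zero order_trans by blast
  have "norm (f y) \<le> max 1 \<bar>c\<bar> ^ Suc m * A * w y" for y
  proof -
    have "1 * (A * w y) \<le> max 1 \<bar>c\<bar> ^ Suc m * (A * w y)"
      using nn[of y] by (intro mult_right_mono[OF _ nn] one_le_power) auto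
    then show ?thesis using dbound_bound[OF Suc.prems(2), of y] by (simp add: mult.assoc)
  qed
  moreover have "dbound m (max 1 \<bar>c\<bar> ^ Suc m * A) (\<lambda>x. w (c *\<^sub>R x + v)) (pd b (\<lambda>x. f (c *\<^sub>R x + v)))"
    if b: "b \<in> Basis" for b
  proof -
    have "pd b (\<lambda>x. f (c *\<^sub>R x + v)) = (\<lambda>x. of_real c * pd b f (c *\<^sub>R x + v))"
      by (rule ext) (simp add: pd_affine smooth_differentiable Suc.prems)
    moreover have "dbound m (norm (complex_of_real c) * (max 1 \<bar>c\<bar> ^ m * A)) (\<lambda>x. w (c *\<^sub>R x + v))
         (\<lambda>x. of_real c * pd b f (c *\<^sub>R x + v))"
      using Suc.prems b by (intro dbound_cmult smooth_affine smooth_pd Suc.IH) auto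
    moreover have "norm (complex_of_real c) * (max 1 \<bar>c\<bar> ^ m * A) * w x \<le> max 1 \<bar>c\<bar> ^ Suc m * A * w x" for x
    proof -
      have "\<bar>c\<bar> * (max 1 \<bar>c\<bar> ^ m * (A * w x)) \<le> max 1 \<bar>c\<bar> * (max 1 \<bar>c\<bar> ^ m * (A * w x))"
        by (intro mult_right_mono mult_nonneg_nonneg[OF _ nn]) auto
      then show ?thesis by (simp add: mult.assoc)
    qed
    ultimately show ?thesis by (auto intro: dbound_mono)
  qed
  ultimately show ?case by auto
qed auto

lemma dbound_translate:
  assumes "smooth f" "dbound m A w f"
  shows "dbound m A (\<lambda>y. w (y + x)) (\<lambda>y. f (y + x))"
  using dbound_affine[OF assms, of 1 x] by simp

text \<open>The derivative of \<open>1 / f\<close> is \<open>- f' * (1 / f) * (1 / f)\<close>, of size \<open>w * (1 / w) * (1 / w) = 1 / w\<close>,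
  so the weight reproduces itself from one order to the next.\<close>
lemma dbound_inverse:
  assumes "smooth f" "\<And>k. \<exists>A. dbound k A w f" "0 < c" "\<And>x. 0 < w x" "\<And>x. c * w x \<le> norm (f x)"
  shows "\<exists>B. dbound m B (\<lambda>x. inverse (w x)) (\<lambda>x. inverse (f x))"
proof (induction m)
  case 0
  have "norm (inverse (f x)) \<le> inverse c * inverse (w x)" for x
    using le_imp_inverse_le[OF assms(5)[of x]] assms(3,4) by (simp add: norm_inverse mult.commute)
  then show ?case by auto
next
  case (Suc m)
  then obtain B where B: "dbound m B (\<lambda>x. inverse (w x)) (\<lambda>x. inverse (f x))" by blast
  obtain A where A: "dbound (Suc m) A w f" using assms(2) by blast
  have f0: "f x \<noteq> 0" for x
    using assms(3-5) by (metis mult_pos_pos norm_zero not_less)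
  have si: "smooth (\<lambda>x. inverse (f x))" using assms(1) f0 by (rule smooth_inverse)
  have nn: "0 \<le> B"
  proof -
    have "0 \<le> B * inverse (w undefined)"
      using dbound_bound[OF B, of undefined] norm_ge_zero order_trans by blast
    then show ?thesis using assms(4)[of undefined] by (simp add: zero_le_mult_iff)
  qed
  let ?B1 = "2 ^ m * A * (2 ^ m * B * B)"
  let ?B = "max B ?B1"
  have prod_bound: "dbound m ?B1 (\<lambda>x. w x * (inverse (w x) * inverse (w x))) (\<lambda>x. pd b f x * (inverse (f x) * inverse (f x)))"
    if b: "b \<in> Basis" for b
    using A B b si assms(1) by (intro dbound_mult smooth_pd smooth_mult) auto
  then have "dbound m ?B1 (\<lambda>x. inverse (w x)) (\<lambda>x. pd b f x * (inverse (f x) * inverse (f x)))"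
    if b: "b \<in> Basis" for b
  proof -
    have "w x * (inverse (w x) * inverse (w x)) = inverse (w x)" for x
      using assms(4)[of x] by (simp add: mult.assoc[symmetric] del: mult.assoc)
    then have "(\<lambda>x. w x * (inverse (w x) * inverse (w x))) = (\<lambda>x. inverse (w x))" by (rule ext)
    then show ?thesis using prod_bound[OF that] by metis
  qed
  then have "dbound m (norm (-1::complex) * ?B1) (\<lambda>x. inverse (w x)) (\<lambda>x. -1 * (pd b f x * (inverse (f x) * inverse (f x))))"
    if b: "b \<in> Basis" for b
    using that si assms(1) by (intro dbound_cmult smooth_mult smooth_pd) auto
  moreover have "pd b (\<lambda>x. inverse (f x)) = (\<lambda>x. -1 * (pd b f x * (inverse (f x) * inverse (f x))))" for b
    by (rule ext) (simp add: pd_inverse f0 smooth_differentiable assms(1))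
  ultimately have "dbound m ?B1 (\<lambda>x. inverse (w x)) (pd b (\<lambda>x. inverse (f x)))" if "b \<in> Basis" for b
    using that by simp
  then have "dbound m ?B (\<lambda>x. inverse (w x)) (pd b (\<lambda>x. inverse (f x)))" if "b \<in> Basis" for b
    by (rule dbound_mono[OF _ mult_right_mono]) (use that assms(4) in \<open>auto simp: less_imp_le\<close>)
  moreover have "norm (inverse (f x)) \<le> ?B * inverse (w x)" for x
    using dbound_bound[OF B, of x] assms(4)[of x]
    by (meson inverse_positive_iff_positive less_imp_le max.cobounded1 mult_right_mono order_trans)
  ultimately show ?case by auto
qed

section \<open>Test functions and Schwartz functions\<close>

lemma C_norm_le: "dbound m A (\<lambda>_. 1) f \<Longrightarrow> C_norm m f \<le> A"
  unfolding C_norm_def by (rule cSUP_least) (auto simp: dbound_iff_iter_deriv multi_indices_def intro!: exI[of _ "[]"])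

lemma finite_multi_indices: "finite (multi_indices m :: 'a::euclidean_space list set)"
  unfolding multi_indices_def by (rule finite_lists_length_le) simp

lemma test_fun_pd:
  assumes "test_fun g" "b \<in> Basis"
  shows "test_fun (pd b g)"
proof -
  have "{x. pd b g x \<noteq> 0} \<subseteq> closure {x. g x \<noteq> 0}"
  proof
    fix x assume x: "x \<in> {x. pd b g x \<noteq> 0}"
    show "x \<in> closure {x. g x \<noteq> 0}"
    proof (rule ccontr)
      assume "x \<notin> closure {x. g x \<noteq> 0}"
      then have "pd b g x = pd b (\<lambda>_. 0) x"
        using closure_subset[of "{x. g x \<noteq> 0}"]
        by (intro pd_cong_open[of "- closure {x. g x \<noteq> 0}"]) auto
      with x show False by simp
    qed
  qed
  then show ?thesis
    using assms unfolding test_fun_def by (auto intro: smooth_pd bounded_subset bounded_closure)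
qed

lemma test_fun_dbound:
  assumes "test_fun f"
  shows "\<exists>A. dbound m A (\<lambda>_. 1) f"
  using assms
proof (induction m arbitrary: f)
  have bd: "\<exists>A. \<forall>x. norm (g x) \<le> A" if "test_fun g" for g :: "'a \<Rightarrow> complex"
  proof -
    obtain R where R: "\<And>x. g x \<noteq> 0 \<Longrightarrow> norm x \<le> R"
      using \<open>test_fun g\<close> by (auto simp: test_fun_def bounded_iff)
    have "bounded (g ` cball 0 R)"
      using that by (intro compact_imp_bounded compact_continuous_image)
         (auto simp: test_fun_def smooth_continuous_on)
    then obtain A where A: "\<And>x. x \<in> cball 0 R \<Longrightarrow> norm (g x) \<le> A"
      unfolding bounded_iff by blast
    have "norm (g x) \<le> max 0 A" for x
      using A[of x] R[of x] by (cases "g x = 0") auto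
    then show ?thesis by blast
  qed
  {
    case 0
    then show ?case using bd by auto
  next
    case (Suc m)
    obtain A where A: "\<And>x. norm (f x) \<le> A" using bd[OF Suc.prems] by blast
    show ?case
    proof (rule dbound_Suc_exI)
      show "\<exists>A. \<forall>x. norm (f x) \<le> A * 1" using A by auto
      show "\<exists>A. dbound m A (\<lambda>_. 1) (pd b f)" if "b \<in> Basis" for b
        by (rule Suc.IH[OF test_fun_pd[OF Suc.prems that]])
    qed auto
  }
qed

lemma test_fun_dbound_C_norm:
  assumes "test_fun f"
  shows "dbound m (C_norm m f) (\<lambda>_. 1) f"
proof -
  obtain A where A: "dbound m A (\<lambda>_. 1) f" using test_fun_dbound[OF assms] by blast
  have "bdd_above ((\<lambda>(x, vs). norm (iter_deriv vs f x)) ` (UNIV \<times> multi_indices m))"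
    using A by (auto simp: dbound_iff_iter_deriv intro!: bdd_aboveI[of _ A])
  then have "norm (iter_deriv vs f x) \<le> C_norm m f" if "vs \<in> multi_indices m" for vs x
    unfolding C_norm_def using that by (intro cSUP_upper2[of _ _ "(x, vs)"]) auto
  then show ?thesis by (auto simp: dbound_iff_iter_deriv)
qed

lemma C_norm_nonneg:
  assumes "test_fun f" shows "0 \<le> C_norm m f"
  using order_trans[OF norm_ge_zero dbound_bound[OF test_fun_dbound_C_norm[OF assms]]] by simp

text \<open>Polynomial weights\<close>

definition wt :: "real \<Rightarrow> 'a::real_normed_vector \<Rightarrow> real" where
  "wt a x = (1 + norm x) powr (- a)"

lemma wt_pos: "0 < wt a x"
  by (simp add: wt_def add_pos_nonneg order.strict_implies_not_eq) (smt (verit) norm_ge_zero)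

lemma weight_bound_nonneg:
  assumes "\<And>x. norm (h x) \<le> A * wt a (x :: 'a::real_normed_vector)"
  shows "0 \<le> A"
  using order_trans[OF norm_ge_zero assms[of 0]] wt_pos[of a "0::'a"] by (simp add: zero_le_mult_iff)

lemma wt_le_1: "0 \<le> a \<Longrightarrow> wt a x \<le> 1"
  by (simp add: wt_def powr_minus inverse_le_1_iff ge_one_powr_ge_zero)

lemma wt_antimono: "a \<le> b \<Longrightarrow> wt b x \<le> wt a x"
  unfolding wt_def by (intro powr_mono) auto

lemma wt_minus_commute: "wt a (x - y) = wt a (y - x)"
  by (simp add: wt_def norm_minus_commute)

lemma wt_measurable [measurable]: "wt a \<in> borel_measurable borel"
  unfolding wt_def by measurable

lemma wt_power_le: "(1 + norm x) ^ N * t \<le> M \<longleftrightarrow> t \<le> M * wt (real N) x"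
proof -
  have "0 < 1 + norm x" by (simp add: add_pos_nonneg)
  then show ?thesis
    by (simp add: wt_def powr_minus powr_realpow field_simps)
qed

lemma wt_add: "wt (a + b) x = wt a x * wt b x"
  by (simp add: wt_def flip: powr_add)

text \<open>Peetre's inequality: a translation changes the weight at most by a factor that depends only on
  the translation.\<close>
lemma wt_peetre:
  assumes "0 \<le> a"
  shows "wt a (x - y) \<le> (1 + norm y) powr a * wt a x"
proof -
  have "1 + norm x \<le> (1 + norm y) * (1 + norm (x - y))"
    using norm_triangle_sub[of x y] by (simp add: algebra_simps) (smt (verit) mult_nonneg_nonneg norm_ge_zero)
  then have "(1 + norm x) powr a \<le> ((1 + norm y) * (1 + norm (x - y))) powr a"
    using assms by (intro powr_mono2) auto
  also have "\<dots> = (1 + norm y) powr a * (1 + norm (x - y)) powr a"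
    by (simp add: powr_mult)
  finally show ?thesis
    using add_pos_nonneg[OF zero_less_one norm_ge_zero[of x]] add_pos_nonneg[OF zero_less_one norm_ge_zero[of "x - y"]]
    by (simp add: wt_def powr_minus field_simps)
qed

text \<open>The defining seminorms use the same index for the order and for the weight; here the two
  are independent.\<close>
lemma schwartz_iff_dbound:
  "schwartz f \<longleftrightarrow> smooth f \<and> (\<forall>m N. \<exists>A. dbound m A (wt (real N)) f)"
proof -
  have "(\<forall>N. \<forall>vs\<in>multi_indices N. \<exists>M. \<forall>x. (1 + norm x) ^ N * norm (iter_deriv vs f x) \<le> M) \<longleftrightarrow>
     (\<forall>m N. \<exists>A. dbound m A (wt (real N)) f)" (is "?L \<longleftrightarrow> ?R")
  proof
    assume L: ?L
    show ?R
    proof (intro allI)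
      fix m N :: nat
      let ?k = "max m N :: nat"
      obtain M where M: "\<And>vs x. vs \<in> multi_indices ?k \<Longrightarrow> (1 + norm x) ^ ?k * norm (iter_deriv vs f x) \<le> M vs"
        using L by metis
      let ?A = "\<Sum>vs\<in>multi_indices ?k. \<bar>M vs\<bar>"
      have "norm (iter_deriv vs f x) \<le> ?A * wt (real N) x" if "vs \<in> multi_indices m" for vs x
      proof -
        have vs: "vs \<in> multi_indices ?k" using that by (auto simp: multi_indices_def)
        have "norm (iter_deriv vs f x) \<le> M vs * wt (real ?k) x"
          using M[OF vs] by (simp add: wt_power_le)
        also have "\<dots> \<le> ?A * wt (real N) x"
        proof (rule mult_mono)
          have "\<bar>M vs\<bar> \<le> ?A" using vs finite_multi_indices by (intro member_le_sum) auto
          then show "M vs \<le> ?A" by linarith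
        qed (auto intro!: wt_antimono sum_nonneg less_imp_le[OF wt_pos])
        finally show ?thesis .
      qed
      then show "\<exists>A. dbound m A (wt (real N)) f" by (auto simp: dbound_iff_iter_deriv)
    qed
  next
    assume R: ?R
    show ?L
      using R unfolding dbound_iff_iter_deriv wt_power_le by meson
  qed
  then show ?thesis by (simp add: schwartz_def)
qed

lemma schwartz_norm_le:
  assumes "dbound N A (wt (real N)) f"
  shows "schwartz_norm N f \<le> A"
  unfolding schwartz_norm_def
  using assms by (intro cSUP_least) (auto simp: dbound_iff_iter_deriv wt_power_le multi_indices_def intro!: exI[of _ "[]"])

lemma schwartz_norm_nonneg:
  assumes "schwartz f"
  shows "0 \<le> schwartz_norm N f"
proof -
  obtain A where A: "dbound N A (wt (real N)) f" using assms unfolding schwartz_iff_dbound by blast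
  have "bdd_above ((\<lambda>(x, vs). (1 + norm x) ^ N * norm (iter_deriv vs f x)) ` (UNIV \<times> multi_indices N))"
    using A by (auto simp: dbound_iff_iter_deriv wt_power_le intro!: bdd_aboveI[of _ A])
  then show ?thesis
    unfolding schwartz_norm_def by (intro cSUP_upper2[of _ _ "(0, [])"]) (auto simp: multi_indices_def)
qed

lemma test_fun_schwartz:
  assumes "test_fun f"
  shows "schwartz f"
  unfolding schwartz_iff_dbound
proof (intro conjI allI)
  show "smooth f" using assms by (simp add: test_fun_def)
  fix m N
  obtain R where R: "\<And>x. f x \<noteq> 0 \<Longrightarrow> norm x \<le> R"
    using assms by (auto simp: test_fun_def bounded_iff)
  obtain A where A: "dbound m A (\<lambda>_. 1) f" using test_fun_dbound[OF assms] by blast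
  have A0: "0 \<le> A" using order_trans[OF norm_ge_zero dbound_bound[OF A]] by simp
  have "dbound m A (\<lambda>x. if x \<in> - cball 0 R then 0 else 1) f"
    by (rule dbound_vanish_open[OF A]) (use R in \<open>auto simp: not_le[symmetric]\<close>)
  then have "dbound m (A * (1 + \<bar>R\<bar>) ^ N) (wt (real N)) f"
  proof (rule dbound_mono)
    fix x :: 'a
    show "A * (if x \<in> - cball 0 R then 0 else 1) \<le> A * (1 + \<bar>R\<bar>) ^ N * wt (real N) x"
    proof (cases "norm x \<le> R")
      case True
      have "(1 + norm x) ^ N \<le> (1 + \<bar>R\<bar>) ^ N" using True by (intro power_mono) auto
      then have "1 \<le> (1 + \<bar>R\<bar>) ^ N * wt (real N) x"
        by (simp add: wt_power_le[symmetric])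
      from mult_left_mono[OF this A0] show ?thesis using True by (simp add: mult.assoc)
    qed (use A0 wt_pos[of "real N" x] in auto)
  qed
  then show "\<exists>A. dbound m A (wt (real N)) f" by blast
qed

lemma test_fun_mult:
  assumes "smooth f" "test_fun g"
  shows "test_fun (\<lambda>x. f x * g x)"
  using assms unfolding test_fun_def
  by (auto intro!: smooth_mult intro: bounded_subset)

lemma test_fun_add:
  assumes "test_fun f" "test_fun g"
  shows "test_fun (\<lambda>x. f x + g x)"
proof -
  have "{x. f x + g x \<noteq> 0} \<subseteq> {x. f x \<noteq> 0} \<union> {x. g x \<noteq> 0}" by auto
  then show ?thesis
    using assms unfolding test_fun_def by (auto intro: smooth_add bounded_subset[OF bounded_Un[THEN iffD2]])
qed

section \<open>One-sided stable laws\<close>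

locale fractional =
  fixes \<beta> :: real
  assumes beta_pos: "0 < \<beta>" and beta_less_1: "\<beta> < 1"
begin

text \<open>The Sibuya distribution, with generating function \<open>1 - (1 - z) powr \<beta>\<close>. The sum of \<open>k\<close>
  independent copies, scaled by \<open>c = k powr (- 1 / \<beta>)\<close>, has the Laplace transform
  \<open>(1 - (1 - exp (- \<nu> * c)) powr \<beta>) ^ k\<close>, which tends to \<open>exp (- \<nu> powr \<beta>)\<close>.\<close>
definition sibuya_weight :: "nat \<Rightarrow> real" where
  "sibuya_weight j = (if j = 0 then 0 else (-1) ^ Suc j * (\<beta> gchoose j))"

lemma sibuya_weight_nonneg: "0 \<le> sibuya_weight j"
proof -
  have "0 \<le> (-1) ^ j * (\<beta> gchoose Suc j)" for j
  proof (induction j)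
    case 0
    then show ?case using beta_pos by simp
  next
    case (Suc j)
    have "of_nat (Suc (Suc j)) * ((-1) ^ Suc j * (\<beta> gchoose Suc (Suc j))) =
       (-1) ^ Suc j * (\<beta> * (\<beta> gchoose Suc j) - of_nat (Suc j) * (\<beta> gchoose Suc j))"
      using gbinomial_mult_1[of \<beta> "Suc j"] by (simp only: mult.left_commute) simp
    also have "\<dots> = (real (Suc j) - \<beta>) * ((-1) ^ j * (\<beta> gchoose Suc j))"
      by (simp add: algebra_simps)
    also have "\<dots> \<ge> 0"
      by (rule mult_nonneg_nonneg[OF _ Suc]) (use beta_less_1 in auto)
    finally show ?case
      by (simp only: zero_le_mult_iff) auto
  qed
  from this[of "j - 1"] show ?thesis
    by (cases j) (auto simp: sibuya_weight_def)
qed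

lemma sibuya_pgf_sums:
  assumes "0 \<le> z" "z < 1"
  shows "(\<lambda>j. sibuya_weight j * z ^ j) sums (1 - (1 - z) powr \<beta>)"
proof -
  have "(\<lambda>j. (\<beta> gchoose j) * (- z) ^ j) sums (1 - z) powr \<beta>"
    using gen_binomial_real[of "- z" \<beta>] assms by simp
  moreover have "(\<lambda>j. if j = 0 then 1 else 0 :: real) sums 1"
    by (rule sums_If_finite[of "\<lambda>j. j = 0" "\<lambda>_. 1", simplified])
  ultimately have "(\<lambda>j. (if j = 0 then 1 else 0) - (\<beta> gchoose j) * (- z) ^ j) sums (1 - (1 - z) powr \<beta>)"
    by (intro sums_diff)
  moreover have "(if j = 0 then 1 else 0) - (\<beta> gchoose j) * (- z) ^ j = sibuya_weight j * z ^ j" for j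
    by (simp add: sibuya_weight_def power_minus[of z])
  ultimately show ?thesis by simp
qed

text \<open>Abel's limit theorem for nonnegative coefficients, applied to the generating function at \<open>z = 1\<close>.\<close>
lemma sibuya_sums_1: "sibuya_weight sums 1"
proof -
  have lim: "((\<lambda>z. 1 - (1 - z) powr \<beta>) \<longlongrightarrow> 1) (at_left 1)"
  proof -
    have "((\<lambda>z. 1 - (1 - z) powr \<beta>) \<longlongrightarrow> 1 - (1 - 1) powr \<beta>) (at_left 1)"
      using beta_pos by (intro tendsto_intros tendsto_powr') (auto simp: eventually_at_left_field intro!: exI[of _ 0])
    then show ?thesis by simp
  qed
  have ev: "eventually (\<lambda>z::real. 0 < z \<and> z < 1) (at_left 1)"
    by (auto simp: eventually_at_left_field intro!: exI[of _ 0])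
  have partial: "(\<Sum>j<n. sibuya_weight j) \<le> 1" for n
  proof (rule tendsto_le[OF _ lim, rotated])
    show "((\<lambda>z. \<Sum>j<n. sibuya_weight j * z ^ j) \<longlongrightarrow> (\<Sum>j<n. sibuya_weight j)) (at_left 1)"
      by (rule tendsto_eq_intros refl | simp)+
    show "eventually (\<lambda>z. (\<Sum>j<n. sibuya_weight j * z ^ j) \<le> 1 - (1 - z) powr \<beta>) (at_left 1)"
      using ev
    proof eventually_elim
      case (elim z)
      then have s: "(\<lambda>j. sibuya_weight j * z ^ j) sums (1 - (1 - z) powr \<beta>)"
        by (intro sibuya_pgf_sums) auto
      show ?case
        using sum_le_suminf[OF sums_summable[OF s], of "{..<n}"] sums_unique[OF s] elim
        by (simp add: sibuya_weight_nonneg)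
    qed
  qed simp
  have sm: "summable sibuya_weight"
    by (rule summableI_nonneg_bounded[OF sibuya_weight_nonneg partial])
  have "suminf sibuya_weight \<le> 1"
    by (rule suminf_le_const[OF sm partial])
  moreover have "1 \<le> suminf sibuya_weight"
  proof (rule tendsto_upperbound[OF lim])
    show "eventually (\<lambda>z. 1 - (1 - z) powr \<beta> \<le> suminf sibuya_weight) (at_left 1)"
      using ev
    proof eventually_elim
      case (elim z)
      then have s: "(\<lambda>j. sibuya_weight j * z ^ j) sums (1 - (1 - z) powr \<beta>)"
        by (intro sibuya_pgf_sums) auto
      have "sibuya_weight j * z ^ j \<le> sibuya_weight j" for j
        using elim sibuya_weight_nonneg[of j] by (simp add: mult_left_le power_le_one)
      from suminf_le[OF this sums_summable[OF s] sm] sums_unique[OF s] show ?case by simp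
    qed
  qed simp
  ultimately show ?thesis using sm by (simp add: sums_iff)
qed

definition sibuya_pmf :: "nat pmf" where
  "sibuya_pmf = embed_pmf sibuya_weight"

lemma pmf_sibuya: "pmf sibuya_pmf j = sibuya_weight j"
  unfolding sibuya_pmf_def
proof (rule pmf_embed_pmf)
  show "(\<integral>\<^sup>+x. ennreal (sibuya_weight x) \<partial>count_space UNIV) = 1"
    using suminf_ennreal_eq[OF sibuya_weight_nonneg sibuya_sums_1]
    by (simp add: nn_integral_count_space_nat)
qed (rule sibuya_weight_nonneg)

lemma sibuya_pgf:
  assumes "0 < z" "z < 1"
  shows "(\<integral>\<^sup>+j. ennreal (z ^ j) \<partial>sibuya_pmf) = ennreal (1 - (1 - z) powr \<beta>)"
proof -
  have "(\<integral>\<^sup>+j. ennreal (z ^ j) \<partial>sibuya_pmf) = (\<integral>\<^sup>+j. ennreal (sibuya_weight j * z ^ j) \<partial>count_space UNIV)"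
    using assms by (simp add: nn_integral_measure_pmf pmf_sibuya ennreal_mult sibuya_weight_nonneg)
  also have "\<dots> = ennreal (1 - (1 - z) powr \<beta>)"
    using assms by (subst nn_integral_count_space_nat)
      (intro suminf_ennreal_eq sibuya_pgf_sums, auto simp: sibuya_weight_nonneg)
  finally show ?thesis .
qed

primrec sibuya_sum :: "nat \<Rightarrow> nat pmf" where
  "sibuya_sum 0 = return_pmf 0"
| "sibuya_sum (Suc k) = bind_pmf (sibuya_sum k) (\<lambda>i. map_pmf (\<lambda>j. i + j) sibuya_pmf)"

lemma sibuya_sum_pgf:
  assumes "0 < z" "z < 1"
  shows "(\<integral>\<^sup>+j. ennreal (z ^ j) \<partial>sibuya_sum k) = ennreal ((1 - (1 - z) powr \<beta>) ^ k)"
proof (induction k)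
  case (Suc k)
  have "(1 - z) powr \<beta> \<le> 1" using assms beta_pos by (simp add: powr_le1)
  have "(\<integral>\<^sup>+j. ennreal (z ^ j) \<partial>sibuya_sum (Suc k)) =
    (\<integral>\<^sup>+i. ennreal (z ^ i) * (\<integral>\<^sup>+j. ennreal (z ^ j) \<partial>sibuya_pmf) \<partial>sibuya_sum k)"
    using assms by (simp add: power_add ennreal_mult nn_integral_cmult)
  also have "\<dots> = ennreal ((1 - (1 - z) powr \<beta>) ^ k) * ennreal (1 - (1 - z) powr \<beta>)"
    using Suc.IH sibuya_pgf[OF assms] by (simp add: nn_integral_multc)
  also have "\<dots> = ennreal ((1 - (1 - z) powr \<beta>) ^ Suc k)"
    using \<open>(1 - z) powr \<beta> \<le> 1\<close> by (simp add: ennreal_mult[symmetric] mult.commute)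
  finally show ?case .
qed simp

definition stable_approx :: "nat \<Rightarrow> real measure" where
  "stable_approx k = distr (measure_pmf (sibuya_sum (Suc k))) borel (\<lambda>j. real j * real (Suc k) powr (- 1 / \<beta>))"

lemma real_distribution_stable_approx: "real_distribution (stable_approx k)"
  unfolding stable_approx_def real_distribution_def real_distribution_axioms_def
  by (auto intro!: measure_pmf.prob_space_distr)

lemma AE_stable_approx: "AE s in stable_approx k. 0 \<le> s"
  unfolding stable_approx_def by (subst AE_distr_iff) (auto simp: )

definition approx_laplace :: "nat \<Rightarrow> real \<Rightarrow> real" where
  "approx_laplace k \<nu> = (1 - (1 - exp (- \<nu> * real (Suc k) powr (- 1 / \<beta>))) powr \<beta>) ^ Suc k"

text \<open>Replacing \<open>s\<close> by \<open>max 0 s\<close> does not change the integral and makes the integrand bounded and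
  continuous on the whole line, so that it can be used as a test function for weak convergence.\<close>
lemma stable_approx_laplace:
  assumes "0 < \<nu>"
  shows "(\<integral>s. exp (- \<nu> * max 0 s) \<partial>stable_approx k) = approx_laplace k \<nu>"
proof -
  let ?c = "real (Suc k) powr (- 1 / \<beta>)"
  let ?z = "exp (- \<nu> * ?c)"
  have c: "0 < ?c" by simp
  have z: "0 < ?z" "?z < 1" using c assms by (auto simp: mult_neg_pos)
  have le: "(1 - ?z) powr \<beta> \<le> 1" using z beta_pos by (intro powr_le1) auto
  have "exp (- \<nu> * max 0 (real j * ?c)) = ?z ^ j" for j
    by (simp add: exp_of_nat_mult[symmetric] max_def mult_ac)
  then have "(\<integral>s. exp (- \<nu> * max 0 s) \<partial>stable_approx k) = (\<integral>j. ?z ^ j \<partial>measure_pmf (sibuya_sum (Suc k)))"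
    unfolding stable_approx_def by (subst integral_distr) auto
  also have "\<dots> = enn2real (\<integral>\<^sup>+j. ennreal (?z ^ j) \<partial>measure_pmf (sibuya_sum (Suc k)))"
    using z by (intro integral_eq_nn_integral) auto
  also have "\<dots> = (1 - (1 - ?z) powr \<beta>) ^ Suc k"
    by (subst sibuya_sum_pgf[OF z]) (use le in \<open>auto intro!: enn2real_ennreal mult_nonneg_nonneg\<close>)
  finally show ?thesis by (simp add: approx_laplace_def)
qed

lemma one_minus_exp_le: "1 - exp (- x) \<le> (x::real)"
  using exp_ge_add_one_self[of "- x"] by linarith

lemma scale_power: "real (Suc k) * (real (Suc k) powr (- 1 / \<beta>)) powr \<beta> = 1"
proof -
  have "- 1 / \<beta> * \<beta> = - 1" using beta_pos by simp
  then have "(real (Suc k) powr (- 1 / \<beta>)) powr \<beta> = inverse (real (Suc k))"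
    by (simp only: powr_powr) (simp add: powr_minus)
  then show ?thesis by (simp del: of_nat_Suc)
qed

text \<open>Bernoulli's inequality; the bound is uniform in \<open>k\<close> and yields tightness.\<close>
lemma approx_laplace_ge:
  assumes "0 < \<nu>"
  shows "1 - \<nu> powr \<beta> \<le> approx_laplace k \<nu>"
proof -
  let ?c = "real (Suc k) powr (- 1 / \<beta>)"
  let ?x = "(1 - exp (- \<nu> * ?c)) powr \<beta>"
  have c: "0 < ?c" by simp
  have z: "0 \<le> 1 - exp (- \<nu> * ?c)" "1 - exp (- \<nu> * ?c) \<le> 1" using c assms by (auto simp: mult_nonneg_nonneg)
  have "?x \<le> 1" using z beta_pos by (intro powr_le1) auto
  have "?x \<le> (\<nu> * ?c) powr \<beta>"
    using z one_minus_exp_le[of "\<nu> * ?c"] beta_pos by (intro powr_mono2) auto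
  also have "\<dots> = \<nu> powr \<beta> * ?c powr \<beta>"
    using assms c by (simp add: powr_mult)
  finally have "real (Suc k) * ?x \<le> real (Suc k) * (\<nu> powr \<beta> * ?c powr \<beta>)"
    by (intro mult_left_mono) auto
  also have "\<dots> = \<nu> powr \<beta> * (real (Suc k) * ?c powr \<beta>)"
    by (simp only: mult_ac)
  also have "\<dots> = \<nu> powr \<beta>"
    by (simp only: scale_power mult_1_right)
  finally have "1 - \<nu> powr \<beta> \<le> 1 + real (Suc k) * (- ?x)" by simp
  also have "\<dots> \<le> (1 + (- ?x)) ^ Suc k"
    using \<open>?x \<le> 1\<close> by (intro Bernoulli_inequality) auto
  finally show ?thesis by (simp add: approx_laplace_def)
qed

lemma approx_laplace_tendsto:
  assumes "0 < \<nu>"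
  shows "(\<lambda>k. approx_laplace k \<nu>) \<longlonglongrightarrow> exp (- (\<nu> powr \<beta>))"
proof -
  define c where "c k = real (Suc k) powr (- 1 / \<beta>)" for k
  define x where "x k = (1 - exp (- \<nu> * c k)) powr \<beta>" for k
  have cpos: "0 < c k" for k by (simp add: c_def)
  have "c \<longlonglongrightarrow> 0"
    unfolding c_def using beta_pos
    by (intro tendsto_neg_powr filterlim_compose[OF filterlim_real_sequentially filterlim_Suc]) auto
  then have "filterlim c (at 0) sequentially"
    using cpos by (simp add: filterlim_at less_imp_neq[symmetric])
  moreover have "((\<lambda>h. (1 - exp (- \<nu> * h)) / h) \<longlongrightarrow> \<nu>) (at 0)"
  proof -
    have "((\<lambda>h. 1 - exp (- \<nu> * h)) has_real_derivative \<nu>) (at 0)"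
      by (auto intro!: derivative_eq_intros)
    then show ?thesis by (simp add: has_field_derivative_iff)
  qed
  ultimately have "(\<lambda>k. (1 - exp (- \<nu> * c k)) / c k) \<longlonglongrightarrow> \<nu>"
    by (rule filterlim_compose[rotated])
  then have "(\<lambda>k. ((1 - exp (- \<nu> * c k)) / c k) powr \<beta>) \<longlonglongrightarrow> \<nu> powr \<beta>"
    using assms by (intro tendsto_intros) auto
  moreover have "((1 - exp (- \<nu> * c k)) / c k) powr \<beta> = real (Suc k) * x k" for k
  proof -
    have "((1 - exp (- \<nu> * c k)) / c k) powr \<beta> = x k / c k powr \<beta>"
      using assms cpos[of k] by (simp add: x_def powr_divide)
    also have "\<dots> = real (Suc k) * x k"
    proof -
      have "1 / c k powr \<beta> = real (Suc k)"
        using scale_power[of k, folded c_def] cpos[of k] by (simp add: field_simps del: of_nat_Suc)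
      then have "x k * (1 / c k powr \<beta>) = x k * real (Suc k)" by (rule arg_cong)
      then show ?thesis by (simp only: times_divide_eq_right mult_1_right mult.commute)
    qed
    finally show ?thesis .
  qed
  ultimately have nx: "(\<lambda>k. real (Suc k) * x k) \<longlonglongrightarrow> \<nu> powr \<beta>" by simp
  have x0: "x \<longlonglongrightarrow> 0"
  proof -
    have "(\<lambda>k. real (Suc k) * x k * (1 / real (Suc k))) \<longlonglongrightarrow> \<nu> powr \<beta> * 0"
      by (intro tendsto_mult nx lim_inverse_n' [THEN LIMSEQ_Suc])
    then show ?thesis by simp
  qed
  have xnn: "0 \<le> x k" for k by (simp add: x_def)
  have xle: "x k < 1" for k
    using powr_less_mono2[of \<beta> "1 - exp (- \<nu> * c k)" 1] assms cpos[of k] beta_pos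
    by (simp add: x_def)
  have low: "exp (- (real (Suc k) * x k / (1 - x k))) \<le> (1 - x k) ^ Suc k" for k
  proof -
    have "1 / (1 - x k) \<le> exp (x k / (1 - x k))"
      using exp_ge_add_one_self[of "x k / (1 - x k)"] xle[of k] by (simp add: field_simps)
    then have "exp (- (x k / (1 - x k))) \<le> 1 - x k"
      using xle[of k] by (simp add: exp_minus field_simps)
    then have "exp (- (x k / (1 - x k))) ^ Suc k \<le> (1 - x k) ^ Suc k"
      by (intro power_mono) auto
    then show ?thesis by (simp only: exp_of_nat_mult[symmetric]) (simp add: field_simps)
  qed
  have up: "(1 - x k) ^ Suc k \<le> exp (- (real (Suc k) * x k))" for k
  proof -
    have "(1 - x k) ^ Suc k \<le> exp (- x k) ^ Suc k"
      using exp_ge_add_one_self[of "- x k"] xle[of k] by (intro power_mono) auto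
    then show ?thesis by (simp only: exp_of_nat_mult[symmetric]) (simp add: field_simps)
  qed
  have "(\<lambda>k. (1 - x k) ^ Suc k) \<longlonglongrightarrow> exp (- (\<nu> powr \<beta>))"
  proof (rule tendsto_sandwich[OF always_eventually always_eventually])
    have "(\<lambda>k. exp (- (real (Suc k) * x k / (1 - x k)))) \<longlonglongrightarrow> exp (- (\<nu> powr \<beta> / (1 - 0)))"
      by (intro tendsto_intros nx x0) auto
    then show "(\<lambda>k. exp (- (real (Suc k) * x k / (1 - x k)))) \<longlonglongrightarrow> exp (- (\<nu> powr \<beta>))" by simp
    show "(\<lambda>k. exp (- (real (Suc k) * x k))) \<longlonglongrightarrow> exp (- (\<nu> powr \<beta>))"
      by (intro tendsto_intros nx)
  qed (use low up in auto)
  then show ?thesis by (simp add: approx_laplace_def x_def c_def)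
qed

lemma exp_m1_le_half: "exp (- 1) \<le> (1/2::real)"
  using exp_ge_add_one_self[of 1] by (simp add: exp_minus field_simps)

text \<open>A law whose Laplace transform is close to \<open>1\<close> at \<open>\<nu>\<close> has little mass beyond \<open>1 / \<nu>\<close>.\<close>
lemma tight_stable_approx: "tight stable_approx"
  unfolding tight_def
proof (intro conjI allI impI)
  show "real_distribution (stable_approx k)" for k by (rule real_distribution_stable_approx)
  fix \<epsilon> :: real assume e: "0 < \<epsilon>"
  define \<nu> where "\<nu> = (\<epsilon> / 4) powr (1 / \<beta>)"
  have l: "0 < \<nu>" "\<nu> powr \<beta> = \<epsilon> / 4"
    using e beta_pos by (auto simp: \<nu>_def powr_powr)
  have "measure (stable_approx k) {-1<..1 / \<nu>} > 1 - \<epsilon>" for k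
  proof -
    interpret real_distribution "stable_approx k" by (rule real_distribution_stable_approx)
    have "1 - \<epsilon> / 4 \<le> (\<integral>s. exp (- \<nu> * max 0 s) \<partial>stable_approx k)"
      using approx_laplace_ge[OF l(1)] stable_approx_laplace[OF l(1)] l(2) by simp
    also have "\<dots> \<le> (\<integral>s. 1/2 + 1/2 * indicator {-1<..1 / \<nu>} s \<partial>stable_approx k)"
    proof (rule integral_mono_AE)
      show "integrable (stable_approx k) (\<lambda>s. exp (- \<nu> * max 0 s))"
        using l by (intro integrable_const_bound[of _ 1]) auto
      show "AE s in stable_approx k. exp (- \<nu> * max 0 s) \<le> 1/2 + 1/2 * indicator {-1<..1 / \<nu>} s"
        using AE_stable_approx[of k]
      proof eventually_elim
        case (elim s)
        show ?case
        proof (cases "s \<le> 1 / \<nu>")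
          case True
          then show ?thesis using elim l by (auto simp: mult_nonneg_nonneg)
        next
          case False
          then have "1 \<le> \<nu> * s" using l by (simp add: field_simps)
          moreover have "max 0 s = s" using elim by simp
          ultimately have "exp (- \<nu> * max 0 s) \<le> exp (- 1)" by simp
          also have "\<dots> \<le> 1 / 2" by (rule exp_m1_le_half)
          finally show ?thesis using False by (simp only: indicator_def) simp
        qed
      qed
    qed (intro integrable_const_bound[of _ 1], auto simp: indicator_def)
    also have "\<dots> = 1/2 + 1/2 * measure (stable_approx k) {-1<..1 / \<nu>}"
      using prob_space
      by (subst Bochner_Integration.integral_add)
         (auto intro!: integrable_const_bound[of _ 1] split: split_indicator)
    finally show ?thesis using e by simp
  qed
  then show "\<exists>a b. a < b \<and> (\<forall>n. 1 - \<epsilon> < measure (stable_approx n) {a<..b})"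
    using l by (intro exI[of _ "-1"] exI[of _ "1 / \<nu>"]) (auto intro: less_trans[of _ 0])
qed

text \<open>Any weak limit point of the rescaled Sibuya sums will do. It has no atom at \<open>0\<close> because its
  Laplace transform vanishes at infinity.\<close>
lemma stable_exists:
  "\<exists>N. real_distribution N \<and> (AE s in N. 0 < s) \<and> (\<forall>\<nu>\<ge>0. (\<integral>s. exp (- \<nu> * s) \<partial>N) = exp (- (\<nu> powr \<beta>)))"
proof -
  obtain r N where r: "strict_mono (r :: nat \<Rightarrow> nat)" and N: "real_distribution N"
    and w: "weak_conv_m (stable_approx \<circ> id \<circ> r) N"
    using tight_imp_convergent_subsubsequence[OF tight_stable_approx strict_mono_id] by auto
  interpret real_distribution N by fact
  have conv: "(\<lambda>n. integral\<^sup>L (stable_approx (r n)) f) \<longlonglongrightarrow> integral\<^sup>L N f"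
    if "\<And>x. isCont f x" "\<And>x. norm (f x) \<le> B" for f :: "real \<Rightarrow> real" and B
    using weak_conv_imp_integral_bdd_continuous_conv[OF _ N w that] real_distribution_stable_approx
    by simp
  have "(\<lambda>n. \<integral>s. max 0 (min 1 (- s)) \<partial>stable_approx (r n)) \<longlonglongrightarrow> (\<integral>s. max 0 (min 1 (- s)) \<partial>N)"
    by (rule conv[of _ 1]) (auto intro!: continuous_intros)
  moreover have "(\<integral>s. max 0 (min 1 (- s)) \<partial>stable_approx n) = 0" for n
  proof -
    have "(\<integral>s. max 0 (min 1 (- s)) \<partial>stable_approx n) = (\<integral>s. 0 \<partial>stable_approx n)"
      using AE_stable_approx[of n]
      by (intro integral_cong_AE) (auto simp: stable_approx_def)
    then show ?thesis by simp
  qed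
  ultimately have "(\<integral>s. max 0 (min 1 (- s)) \<partial>N) = 0"
    by (simp add: LIMSEQ_const_iff)
  then have "AE s in N. max 0 (min 1 (- s)) = 0"
    by (subst (asm) integral_nonneg_eq_0_iff_AE) (auto intro!: integrable_const_bound[of _ 1])
  then have nn: "AE s in N. 0 \<le> s"
    by eventually_elim (auto simp: max_def min_def split: if_splits)
  have lap': "(\<integral>s. exp (- \<nu> * max 0 s) \<partial>N) = exp (- (\<nu> powr \<beta>))" if "0 < \<nu>" for \<nu>
  proof -
    have "(\<lambda>n. \<integral>s. exp (- \<nu> * max 0 s) \<partial>stable_approx (r n)) \<longlonglongrightarrow> (\<integral>s. exp (- \<nu> * max 0 s) \<partial>N)"
      using that by (intro conv[of _ 1]) (auto intro!: continuous_intros)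
    moreover have "(\<lambda>n. \<integral>s. exp (- \<nu> * max 0 s) \<partial>stable_approx (r n)) \<longlonglongrightarrow> exp (- (\<nu> powr \<beta>))"
      using LIMSEQ_subseq_LIMSEQ[OF approx_laplace_tendsto[OF that] r]
      by (simp only: stable_approx_laplace[OF that] o_def)
    ultimately show ?thesis by (rule LIMSEQ_unique)
  qed
  have lap: "(\<integral>s. exp (- \<nu> * s) \<partial>N) = exp (- (\<nu> powr \<beta>))" if "0 \<le> \<nu>" for \<nu>
  proof (cases "\<nu> = 0")
    case False
    have "(\<integral>s. exp (- \<nu> * s) \<partial>N) = (\<integral>s. exp (- \<nu> * max 0 s) \<partial>N)"
    proof (rule integral_cong_AE)
      show "AE s in N. exp (- \<nu> * s) = exp (- \<nu> * max 0 s)"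
        using nn by eventually_elim (simp add: max_def)
    qed auto
    then show ?thesis using lap'[of \<nu>] False that by simp
  qed (use prob_space space_eq_univ in simp)
  have "measure N {0} \<le> exp (- (\<nu> powr \<beta>))" if "0 < \<nu>" for \<nu>
  proof -
    have "measure N {0} = (\<integral>s. indicator {0} s \<partial>N)" by simp
    also have "\<dots> \<le> (\<integral>s. exp (- \<nu> * max 0 s) \<partial>N)"
      using that by (intro integral_mono integrable_const_bound[of _ 1]) (auto simp: indicator_def)
    finally show ?thesis using lap'[OF that] by simp
  qed
  then have "measure N {0} \<le> exp (- ((y powr (1/\<beta>)) powr \<beta>))" if "0 < y" for y
    using that by simp
  then have *: "measure N {0} \<le> exp (- y)" if "0 < y" for y
    using that beta_pos by (simp add: powr_powr)
  have "measure N {0} \<le> 0"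
  proof (rule tendsto_lowerbound)
    show "((\<lambda>y::real. exp (- y)) \<longlongrightarrow> 0) at_top"
      by (intro filterlim_compose[OF exp_at_bot] filterlim_uminus_at_top_at_bot filterlim_ident)
        (simp add: filterlim_uminus_at_bot_at_top)?
    show "\<forall>\<^sub>F y in at_top. measure N {0} \<le> exp (- y)"
      using eventually_gt_at_top[of 0] by eventually_elim (rule *)
  qed simp
  then have "measure N {0} = 0" by (simp add: antisym)
  then have "AE s in N. s \<noteq> 0"
    by (intro AE_I[of _ _ "{0}"]) (auto simp: emeasure_eq_measure)
  with nn have "AE s in N. 0 < s" by eventually_elim auto
  with N lap show ?thesis by blast
qed

definition stable :: "real measure" where
  "stable = (SOME N. real_distribution N \<and> (AE s in N. 0 < s) \<and>
     (\<forall>\<nu>\<ge>0. (\<integral>s. exp (- \<nu> * s) \<partial>N) = exp (- (\<nu> powr \<beta>))))"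

lemma stable_props: "real_distribution stable" "AE s in stable. 0 < s"
  "0 \<le> \<nu> \<Longrightarrow> (\<integral>s. exp (- \<nu> * s) \<partial>stable) = exp (- (\<nu> powr \<beta>))"
  using someI_ex[OF stable_exists] unfolding stable_def[symmetric] by auto

sublocale stable: real_distribution stable
  by (rule stable_props)

lemma stable_exp_integrable: "0 \<le> \<nu> \<Longrightarrow> integrable stable (\<lambda>s. exp (- \<nu> * s))"
  by (rule stable.integrable_const_bound[of _ 1])
     (use stable_props(2) in \<open>auto elim!: eventually_mono simp: mult_nonneg_nonneg\<close>)

end

section \<open>Negative moments of the stable law\<close>

lemma powr_le_exp:
  fixes q d y :: real
  assumes "0 < q" "0 < d" "0 < y"
  shows "y powr q \<le> (q / d) powr q * exp (d * y)"
proof -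
  define z where "z = d * y / q"
  have z: "0 < z" and y: "y = q / d * z" using assms by (auto simp: z_def)
  have "ln z \<le> z" using ln_bound[OF z] by simp
  then have "z powr q \<le> exp (q * z)"
    using z assms by (simp add: powr_def mult_left_mono)
  also have "q * z = d * y" using assms by (simp add: z_def)
  finally have "(q / d) powr q * z powr q \<le> (q / d) powr q * exp (d * y)"
    by (intro mult_left_mono) auto
  then show ?thesis using assms z by (simp add: y powr_mult[symmetric])
qed

lemma ennreal_term_le_suminf:
  fixes f :: "nat \<Rightarrow> ennreal"
  shows "f k \<le> suminf f"
  using sum_le_suminf[OF summableI, of "{k}" f] by simp

context fractional begin

text \<open>The profile of the heat kernel: for \<open>p = n / 2\<close> and \<open>a = (norm x)\<^sup>2\<close> this is \<open>K 1 x\<close> up to a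
  constant. Differentiation in \<open>a\<close> raises \<open>p\<close> by one.\<close>
definition gauss_mom :: "real \<Rightarrow> real \<Rightarrow> real" where
  "gauss_mom p a = (\<integral>s. s powr (- p) * exp (- a / (4 * s)) \<partial>stable)"

text \<open>For \<open>k + 1 \<le> 1 / s \<le> k + 2\<close> the function \<open>s powr - p\<close> is at most the \<open>k\<close>-th term of a series of
  exponentials \<open>exp (- (k + 1) * s)\<close>; these integrate to \<open>exp (- (k + 1) powr \<beta>)\<close>, which decays
  faster than any power of \<open>k\<close>.\<close>
lemma stable_moment_integrable:
  assumes p: "0 \<le> p"
  shows "integrable stable (\<lambda>s. s powr (- p))"
proof (rule integrableI_nonneg)
  have pw: "ennreal (s powr (- p)) \<le> 1 + (\<Sum>k. ennreal (exp 1 * (real k + 2) powr p * exp (- (real k + 1) * s)))"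
    if s: "0 < s" for s
  proof (cases "1 \<le> s")
    case True
    have "s powr (- p) \<le> 1" using True p by (simp add: powr_minus inverse_le_1_iff ge_one_powr_ge_zero)
    then have "ennreal (s powr (- p)) \<le> 1" by (simp add: ennreal_le_1)
    then show ?thesis by (meson add_increasing2 zero_le)
  next
    case False
    define k where "k = nat (\<lfloor>1 / s\<rfloor> - 1)"
    have ge1: "1 \<le> 1 / s" using s False by (simp add: field_simps)
    have k1: "real k + 1 = of_int \<lfloor>1 / s\<rfloor>"
      using ge1 by (simp add: k_def)
    have 1: "real k + 1 \<le> 1 / s" "1 / s \<le> real k + 2"
      unfolding k1 using k1 by linarith+
    have "s powr (- p) = (1 / s) powr p"
      using s by (simp add: powr_minus powr_divide field_simps)
    also have "\<dots> \<le> (real k + 2) powr p"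
      using 1 s p by (intro powr_mono2) auto
    also have "\<dots> \<le> (real k + 2) powr p * (exp 1 * exp (- (real k + 1) * s))"
    proof -
      have "(real k + 1) * s \<le> 1" using 1(1) s by (simp add: field_simps)
      then have "1 \<le> exp 1 * exp (- (real k + 1) * s)"
        by (simp add: exp_add[symmetric] algebra_simps)
      from mult_left_mono[OF this, of "(real k + 2) powr p"] show ?thesis by simp
    qed
    finally have "ennreal (s powr (- p)) \<le> ennreal (exp 1 * (real k + 2) powr p * exp (- (real k + 1) * s))"
      by (intro ennreal_leI) (simp add: mult_ac)
    also have "\<dots> \<le> (\<Sum>k. ennreal (exp 1 * (real k + 2) powr p * exp (- (real k + 1) * s)))"
      by (rule ennreal_term_le_suminf)
    finally show ?thesis by (simp add: add_increasing)
  qed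
  define q where "q = (p + 2) / \<beta>"
  have q: "0 < q" "\<beta> * q = p + 2" using p beta_pos by (auto simp: q_def)
  have bd: "exp 1 * (real k + 2) powr p * exp (- ((real k + 1) powr \<beta>)) \<le>
      (exp 1 * 2 powr p * q powr q) * (1 / (real (Suc k))\<^sup>2)" for k
  proof -
    let ?x = "real k + 1"
    have x: "0 < ?x" by simp
    have "?x powr (p + 2) \<le> q powr q * exp (?x powr \<beta>)"
      using powr_le_exp[of q 1 "?x powr \<beta>"] q x by (simp add: powr_powr)
    then have "exp (- (?x powr \<beta>)) \<le> q powr q * ?x powr (- (p + 2))"
      using x by (simp only: exp_minus powr_minus) (simp add: field_simps)
    then have "(real k + 2) powr p * exp (- (?x powr \<beta>)) \<le> (2 * ?x) powr p * (q powr q * ?x powr (- (p + 2)))"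
      using p by (intro mult_mono powr_mono2) auto
    also have "\<dots> = 2 powr p * q powr q * ?x powr (p + (- (p + 2)))"
    proof -
      have "(2 * ?x) powr p = 2 powr p * ?x powr p" using x by (intro powr_mult)
      then show ?thesis by (simp only: powr_add mult_ac)
    qed
    also have "?x powr (p + (- (p + 2))) = 1 / (real (Suc k))\<^sup>2"
      using x by (simp add: powr_minus powr_realpow[of ?x 2, simplified] field_simps)
    finally have "exp 1 * ((real k + 2) powr p * exp (- (?x powr \<beta>))) \<le>
        exp 1 * (2 powr p * q powr q * (1 / (real (Suc k))\<^sup>2))"
      by (intro mult_left_mono) auto
    then show ?thesis by (simp only: mult_ac)
  qed
  have sm: "summable (\<lambda>k. exp 1 * (real k + 2) powr p * exp (- ((real k + 1) powr \<beta>)))"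
  proof (rule summable_comparison_test'[of _ 0])
    have "summable (\<lambda>k. 1 / (real (Suc k))\<^sup>2)"
      using inverse_power_summable[of 2, where 'a = real] summable_Suc_iff[of "\<lambda>k. 1 / (real k)\<^sup>2"]
      by (simp add: inverse_eq_divide)
    then show "summable (\<lambda>k. (exp 1 * 2 powr p * q powr q) * (1 / (real (Suc k))\<^sup>2))"
      by (rule summable_mult)
  qed (use bd in simp)
  have "(\<integral>\<^sup>+s. ennreal (s powr (- p)) \<partial>stable) \<le>
      (\<integral>\<^sup>+s. 1 + (\<Sum>k. ennreal (exp 1 * (real k + 2) powr p * exp (- (real k + 1) * s))) \<partial>stable)"
    by (rule nn_integral_mono_AE, rule eventually_mono[OF stable_props(2)], rule pw)
  also have "\<dots> = 1 + (\<Sum>k. \<integral>\<^sup>+s. ennreal (exp 1 * (real k + 2) powr p * exp (- (real k + 1) * s)) \<partial>stable)"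
    using stable.emeasure_space_1
    by (subst nn_integral_add) (auto simp: nn_integral_suminf)
  also have "(\<Sum>k. \<integral>\<^sup>+s. ennreal (exp 1 * (real k + 2) powr p * exp (- (real k + 1) * s)) \<partial>stable) =
      (\<Sum>k. ennreal (exp 1 * (real k + 2) powr p * exp (- ((real k + 1) powr \<beta>))))"
  proof (rule arg_cong[of _ _ suminf], rule ext)
    fix k
    have "(\<integral>\<^sup>+s. ennreal (exp 1 * (real k + 2) powr p * exp (- (real k + 1) * s)) \<partial>stable) =
        ennreal (\<integral>s. exp 1 * (real k + 2) powr p * exp (- (real k + 1) * s) \<partial>stable)"
      using stable_exp_integrable[of "real k + 1"]
      by (intro nn_integral_eq_integral integrable_mult_right) auto
    then show "(\<integral>\<^sup>+s. ennreal (exp 1 * (real k + 2) powr p * exp (- (real k + 1) * s)) \<partial>stable) =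
        ennreal (exp 1 * (real k + 2) powr p * exp (- ((real k + 1) powr \<beta>)))"
      using stable_props(3)[of "real k + 1"] by simp
  qed
  also have "\<dots> = ennreal (\<Sum>k. exp 1 * (real k + 2) powr p * exp (- ((real k + 1) powr \<beta>)))"
    by (rule suminf_ennreal2[OF _ sm]) simp
  finally have "(\<integral>\<^sup>+s. ennreal (s powr (- p)) \<partial>stable) \<le>
      1 + ennreal (\<Sum>k. exp 1 * (real k + 2) powr p * exp (- ((real k + 1) powr \<beta>)))" .
  also have "\<dots> < \<infinity>"
    by (simp only: infinity_ennreal_def ennreal_add_less_top ennreal_less_top ennreal_1[symmetric])
  finally show "(\<integral>\<^sup>+s. ennreal (s powr (- p)) \<partial>stable) < \<infinity>" .
qed auto

lemma gauss_mom_integrable: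
  assumes "0 \<le> p" "0 \<le> a"
  shows "integrable stable (\<lambda>s. s powr (- p) * exp (- a / (4 * s)))"
proof (rule Bochner_Integration.integrable_bound[OF stable_moment_integrable[OF assms(1)]])
  show "AE s in stable. norm (s powr (- p) * exp (- a / (4 * s))) \<le> norm (s powr (- p))"
    using stable_props(2) by eventually_elim (use assms(2) in \<open>simp add: mult_left_le\<close>)
qed auto

lemma exp_taylor2_bound:
  fixes u v :: real
  assumes "0 \<le> u" "0 \<le> v"
  shows "\<bar>exp (- u) - exp (- v) + (u - v) * exp (- v)\<bar> \<le> (u - v)\<^sup>2"
proof -
  have upper: "exp (- u) - exp (- v) + (u - v) * exp (- v) \<le> (u - v)\<^sup>2"
  proof -
    have a: "exp (- u) - exp (- v) \<le> - (u - v) * exp (- u)"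
    proof -
      have "1 + (u - v) \<le> exp (u - v)" by (rule exp_ge_add_one_self)
      then have "(1 + (u - v)) * exp (- u) \<le> exp (u - v) * exp (- u)" by (rule mult_right_mono) simp
      then show ?thesis by (simp add: exp_add[symmetric] algebra_simps)
    qed
    then have "exp (- u) - exp (- v) + (u - v) * exp (- v) \<le> (u - v) * (exp (- v) - exp (- u))"
      by (simp add: algebra_simps)
    also have "\<dots> \<le> \<bar>u - v\<bar> * \<bar>exp (- v) - exp (- u)\<bar>"
      by (simp add: abs_mult[symmetric])
    also have "\<dots> \<le> \<bar>u - v\<bar> * \<bar>u - v\<bar>"
    proof (rule mult_left_mono)
      have *: "exp (- x) - exp (- y) \<le> y - x" if "0 \<le> x" "x \<le> y" for x y :: real
      proof -
        have "exp (- x) - exp (- y) = exp (- x) * (1 - exp (- (y - x)))"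
          by (simp add: algebra_simps exp_add[symmetric])
        also have "\<dots> \<le> 1 * (y - x)"
          using that one_minus_exp_le[of "y - x"] by (intro mult_mono) auto
        finally show ?thesis by simp
      qed
      show "\<bar>exp (- v) - exp (- u)\<bar> \<le> \<bar>u - v\<bar>"
        using *[of u v] *[of v u] assms by (cases "u \<le> v") auto
    qed simp
    finally show ?thesis by (simp add: power2_eq_square)
  qed
  have lower: "0 \<le> exp (- u) - exp (- v) + (u - v) * exp (- v)"
  proof -
    have "1 + (v - u) \<le> exp (v - u)" by (rule exp_ge_add_one_self)
    then have "(1 + (v - u)) * exp (- v) \<le> exp (v - u) * exp (- v)" by (rule mult_right_mono) simp
    then show ?thesis by (simp add: exp_add[symmetric] algebra_simps)
  qed
  from upper lower show ?thesis by simp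
qed

lemma gauss_mom_taylor:
  assumes "0 \<le> p" "0 \<le> a" "0 \<le> b"
  shows "\<bar>gauss_mom p b - gauss_mom p a + (b - a) * (gauss_mom (p + 1) a / 4)\<bar> \<le> (b - a)\<^sup>2 * (gauss_mom (p + 2) 0 / 16)"
proof -
  note [simp] = gauss_mom_integrable
  have eq: "gauss_mom p b - gauss_mom p a + (b - a) * (gauss_mom (p + 1) a / 4) =
    (\<integral>s. (s powr (- p) * exp (- b / (4 * s)) - s powr (- p) * exp (- a / (4 * s)))
        + (b - a) / 4 * (s powr (- (p + 1)) * exp (- a / (4 * s))) \<partial>stable)"
    using assms gauss_mom_integrable[of p a] gauss_mom_integrable[of p b] gauss_mom_integrable[of "p + 1" a]
    unfolding gauss_mom_def
    by (subst Bochner_Integration.integral_add) (auto simp del: minus_add_distrib)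
  have "\<bar>gauss_mom p b - gauss_mom p a + (b - a) * (gauss_mom (p + 1) a / 4)\<bar> \<le> (\<integral>s. (b - a)\<^sup>2 / 16 * (s powr (- (p + 2)) * exp (- 0 / (4 * s))) \<partial>stable)"
    unfolding eq
  proof (rule integral_abs_bound[THEN order_trans], rule integral_mono_AE)
    show "integrable stable (\<lambda>s. \<bar>(s powr (- p) * exp (- b / (4 * s)) - s powr (- p) * exp (- a / (4 * s)))
        + (b - a) / 4 * (s powr (- (p + 1)) * exp (- a / (4 * s)))\<bar>)"
      using assms gauss_mom_integrable[of p a] gauss_mom_integrable[of p b] gauss_mom_integrable[of "p + 1" a]
      by (intro integrable_abs Bochner_Integration.integrable_add Bochner_Integration.integrable_diff
          Bochner_Integration.integrable_mult_right) auto
    show "integrable stable (\<lambda>s. (b - a)\<^sup>2 / 16 * (s powr (- (p + 2)) * exp (- 0 / (4 * s))))"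
      using assms gauss_mom_integrable[of "p + 2" 0] by (intro Bochner_Integration.integrable_mult_right) auto
    show "AE s in stable. \<bar>(s powr (- p) * exp (- b / (4 * s)) - s powr (- p) * exp (- a / (4 * s)))
        + (b - a) / 4 * (s powr (- (p + 1)) * exp (- a / (4 * s)))\<bar>
       \<le> (b - a)\<^sup>2 / 16 * (s powr (- (p + 2)) * exp (- 0 / (4 * s)))"
      using stable_props(2)
    proof eventually_elim
      case (elim s)
      let ?u = "b / (4 * s)" and ?v = "a / (4 * s)"
      have 1: "s powr (- (p + 1)) = s powr (- p) / s"
        using elim powr_add[of s "- p" "- 1"] by (simp add: powr_minus field_simps)
      have 2: "s powr (- (p + 2)) = s powr (- p) / s\<^sup>2"
        using elim powr_add[of s "- p" "- 2"] by (simp add: powr_minus powr_realpow[of s 2, simplified] field_simps)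
      have "(s powr (- p) * exp (- b / (4 * s)) - s powr (- p) * exp (- a / (4 * s)))
        + (b - a) / 4 * (s powr (- (p + 1)) * exp (- a / (4 * s))) =
        s powr (- p) * (exp (- ?u) - exp (- ?v) + (?u - ?v) * exp (- ?v))"
        unfolding 1 using elim by (simp add: field_simps)
      then have "\<bar>(s powr (- p) * exp (- b / (4 * s)) - s powr (- p) * exp (- a / (4 * s)))
        + (b - a) / 4 * (s powr (- (p + 1)) * exp (- a / (4 * s)))\<bar> =
        s powr (- p) * \<bar>exp (- ?u) - exp (- ?v) + (?u - ?v) * exp (- ?v)\<bar>"
        by (simp add: abs_mult)
      also have "\<dots> \<le> s powr (- p) * (?u - ?v)\<^sup>2"
        using assms elim by (intro mult_left_mono exp_taylor2_bound) auto
      also have "\<dots> = (b - a)\<^sup>2 / 16 * (s powr (- (p + 2)) * exp (- 0 / (4 * s)))"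
        unfolding 2 using elim by (simp add: power2_eq_square field_simps)
      finally show ?case .
    qed
  qed
  also have "\<dots> = (b - a)\<^sup>2 * (gauss_mom (p + 2) 0 / 16)"
    unfolding gauss_mom_def by (subst Bochner_Integration.integral_mult_right_zero) simp
  finally show ?thesis .
qed

lemma gauss_mom_nonneg: "0 \<le> gauss_mom p a"
  unfolding gauss_mom_def by (intro Bochner_Integration.integral_nonneg) auto

lemma gauss_mom_derivative:
  assumes "0 \<le> p" "0 \<le> a"
  shows "(gauss_mom p has_real_derivative - gauss_mom (p + 1) a / 4) (at a within {0..})"
  unfolding has_field_derivative_def
proof (rule has_derivative_quadratic_remainder[OF bounded_linear_mult_right])
  fix y :: real assume "y \<in> {0..}"
  then show "norm (gauss_mom p y - gauss_mom p a - - gauss_mom (p + 1) a / 4 * (y - a)) \<le>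
      gauss_mom (p + 2) 0 / 16 * (norm (y - a))\<^sup>2"
    using gauss_mom_taylor[of p a y] assms by (simp add: mult.commute)
qed

lemma gauss_mom_antimono:
  assumes "0 \<le> p" "0 \<le> a" "a \<le> b"
  shows "gauss_mom p b \<le> gauss_mom p a"
  unfolding gauss_mom_def
proof (rule integral_mono_AE)
  show "AE s in stable. s powr (- p) * exp (- b / (4 * s)) \<le> s powr (- p) * exp (- a / (4 * s))"
    using stable_props(2)
    by eventually_elim (use assms in \<open>auto intro!: mult_left_mono divide_right_mono\<close>)
qed (use assms gauss_mom_integrable[of p a] gauss_mom_integrable[of p b] in auto)

text \<open>With \<open>v = s / a\<close> the integrand is at most a constant times \<open>a powr - p * (1 - exp (- v))\<close>: it is
  exponentially small at \<open>v = 0\<close> and bounded at infinity. The integral of \<open>1 - exp (- s / a)\<close> is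
  known and at most \<open>a powr - \<beta>\<close>.\<close>
lemma gauss_mom_upper_large:
  assumes "0 \<le> p"
  shows "\<exists>C\<ge>0. \<forall>a>0. gauss_mom p a \<le> C * a powr (- (p + \<beta>))"
proof -
  define C where "C = 2 + 2 * ((p + 1) / (1/4)) powr (p + 1)"
  have C: "0 \<le> C" "2 \<le> C" "2 * ((p + 1) / (1/4)) powr (p + 1) \<le> C" by (auto simp: C_def)
  have half: "exp (- 1) \<le> (1/2::real)" by (rule exp_m1_le_half)
  have pw: "v powr (- p) * exp (- 1 / (4 * v)) \<le> C * (1 - exp (- v))" if v: "0 < v" for v
  proof (cases "1 \<le> v")
    case True
    have "v powr (- p) * exp (- 1 / (4 * v)) \<le> 1 * 1"
      using True assms v by (intro mult_mono) (auto simp: powr_minus inverse_le_1_iff ge_one_powr_ge_zero)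
    moreover have "exp (- v) \<le> 1/2" using True half by (metis exp_le_cancel_iff neg_le_iff_le order_trans)
    then have "2 * (1/2) \<le> C * (1 - exp (- v))" using C by (intro mult_mono) auto
    ultimately show ?thesis by simp
  next
    case False
    have "(1 / v) powr (p + 1) \<le> ((p + 1) / (1/4)) powr (p + 1) * exp (1/4 * (1 / v))"
      using assms v by (intro powr_le_exp) auto
    then have "v powr (- p) * exp (- 1 / (4 * v)) \<le> ((p + 1) / (1/4)) powr (p + 1) * v"
      using v by (simp add: powr_divide powr_minus powr_add exp_minus field_simps)
    moreover have "v / 2 \<le> 1 - exp (- v)"
    proof -
      have "1 + v \<le> exp v" by (rule exp_ge_add_one_self)
      then have "exp (- v) \<le> 1 / (1 + v)" using v by (simp add: exp_minus field_simps)
      also have "\<dots> \<le> 1 - v / 2" using v False by (simp add: field_simps)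
      finally show ?thesis by simp
    qed
    then have "C * (v / 2) \<le> C * (1 - exp (- v))" using C by (intro mult_left_mono) auto
    moreover have "((p + 1) / (1/4)) powr (p + 1) * v \<le> C * (v / 2)"
      using mult_right_mono[OF C(3), of "v / 2"] v by simp
    ultimately show ?thesis by linarith
  qed
  have "gauss_mom p a \<le> C * a powr (- (p + \<beta>))" if a: "0 < a" for a
  proof -
    have "gauss_mom p a \<le> (\<integral>s. a powr (- p) * (C * (1 - exp (- (1 / a) * s))) \<partial>stable)"
      unfolding gauss_mom_def
    proof (rule integral_mono_AE)
      show "integrable stable (\<lambda>s. s powr (- p) * exp (- a / (4 * s)))"
        using assms a by (intro gauss_mom_integrable) auto
      show "integrable stable (\<lambda>s. a powr (- p) * (C * (1 - exp (- (1 / a) * s))))"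
        using stable_exp_integrable[of "1 / a"] a by auto
      show "AE s in stable. s powr (- p) * exp (- a / (4 * s)) \<le> a powr (- p) * (C * (1 - exp (- (1 / a) * s)))"
        using stable_props(2)
      proof eventually_elim
        case (elim s)
        have "s powr (- p) * exp (- a / (4 * s)) = a powr (- p) * ((s / a) powr (- p) * exp (- 1 / (4 * (s / a))))"
          using elim a by (simp add: powr_divide)
        also have "\<dots> \<le> a powr (- p) * (C * (1 - exp (- (s / a))))"
          using elim a by (intro mult_left_mono pw) auto
        finally show ?case by simp
      qed
    qed
    also have "\<dots> = a powr (- p) * (C * (1 - exp (- ((1 / a) powr \<beta>))))"
      using stable_exp_integrable[of "1 / a"] stable_props(3)[of "1 / a"] a stable.prob_space
      by (simp add: Bochner_Integration.integral_diff)
    also have "\<dots> \<le> a powr (- p) * (C * (1 / a) powr \<beta>)"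
      using C one_minus_exp_le by (intro mult_left_mono) auto
    also have "\<dots> = C * a powr (- (p + \<beta>))"
      using a by (simp add: powr_divide powr_minus powr_add powr_diff field_simps)
    finally show ?thesis .
  qed
  with C show ?thesis by blast
qed

lemma gauss_mom_upper:
  assumes "0 \<le> p"
  shows "\<exists>C\<ge>0. \<forall>a\<ge>0. gauss_mom p a \<le> C * (1 + a) powr (- (p + \<beta>))"
proof -
  obtain C where C: "0 \<le> C" "\<And>a. 0 < a \<Longrightarrow> gauss_mom p a \<le> C * a powr (- (p + \<beta>))"
    using gauss_mom_upper_large[OF assms] by blast
  let ?D = "max C (gauss_mom p 0) * 2 powr (p + \<beta>)"
  have D: "gauss_mom p a \<le> ?D * (1 + a) powr (- (p + \<beta>))" if a: "0 \<le> a" for a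
  proof (cases "1 \<le> a")
    case True
    have "gauss_mom p a \<le> C * a powr (- (p + \<beta>))" using C True by auto
    also have "a powr (- (p + \<beta>)) \<le> ((1 + a) / 2) powr (- (p + \<beta>))"
      using True assms beta_pos by (intro powr_mono2') auto
    also have "\<dots> = 2 powr (p + \<beta>) * (1 + a) powr (- (p + \<beta>))"
      using a by (simp add: powr_divide powr_minus powr_diff powr_add field_simps)
    also have "C * (2 powr (p + \<beta>) * (1 + a) powr (- (p + \<beta>))) \<le> max C (gauss_mom p 0) * (2 powr (p + \<beta>) * (1 + a) powr (- (p + \<beta>)))"
      by (intro mult_right_mono) auto
    finally show ?thesis using C(1) by (simp add: mult.assoc mult_left_mono)
  next
    case False
    have "gauss_mom p a \<le> gauss_mom p 0" using a assms by (intro gauss_mom_antimono) auto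
    also have "gauss_mom p 0 \<le> max C (gauss_mom p 0) * 1" by simp
    also have "1 \<le> 2 powr (p + \<beta>) * (1 + a) powr (- (p + \<beta>))"
    proof -
      have "(1 + a) powr (p + \<beta>) \<le> 2 powr (p + \<beta>)"
        using a False assms beta_pos by (intro powr_mono2) auto
      then show ?thesis using a by (simp only: powr_minus) (simp add: field_simps)
    qed
    finally show ?thesis using C(1) by (simp add: mult.assoc mult_left_mono)
  qed
  then show ?thesis using C(1) by (intro exI[of _ ?D]) auto
qed

text \<open>Conversely, with \<open>l = 1 / a\<close> and \<open>v = l * s\<close>, the function \<open>1 - exp (- v)\<close> is at most a multiple of the integrand plus two error terms, one
  for small and one for large \<open>v\<close>, which are combinations of exponentials. The integral of the
  left-hand side is at least \<open>l powr \<beta> / 2\<close>.\<close>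
lemma gauss_mom_lower_large:
  assumes p: "0 \<le> p"
  shows "\<exists>c>0. \<forall>a\<ge>1. c * a powr (- (p + \<beta>)) \<le> gauss_mom p a"
proof -
  \<comment> \<open>The cut points \<open>e0\<close> and \<open>A\<close> between small, medium and large \<open>v\<close> are such that each error term
     contributes at most \<open>l powr \<beta> / 8\<close>.\<close>
  define e0 where "e0 = (1 / (16 * exp 1)) powr (1 / (1 - \<beta>))"
  define A where "A = (16::real) powr (1 / \<beta>)"
  have e0: "0 < e0" "2 * exp 1 * e0 powr (1 - \<beta>) = 1/8"
    using beta_less_1 by (auto simp: e0_def powr_powr)
  have A: "0 < A" "2 * A powr (- \<beta>) = 1/8"
    using beta_pos by (auto simp: A_def powr_powr powr_minus)
  define C where "C = A powr p * exp (1 / (4 * e0))"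
  have C: "0 < C" using A by (simp add: C_def)
  have half: "exp (- 1) \<le> (1/2::real)" by (rule exp_m1_le_half)
  let ?R = "\<lambda>v. C * (v powr (- p) * exp (- 1 / (4 * v))) +
      2 * exp 1 * e0 * (exp (- (1 / (2 * e0)) * v) - exp (- (1 / e0) * v)) + 2 * (1 - exp (- (1 / A) * v))"
  have pw: "1 - exp (- v) \<le> ?R v" if v: "0 < v" for v
  proof -
    have 1: "0 \<le> C * (v powr (- p) * exp (- 1 / (4 * v)))" using C by simp
    have 2: "0 \<le> 2 * exp 1 * e0 * (exp (- (1 / (2 * e0)) * v) - exp (- (1 / e0) * v))"
      using e0 v by (auto intro!: mult_nonneg_nonneg simp: field_simps)
    have 3: "0 \<le> 2 * (1 - exp (- (1 / A) * v))" using A v by simp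
    consider "v \<le> e0" | "A \<le> v" | "e0 < v" "v < A" by linarith
    then show ?thesis
    proof cases
      case 1
      define y where "y = v / (2 * e0)"
      have y: "0 < y" "y \<le> 1/2" using 1 v e0 by (auto simp: y_def field_simps)
      have "exp (- 1) * y \<le> exp (- 2 * y) * (exp y - 1)"
      proof -
        have "y \<le> exp y - 1" using exp_ge_add_one_self[of y] by linarith
        then show ?thesis using y by (intro mult_mono) auto
      qed
      also have "\<dots> = exp (- (1 / (2 * e0)) * v) - exp (- (1 / e0) * v)"
        using e0 by (simp add: y_def algebra_simps exp_add[symmetric])
      finally have "2 * exp 1 * e0 * (exp (- 1) * y) \<le> 2 * exp 1 * e0 * (exp (- (1 / (2 * e0)) * v) - exp (- (1 / e0) * v))"
        using e0 by (intro mult_left_mono) auto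
      moreover have "2 * exp 1 * e0 * (exp (- 1) * y) = v"
        using e0 by (simp add: y_def exp_minus)
      ultimately show ?thesis
        using \<open>0 \<le> C * _\<close> 3 one_minus_exp_le[of v] by linarith
    next
      case 2
      then have "1 \<le> (1 / A) * v" using A by (simp add: field_simps)
      then have "exp (- (1 / A) * v) \<le> exp (- 1)" by simp
      then have "exp (- (1 / A) * v) \<le> 1 / 2" using half by (rule order_trans)
      moreover have "1 \<le> 2 * (1 - E)" if "E \<le> 1 / 2" for E :: real using that by simp
      ultimately have "1 \<le> 2 * (1 - exp (- (1 / A) * v))" by blast
      moreover have "0 < exp (- v)" by simp
      ultimately show ?thesis
        using 1 \<open>0 \<le> 2 * exp 1 * e0 * _\<close> by linarith
    next
      case 3
      have "A powr (- p) \<le> v powr (- p)" using 3 v p by (intro powr_mono2') auto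
      moreover have "exp (- 1 / (4 * e0)) \<le> exp (- 1 / (4 * v))"
        using 3 e0 by (simp add: field_simps)
      ultimately have "C * (A powr (- p) * exp (- 1 / (4 * e0))) \<le> C * (v powr (- p) * exp (- 1 / (4 * v)))"
        using C by (intro mult_left_mono mult_mono) auto
      moreover have "C * (A powr (- p) * exp (- 1 / (4 * e0))) = 1"
        using A(1) by (simp add: C_def powr_minus exp_minus field_simps)
      moreover have "0 < exp (- v)" by simp
      ultimately show ?thesis
        using 2 \<open>0 \<le> 2 * (1 - _)\<close> by linarith
    qed
  qed
  have "1 / (4 * C) * a powr (- (p + \<beta>)) \<le> gauss_mom p a" if a: "1 \<le> a" for a
  proof -
    define l where "l = 1 / a"
    have l: "0 < l" "l \<le> 1" using a by (auto simp: l_def)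
    have int: "integrable stable (\<lambda>s. exp (- x * s))" "(\<integral>s. exp (- x * s) \<partial>stable) = exp (- (x powr \<beta>))"
      if "0 \<le> x" for x
      using stable_exp_integrable[OF that] stable_props(3)[OF that] by auto
    have "1 - exp (- (l powr \<beta>)) = (\<integral>s. 1 - exp (- l * s) \<partial>stable)"
      using int[of l] l stable.prob_space by (subst Bochner_Integration.integral_diff) auto
    also have "\<dots> \<le> (\<integral>s. (C * a powr p) * (s powr (- p) * exp (- a / (4 * s))) +
      (2 * exp 1 * e0 * (exp (- (l / (2 * e0)) * s) - exp (- (l / e0) * s)) + 2 * (1 - exp (- (l / A) * s))) \<partial>stable)"
    proof (rule integral_mono_AE)
      show "integrable stable (\<lambda>s. 1 - exp (- l * s))" using int[of l] l by auto
      show "integrable stable (\<lambda>s. (C * a powr p) * (s powr (- p) * exp (- a / (4 * s))) +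
      (2 * exp 1 * e0 * (exp (- (l / (2 * e0)) * s) - exp (- (l / e0) * s)) + 2 * (1 - exp (- (l / A) * s))))"
        using int(1)[of "l / (2 * e0)"] int(1)[of "l / e0"] int(1)[of "l / A"] gauss_mom_integrable[of p a] l e0 A a p
        by (intro Bochner_Integration.integrable_add Bochner_Integration.integrable_mult_right
            Bochner_Integration.integrable_diff) auto
      show "AE s in stable. 1 - exp (- l * s) \<le> (C * a powr p) * (s powr (- p) * exp (- a / (4 * s))) +
      (2 * exp 1 * e0 * (exp (- (l / (2 * e0)) * s) - exp (- (l / e0) * s)) + 2 * (1 - exp (- (l / A) * s)))"
        using stable_props(2)
      proof eventually_elim
        case (elim s)
        have *: "(l * s) powr (- p) = a powr p * s powr (- p)"
          using elim a by (simp add: l_def powr_divide powr_minus powr_mult field_simps)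
        have "1 - exp (- (l * s)) \<le> ?R (l * s)" using elim l by (intro pw) auto
        also have "\<dots> = (C * a powr p) * (s powr (- p) * exp (- a / (4 * s))) +
      (2 * exp 1 * e0 * (exp (- (l / (2 * e0)) * s) - exp (- (l / e0) * s)) + 2 * (1 - exp (- (l / A) * s)))"
          unfolding * using a elim by (simp add: l_def field_simps)
        finally show ?case by simp
      qed
    qed
    also have "\<dots> = (C * a powr p) * gauss_mom p a +
      (2 * exp 1 * e0 * (exp (- ((l / (2 * e0)) powr \<beta>)) - exp (- ((l / e0) powr \<beta>))) + 2 * (1 - exp (- ((l / A) powr \<beta>))))"
      using int[of "l / (2 * e0)"] int[of "l / e0"] int[of "l / A"] gauss_mom_integrable[of p a] l e0 A a p stable.prob_space
      unfolding gauss_mom_def by (simp add: Bochner_Integration.integral_add Bochner_Integration.integral_diff)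
    also have "\<dots> \<le> (C * a powr p) * gauss_mom p a + (2 * exp 1 * e0 * (l / e0) powr \<beta> + 2 * (l / A) powr \<beta>)"
    proof -
      have "exp (- ((l / (2 * e0)) powr \<beta>)) \<le> 1" by simp
      then have "exp (- ((l / (2 * e0)) powr \<beta>)) - exp (- ((l / e0) powr \<beta>)) \<le> (l / e0) powr \<beta>"
        using one_minus_exp_le[of "(l / e0) powr \<beta>"] by linarith
      then show ?thesis
        using one_minus_exp_le[of "(l / A) powr \<beta>"] e0
        by (intro add_left_mono, intro add_mono mult_left_mono) auto
    qed
    also have "2 * exp 1 * e0 * (l / e0) powr \<beta> = l powr \<beta> * (2 * exp 1 * e0 powr (1 - \<beta>))"
      using l e0 by (simp add: powr_divide powr_diff)
    also have "2 * (l / A) powr \<beta> = l powr \<beta> * (2 * A powr (- \<beta>))"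
      using l A by (simp add: powr_divide powr_minus field_simps)
    also have "l powr \<beta> * (2 * exp 1 * e0 powr (1 - \<beta>)) + l powr \<beta> * (2 * A powr (- \<beta>)) = l powr \<beta> / 4"
      by (simp only: e0 A)
    finally have up: "1 - exp (- (l powr \<beta>)) \<le> (C * a powr p) * gauss_mom p a + l powr \<beta> / 4" .
    have "l powr \<beta> / 2 \<le> 1 - exp (- (l powr \<beta>))"
    proof -
      define y where "y = l powr \<beta>"
      have y: "0 < y" "y \<le> 1" using l beta_pos by (auto simp: y_def powr_le1)
      have "1 + y \<le> exp y" by (rule exp_ge_add_one_self)
      then have "exp (- y) \<le> 1 / (1 + y)" using y by (simp add: exp_minus field_simps)
      also have "\<dots> \<le> 1 - y / 2" using y by (simp add: field_simps)
      finally show ?thesis by (simp add: y_def)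
    qed
    with up have "l powr \<beta> / 4 \<le> (C * a powr p) * gauss_mom p a" by linarith
    then show ?thesis
      using C a by (simp add: l_def powr_divide powr_minus powr_add powr_diff field_simps)
  qed
  then show ?thesis using C by (intro exI[of _ "1 / (4 * C)"]) auto
qed

lemma gauss_mom_lower:
  assumes "0 \<le> p"
  shows "\<exists>c>0. \<forall>a\<ge>0. c * (1 + a) powr (- (p + \<beta>)) \<le> gauss_mom p a"
proof -
  obtain c where c: "0 < c" "\<And>a. 1 \<le> a \<Longrightarrow> c * a powr (- (p + \<beta>)) \<le> gauss_mom p a"
    using gauss_mom_lower_large[OF assms] by blast
  have "c * (1 + a) powr (- (p + \<beta>)) \<le> gauss_mom p a" if a: "0 \<le> a" for a
  proof -
    have "c * (1 + a) powr (- (p + \<beta>)) \<le> gauss_mom p (1 + a)" using c a by auto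
    also have "\<dots> \<le> gauss_mom p a" using a assms by (intro gauss_mom_antimono) auto
    finally show ?thesis .
  qed
  with c show ?thesis by blast
qed

end

section \<open>Gaussian integrals and changes of variables\<close>

lemma lborel_nn_integral_affine:
  fixes t :: "'a::euclidean_space"
  assumes "c \<noteq> 0" and [measurable]: "f \<in> borel_measurable borel"
  shows "(\<integral>\<^sup>+x. f x \<partial>lborel) = ennreal (\<bar>c\<bar> ^ DIM('a)) * (\<integral>\<^sup>+x. f (t + c *\<^sub>R x) \<partial>lborel)"
  by (subst lborel_affine[OF assms(1), of t])
     (simp add: nn_integral_density nn_integral_distr nn_integral_cmult)

lemma lborel_integral_affine:
  fixes t :: "'a::euclidean_space" and f :: "'a \<Rightarrow> 'b::{banach, second_countable_topology}"
  assumes "c \<noteq> 0" "f \<in> borel_measurable borel"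
  shows "integral\<^sup>L lborel f = \<bar>c\<bar> ^ DIM('a) *\<^sub>R (\<integral>x. f (t + c *\<^sub>R x) \<partial>lborel)"
  using assms(2)
  by (subst lborel_affine[OF assms(1), of t]) (simp add: integral_density integral_distr)

lemma lborel_integrable_affine:
  fixes t :: "'a::euclidean_space" and f :: "'a \<Rightarrow> 'b::{banach, second_countable_topology}"
  assumes "c \<noteq> 0" "integrable lborel f"
  shows "integrable lborel (\<lambda>x. f (t + c *\<^sub>R x))"
proof -
  have [measurable]: "f \<in> borel_measurable borel" using assms(2) by simp
  have "integrable (density (distr lborel borel (\<lambda>x. t + c *\<^sub>R x)) (\<lambda>_. \<bar>c\<bar>^DIM('a))) f"
    using assms(2) by (subst lborel_affine[OF assms(1), of t, symmetric])
  then have "integrable lborel (\<lambda>x. \<bar>c\<bar>^DIM('a) *\<^sub>R f (t + c *\<^sub>R x))"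
    by (subst (asm) integrable_density) (auto simp: integrable_distr_eq)
  from integrable_scaleR_right[OF this, of "inverse (\<bar>c\<bar> ^ DIM('a))"] show ?thesis
    using assms(1) by simp
qed

lemma cis_measurable [measurable]:
  "f \<in> borel_measurable M \<Longrightarrow> (\<lambda>x. cis (f x)) \<in> borel_measurable M"
  by (rule borel_measurable_continuous_on[of cis]) (auto intro!: continuous_intros)

lemma lborel_integral_reflect:
  fixes f :: "'a::euclidean_space \<Rightarrow> 'b::{banach, second_countable_topology}"
  assumes "f \<in> borel_measurable borel"
  shows "(\<integral>y. f (x - y) \<partial>lborel) = integral\<^sup>L lborel f"
  using lborel_integral_affine[of "-1" f x] assms by simp

lemma lborel_integrable_reflect:
  fixes f :: "'a::euclidean_space \<Rightarrow> 'b::{banach, second_countable_topology}"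
  assumes "integrable lborel f"
  shows "integrable lborel (\<lambda>y. f (x - y))"
  using lborel_integrable_affine[of "-1" f x] assms by simp

lemma gaussian_fourier_1d:
  fixes c t :: real
  assumes c: "0 < c"
  shows "integrable lborel (\<lambda>x. cis (x * t) * of_real (exp (- c * x\<^sup>2)))" (is ?I)
    and "(\<integral>x. cis (x * t) * of_real (exp (- c * x\<^sup>2)) \<partial>lborel) = of_real (sqrt (pi / c) * exp (- t\<^sup>2 / (4 * c)))" (is ?E)
proof -
  define k where "k = 1 / sqrt (2 * c)"
  have k: "0 < k" "k\<^sup>2 = 1 / (2 * c)" using c by (auto simp: k_def power_divide)
  define g where "g = (\<lambda>x. std_normal_density x *\<^sub>R cis (k * t * x))"
  have int: "integrable lborel g"
    unfolding g_def
    by (rule Bochner_Integration.integrable_bound[OF integrable_std_normal_moment_abs[of 0]])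
       (auto simp: normal_density_nonneg)
  have "integral\<^sup>L lborel g = char std_normal_distribution (k * t)"
    by (simp add: char_def g_def integral_density normal_density_nonneg cis_conv_exp mult_ac)
  also have "\<dots> = of_real (exp (- (k * t)\<^sup>2 / 2))"
    by (simp add: char_std_normal_distribution)
  finally have val: "integral\<^sup>L lborel g = of_real (exp (- (k * t)\<^sup>2 / 2))" .
  have eq: "cis (x * t) * of_real (exp (- c * x\<^sup>2)) = of_real (sqrt (2 * pi)) * g (0 + (1 / k) * x)" for x
  proof -
    have "(x / k)\<^sup>2 / 2 = c * x\<^sup>2" using k c by (simp add: power_divide)
    then show ?thesis
      using k by (simp add: g_def std_normal_density_def scaleR_conv_of_real mult_ac)
  qed
  show ?I
    unfolding eq using k int by (intro integrable_mult_right lborel_integrable_real_affine) auto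
  have "(\<integral>x. cis (x * t) * of_real (exp (- c * x\<^sup>2)) \<partial>lborel) = of_real (sqrt (2 * pi)) * (\<integral>x. g (0 + (1 / k) * x) \<partial>lborel)"
    unfolding eq by (rule integral_mult_right_zero)
  also have "(\<integral>x. g (0 + (1 / k) * x) \<partial>lborel) = of_real k * integral\<^sup>L lborel g"
    using lborel_integral_real_affine[of "1 / k" g 0] k
    by (simp add: scaleR_conv_of_real)
  also have "of_real (sqrt (2 * pi)) * (of_real k * integral\<^sup>L lborel g) =
     of_real (sqrt (pi / c) * exp (- t\<^sup>2 / (4 * c)))"
  proof -
    have "sqrt (2 * pi) * k = sqrt (pi / c)"
      using c by (simp add: k_def real_sqrt_mult real_sqrt_divide)
    moreover have "(k * t)\<^sup>2 / 2 = t\<^sup>2 / (4 * c)" using k by (simp add: power_mult_distrib)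
    ultimately show ?thesis unfolding val
      by (simp add: mult.assoc[symmetric] flip: of_real_mult)
  qed
  finally show ?E .
qed

lemma norm_power2_sum: "(norm x)\<^sup>2 = (\<Sum>b\<in>Basis. (x \<bullet> b)\<^sup>2)" for x :: "'a::euclidean_space"
  by (subst power2_norm_eq_inner, subst euclidean_inner) (simp add: power2_eq_square)

lemma gaussian_fourier:
  fixes y :: "'a::euclidean_space"
  assumes c: "0 < c"
  shows "integrable lborel (\<lambda>x. cis (x \<bullet> y) * of_real (exp (- c * (norm x)\<^sup>2)))" (is "integrable _ ?f")
    and "(\<integral>x. cis (x \<bullet> y) * of_real (exp (- c * (norm x)\<^sup>2)) \<partial>lborel) =
       of_real ((pi / c) powr (DIM('a) / 2) * exp (- (norm y)\<^sup>2 / (4 * c)))" (is ?E)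
proof -
  let ?g = "\<lambda>b x. cis (x * (y \<bullet> b)) * of_real (exp (- c * x\<^sup>2))"
  interpret product_sigma_finite "\<lambda>_. lborel :: real measure" by standard
  have f: "?f x = (\<Prod>b\<in>Basis. ?g b (x \<bullet> b))" for x
  proof -
    have "cis (x \<bullet> y) = (\<Prod>b\<in>Basis. cis ((x \<bullet> b) * (y \<bullet> b)))"
      by (simp add: euclidean_inner[of x y] cis_conv_exp sum_distrib_left exp_sum)
    moreover have "exp (- c * (norm x)\<^sup>2) = (\<Prod>b\<in>Basis. exp (- c * (x \<bullet> b)\<^sup>2))"
      by (simp only: norm_power2_sum[of x] sum_distrib_left exp_sum finite_Basis)
    ultimately show ?thesis by (simp only: prod.distrib of_real_prod)
  qed
  let ?T = "\<lambda>f. \<Sum>b\<in>Basis. f b *\<^sub>R b :: 'a"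
  have T: "?T z \<bullet> b = z b" if "b \<in> Basis" for z b
    using that by (simp add: inner_sum_left inner_Basis if_distrib cong: if_cong)
  have Tf: "?f (?T z) = (\<Prod>b\<in>Basis. ?g b (z b))" for z
    unfolding f using T by (intro prod.cong) auto
  have m: "?T \<in> measurable (Pi\<^sub>M Basis (\<lambda>b. lborel)) borel"
    by measurable
  have fm: "?f \<in> borel_measurable borel" by measurable
  have L: "distr (Pi\<^sub>M Basis (\<lambda>b. lborel)) borel ?T = lborel"
    by (rule lborel_eq[symmetric])
  have "integrable (Pi\<^sub>M Basis (\<lambda>b. lborel)) (\<lambda>z. ?f (?T z))"
    unfolding Tf by (intro product_integrable_prod gaussian_fourier_1d(1)[OF c]) auto
  then show "integrable lborel ?f"
    using integrable_distr_eq[OF m fm] unfolding L by blast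
  have "(\<integral>x. ?f x \<partial>lborel) = (\<integral>z. ?f (?T z) \<partial>Pi\<^sub>M Basis (\<lambda>b. lborel))"
    using integral_distr[OF m fm] unfolding L .
  also have "\<dots> = (\<Prod>b\<in>Basis. \<integral>x. ?g b x \<partial>lborel)"
    unfolding Tf by (intro product_integral_prod gaussian_fourier_1d(1)[OF c]) auto
  also have "\<dots> = (\<Prod>b\<in>Basis. of_real (sqrt (pi / c) * exp (- (y \<bullet> b)\<^sup>2 / (4 * c))))"
    using gaussian_fourier_1d(2)[OF c] by (intro prod.cong) auto
  also have "\<dots> = of_real (sqrt (pi / c) ^ DIM('a) * exp (- (norm y)\<^sup>2 / (4 * c)))"
  proof -
    have "(\<Sum>b\<in>Basis. - (y \<bullet> b)\<^sup>2 / (4 * c)) = - (norm y)\<^sup>2 / (4 * c)"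
      by (simp add: norm_power2_sum[of y] sum_divide_distrib sum_negf)
    then have "(\<Prod>b\<in>Basis. exp (- (y \<bullet> b)\<^sup>2 / (4 * c))) = exp (- (norm y)\<^sup>2 / (4 * c))"
      by (simp only: exp_sum[symmetric] finite_Basis)
    then show ?thesis
      by (simp only: of_real_prod[symmetric] prod.distrib prod_constant)
  qed
  also have "sqrt (pi / c) ^ DIM('a) = (pi / c) powr (DIM('a) / 2)"
    using c by (simp add: powr_half_sqrt[symmetric] powr_powr flip: powr_realpow)
  finally show ?E .
qed

lemma gaussian_integral:
  assumes c: "0 < c"
  shows "integrable lborel (\<lambda>x::'a::euclidean_space. exp (- c * (norm x)\<^sup>2))"
    and "(\<integral>x. exp (- c * (norm (x::'a))\<^sup>2) \<partial>lborel) = (pi / c) powr (DIM('a) / 2)"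
proof -
  show "integrable lborel (\<lambda>x::'a. exp (- c * (norm x)\<^sup>2))"
    using integrable_norm[OF gaussian_fourier(1)[OF c, of 0]] by (simp add: norm_mult)
  have "complex_of_real (\<integral>x. exp (- c * (norm (x::'a))\<^sup>2) \<partial>lborel) = of_real ((pi / c) powr (DIM('a) / 2))"
    using gaussian_fourier(2)[OF c, of "0::'a"] by simp
  then show "(\<integral>x. exp (- c * (norm (x::'a))\<^sup>2) \<partial>lborel) = (pi / c) powr (DIM('a) / 2)"
    by (simp only: of_real_eq_iff)
qed

text \<open>The justification of Fubini's theorem for products with an oscillating factor \<open>h\<close>.\<close>
lemma integrable_product_bounded:
  fixes M :: "'a measure" and N :: "'b measure"
    and f :: "'a \<Rightarrow> complex" and g :: "'b \<Rightarrow> complex" and h :: "'a \<Rightarrow> 'b \<Rightarrow> complex"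
  assumes "sigma_finite_measure M" "sigma_finite_measure N"
  assumes f: "integrable M f" and g: "integrable N g"
    and h[measurable]: "(\<lambda>(x, y). h x y) \<in> borel_measurable (M \<Otimes>\<^sub>M N)"
    and le: "\<And>x y. norm (h x y) \<le> B"
  shows "integrable (M \<Otimes>\<^sub>M N) (\<lambda>(x, y). f x * g y * h x y)"
proof -
  interpret M: sigma_finite_measure M by fact
  interpret N: sigma_finite_measure N by fact
  interpret pair_sigma_finite M N ..
  have [measurable]: "f \<in> borel_measurable M" "g \<in> borel_measurable N" using f g by auto
  have h'[measurable]: "(\<lambda>p. h (fst p) (snd p)) \<in> borel_measurable (M \<Otimes>\<^sub>M N)"
    using h by (simp add: case_prod_beta')
  have 1: "integrable (M \<Otimes>\<^sub>M N) (\<lambda>(x, y). f x * g y)"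
  proof (rule Fubini_integrable)
    show "integrable M (\<lambda>x. \<integral>y. norm (case (x, y) of (x, y) \<Rightarrow> f x * g y) \<partial>N)"
      using f by (simp add: norm_mult)
    show "AE x in M. integrable N (\<lambda>y. case (x, y) of (x, y) \<Rightarrow> f x * g y)"
      using g by simp
  qed measurable
  show ?thesis
  proof (rule Bochner_Integration.integrable_bound[OF integrable_mult_right[OF 1, of "of_real B"]])
    show "AE p in M \<Otimes>\<^sub>M N. norm (case p of (x, y) \<Rightarrow> f x * g y * h x y) \<le> norm (of_real B * (case p of (x, y) \<Rightarrow> f x * g y))"
    proof (rule AE_I2)
      fix p :: "'a \<times> 'b"
      obtain x y where p: "p = (x, y)" by (cases p)
      have "norm (h x y) \<le> \<bar>B\<bar>" using le[of x y] by linarith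
      then show "norm (case p of (x, y) \<Rightarrow> f x * g y * h x y) \<le> norm (of_real B * (case p of (x, y) \<Rightarrow> f x * g y))"
        by (simp add: p norm_mult mult.commute mult_right_mono)
    qed
  qed (simp add: case_prod_beta')
qed

section \<open>The kernel of the fractional heat semigroup\<close>

context fractional begin

text \<open>The negative moments of the stable law are finite, so a power bound on the integral norms
  in \<open>s\<close> suffices for exchanging the mixture with an integral over space.\<close>
lemma stable_fubini:
  fixes f :: "real \<Rightarrow> 'a::euclidean_space \<Rightarrow> complex"
  assumes f[measurable]: "(\<lambda>(s, x). f s x) \<in> borel_measurable (borel \<Otimes>\<^sub>M borel)"
    and int: "\<And>s. 0 < s \<Longrightarrow> integrable lborel (f s)"
    and le: "\<And>s. 0 < s \<Longrightarrow> (\<integral>x. norm (f s x) \<partial>lborel) \<le> C * s powr (- p)" and p: "0 \<le> p"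
  shows "(\<integral>x. (\<integral>s. f s x \<partial>stable) \<partial>lborel) = (\<integral>s. (\<integral>x. f s x \<partial>lborel) \<partial>stable)"
    and "integrable lborel (\<lambda>x. \<integral>s. f s x \<partial>stable)"
proof -
  interpret pair_sigma_finite stable "lborel :: 'a measure" ..
  have "integrable (stable \<Otimes>\<^sub>M lborel) (\<lambda>(s, x). f s x)"
  proof (rule Fubini_integrable)
    show "integrable stable (\<lambda>s. \<integral>x. norm (case (s, x) of (s, x) \<Rightarrow> f s x) \<partial>lborel)"
    proof (rule Bochner_Integration.integrable_bound[OF integrable_mult_right[OF stable_moment_integrable[OF p], of C]])
      show "AE s in stable. norm (\<integral>x. norm (case (s, x) of (s, x) \<Rightarrow> f s x) \<partial>lborel) \<le> norm (C * s powr (- p))"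
        using stable_props(2)
      proof eventually_elim
        case (elim s)
        have "0 \<le> (\<integral>x. norm (f s x) \<partial>lborel)" by simp
        then show ?case using le[OF elim] by simp
      qed
    qed measurable
    show "AE s in stable. integrable lborel (\<lambda>x. case (s, x) of (s, x) \<Rightarrow> f s x)"
      using stable_props(2) by eventually_elim (simp add: int)
  qed measurable
  from Fubini_integral[OF this] integrable_snd[OF this]
  show "(\<integral>x. (\<integral>s. f s x \<partial>stable) \<partial>lborel) = (\<integral>s. (\<integral>x. f s x \<partial>lborel) \<partial>stable)"
    "integrable lborel (\<lambda>x. \<integral>s. f s x \<partial>stable)" by auto
qed

text \<open>The Gaussian mixture that turns out to be the heat kernel.\<close>
definition kern :: "real \<Rightarrow> 'a::euclidean_space \<Rightarrow> real" where
  "kern t x = (4 * pi) powr (- (DIM('a) / 2)) * t powr (- (DIM('a) / (2 * \<beta>))) *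
     gauss_mom (DIM('a) / 2) ((norm x)\<^sup>2 * t powr (- 1 / \<beta>))"

lemma kern_mixture:
  fixes x :: "'a::euclidean_space"
  assumes t: "0 < t"
  shows "kern t x = (\<integral>s. (4 * pi * (t powr (1 / \<beta>) * s)) powr (- (DIM('a) / 2)) *
     exp (- (norm x)\<^sup>2 / (4 * (t powr (1 / \<beta>) * s))) \<partial>stable)"
proof -
  have "(\<integral>s. (4 * pi * (t powr (1 / \<beta>) * s)) powr (- (DIM('a) / 2)) *
     exp (- (norm x)\<^sup>2 / (4 * (t powr (1 / \<beta>) * s))) \<partial>stable) =
    (\<integral>s. ((4 * pi) powr (- (DIM('a) / 2)) * t powr (- (DIM('a) / (2 * \<beta>)))) *
      (s powr (- (DIM('a) / 2)) * exp (- ((norm x)\<^sup>2 * t powr (- 1 / \<beta>)) / (4 * s))) \<partial>stable)"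
  proof (rule integral_cong_AE)
    show "AE s in stable. (4 * pi * (t powr (1 / \<beta>) * s)) powr (- (DIM('a) / 2)) *
     exp (- (norm x)\<^sup>2 / (4 * (t powr (1 / \<beta>) * s))) =
      ((4 * pi) powr (- (DIM('a) / 2)) * t powr (- (DIM('a) / (2 * \<beta>)))) *
      (s powr (- (DIM('a) / 2)) * exp (- ((norm x)\<^sup>2 * t powr (- 1 / \<beta>)) / (4 * s)))"
      using stable_props(2)
    proof eventually_elim
      case (elim s)
      have "(4 * pi * (t powr (1 / \<beta>) * s)) powr (- (DIM('a) / 2)) =
        (4 * pi) powr (- (DIM('a) / 2)) * t powr (- (DIM('a) / (2 * \<beta>))) * s powr (- (DIM('a) / 2))"
        using elim t by (simp add: powr_mult powr_powr mult.commute)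
      moreover have "- (norm x)\<^sup>2 / (4 * (t powr (1 / \<beta>) * s)) = - ((norm x)\<^sup>2 * t powr (- 1 / \<beta>)) / (4 * s)"
        using elim t by (simp add: powr_minus field_simps)
      ultimately show ?case by simp
    qed
  qed auto
  then show ?thesis by (simp add: kern_def gauss_mom_def)
qed

lemma symbol_mixture:
  fixes \<xi> :: "'a::euclidean_space"
  assumes t: "0 < t"
  shows "(\<integral>s. exp (- (t powr (1 / \<beta>) * s) * (norm \<xi>)\<^sup>2) \<partial>stable) = exp (- t * norm \<xi> powr (2 * \<beta>))"
proof -
  have "(\<integral>s. exp (- (t powr (1 / \<beta>) * s) * (norm \<xi>)\<^sup>2) \<partial>stable) = (\<integral>s. exp (- (t powr (1 / \<beta>) * (norm \<xi>)\<^sup>2) * s) \<partial>stable)"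
    by (simp add: mult_ac)
  also have "\<dots> = exp (- ((t powr (1 / \<beta>) * (norm \<xi>)\<^sup>2) powr \<beta>))"
    by (rule stable_props) simp
  also have "(t powr (1 / \<beta>) * (norm \<xi>)\<^sup>2) powr \<beta> = t * norm \<xi> powr (2 * \<beta>)"
  proof (cases "\<xi> = 0")
    case False
    then have "(norm \<xi>)\<^sup>2 = norm \<xi> powr 2" by simp
    then show ?thesis
      using t beta_pos by (simp only: powr_mult powr_powr) simp
  qed simp
  finally show ?thesis by simp
qed

lemma symbol_integrable:
  assumes t: "0 < t"
  shows "integrable lborel (\<lambda>\<xi>::'a::euclidean_space. exp (- t * norm \<xi> powr (2 * \<beta>)))"
proof -
  let ?T = "t powr (1 / \<beta>)"
  have T: "0 < ?T" using t by simp
  have "integrable lborel (\<lambda>\<xi>::'a. \<integral>s. complex_of_real (exp (- (?T * s) * (norm \<xi>)\<^sup>2)) \<partial>stable)"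
  proof (rule stable_fubini(2)[where C = "(pi / ?T) powr (DIM('a) / 2)" and p = "DIM('a) / 2"])
    fix s :: real assume s: "0 < s"
    show "integrable lborel (\<lambda>\<xi>::'a. complex_of_real (exp (- (?T * s) * (norm \<xi>)\<^sup>2)))"
      using gaussian_integral(1)[of "?T * s"] T s by (intro integrable_of_real) simp
    show "(\<integral>\<xi>. norm (complex_of_real (exp (- (?T * s) * (norm (\<xi>::'a))\<^sup>2))) \<partial>lborel)
      \<le> (pi / ?T) powr (DIM('a) / 2) * s powr (- (DIM('a) / 2))"
      using gaussian_integral(2)[of "?T * s", where 'a = 'a] T s
      by (simp add: powr_divide powr_mult powr_minus field_simps)
  qed auto
  then show ?thesis
    by (simp only: integral_complex_of_real symbol_mixture[OF t] complex_of_real_integrable_eq)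
qed

text \<open>The inversion formula for Gaussians, integrated over the mixing law.\<close>
lemma heat_kernel_eq_kern:
  fixes x :: "'a::euclidean_space"
  assumes t: "0 < t"
  shows "heat_kernel \<beta> t x = of_real (kern t x)"
proof -
  let ?T = "t powr (1 / \<beta>)"
  have T: "0 < ?T" using t by simp
  let ?f = "\<lambda>s \<xi>. cis (\<xi> \<bullet> x) * of_real (exp (- (?T * s) * (norm \<xi>)\<^sup>2))"
  have "(\<integral>\<xi>. cis (x \<bullet> \<xi>) * complex_of_real (exp (- t * norm \<xi> powr (2 * \<beta>))) \<partial>lborel) =
    (\<integral>\<xi>. (\<integral>s. ?f s \<xi> \<partial>stable) \<partial>lborel)"
  proof -
    have "(\<integral>s. ?f s \<xi> \<partial>stable) = cis (x \<bullet> \<xi>) * complex_of_real (exp (- t * norm \<xi> powr (2 * \<beta>)))" for \<xi>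
      by (simp only: integral_mult_right_zero integral_complex_of_real symbol_mixture[OF t] inner_commute[of \<xi> x])
    then show ?thesis by (simp only:)
  qed
  also have "\<dots> = (\<integral>s. (\<integral>\<xi>. ?f s \<xi> \<partial>lborel) \<partial>stable)"
  proof (rule stable_fubini(1)[where C = "(pi / ?T) powr (DIM('a) / 2)" and p = "DIM('a) / 2"])
    fix s :: real assume s: "0 < s"
    show "integrable lborel (\<lambda>\<xi>. ?f s \<xi>)"
      using gaussian_fourier(1)[of "?T * s" x] T s by simp
    show "(\<integral>\<xi>. norm (?f s \<xi>) \<partial>lborel) \<le> (pi / ?T) powr (DIM('a) / 2) * s powr (- (DIM('a) / 2))"
      using gaussian_integral(2)[of "?T * s", where 'a = 'a] T s
      by (simp add: norm_mult powr_divide powr_mult powr_minus field_simps)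
  qed auto
  also have "\<dots> = (\<integral>s. of_real ((2 * pi) ^ DIM('a)) * of_real ((4 * pi * (?T * s)) powr (- (DIM('a) / 2)) *
     exp (- (norm x)\<^sup>2 / (4 * (?T * s)))) \<partial>stable)"
  proof (rule integral_cong_AE)
    show "AE s in stable. (\<integral>\<xi>. ?f s \<xi> \<partial>lborel) = of_real ((2 * pi) ^ DIM('a)) *
      of_real ((4 * pi * (?T * s)) powr (- (DIM('a) / 2)) * exp (- (norm x)\<^sup>2 / (4 * (?T * s))))"
      using stable_props(2)
    proof eventually_elim
      case (elim s)
      have Ts: "0 < ?T * s" using T elim by simp
      have 1: "(pi / (?T * s)) powr (DIM('a) / 2) = (2 * pi) ^ DIM('a) * (4 * pi * (?T * s)) powr (- (DIM('a) / 2))"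
      proof -
        have "(2 * pi) ^ DIM('a) = ((2 * pi) powr 2) powr (DIM('a) / 2)"
          by (simp only: powr_powr) (simp add: powr_realpow)
        also have "\<dots> * (4 * pi * (?T * s)) powr (- (DIM('a) / 2)) = ((2 * pi) powr 2 / (4 * pi * (?T * s))) powr (DIM('a) / 2)"
        proof -
          have "P powr h * D powr (- h) = (P / D) powr h" if "0 \<le> P" "0 < D" for P D h :: real
            using that by (simp add: powr_divide powr_minus field_simps)
          then show ?thesis using Ts by simp
        qed
        also have "(2 * pi) powr 2 / (4 * pi * (?T * s)) = pi / (?T * s)"
          using Ts by (simp add: powr_realpow[of "2 * pi" 2, simplified] power2_eq_square)
        finally show ?thesis by simp
      qed
      have "(\<integral>\<xi>. ?f s \<xi> \<partial>lborel) = of_real ((pi / (?T * s)) powr (DIM('a) / 2) * exp (- (norm x)\<^sup>2 / (4 * (?T * s))))"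
        by (rule gaussian_fourier(2)[OF Ts, of x])
      then show ?case by (simp only: 1 of_real_mult mult.assoc)
    qed
  qed auto
  also have "\<dots> = of_real ((2 * pi) ^ DIM('a)) * of_real (kern t x)"
    by (simp only: integral_mult_right_zero integral_complex_of_real kern_mixture[OF t])
  finally show ?thesis
    by (simp add: heat_kernel_def inv_fourier_def)
qed

lemma kern_nonneg: "0 \<le> kern t x"
  by (simp add: kern_def gauss_mom_nonneg)

lemma kern_minus [simp]: "kern t (- x) = kern t x"
  by (simp add: kern_def)

lemma kern_minus_commute: "kern t (x - y) = kern t (y - x)"
  by (simp add: kern_def norm_minus_commute)

lemma gauss_mom_measurable [measurable]: "gauss_mom p \<in> borel_measurable borel"
  unfolding gauss_mom_def by measurable

lemma kern_measurable [measurable]: "kern t \<in> borel_measurable borel"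
  unfolding kern_def by measurable

lemma kern_fourier:
  fixes \<xi> :: "'a::euclidean_space"
  assumes t: "0 < t"
  shows "(\<integral>x. cis (x \<bullet> \<xi>) * of_real (kern t x) \<partial>lborel) = of_real (exp (- t * norm \<xi> powr (2 * \<beta>)))"
    and "integrable lborel (kern t :: 'a \<Rightarrow> real)"
proof -
  let ?T = "t powr (1 / \<beta>)"
  have T: "0 < ?T" using t by simp
  let ?g = "\<lambda>s x::'a. (4 * pi * (?T * s)) powr (- (DIM('a) / 2)) * exp (- (norm x)\<^sup>2 / (4 * (?T * s)))"
  let ?f = "\<lambda>\<xi> s x::'a. cis (x \<bullet> \<xi>) * complex_of_real (?g s x)"
  have g: "?g s = (\<lambda>x. (4 * pi * (?T * s)) powr (- (DIM('a) / 2)) * exp (- (1 / (4 * (?T * s))) * (norm x)\<^sup>2))" for s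
    by simp
  have c: "0 < 1 / (4 * (?T * s))" if "0 < s" for s using T that by simp
  have int: "integrable lborel (\<lambda>x. ?f \<xi> s x)" if s: "0 < s" for s and \<xi> :: 'a
  proof -
    have "integrable lborel (\<lambda>x::'a. complex_of_real ((4 * pi * (?T * s)) powr (- (DIM('a) / 2))) *
      (cis (x \<bullet> \<xi>) * of_real (exp (- (1 / (4 * (?T * s))) * (norm x)\<^sup>2))))"
      by (intro integrable_mult_right gaussian_fourier(1) c s)
    then show ?thesis by (simp add: mult_ac)
  qed
  have one: "(4 * pi * (?T * s)) powr (- (DIM('a) / 2)) * (pi / (1 / (4 * (?T * s)))) powr (DIM('a) / 2) = 1"
    if s: "0 < s" for s
    using T s by (simp add: powr_minus mult_ac)
  have val: "(\<integral>x. ?f \<xi> s x \<partial>lborel) = of_real (exp (- (?T * s) * (norm \<xi>)\<^sup>2))" if s: "0 < s" for s and \<xi> :: 'a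
  proof -
    have "(\<integral>x. ?f \<xi> s x \<partial>lborel) = of_real ((4 * pi * (?T * s)) powr (- (DIM('a) / 2))) *
      (\<integral>x. cis (x \<bullet> \<xi>) * of_real (exp (- (1 / (4 * (?T * s))) * (norm x)\<^sup>2)) \<partial>lborel)"
      by (subst integral_mult_right_zero[symmetric]) (simp add: mult_ac)
    also have "\<dots> = of_real ((4 * pi * (?T * s)) powr (- (DIM('a) / 2)) * (pi / (1 / (4 * (?T * s)))) powr (DIM('a) / 2) *
       exp (- (norm \<xi>)\<^sup>2 / (4 * (1 / (4 * (?T * s))))))"
      by (subst gaussian_fourier(2)[OF c[OF s]]) (simp only: of_real_mult mult.assoc)
    also have "\<dots> = of_real (exp (- (?T * s) * (norm \<xi>)\<^sup>2))"
      unfolding one[OF s] using T s by (simp add: mult_ac)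
    finally show ?thesis .
  qed
  have nrm: "(\<integral>x. norm (?f \<xi> s x) \<partial>lborel) \<le> 1 * s powr (- 0)" if s: "0 < s" for s and \<xi> :: 'a
  proof -
    have "complex_of_real (\<integral>x. norm (?f \<xi> s x) \<partial>lborel) = (\<integral>x. ?f 0 s x \<partial>lborel)"
      by (subst integral_complex_of_real[symmetric]) (simp add: norm_mult)
    also have "\<dots> = of_real 1" using val[OF s, of 0] by simp
    finally show ?thesis using s by (simp only: of_real_eq_iff) simp
  qed
  have mix: "cis (x \<bullet> \<xi>) * of_real (kern t x) = (\<integral>s. ?f \<xi> s x \<partial>stable)" for x \<xi> :: 'a
  proof -
    have "(\<integral>s. ?f \<xi> s x \<partial>stable) = cis (x \<bullet> \<xi>) * of_real (\<integral>s. ?g s x \<partial>stable)"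
      by (simp only: integral_mult_right_zero integral_complex_of_real)
    then show ?thesis by (simp only: kern_mixture[OF t])
  qed
  have "(\<integral>x. cis (x \<bullet> \<xi>) * of_real (kern t x) \<partial>lborel) = (\<integral>x. (\<integral>s. ?f \<xi> s x \<partial>stable) \<partial>lborel)"
    by (simp only: mix)
  also have "\<dots> = (\<integral>s. (\<integral>x. ?f \<xi> s x \<partial>lborel) \<partial>stable)"
    by (rule stable_fubini(1)[where C = 1 and p = 0]) (use int nrm in auto)
  also have "\<dots> = (\<integral>s. of_real (exp (- (?T * s) * (norm \<xi>)\<^sup>2)) \<partial>stable)"
    by (rule integral_cong_AE) (use stable_props(2) val in \<open>auto elim!: eventually_mono\<close>)
  also have "\<dots> = of_real (exp (- t * norm \<xi> powr (2 * \<beta>)))"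
    by (simp only: integral_complex_of_real symbol_mixture[OF t])
  finally show "(\<integral>x. cis (x \<bullet> \<xi>) * of_real (kern t x) \<partial>lborel) = of_real (exp (- t * norm \<xi> powr (2 * \<beta>)))" .
  have "integrable lborel (\<lambda>x. \<integral>s. ?f 0 s x \<partial>stable)"
    by (rule stable_fubini(2)[where C = 1 and p = 0]) (use int[of _ 0] nrm[of _ 0] in auto)
  then have "integrable lborel (\<lambda>x::'a. complex_of_real (kern t x))"
    by (simp only: mix[symmetric]) simp
  then show "integrable lborel (kern t :: 'a \<Rightarrow> real)"
    by (simp only: complex_of_real_integrable_eq)
qed

lemma kern_integral_1:
  assumes "0 < t"
  shows "(\<integral>x. kern t (x::'a::euclidean_space) \<partial>lborel) = 1"
proof -
  have "complex_of_real (\<integral>x. kern t (x::'a) \<partial>lborel) = of_real 1"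
    using kern_fourier(1)[OF assms, of "0::'a"] beta_pos by simp
  then show ?thesis by (simp only: of_real_eq_iff)
qed

text \<open>Expanding one factor by the inversion formula turns the convolution into the Fourier integral
  of the product of the two symbols.\<close>
lemma kern_convolution:
  fixes x z :: "'a::euclidean_space"
  assumes s: "0 < s" and t: "0 < t"
  shows "(\<integral>y. complex_of_real (kern s (z - y)) * of_real (kern t (x - y)) \<partial>lborel) = of_real (kern (s + t) (x - z))"
proof -
  let ?e = "\<lambda>t \<xi>. complex_of_real (exp (- t * norm (\<xi>::'a) powr (2 * \<beta>)))"
  let ?N = "complex_of_real ((2 * pi) ^ DIM('a))"
  have k: "of_real (kern t x) = (\<integral>\<xi>. cis (x \<bullet> \<xi>) * ?e t \<xi> \<partial>lborel) / ?N" if "0 < t" for t and x :: 'a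
    using heat_kernel_eq_kern[OF that, of x] by (simp add: heat_kernel_def inv_fourier_def)
  have int: "integrable (lborel \<Otimes>\<^sub>M lborel) (\<lambda>(y, \<xi>). of_real (kern s (z - y)) * ?e t \<xi> * cis ((x - y) \<bullet> \<xi>))"
  proof (rule integrable_product_bounded[where B = 1])
    show "integrable lborel (\<lambda>y. complex_of_real (kern s (z - y)))"
      by (intro integrable_of_real lborel_integrable_reflect kern_fourier s)
    show "integrable lborel (\<lambda>\<xi>::'a. ?e t \<xi>)"
      by (intro integrable_of_real symbol_integrable t)
  qed (auto simp: sigma_finite_lborel)
  have inner: "(\<integral>y. of_real (kern s (z - y)) * ?e t \<xi> * cis ((x - y) \<bullet> \<xi>) \<partial>lborel) = cis ((x - z) \<bullet> \<xi>) * ?e (s + t) \<xi>" for \<xi>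
  proof -
    have "(\<integral>y. of_real (kern s (z - y)) * ?e t \<xi> * cis ((x - y) \<bullet> \<xi>) \<partial>lborel) =
      (\<integral>y. (\<lambda>v. ?e t \<xi> * cis ((x - z) \<bullet> \<xi>) * (cis (v \<bullet> \<xi>) * of_real (kern s v))) (z - y) \<partial>lborel)"
    proof (rule Bochner_Integration.integral_cong[OF refl])
      fix y
      have "cis ((x - y) \<bullet> \<xi>) = cis ((x - z) \<bullet> \<xi>) * cis ((z - y) \<bullet> \<xi>)"
        by (simp add: cis_mult inner_diff_left)
      then show "of_real (kern s (z - y)) * ?e t \<xi> * cis ((x - y) \<bullet> \<xi>) =
        (\<lambda>v. ?e t \<xi> * cis ((x - z) \<bullet> \<xi>) * (cis (v \<bullet> \<xi>) * of_real (kern s v))) (z - y)"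
        by simp
    qed
    also have "\<dots> = (\<integral>v. ?e t \<xi> * cis ((x - z) \<bullet> \<xi>) * (cis (v \<bullet> \<xi>) * of_real (kern s v)) \<partial>lborel)"
      by (rule lborel_integral_reflect) measurable
    also have "\<dots> = ?e t \<xi> * cis ((x - z) \<bullet> \<xi>) * ?e s \<xi>"
      by (simp only: integral_mult_right_zero kern_fourier[OF s])
    also have "\<dots> = cis ((x - z) \<bullet> \<xi>) * ?e (s + t) \<xi>"
      by (simp add: algebra_simps exp_add[symmetric] flip: of_real_mult)
    finally show ?thesis .
  qed
  have "(\<integral>y. of_real (kern s (z - y)) * of_real (kern t (x - y)) \<partial>lborel) =
     (\<integral>y. (\<integral>\<xi>. of_real (kern s (z - y)) * ?e t \<xi> * cis ((x - y) \<bullet> \<xi>) \<partial>lborel) / ?N \<partial>lborel)"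
    unfolding k[OF t] by (simp add: mult_ac flip: integral_mult_right_zero)
  also have "\<dots> = (\<integral>y. (\<integral>\<xi>. of_real (kern s (z - y)) * ?e t \<xi> * cis ((x - y) \<bullet> \<xi>) \<partial>lborel) \<partial>lborel) / ?N"
    by simp
  also have "\<dots> = (\<integral>\<xi>. (\<integral>y. of_real (kern s (z - y)) * ?e t \<xi> * cis ((x - y) \<bullet> \<xi>) \<partial>lborel) \<partial>lborel) / ?N"
    by (subst lborel_pair.Fubini_integral[OF int]) simp
  also have "\<dots> = (\<integral>\<xi>. cis ((x - z) \<bullet> \<xi>) * ?e (s + t) \<xi> \<partial>lborel) / ?N"
    by (simp only: inner)
  also have "\<dots> = of_real (kern (s + t) (x - z))"
    using s t by (subst k) auto
  finally show ?thesis .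
qed

end

section \<open>Convolutions with smooth functions\<close>

lemma segment_derivative_bound:
  fixes f :: "'a::euclidean_space \<Rightarrow> complex"
  assumes d: "\<And>v. v \<in> closed_segment u (u + h) \<Longrightarrow> (f has_derivative (\<lambda>h. \<Sum>b\<in>Basis. of_real (h \<bullet> b) * c v b)) (at v)"
    and le: "\<And>v b. v \<in> closed_segment u (u + h) \<Longrightarrow> b \<in> Basis \<Longrightarrow> norm (c v b) \<le> B"
  shows "norm (f (u + h) - f u) \<le> real DIM('a) * B * norm h"
proof -
  have "norm (f (u + h) - f u) \<le> real DIM('a) * B * norm (u + h - u)"
  proof (rule differentiable_bound[of "closed_segment u (u + h)" f "\<lambda>v h. \<Sum>b\<in>Basis. of_real (h \<bullet> b) * c v b"])
    fix v assume v: "v \<in> closed_segment u (u + h)"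
    show "(f has_derivative (\<lambda>h. \<Sum>b\<in>Basis. of_real (h \<bullet> b) * c v b)) (at v within closed_segment u (u + h))"
      using d[OF v] by (rule has_derivative_at_withinI)
    have "norm (\<Sum>b\<in>Basis. of_real (h \<bullet> b) * c v b) \<le> real DIM('a) * B * norm h" for h
    proof -
      have "norm (\<Sum>b\<in>Basis. of_real (h \<bullet> b) * c v b) \<le> (\<Sum>b\<in>(Basis::'a set). norm h * B)"
        using le[OF v] by (intro sum_norm_le) (auto simp: norm_mult intro!: mult_mono Basis_le_norm)
      then show ?thesis by (simp add: mult_ac)
    qed
    then show "onorm (\<lambda>h. \<Sum>b\<in>Basis. of_real (h \<bullet> b) * c v b) \<le> real DIM('a) * B"
      by (intro onorm_le) (simp add: mult_ac)
  qed auto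
  then show ?thesis by simp
qed

lemma smooth_lipschitz:
  fixes k :: "'a::euclidean_space \<Rightarrow> complex"
  assumes "smooth k" "\<And>v b. v \<in> closed_segment u (u + h) \<Longrightarrow> b \<in> Basis \<Longrightarrow> norm (pd b k v) \<le> B"
  shows "norm (k (u + h) - k u) \<le> real DIM('a) * B * norm h"
  by (rule segment_derivative_bound[where c = "\<lambda>v b. pd b k v"])
     (use assms in \<open>auto intro: differentiable_has_derivative_pd smooth_differentiable\<close>)

lemma smooth_taylor2:
  fixes k :: "'a::euclidean_space \<Rightarrow> complex"
  assumes k: "smooth k" and A: "dbound 2 A (\<lambda>_. 1) k"
  shows "norm (k (u + h) - k u - (\<Sum>b\<in>Basis. of_real (h \<bullet> b) * pd b k u)) \<le> (real DIM('a))\<^sup>2 * A * (norm h)\<^sup>2"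
proof -
  have A2: "dbound 1 A (\<lambda>_. 1) (pd b k)" if "b \<in> Basis" for b
    using A that by (simp add: numeral_2_eq_2)
  have lip: "norm (pd b k v - pd b k u) \<le> real DIM('a) * A * norm h"
    if v: "v \<in> closed_segment u (u + h)" and b: "b \<in> Basis" for v b
  proof -
    have "norm (pd b k (u + (v - u)) - pd b k u) \<le> real DIM('a) * A * norm (v - u)"
      using A2[OF b] dbound_bound[OF dbound_pd, of 0 A "\<lambda>_. 1" "pd b k"]
      by (intro smooth_lipschitz smooth_pd k b) (auto simp del: dbound.simps)
    also have "norm (v - u) \<le> norm h"
      using v segment_bound1[of v u "u + h"] by (simp add: norm_minus_commute)
    finally show ?thesis
      using order_trans[OF norm_ge_zero dbound_bound[OF A]] by (simp add: mult_left_mono)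
  qed
  let ?f = "\<lambda>v. k v - (\<Sum>b\<in>Basis. of_real (v \<bullet> b) * pd b k u)"
  have "norm (?f (u + h) - ?f u) \<le> real DIM('a) * (real DIM('a) * A * norm h) * norm h"
  proof (rule segment_derivative_bound[where c = "\<lambda>v b. pd b k v - pd b k u"])
    fix v
    have "(?f has_derivative (\<lambda>h. (\<Sum>b\<in>Basis. of_real (h \<bullet> b) * pd b k v) - (\<Sum>b\<in>Basis. of_real (h \<bullet> b) * pd b k u))) (at v)"
      by (intro has_derivative_diff differentiable_has_derivative_pd smooth_differentiable k
          has_derivative_sum has_derivative_mult_left inner_has_derivative_complex)
    then show "(?f has_derivative (\<lambda>h. \<Sum>b\<in>Basis. of_real (h \<bullet> b) * (pd b k v - pd b k u))) (at v)"
      by (simp add: right_diff_distrib sum_subtractf)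
  qed (rule lip)
  also have "?f (u + h) - ?f u = k (u + h) - k u - (\<Sum>b\<in>Basis. of_real (h \<bullet> b) * pd b k u)"
    by (simp add: inner_add_left distrib_right sum.distrib)
  finally show ?thesis by (simp add: power2_eq_square mult_ac)
qed

definition bsmooth :: "('a::euclidean_space \<Rightarrow> complex) \<Rightarrow> bool" where
  "bsmooth k \<longleftrightarrow> smooth k \<and> (\<forall>m. \<exists>A. dbound m A (\<lambda>_. 1) k)"

lemma bsmooth_pd: "bsmooth k \<Longrightarrow> b \<in> Basis \<Longrightarrow> bsmooth (pd b k)"
  unfolding bsmooth_def using smooth_pd dbound_pd by metis

text \<open>Substituting \<open>g y\<close> for \<open>y\<close> in the kernel covers both the convolution itself and its
  approximations by finite sums, in which \<open>g\<close> is a simple function close to the identity.\<close>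
definition conv :: "('a \<Rightarrow> complex) \<Rightarrow> ('a \<Rightarrow> 'a) \<Rightarrow> ('a::euclidean_space \<Rightarrow> complex) \<Rightarrow> 'a \<Rightarrow> complex" where
  "conv \<theta> g k z = (\<integral>y. \<theta> y * k (z - g y) \<partial>lborel)"

lemma conv_integrable:
  assumes \<theta>: "integrable lborel \<theta>" and g[measurable]: "g \<in> borel_measurable borel"
    and k: "bsmooth k"
  shows "integrable lborel (\<lambda>y. \<theta> y * k (z - g y))"
proof -
  obtain A where A: "dbound 0 A (\<lambda>_. 1) k" using k unfolding bsmooth_def by blast
  have [measurable]: "k \<in> borel_measurable borel" using k by (simp add: bsmooth_def smooth_measurable)
  have [measurable]: "\<theta> \<in> borel_measurable borel" using \<theta> by simp
  show ?thesis
  proof (rule Bochner_Integration.integrable_bound[OF integrable_mult_right[OF \<theta>, of "of_real A"]])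
    show "AE y in lborel. norm (\<theta> y * k (z - g y)) \<le> norm (of_real A * \<theta> y)"
    proof (rule AE_I2)
      fix y
      have "norm (k (z - g y)) \<le> \<bar>A\<bar>" using dbound_bound[OF A, of "z - g y"] by simp
      then show "norm (\<theta> y * k (z - g y)) \<le> norm (of_real A * \<theta> y)"
        using mult_left_mono[of "norm (k (z - g y))" "\<bar>A\<bar>" "norm (\<theta> y)"]
        by (simp add: norm_mult mult.commute)
    qed
  qed measurable
qed

lemma conv_has_derivative:
  assumes \<theta>: "integrable lborel \<theta>" and g: "g \<in> borel_measurable borel" and k: "bsmooth k"
  shows "(conv \<theta> g k has_derivative (\<lambda>h. \<Sum>b\<in>Basis. of_real (h \<bullet> b) * conv \<theta> g (pd b k) z)) (at z)"
proof -
  obtain A where A: "dbound 2 A (\<lambda>_. 1) k" using k unfolding bsmooth_def by blast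
  let ?C = "(\<integral>y. norm (\<theta> y) \<partial>lborel) * ((real DIM('a))\<^sup>2 * A)"
  have lin: "bounded_linear (\<lambda>h. \<Sum>b\<in>Basis. of_real (h \<bullet> b) * conv \<theta> g (pd b k) z)"
    by (intro bounded_linear_sum bounded_linear_mult_const has_derivative_bounded_linear[OF inner_has_derivative_complex])
  have rem: "norm (conv \<theta> g k x - conv \<theta> g k z - (\<Sum>b\<in>Basis. of_real ((x - z) \<bullet> b) * conv \<theta> g (pd b k) z)) \<le> ?C * (norm (x - z))\<^sup>2" for x
  proof -
    note int = conv_integrable[OF \<theta> g]
    let ?r = "\<lambda>y. k (x - g y) - k (z - g y) - (\<Sum>b\<in>Basis. of_real ((x - z) \<bullet> b) * pd b k (z - g y))"
    have eq: "conv \<theta> g k x - conv \<theta> g k z - (\<Sum>b\<in>Basis. of_real ((x - z) \<bullet> b) * conv \<theta> g (pd b k) z) =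
      (\<integral>y. \<theta> y * k (x - g y) - \<theta> y * k (z - g y) - (\<Sum>b\<in>Basis. of_real ((x - z) \<bullet> b) * (\<theta> y * pd b k (z - g y))) \<partial>lborel)"
      unfolding conv_def
      using int[OF k] int[OF bsmooth_pd[OF k]]
      by (simp add: Bochner_Integration.integral_diff Bochner_Integration.integral_sum)
    also have "\<dots> = (\<integral>y. \<theta> y * ?r y \<partial>lborel)"
      by (intro Bochner_Integration.integral_cong refl) (simp add: algebra_simps sum_distrib_left)
    finally have "norm (conv \<theta> g k x - conv \<theta> g k z - (\<Sum>b\<in>Basis. of_real ((x - z) \<bullet> b) * conv \<theta> g (pd b k) z)) =
      norm (\<integral>y. \<theta> y * ?r y \<partial>lborel)" by simp
    also have "\<dots> \<le> (\<integral>y. norm (\<theta> y) * ((real DIM('a))\<^sup>2 * A * (norm (x - z))\<^sup>2) \<partial>lborel)"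
    proof (rule Bochner_Integration.integral_norm_bound_integral)
      show "integrable lborel (\<lambda>y. \<theta> y * ?r y)"
      proof -
        have "integrable lborel (\<lambda>y. \<theta> y * k (x - g y) - \<theta> y * k (z - g y) - (\<Sum>b\<in>Basis. of_real ((x - z) \<bullet> b) * (\<theta> y * pd b k (z - g y))))"
          using int[OF k] int[OF bsmooth_pd[OF k]]
          by (intro Bochner_Integration.integrable_diff Bochner_Integration.integrable_sum integrable_mult_right) auto
        then show ?thesis
          by (rule Bochner_Integration.integrable_cong[THEN iffD1, rotated -1])
             (simp_all add: algebra_simps sum_distrib_left)
      qed
      show "integrable lborel (\<lambda>y. norm (\<theta> y) * ((real DIM('a))\<^sup>2 * A * (norm (x - z))\<^sup>2))"
        using \<theta> by auto
      fix y
      have "norm (?r y) \<le> (real DIM('a))\<^sup>2 * A * (norm (x - z))\<^sup>2"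
        using smooth_taylor2[of k A "z - g y" "x - z"] k A by (simp add: bsmooth_def)
      then show "norm (\<theta> y * ?r y) \<le> norm (\<theta> y) * ((real DIM('a))\<^sup>2 * A * (norm (x - z))\<^sup>2)"
        by (simp add: norm_mult mult_left_mono)
    qed
    also have "\<dots> = ?C * (norm (x - z))\<^sup>2" by simp
    finally show ?thesis .
  qed
  show ?thesis by (rule has_derivative_quadratic_remainder[OF lin rem])
qed

lemma pd_conv:
  assumes "integrable lborel \<theta>" "g \<in> borel_measurable borel" "bsmooth k" "b \<in> Basis"
  shows "pd b (conv \<theta> g k) = conv \<theta> g (pd b k)"
  by (rule ext) (rule pd_eq_coefficient[OF conv_has_derivative[OF assms(1-3)] assms(4)])

lemma smooth_conv:
  assumes "integrable lborel \<theta>" "g \<in> borel_measurable borel" "bsmooth k"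
  shows "smooth (conv \<theta> g k)"
proof (rule smooth_coinduct[where P = "\<lambda>F. \<exists>k. bsmooth k \<and> F = conv \<theta> g k"])
  show "\<exists>k'. bsmooth k' \<and> conv \<theta> g k = conv \<theta> g k'" using assms by blast
  show "F differentiable (at x)" if "\<exists>k. bsmooth k \<and> F = conv \<theta> g k" for F x
    using that conv_has_derivative[OF assms(1,2)] unfolding differentiable_def by blast
  show "\<exists>k. bsmooth k \<and> pd b F = conv \<theta> g k" if "\<exists>k. bsmooth k \<and> F = conv \<theta> g k" "b \<in> Basis" for F b
    using that pd_conv[OF assms(1,2)] bsmooth_pd by metis
qed

lemma dbound_conv:
  assumes \<theta>: "integrable lborel \<theta>" and g: "g \<in> borel_measurable borel" and k: "bsmooth k"
    and w: "dbound m A w k" and A: "0 \<le> A"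
    and int: "\<And>z. integrable lborel (\<lambda>y. norm (\<theta> y) * w (z - g y))"
    and le: "\<And>z. (\<integral>y. norm (\<theta> y) * w (z - g y) \<partial>lborel) \<le> B * v z"
  shows "dbound m (A * B) v (conv \<theta> g k)"
proof -
  have base: "norm (conv \<theta> g k z) \<le> A * B * v z" if k: "bsmooth k" and w: "dbound m A w k" for m k z
  proof -
    have "norm (conv \<theta> g k z) \<le> (\<integral>y. A * (norm (\<theta> y) * w (z - g y)) \<partial>lborel)"
      unfolding conv_def
    proof (rule Bochner_Integration.integral_norm_bound_integral)
      show "norm (\<theta> y * k (z - g y)) \<le> A * (norm (\<theta> y) * w (z - g y))" for y
        using mult_left_mono[OF dbound_bound[OF w], of "norm (\<theta> y)" "z - g y"] by (simp add: norm_mult mult_ac)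
    qed (use conv_integrable[OF \<theta> g k] int in auto)
    also have "\<dots> \<le> A * (B * v z)" using le[of z] A by (simp add: mult_left_mono)
    finally show ?thesis by (simp add: mult.assoc)
  qed
  show ?thesis using k w
  proof (induction m arbitrary: k)
    case (0 k)
    show ?case using base[OF 0] by simp
  next
    case (Suc m k)
    show ?case
      using base[OF Suc.prems] Suc.IH[OF bsmooth_pd[OF Suc.prems(1)] dbound_pd[OF Suc.prems(2)]]
        pd_conv[OF \<theta> g Suc.prems(1)] by simp
  qed
qed

text \<open>By the mean value theorem, replacing \<open>y\<close> by \<open>g y\<close> costs one derivative of \<open>k\<close> and a factor
  \<open>norm (y - g y)\<close>.\<close>
lemma dbound_conv_diff:
  assumes \<theta>: "integrable lborel \<theta>" and g[measurable]: "g \<in> borel_measurable borel" and k: "bsmooth k"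
    and dk: "dbound (Suc m) A (\<lambda>_. 1) k"
    and int: "integrable lborel (\<lambda>y. norm (\<theta> y) * norm (y - g y))"
  shows "dbound m (real DIM('a) * A * (\<integral>y. norm (\<theta> y) * norm (y - g y) \<partial>lborel)) (\<lambda>_. 1)
     (\<lambda>z. conv \<theta> (\<lambda>y. y) k z - conv \<theta> g k (z::'a::euclidean_space))"
proof -
  let ?D = "real DIM('a) * A * (\<integral>y. norm (\<theta> y) * norm (y - g y) \<partial>lborel)"
  have base: "norm (conv \<theta> (\<lambda>y. y) k z - conv \<theta> g k z) \<le> ?D"
    if k: "bsmooth k" and w: "dbound (Suc 0) A (\<lambda>_. 1) k" for k z
  proof -
    have i: "integrable lborel (\<lambda>y. \<theta> y * k (z - y))" "integrable lborel (\<lambda>y. \<theta> y * k (z - g y))"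
      by (intro conv_integrable \<theta> k g; simp)+
    have "norm (conv \<theta> (\<lambda>y. y) k z - conv \<theta> g k z) = norm (\<integral>y. \<theta> y * k (z - y) - \<theta> y * k (z - g y) \<partial>lborel)"
      unfolding conv_def by (subst Bochner_Integration.integral_diff) (use i in auto)
    also have "\<dots> \<le> (\<integral>y. real DIM('a) * A * (norm (\<theta> y) * norm (y - g y)) \<partial>lborel)"
    proof (rule Bochner_Integration.integral_norm_bound_integral)
      fix y
      have "norm (k ((z - g y) + (g y - y)) - k (z - g y)) \<le> real DIM('a) * A * norm (g y - y)"
        using k w dbound_bound[OF dbound_pd[OF w]] by (intro smooth_lipschitz) (auto simp: bsmooth_def)
      then have "norm (\<theta> y) * norm (k (z - y) - k (z - g y)) \<le> norm (\<theta> y) * (real DIM('a) * A * norm (y - g y))"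
        by (intro mult_left_mono) (auto simp: norm_minus_commute)
      then show "norm (\<theta> y * k (z - y) - \<theta> y * k (z - g y)) \<le> real DIM('a) * A * (norm (\<theta> y) * norm (y - g y))"
        by (simp add: right_diff_distrib[symmetric] norm_mult mult_ac)
    qed (use i int in auto)
    also have "\<dots> = ?D" by simp
    finally show ?thesis .
  qed
  show ?thesis using k dk
  proof (induction m arbitrary: k)
    case (0 k)
    show ?case using base[OF 0] by simp
  next
    case (Suc m k)
    have id: "(\<lambda>y. y) \<in> borel_measurable borel" by simp
    have "pd b (\<lambda>z. conv \<theta> (\<lambda>y. y) k z - conv \<theta> g k z) = (\<lambda>z. conv \<theta> (\<lambda>y. y) (pd b k) z - conv \<theta> g (pd b k) z)"
      if "b \<in> Basis" for b
    proof
      fix z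
      have "pd b (\<lambda>z. conv \<theta> (\<lambda>y. y) k z + (-1) * conv \<theta> g k z) z = pd b (conv \<theta> (\<lambda>y. y) k) z + (-1) * pd b (conv \<theta> g k) z"
        using smooth_differentiable[OF smooth_conv[OF \<theta> g Suc.prems(1)]]
          smooth_differentiable[OF smooth_conv[OF \<theta> id Suc.prems(1)]]
          smooth_differentiable[OF smooth_cmult[OF smooth_conv[OF \<theta> g Suc.prems(1)], of "-1"]]
        by (subst pd_add) (auto simp: pd_cmult[where c = "-1", simplified])
      then show "pd b (\<lambda>z. conv \<theta> (\<lambda>y. y) k z - conv \<theta> g k z) z = conv \<theta> (\<lambda>y. y) (pd b k) z - conv \<theta> g (pd b k) z"
        using pd_conv[OF \<theta> g Suc.prems(1) that] pd_conv[OF \<theta> id Suc.prems(1) that] by simp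
    qed
    moreover have "dbound (Suc 0) A (\<lambda>_. 1) k" using Suc.prems(2) by (rule dbound_mono_order) simp
    ultimately show ?case
      using base[OF Suc.prems(1)] Suc.IH[OF bsmooth_pd[OF Suc.prems(1)] dbound_pd[OF Suc.prems(2)]]
      by simp
  qed
qed

text \<open>The mean value theorem; \<open>B\<close> accounts for the variation of the weight along the segment.\<close>
lemma dbound_translate_diff:
  assumes "smooth k" "dbound (Suc m) A w k" "\<And>z u. norm u \<le> norm h \<Longrightarrow> w (z + u) \<le> B * w z" "0 \<le> A"
  shows "dbound m (real DIM('a) * A * B * norm h) w (\<lambda>z. k (z + h) - k (z::'a::euclidean_space))"
  using assms(1,2)
proof (induction m arbitrary: k)
  have base: "norm (k (z + h) - k z) \<le> real DIM('a) * A * B * norm h * w z"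
    if k: "smooth k" and w: "dbound (Suc 0) A w k" for k z
  proof -
    have "norm (k (z + h) - k z) \<le> real DIM('a) * (A * (B * w z)) * norm h"
    proof (rule smooth_lipschitz[OF k])
      fix v b assume v: "v \<in> closed_segment z (z + h)" and b: "b \<in> (Basis :: 'a set)"
      have "norm (v - z) \<le> norm h"
        using v segment_bound1[of v z "z + h"] by (simp add: norm_minus_commute)
      then have "w (z + (v - z)) \<le> B * w z" by (rule assms(3))
      then have "A * w v \<le> A * (B * w z)" using assms(4) by (intro mult_left_mono) auto
      then show "norm (pd b k v) \<le> A * (B * w z)"
        using dbound_bound[OF dbound_pd[OF w b], of v] by linarith
    qed
    then show ?thesis by (simp add: mult_ac)
  qed
  {
    case (0 k)
    then show ?case using base by simp
  next
    case (Suc m k)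
    have "pd b (\<lambda>z. k (z + h) - k z) = (\<lambda>z. pd b k (z + h) - pd b k z)" if "b \<in> Basis" for b
    proof
      fix z
      have sh: "smooth (\<lambda>z. k (z + h))" using smooth_affine[OF Suc.prems(1), of 1 h] by simp
      have "pd b (\<lambda>z. k (z + h)) z = pd b k (z + h)"
        using pd_affine[of k 1 z h b] smooth_differentiable[OF Suc.prems(1)] by simp
      then show "pd b (\<lambda>z. k (z + h) - k z) z = pd b k (z + h) - pd b k z"
        using pd_add[OF smooth_differentiable[OF sh] smooth_differentiable[OF smooth_cmult[OF Suc.prems(1), of "-1"]], of b z]
          pd_cmult[OF smooth_differentiable[OF Suc.prems(1)], of b "-1" z] by simp
    qed
    moreover have "dbound (Suc 0) A w k" using Suc.prems(2) by (rule dbound_mono_order) simp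
    ultimately show ?case
      using base[OF Suc.prems(1)] Suc.IH[OF smooth_pd[OF Suc.prems(1)] dbound_pd[OF Suc.prems(2)]]
      by simp
  }
qed

lemma wt_scale:
  assumes "0 < c" "0 \<le> a"
  shows "wt a (c *\<^sub>R x) \<le> max 1 (1 / c) powr a * wt a x"
proof -
  have "1 + norm x \<le> max 1 (1 / c) * (1 + c * norm x)"
  proof -
    have "1 / c * (c * norm x) \<le> max 1 (1 / c) * (c * norm x)"
      using assms by (intro mult_right_mono) auto
    then have "norm x \<le> max 1 (1 / c) * (c * norm x)" using assms by simp
    moreover have "1 \<le> max 1 (1 / c) * (1::real)" by simp
    ultimately show ?thesis by (simp add: distrib_left)
  qed
  then have "(1 + norm x) powr a \<le> (max 1 (1 / c) * (1 + c * norm x)) powr a"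
    using assms by (intro powr_mono2) auto
  also have "\<dots> = max 1 (1 / c) powr a * (1 + c * norm x) powr a"
    by (rule powr_mult)
  finally have "(1 + norm x) powr a \<le> max 1 (1 / c) powr a * (1 + c * norm x) powr a" .
  moreover have "0 < 1 + norm x" "0 < 1 + c * norm x"
    using assms by (auto intro!: add_pos_nonneg)
  ultimately show ?thesis
    using assms by (simp add: wt_def powr_minus field_simps)
qed

text \<open>One of \<open>x - y\<close> and \<open>y\<close> has at least half the norm of \<open>x\<close>, so its weight is at most a multiple of
  that of \<open>x\<close>.\<close>
lemma wt_conv_pointwise:
  assumes "0 \<le> a"
  shows "wt a (x - y) * wt a y \<le> 2 powr a * wt a x * (wt a y + wt a (x - y))"
proof -
  have half: "wt a u \<le> 2 powr a * wt a x" if "norm x \<le> 2 * norm u" for u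
  proof -
    have "(1 + norm x) powr a \<le> (2 * (1 + norm u)) powr a"
      using that assms by (intro powr_mono2) auto
    also have "\<dots> = 2 powr a * (1 + norm u) powr a" by (rule powr_mult)
    finally show ?thesis
      using add_pos_nonneg[OF zero_less_one norm_ge_zero[of x]] add_pos_nonneg[OF zero_less_one norm_ge_zero[of u]]
      by (simp add: wt_def powr_minus field_simps)
  qed
  have pos: "0 \<le> 2 powr a * wt a x * wt a u" for u
    by (intro mult_nonneg_nonneg) (auto intro: less_imp_le[OF wt_pos])
  have "norm x \<le> norm (x - y) + norm y" using norm_triangle_ineq[of "x - y" y] by simp
  then consider "norm x \<le> 2 * norm (x - y)" | "norm x \<le> 2 * norm y" by linarith
  then show ?thesis
  proof cases
    case 1
    have "wt a (x - y) * wt a y \<le> 2 powr a * wt a x * wt a y"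
      using half[OF 1] by (intro mult_right_mono) (auto intro: less_imp_le[OF wt_pos])
    then show ?thesis using pos[of "x - y"] by (simp add: distrib_left)
  next
    case 2
    have "wt a (x - y) * wt a y \<le> wt a (x - y) * (2 powr a * wt a x)"
      using half[OF 2] by (intro mult_left_mono) (auto intro: less_imp_le[OF wt_pos])
    then show ?thesis using pos[of y] by (simp add: distrib_left mult_ac)
  qed
qed

lemma wt_convolution:
  fixes x :: "'a::euclidean_space"
  assumes a: "0 \<le> a" and int: "integrable lborel (wt a :: 'a \<Rightarrow> real)"
  shows "integrable lborel (\<lambda>y. wt a (x - y) * wt a y)"
    and "(\<integral>y. wt a (x - y) * wt a y \<partial>lborel) \<le> (2 * 2 powr a * (\<integral>y. wt a (y::'a) \<partial>lborel)) * wt a x"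
proof -
  have int': "integrable lborel (\<lambda>y. wt a (x - y))"
    using lborel_integrable_reflect[OF int] .
  have i: "integrable lborel (\<lambda>y. 2 powr a * wt a x * (wt a y + wt a (x - y)))"
    using int int' by auto
  show 1: "integrable lborel (\<lambda>y. wt a (x - y) * wt a y)"
    by (rule Bochner_Integration.integrable_bound[OF i])
       (use wt_conv_pointwise[OF a] in \<open>auto simp: abs_mult intro!: order_trans[OF _ abs_ge_self] simp: less_imp_le[OF wt_pos]\<close>)
  have "(\<integral>y. wt a (x - y) * wt a y \<partial>lborel) \<le> (\<integral>y. 2 powr a * wt a x * (wt a y + wt a (x - y)) \<partial>lborel)"
    by (rule integral_mono[OF 1 i]) (rule wt_conv_pointwise[OF a])
  also have "\<dots> = 2 powr a * wt a x * ((\<integral>y. wt a (y::'a) \<partial>lborel) + (\<integral>y. wt a (x - y) \<partial>lborel))"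
    using int int' by simp
  also have "(\<integral>y. wt a (x - y) \<partial>lborel) = (\<integral>y. wt a (y::'a) \<partial>lborel)"
    by (rule lborel_integral_reflect) simp
  finally show "(\<integral>y. wt a (x - y) * wt a y \<partial>lborel) \<le> (2 * 2 powr a * (\<integral>y. wt a (y::'a) \<partial>lborel)) * wt a x"
    by (simp add: mult_ac)
qed

section \<open>Size and smoothness of the heat kernel\<close>

lemma dbound_inner:
  assumes "b \<in> Basis"
  shows "dbound m 1 (\<lambda>x. 1 + norm x) (\<lambda>x::'a::euclidean_space. complex_of_real (x \<bullet> b))"
proof -
  have le: "norm (complex_of_real (x \<bullet> b)) \<le> 1 * (1 + norm x)" for x :: 'a
    using Basis_le_norm[OF assms, of x] by simp
  have c: "dbound m 1 (\<lambda>x::'a. 1 + norm x) (\<lambda>x. complex_of_real (c \<bullet> b))" if "c \<in> Basis" for m c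
  proof (rule dbound_mono[OF dbound_const])
    have "norm (complex_of_real (c \<bullet> b)) \<le> 1" using Basis_le_norm[OF assms, of c] that by simp
    then show "norm (complex_of_real (c \<bullet> b)) * 1 \<le> 1 * (1 + norm x)" for x :: 'a
      by (simp add: add_increasing2)
  qed
  have "pd c (\<lambda>x. complex_of_real (x \<bullet> b)) = (\<lambda>x. complex_of_real (c \<bullet> b))" for c
    by (rule ext) (rule pd_eq[OF inner_has_derivative_complex])
  then show ?thesis using le c by (cases m) auto
qed

context fractional begin

definition gauss_mom_c :: "real \<Rightarrow> 'a::euclidean_space \<Rightarrow> complex" where
  "gauss_mom_c p x = of_real (gauss_mom p ((norm x)\<^sup>2))"

lemma gauss_mom_c_has_derivative:
  assumes "0 \<le> p"
  shows "(gauss_mom_c p has_derivative (\<lambda>h. of_real (- gauss_mom (p + 1) ((norm x)\<^sup>2) / 4 * (2 * (x \<bullet> h))))) (at x)"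
proof -
  have 1: "((\<lambda>x. (norm x)\<^sup>2) has_derivative (\<lambda>h. 2 * (x \<bullet> h))) (at x)"
    unfolding power2_norm_eq_inner by (auto intro!: derivative_eq_intros simp: inner_commute)
  have 2: "(gauss_mom p has_derivative (\<lambda>y. - gauss_mom (p + 1) ((norm x)\<^sup>2) / 4 * y)) (at ((norm x)\<^sup>2) within (\<lambda>x::'a. (norm x)\<^sup>2) ` UNIV)"
    using gauss_mom_derivative[OF assms, of "(norm x)\<^sup>2"] unfolding has_field_derivative_def
    by (rule has_derivative_subset) auto
  from has_derivative_of_real[OF has_derivative_in_compose[OF 1 2]]
  show ?thesis unfolding gauss_mom_c_def[abs_def] .
qed

lemma pd_gauss_mom_c:
  assumes "0 \<le> p"
  shows "pd b (gauss_mom_c p) = (\<lambda>x. (- 1/2) * (of_real (x \<bullet> b) * gauss_mom_c (p + 1) x))"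
  by (rule ext) (subst pd_eq[OF gauss_mom_c_has_derivative[OF assms]], simp add: gauss_mom_c_def)

lemma cm_on_gauss_mom_c: "0 \<le> p \<Longrightarrow> cm_on m UNIV (gauss_mom_c p :: 'a::euclidean_space \<Rightarrow> complex)"
proof (induction m arbitrary: p)
  case (Suc m)
  have "cm_on m UNIV (gauss_mom_c (p + 1) :: 'a \<Rightarrow> complex)" using Suc by simp
  then have "cm_on m UNIV (pd b (gauss_mom_c p :: 'a \<Rightarrow> complex))" for b
    unfolding pd_gauss_mom_c[OF Suc.prems]
    by (intro cm_on_mult[OF open_UNIV cm_on_const cm_on_mult[OF open_UNIV cm_on_inner]])
  then show ?case using gauss_mom_c_has_derivative[OF Suc.prems] by (auto simp: differentiable_def)
qed auto

lemma smooth_gauss_mom_c: "0 \<le> p \<Longrightarrow> smooth (gauss_mom_c p)"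
  by (simp add: smooth_iff_cm_on cm_on_gauss_mom_c)

lemma gauss_mom_c_bound:
  assumes "0 \<le> p"
  shows "\<exists>A\<ge>0. \<forall>x. norm (gauss_mom_c p x) \<le> A * wt (2 * p + 2 * \<beta>) x"
proof -
  obtain C where C: "0 \<le> C" "\<And>a. 0 \<le> a \<Longrightarrow> gauss_mom p a \<le> C * (1 + a) powr (- (p + \<beta>))"
    using gauss_mom_upper[OF assms] by blast
  have "norm (gauss_mom_c p x) \<le> C * 2 powr (p + \<beta>) * wt (2 * p + 2 * \<beta>) x" for x :: 'a
  proof -
    have "(1 + norm x)\<^sup>2 \<le> 2 * (1 + (norm x)\<^sup>2)"
      using zero_le_power2[of "1 - norm x"] by (simp add: power2_eq_square algebra_simps)
    then have "(1 + (norm x)\<^sup>2) powr (- (p + \<beta>)) \<le> ((1 + norm x)\<^sup>2 / 2) powr (- (p + \<beta>))"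
      using assms beta_pos add_pos_nonneg[OF zero_less_one norm_ge_zero[of x]]
      by (intro powr_mono2') auto
    also have "\<dots> = 2 powr (p + \<beta>) * wt (2 * p + 2 * \<beta>) x"
    proof -
      have pos: "0 < 1 + norm x" by (simp add: add_pos_nonneg)
      then have "(1 + norm x)\<^sup>2 = (1 + norm x) powr 2" by simp
      then have "((1 + norm x)\<^sup>2) powr (- (p + \<beta>)) = wt (2 * p + 2 * \<beta>) x"
        by (simp only: powr_powr wt_def) (simp add: algebra_simps)
      moreover have "((1 + norm x)\<^sup>2 / 2) powr (- (p + \<beta>)) = ((1 + norm x)\<^sup>2) powr (- (p + \<beta>)) * 2 powr (p + \<beta>)"
        by (simp add: powr_divide powr_minus_divide del: minus_add_distrib)
      ultimately show ?thesis by simp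
    qed
    finally have "C * (1 + (norm x)\<^sup>2) powr (- (p + \<beta>)) \<le> C * (2 powr (p + \<beta>) * wt (2 * p + 2 * \<beta>) x)"
      using C(1) by (rule mult_left_mono)
    then show ?thesis
      using C(2)[of "(norm x)\<^sup>2"] gauss_mom_nonneg[of p "(norm x)\<^sup>2"] by (simp add: gauss_mom_c_def mult.assoc)
  qed
  then show ?thesis using C(1) by (intro exI[of _ "C * 2 powr (p + \<beta>)"]) auto
qed

text \<open>A derivative brings down a coordinate of \<open>x\<close> and raises \<open>p\<close> by one; the gain of decay outweighs
  the growing factor.\<close>
lemma dbound_gauss_mom_c:
  assumes "0 \<le> p"
  shows "\<exists>A. dbound m A (wt (2 * p + 2 * \<beta>)) (gauss_mom_c p :: 'a::euclidean_space \<Rightarrow> complex)"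
  using assms
proof (induction m arbitrary: p)
  case 0
  then show ?case using gauss_mom_c_bound[of p, where 'a = 'a] by auto
next
  case (Suc m)
  obtain B where B: "dbound m B (wt (2 * (p + 1) + 2 * \<beta>)) (gauss_mom_c (p + 1) :: 'a \<Rightarrow> complex)"
    using Suc.IH[of "p + 1"] Suc.prems by auto
  let ?C = "norm (- 1/2 :: complex) * (2 ^ m * 1 * B)"
  have C0: "0 \<le> ?C" using weight_bound_nonneg[OF dbound_bound[OF B]] by simp
  show ?case
  proof (rule dbound_Suc_exI)
    show "\<exists>A. \<forall>x::'a. norm (gauss_mom_c p x) \<le> A * wt (2 * p + 2 * \<beta>) x"
      using gauss_mom_c_bound[OF Suc.prems] by blast
    fix b :: 'a assume b: "b \<in> Basis"
    have "dbound m ?C (\<lambda>x. (1 + norm x) * wt (2 * (p + 1) + 2 * \<beta>) x) (\<lambda>x::'a. (- 1/2) * (of_real (x \<bullet> b) * gauss_mom_c (p + 1) x))"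
      using Suc.prems b B by (intro dbound_cmult dbound_mult smooth_mult smooth_inner smooth_gauss_mom_c dbound_inner) auto
    then have "dbound m ?C (wt (2 * p + 2 * \<beta>)) (pd b (gauss_mom_c p :: 'a \<Rightarrow> complex))"
      unfolding pd_gauss_mom_c[OF Suc.prems]
    proof (rule dbound_mono)
      fix x :: 'a
      have "1 + norm x = wt (- 1) x"
        using add_pos_nonneg[OF zero_less_one norm_ge_zero[of x]] by (simp add: wt_def)
      then have "(1 + norm x) * wt (2 * (p + 1) + 2 * \<beta>) x = wt (- 1 + (2 * (p + 1) + 2 * \<beta>)) x"
        by (simp only: wt_add)
      also have "\<dots> \<le> wt (2 * p + 2 * \<beta>) x" by (rule wt_antimono) simp
      finally show "?C * ((1 + norm x) * wt (2 * (p + 1) + 2 * \<beta>) x) \<le> ?C * wt (2 * p + 2 * \<beta>) x"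
        using C0 by (rule mult_left_mono)
    qed
    then show "\<exists>A. dbound m A (wt (2 * p + 2 * \<beta>)) (pd b (gauss_mom_c p :: 'a \<Rightarrow> complex))" by blast
  qed (rule less_imp_le[OF wt_pos])
qed

text \<open>The exact order of decay of the heat kernel (\<open>kern_lower\<close>, \<open>kern_upper\<close>), denoted \<open>w\<close> in the
  introduction.\<close>
definition kwt :: "'a::euclidean_space \<Rightarrow> real" where
  "kwt = wt (real DIM('a) + 2 * \<beta>)"

lemma kwt_exp_nonneg: "0 \<le> real DIM('a::euclidean_space) + 2 * \<beta>"
  using beta_pos by simp

lemma kwt_pos: "0 < kwt x" by (simp add: kwt_def wt_pos)
lemma kwt_nonneg: "0 \<le> kwt x" by (rule less_imp_le[OF kwt_pos])
lemma kwt_le_1: "kwt x \<le> 1" unfolding kwt_def using beta_pos by (intro wt_le_1) auto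
lemma kwt_measurable [measurable]: "kwt \<in> borel_measurable borel" by (simp add: kwt_def)
lemma kwt_minus_commute: "kwt (x - y) = kwt (y - x)" by (simp add: kwt_def wt_minus_commute)

lemma kwt_peetre: "kwt (x - y) \<le> (1 + norm y) powr (real DIM('a) + 2 * \<beta>) * kwt (x::'a::euclidean_space)"
  unfolding kwt_def by (rule wt_peetre[OF kwt_exp_nonneg])

definition ckern :: "real \<Rightarrow> 'a::euclidean_space \<Rightarrow> complex" where
  "ckern t x = of_real (kern t x)"

lemma ckern_eq_gauss_mom_c:
  fixes x :: "'a::euclidean_space"
  assumes "0 < t"
  shows "ckern t x = of_real ((4 * pi) powr (- (DIM('a) / 2)) * t powr (- (DIM('a) / (2 * \<beta>)))) *
     gauss_mom_c (DIM('a) / 2) (t powr (- 1 / (2 * \<beta>)) *\<^sub>R x + 0)"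
proof -
  have "(norm (t powr (- 1 / (2 * \<beta>)) *\<^sub>R x))\<^sup>2 = (norm x)\<^sup>2 * t powr (- 1 / \<beta>)"
  proof -
    have "- 1 / (2 * \<beta>) + - 1 / (2 * \<beta>) = - 1 / \<beta>" using beta_pos by (simp add: field_simps)
    then have "(t powr (- 1 / (2 * \<beta>)))\<^sup>2 = t powr (- 1 / \<beta>)"
      by (simp only: power2_eq_square powr_add[symmetric])
    then show ?thesis by (simp add: power_mult_distrib mult.commute)
  qed
  then show ?thesis by (simp add: ckern_def gauss_mom_c_def kern_def)
qed

lemma smooth_ckern:
  assumes "0 < t"
  shows "smooth (ckern t :: 'a::euclidean_space \<Rightarrow> complex)"
  unfolding ckern_eq_gauss_mom_c[OF assms, abs_def]
  by (intro smooth_cmult smooth_affine smooth_gauss_mom_c) simp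

lemma dbound_ckern:
  assumes t: "0 < t"
  shows "\<exists>A\<ge>0. dbound m A kwt (ckern t :: 'a::euclidean_space \<Rightarrow> complex)"
proof -
  let ?n = "real DIM('a)"
  let ?c = "t powr (- 1 / (2 * \<beta>))"
  let ?K = "of_real ((4 * pi) powr (- (DIM('a) / 2)) * t powr (- (DIM('a) / (2 * \<beta>)))) :: complex"
  have c: "0 < ?c" using t by simp
  obtain A where A: "dbound m A (wt (2 * (?n / 2) + 2 * \<beta>)) (gauss_mom_c (?n / 2) :: 'a \<Rightarrow> complex)"
    using dbound_gauss_mom_c[of "?n / 2" m, where 'a = 'a] by auto
  have A': "dbound m A kwt (gauss_mom_c (?n / 2) :: 'a \<Rightarrow> complex)"
    using A by (simp add: kwt_def)
  have A0: "0 \<le> A" by (rule weight_bound_nonneg[OF dbound_bound[OF A]])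
  let ?B = "norm ?K * (max 1 \<bar>?c\<bar> ^ m * A)"
  have B0: "0 \<le> ?B" using A0 by simp
  have "dbound m ?B (\<lambda>x. kwt (?c *\<^sub>R x + 0)) (ckern t :: 'a \<Rightarrow> complex)"
    unfolding ckern_eq_gauss_mom_c[OF t, abs_def]
    by (intro dbound_cmult smooth_affine smooth_gauss_mom_c dbound_affine A') auto
  then have "dbound m (?B * max 1 (1 / ?c) powr (?n + 2 * \<beta>)) kwt (ckern t :: 'a \<Rightarrow> complex)"
  proof (rule dbound_mono)
    fix x :: 'a
    have "kwt (?c *\<^sub>R x + 0) \<le> max 1 (1 / ?c) powr (?n + 2 * \<beta>) * kwt x"
      unfolding kwt_def using wt_scale[OF c kwt_exp_nonneg[where 'a = 'a]] by simp
    from mult_left_mono[OF this B0]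
    show "?B * kwt (?c *\<^sub>R x + 0) \<le> ?B * max 1 (1 / ?c) powr (?n + 2 * \<beta>) * kwt x"
      by (simp only: mult.assoc)
  qed
  then show ?thesis using B0 by (intro exI[of _ "?B * max 1 (1 / ?c) powr (?n + 2 * \<beta>)"]) auto
qed

lemma bsmooth_ckern:
  assumes "0 < t"
  shows "bsmooth (ckern t :: 'a::euclidean_space \<Rightarrow> complex)"
  unfolding bsmooth_def
proof (intro conjI allI smooth_ckern assms)
  fix m
  obtain A where "0 \<le> A" "dbound m A kwt (ckern t :: 'a \<Rightarrow> complex)" using dbound_ckern[OF assms] by blast
  then show "\<exists>A. dbound m A (\<lambda>_. 1) (ckern t :: 'a \<Rightarrow> complex)"
    by (intro exI[of _ A]) (auto intro: dbound_mono simp: mult_left_le kwt_le_1)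
qed

lemma kern_lower: "\<exists>c>0. \<forall>x::'a::euclidean_space. c * kwt x \<le> kern 1 x"
proof -
  let ?n = "real DIM('a)"
  obtain c where c: "0 < c" "\<And>a. 0 \<le> a \<Longrightarrow> c * (1 + a) powr (- (?n / 2 + \<beta>)) \<le> gauss_mom (?n / 2) a"
    using gauss_mom_lower[of "?n / 2"] by auto
  let ?K = "(4 * pi) powr (- (?n / 2))"
  have "?K * c * kwt x \<le> kern 1 x" for x :: 'a
  proof -
    have pos: "0 < 1 + norm x" by (simp add: add_pos_nonneg)
    then have e: "(1 + norm x)\<^sup>2 = (1 + norm x) powr 2" by simp
    have "kwt x = ((1 + norm x)\<^sup>2) powr (- (?n / 2 + \<beta>))"
    proof -
      have "2 * (- (?n / 2 + \<beta>)) = - (?n + 2 * \<beta>)" by simp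
      then show ?thesis by (simp only: e powr_powr kwt_def wt_def)
    qed
    also have "\<dots> \<le> (1 + (norm x)\<^sup>2) powr (- (?n / 2 + \<beta>))"
      using beta_pos by (intro powr_mono2') (auto simp: power2_eq_square algebra_simps add_pos_nonneg)
    finally have "c * kwt x \<le> gauss_mom (?n / 2) ((norm x)\<^sup>2)"
      using c(2)[of "(norm x)\<^sup>2"] c(1) by (meson mult_left_mono less_imp_le order_trans zero_le_power2)
    then have "?K * (c * kwt x) \<le> ?K * gauss_mom (?n / 2) ((norm x)\<^sup>2)"
      by (intro mult_left_mono) auto
    then show ?thesis by (simp add: kern_def mult.assoc)
  qed
  then show ?thesis using c(1) by (intro exI[of _ "?K * c"]) auto
qed

lemma kern_upper: "\<exists>C\<ge>0. \<forall>t>0. \<forall>x::'a::euclidean_space.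
    kern t x \<le> C * t powr (- (DIM('a) / (2 * \<beta>))) * kwt (t powr (- 1 / (2 * \<beta>)) *\<^sub>R x)"
proof -
  let ?n = "real DIM('a)"
  obtain C where C: "0 \<le> C" "\<And>x::'a. norm (gauss_mom_c (?n / 2) x) \<le> C * wt (2 * (?n / 2) + 2 * \<beta>) x"
    using gauss_mom_c_bound[of "?n / 2", where 'a = 'a] by auto
  let ?K = "(4 * pi) powr (- (?n / 2))"
  have "kern t x \<le> (?K * C) * t powr (- (DIM('a) / (2 * \<beta>))) * kwt (t powr (- 1 / (2 * \<beta>)) *\<^sub>R x)"
    if t: "0 < t" for t and x :: 'a
  proof -
    have "kern t x = norm (ckern t x)" by (simp add: ckern_def kern_nonneg)
    also have "\<dots> = (?K * t powr (- (?n / (2 * \<beta>)))) * norm (gauss_mom_c (?n / 2) (t powr (- 1 / (2 * \<beta>)) *\<^sub>R x))"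
      by (simp add: ckern_eq_gauss_mom_c[OF t] norm_mult)
    also have "\<dots> \<le> (?K * t powr (- (?n / (2 * \<beta>)))) * (C * kwt (t powr (- 1 / (2 * \<beta>)) *\<^sub>R x))"
      using C(2)[of "t powr (- 1 / (2 * \<beta>)) *\<^sub>R x"] by (intro mult_left_mono) (auto simp: kwt_def)
    finally show ?thesis by (simp add: mult_ac)
  qed
  then show ?thesis using C(1) by (intro exI[of _ "?K * C"]) auto
qed

text \<open>The weight is dominated by a probability density, namely by the kernel itself.\<close>
lemma kwt_integrable: "integrable lborel (kwt :: 'a::euclidean_space \<Rightarrow> real)"
proof -
  obtain c where c: "0 < c" "\<And>x::'a. c * kwt x \<le> kern 1 x" using kern_lower by blast
  have "integrable lborel (\<lambda>x::'a. c * kwt x)"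
    by (rule Bochner_Integration.integrable_bound[OF kern_fourier(2)[of 1]])
       (use c in \<open>auto simp: abs_mult kwt_nonneg kern_nonneg\<close>)
  then show ?thesis using c(1) by simp
qed

lemma wt_integrable:
  assumes "real DIM('a) + 2 * \<beta> \<le> a"
  shows "integrable lborel (wt a :: 'a::euclidean_space \<Rightarrow> real)"
  by (rule Bochner_Integration.integrable_bound[OF kwt_integrable])
     (use assms in \<open>auto simp: kwt_def less_imp_le[OF wt_pos] intro: wt_antimono\<close>)

lemma dbound_conv_wt:
  fixes k :: "'a::euclidean_space \<Rightarrow> complex"
  assumes a: "real DIM('a) + 2 * \<beta> \<le> a" and k: "bsmooth k" "dbound m A (wt a) k"
  shows "\<exists>K\<ge>0. \<forall>\<theta> B. \<theta> \<in> borel_measurable borel \<longrightarrow> (\<forall>y. norm (\<theta> y) \<le> B * wt a y) \<longrightarrow>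
    dbound m (K * B) (wt a) (conv \<theta> (\<lambda>y. y) k)"
proof -
  have a0: "0 \<le> a" using a beta_pos by (smt (verit) of_nat_0_le_iff)
  note wi = wt_integrable[OF a]
  note C = wt_convolution[OF a0 wi]
  let ?C = "2 * 2 powr a * (\<integral>y. wt a (y::'a) \<partial>lborel)"
  have C0: "0 \<le> ?C"
    by (intro mult_nonneg_nonneg Bochner_Integration.integral_nonneg less_imp_le[OF wt_pos]) auto
  have A0: "0 \<le> A" by (rule weight_bound_nonneg[OF dbound_bound[OF k(2)]])
  have "dbound m ((A * ?C) * B) (wt a) (conv \<theta> (\<lambda>y. y) k)"
    if [measurable]: "\<theta> \<in> borel_measurable borel" and B: "\<And>y. norm (\<theta> y) \<le> B * wt a y" for \<theta> B
  proof -
    have B0: "0 \<le> B" by (rule weight_bound_nonneg[OF B])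
    have \<theta>i: "integrable lborel \<theta>"
      by (rule Bochner_Integration.integrable_bound[OF integrable_mult_right[OF wi, of B]])
         (use B in \<open>auto intro!: AE_I2 intro: order_trans[OF _ abs_ge_self]\<close>)
    have pw: "norm (\<theta> y) * wt a (z - y) \<le> B * (wt a (z - y) * wt a y)" for y z
      using mult_right_mono[OF B[of y] less_imp_le[OF wt_pos[of a "z - y"]]] by (simp add: mult_ac)
    have i: "integrable lborel (\<lambda>y. B * (wt a (z - y) * wt a y))" for z :: 'a
      by (intro integrable_mult_right C)
    have 1: "integrable lborel (\<lambda>y. norm (\<theta> y) * wt a (z - y))" for z
      by (rule Bochner_Integration.integrable_bound[OF i[of z]])
         (use pw in \<open>auto simp: abs_mult less_imp_le[OF wt_pos] B0\<close>)
    have "dbound m (A * (B * ?C)) (wt a) (conv \<theta> (\<lambda>y. y) k)"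
    proof (rule dbound_conv[OF \<theta>i _ k A0 1])
      fix z :: 'a
      have "(\<integral>y. norm (\<theta> y) * wt a (z - y) \<partial>lborel) \<le> (\<integral>y. B * (wt a (z - y) * wt a y) \<partial>lborel)"
        by (rule integral_mono[OF 1 i pw])
      also have "\<dots> \<le> B * (?C * wt a z)" using C(2)[of z] B0 by (simp add: mult_left_mono)
      finally show "(\<integral>y. norm (\<theta> y) * wt a (z - y) \<partial>lborel) \<le> B * ?C * wt a z" by (simp only: mult.assoc)
    qed simp
    then show ?thesis by (simp only: mult_ac)
  qed
  then show ?thesis using A0 C0 by (intro exI[of _ "A * ?C"]) auto
qed

lemma dbound_conv_ckern:
  assumes "0 < s"
  shows "\<exists>K\<ge>0. \<forall>\<theta> B. \<theta> \<in> borel_measurable borel \<longrightarrow> (\<forall>y. norm (\<theta> y) \<le> B * kwt y) \<longrightarrow>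
     dbound m (K * B) kwt (conv \<theta> (\<lambda>y. y) (ckern s :: 'a::euclidean_space \<Rightarrow> complex))"
proof -
  obtain A where "dbound m A kwt (ckern s :: 'a \<Rightarrow> complex)" using dbound_ckern[OF assms] by blast
  from dbound_conv_wt[OF order_refl bsmooth_ckern[OF assms] this[unfolded kwt_def]]
  show ?thesis by (simp only: kwt_def)
qed

end

section \<open>Pairing a distribution with functions of kernel decay\<close>

text \<open>The cutoff is a parameter because the dyadic partition itself provides one, see
  \<open>dyadic_cut\<close>.\<close>
locale heat_data = fractional \<beta> for \<beta> +
  fixes f :: "'a::euclidean_space functional" and cut :: "'a \<Rightarrow> complex"
  assumes f_tempered: "tempered f" and f_heat: "heat_defined \<beta> f"
    and cut_smooth: "smooth cut"
    and cut_one: "\<And>x. norm x < 1 \<Longrightarrow> cut x = 1"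
    and cut_zero: "\<And>x. 3 < norm x \<Longrightarrow> cut x = 0"
begin

lemma f_add: "schwartz h \<Longrightarrow> schwartz k \<Longrightarrow> f (\<lambda>x. h x + k x) = f h + f k"
  using f_tempered by (auto simp: tempered_def)

lemma f_cmult: "schwartz h \<Longrightarrow> f (\<lambda>x. c * h x) = c * f h"
  using f_tempered by (auto simp: tempered_def)

lemma f_diff:
  assumes "schwartz h" "schwartz k" "schwartz (\<lambda>x. -1 * k x)"
  shows "f (\<lambda>x. h x - k x) = f h - f k"
  using f_add[OF assms(1,3)] f_cmult[OF assms(2), of "-1"] by simp

lemma test_fun_cmult: "test_fun h \<Longrightarrow> test_fun (\<lambda>x. c * h x)" for h :: "'a \<Rightarrow> complex"
  by (rule test_fun_mult[OF smooth_const])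

lemma f_test_diff: "test_fun h \<Longrightarrow> test_fun k \<Longrightarrow> f (\<lambda>x. h x - k x) = f h - f k"
  using f_diff test_fun_schwartz test_fun_cmult by blast

lemma f_zero: "f (\<lambda>x. 0) = 0"
proof -
  have "test_fun (\<lambda>x::'a. 0)" by (simp add: test_fun_def smooth_const)
  from f_cmult[OF test_fun_schwartz[OF this], of 0] show ?thesis by simp
qed

definition cutoff :: "real \<Rightarrow> 'a \<Rightarrow> complex" where
  "cutoff R x = cut ((1 / R) *\<^sub>R x)"

lemma cut_test_fun: "test_fun cut"
  unfolding test_fun_def using cut_smooth cut_zero
  by (auto simp: bounded_iff intro!: exI[of _ 3] leI)

lemma cutoff_smooth: "smooth (cutoff R)"
  using smooth_affine[OF cut_smooth, of "1 / R" 0] by (simp add: cutoff_def[abs_def])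

lemma cutoff_one: "0 < R \<Longrightarrow> norm x < R \<Longrightarrow> cutoff R x = 1"
  by (simp add: cutoff_def cut_one field_simps)

lemma cutoff_zero: "0 < R \<Longrightarrow> 3 * R < norm x \<Longrightarrow> cutoff R x = 0"
  by (simp add: cutoff_def cut_zero field_simps)

lemma cutoff_test_fun: "0 < R \<Longrightarrow> test_fun (cutoff R)"
  unfolding test_fun_def using cutoff_smooth cutoff_zero
  by (auto simp: bounded_iff intro!: exI[of _ "3 * R"] leI)

definition cutoff_bound :: "nat \<Rightarrow> real" where "cutoff_bound m = C_norm m cut"

lemma cutoff_bound_nonneg: "0 \<le> cutoff_bound m"
  unfolding cutoff_bound_def by (rule C_norm_nonneg[OF cut_test_fun])

lemma dbound_cutoff:
  assumes "1 \<le> R"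
  shows "dbound m (cutoff_bound m) (\<lambda>_. 1) (cutoff R)"
  using dbound_affine[OF cut_smooth test_fun_dbound_C_norm[OF cut_test_fun, of m], of "1 / R" 0] assms
  by (simp add: cutoff_def[abs_def] cutoff_bound_def)

lemma approx_unit_cutoff: "approx_unit (\<lambda>k. cutoff (real k + 1))"
  unfolding approx_unit_def
proof (intro conjI allI)
  show "test_fun (cutoff (real k + 1))" for k by (rule cutoff_test_fun) simp
  show "\<exists>M. \<forall>k. C_norm m (cutoff (real k + 1)) \<le> M" for m
    by (intro exI[of _ "cutoff_bound m"] allI C_norm_le dbound_cutoff) simp
  fix R :: real
  show "\<forall>\<^sub>F k in sequentially. \<forall>x\<in>cball 0 R. cutoff (real k + 1) x = 1"
    using eventually_gt_at_top[of "nat \<lceil>R\<rceil>"]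
  proof eventually_elim
    case (elim k)
    then have "R < real k + 1" by linarith
    then show ?case by (auto intro!: cutoff_one)
  qed
qed

text \<open>Multiplying by the kernel and dividing by it again turns integrability of the product
  of \<open>f\<close> with the kernel into a weighted estimate for \<open>f\<close> itself.\<close>
lemma f_bound_ex:
  "\<exists>m C. 0 \<le> C \<and> (\<forall>h A. test_fun h \<longrightarrow> dbound m A kwt h \<longrightarrow> norm (f h) \<le> C * A)"
proof -
  have "convolvable (heat_kernel \<beta> 1) f" using f_heat by (simp add: heat_defined_def)
  then have "integrable_dist (dist_mult (\<lambda>y. heat_kernel \<beta> 1 (0 - y)) f)"
    unfolding convolvable_def by blast
  then obtain C m where C: "\<And>\<eta>. test_fun \<eta> \<Longrightarrow> norm (dist_mult (\<lambda>y. heat_kernel \<beta> 1 (0 - y)) f \<eta>) \<le> C * C_norm m \<eta>"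
    unfolding integrable_dist_def by blast
  have hk: "heat_kernel \<beta> 1 (0 - y) = ckern 1 y" for y :: 'a
    by (simp add: heat_kernel_eq_kern ckern_def)
  obtain c where c: "0 < c" "\<And>x::'a. c * kwt x \<le> kern 1 x" using kern_lower by blast
  have low: "c * kwt x \<le> norm (ckern 1 x)" for x :: 'a
    using c(2)[of x] by (simp add: ckern_def kern_nonneg)
  have nz: "ckern 1 x \<noteq> 0" for x :: 'a
    using low[of x] c(1) kwt_pos[of x] by (metis mult_pos_pos norm_zero not_less)
  have sm: "smooth (ckern 1 :: 'a \<Rightarrow> complex)" by (rule smooth_ckern) simp
  have "\<exists>B. dbound m B (\<lambda>x. inverse (kwt x)) (\<lambda>x::'a. inverse (ckern 1 x))"
    using dbound_ckern[of 1] c(1) low by (intro dbound_inverse[OF sm]) (auto simp: kwt_pos)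
  then obtain B where B: "dbound m B (\<lambda>x. inverse (kwt x)) (\<lambda>x::'a. inverse (ckern 1 x))" by blast
  have smi: "smooth (\<lambda>x::'a. inverse (ckern 1 x))" by (rule smooth_inverse[OF sm nz])
  have B0: "0 \<le> B"
  proof -
    have "0 \<le> B * inverse (kwt (0::'a))" by (rule order_trans[OF norm_ge_zero dbound_bound[OF B]])
    then show ?thesis using kwt_pos[of "0::'a"] by (simp add: zero_le_mult_iff)
  qed
  have "norm (f h) \<le> (\<bar>C\<bar> * (2 ^ m * B)) * A" if h: "test_fun h" "dbound m A kwt h" for h A
  proof -
    let ?\<eta> = "\<lambda>x. inverse (ckern 1 x) * h x"
    have t: "test_fun ?\<eta>" by (rule test_fun_mult[OF smi h(1)])
    have "dbound m (2 ^ m * B * A) (\<lambda>x. inverse (kwt x) * kwt x) ?\<eta>"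
      using h smi B by (intro dbound_mult) (auto simp: test_fun_def)
    then have "dbound m (2 ^ m * B * A) (\<lambda>_. 1) ?\<eta>"
      by (rule dbound_mono) (simp add: less_imp_neq[OF kwt_pos, symmetric])
    then have le: "C_norm m ?\<eta> \<le> 2 ^ m * B * A" by (rule C_norm_le)
    have "f h = dist_mult (\<lambda>y. heat_kernel \<beta> 1 (0 - y)) f ?\<eta>"
    proof -
      have "(\<lambda>x. ckern 1 x * (inverse (ckern 1 x) * h x)) = h"
        by (rule ext) (simp add: nz mult.assoc[symmetric])
      then show ?thesis by (simp add: dist_mult_def hk del: diff_0)
    qed
    then have "norm (f h) \<le> C * C_norm m ?\<eta>" using C[OF t] by simp
    also have "\<dots> \<le> \<bar>C\<bar> * C_norm m ?\<eta>" using C_norm_nonneg[OF t] by (intro mult_right_mono) auto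
    also have "\<dots> \<le> \<bar>C\<bar> * (2 ^ m * B * A)" using le by (intro mult_left_mono) auto
    finally show ?thesis by (simp add: mult.assoc)
  qed
  then show ?thesis using B0 by (intro exI[of _ m] exI[of _ "\<bar>C\<bar> * (2 ^ m * B)"]) auto
qed

definition ord_f :: nat where
  "ord_f = (SOME m. \<exists>C. 0 \<le> C \<and> (\<forall>h A. test_fun h \<longrightarrow> dbound m A kwt h \<longrightarrow> norm (f h) \<le> C * A))"

definition const_f :: real where
  "const_f = (SOME C. 0 \<le> C \<and> (\<forall>h A. test_fun h \<longrightarrow> dbound ord_f A kwt h \<longrightarrow> norm (f h) \<le> C * A))"

lemma const_f: "0 \<le> const_f" "test_fun h \<Longrightarrow> dbound ord_f A kwt h \<Longrightarrow> norm (f h) \<le> const_f * A"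
proof -
  have "\<exists>C. 0 \<le> C \<and> (\<forall>h A. test_fun h \<longrightarrow> dbound ord_f A kwt h \<longrightarrow> norm (f h) \<le> C * A)"
    unfolding ord_f_def by (rule someI_ex[OF f_bound_ex])
  from someI_ex[OF this, folded const_f_def]
  show "0 \<le> const_f" "test_fun h \<Longrightarrow> dbound ord_f A kwt h \<Longrightarrow> norm (f h) \<le> const_f * A" by auto
qed

lemma dbound_kwt_nonneg: "dbound m A kwt (h :: 'a \<Rightarrow> complex) \<Longrightarrow> 0 \<le> A"
  using order_trans[OF norm_ge_zero dbound_bound[of m A kwt h 0]] kwt_pos[of "0::'a"]
  by (simp add: zero_le_mult_iff)

text \<open>Gliding hump: test functions far out on which \<open>f\<close> does not become small could be added up
  with disjoint supports, contradicting the uniform bound.\<close>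
lemma f_tail:
  assumes e: "0 < \<epsilon>"
  shows "\<exists>R\<ge>1. \<forall>h A. test_fun h \<longrightarrow> (\<forall>x. norm x < R \<longrightarrow> h x = 0) \<longrightarrow> dbound ord_f A kwt h \<longrightarrow> norm (f h) \<le> \<epsilon> * A"
proof (rule ccontr)
  assume "\<not> ?thesis"
  then have far: "\<exists>h A. test_fun h \<and> (\<forall>x. norm x < R \<longrightarrow> h x = 0) \<and> dbound ord_f A kwt h \<and> \<epsilon> * A < norm (f h)"
    if "1 \<le> R" for R using that by (auto simp: not_le dest!: spec[of _ R])
  have far1: "\<exists>h. test_fun h \<and> (\<forall>x. norm x < R \<longrightarrow> h x = 0) \<and> dbound ord_f 1 kwt h \<and> \<epsilon> \<le> Re (f h)"
    if R: "1 \<le> R" for R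
  proof -
    obtain h A where h: "test_fun h" "\<And>x. norm x < R \<Longrightarrow> h x = 0" "dbound ord_f A kwt h" "\<epsilon> * A < norm (f h)"
      using far[OF R] by blast
    have "0 \<le> A" by (rule dbound_kwt_nonneg[OF h(3)])
    moreover have "A \<noteq> 0"
    proof
      assume "A = 0"
      then have "h = (\<lambda>_. 0)" using dbound_bound[OF h(3)] by auto
      then show False using h(4) \<open>A = 0\<close> f_zero by simp
    qed
    ultimately have A: "0 < A" by simp
    have fh: "0 < norm (f h)" using h(4) e A by (smt (verit) mult_pos_pos)
    \<comment> \<open>Normalise to \<open>A = 1\<close> and rotate, so that the values of disjoint humps add up.\<close>
    define c where "c = cnj (f h) / (of_real (norm (f h)) * of_real A)"
    have nc: "norm c * A = 1" using fh A by (simp add: c_def norm_divide norm_mult)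
    have "f (\<lambda>x. c * h x) = c * f h" by (rule f_cmult[OF test_fun_schwartz[OF h(1)]])
    also have "\<dots> = of_real (norm (f h) / A)"
    proof -
      have "cnj (f h) * f h = of_real (norm (f h)) * of_real (norm (f h))"
        by (metis complex_norm_square mult.commute of_real_mult power2_eq_square)
      then show ?thesis using fh A by (simp add: c_def)
    qed
    finally have "Re (f (\<lambda>x. c * h x)) = norm (f h) / A" by simp
    then have "\<epsilon> \<le> Re (f (\<lambda>x. c * h x))" using h(4) A by (simp add: pos_le_divide_eq)
    moreover have "dbound ord_f 1 kwt (\<lambda>x. c * h x)"
      using dbound_cmult[OF _ h(3), of c] h(1) nc by (simp add: test_fun_def)
    ultimately show ?thesis using h by (intro exI[of _ "\<lambda>x. c * h x"]) (auto intro: test_fun_cmult)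
  qed
  have "\<exists>h. test_fun h \<and> dbound ord_f 1 kwt h \<and> real N * \<epsilon> \<le> Re (f h)" for N
  proof (induction N)
    case 0
    show ?case
      by (intro exI[of _ "\<lambda>_. 0"]) (auto simp: test_fun_def smooth_const f_zero kwt_nonneg intro!: dbound_zero)
  next
    case (Suc N)
    then obtain h where h: "test_fun h" "dbound ord_f 1 kwt h" "real N * \<epsilon> \<le> Re (f h)" by blast
    obtain R where R: "\<And>x. h x \<noteq> 0 \<Longrightarrow> norm x \<le> R"
      using h(1) by (auto simp: test_fun_def bounded_iff)
    let ?R = "max R 0 + 1"
    obtain k where k: "test_fun k" "\<And>x. norm x < ?R \<Longrightarrow> k x = 0" "dbound ord_f 1 kwt k" "\<epsilon> \<le> Re (f k)"
      using far1[of ?R] by auto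
    have "dbound ord_f 1 kwt (\<lambda>x. h x + k x)"
    proof (rule dbound_local)
      fix x :: 'a
      show "\<exists>U g. open U \<and> x \<in> U \<and> (\<forall>y\<in>U. g y = h y + k y) \<and> dbound ord_f 1 kwt g"
      proof (cases "norm x < ?R")
        case True
        then show ?thesis using h(2) k(2) by (intro exI[of _ "ball 0 ?R"] exI[of _ h]) auto
      next
        case False
        have "h y = 0" if "y \<in> - cball 0 R" for y using R[of y] that by auto
        then show ?thesis using k(3) False by (intro exI[of _ "- cball 0 R"] exI[of _ k]) auto
      qed
    qed
    moreover have "f (\<lambda>x. h x + k x) = f h + f k"
      using h(1) k(1) by (intro f_add test_fun_schwartz)
    ultimately show ?case
      using h k by (intro exI[of _ "\<lambda>x. h x + k x"]) (auto intro!: test_fun_add simp: distrib_right)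
  qed
  then have "real N * \<epsilon> \<le> const_f" for N
    using const_f(2)[where A = 1] complex_Re_le_cmod by (metis mult_1_right order_trans)
  moreover obtain N where "const_f / \<epsilon> < real N" using reals_Archimedean2 by blast
  ultimately show False using e by (metis divide_less_eq not_less)
qed

text \<open>The class of functions to which \<open>f\<close> extends; only derivatives up to the order of \<open>f\<close> are
  controlled.\<close>
definition admissible :: "('a \<Rightarrow> complex) \<Rightarrow> bool" where
  "admissible h \<longleftrightarrow> smooth h \<and> (\<exists>A. dbound ord_f A kwt h)"

lemma admissibleI: "smooth h \<Longrightarrow> dbound ord_f A kwt h \<Longrightarrow> admissible h"
  by (auto simp: admissible_def)

text \<open>The extension of \<open>f\<close>: it agrees with \<open>f\<close> on Schwartz functions by \<open>mass_schwartz\<close>.\<close>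
definition mass :: "('a \<Rightarrow> complex) \<Rightarrow> complex" where
  "mass h = dist_total (dist_mult h f)"

lemma f_cutoff_diff:
  assumes h: "smooth h" "dbound ord_f A kwt h"
    and g: "test_fun g1" "test_fun g2" "dbound ord_f M1 (\<lambda>_. 1) g1" "dbound ord_f M2 (\<lambda>_. 1) g2"
    and R: "\<And>h A. test_fun h \<Longrightarrow> (\<forall>x. norm x < R \<longrightarrow> h x = 0) \<Longrightarrow> dbound ord_f A kwt h \<Longrightarrow> norm (f h) \<le> \<epsilon> * A"
    and eq: "\<And>x. norm x < R \<Longrightarrow> g1 x = g2 x"
  shows "norm (f (\<lambda>x. h x * g1 x) - f (\<lambda>x. h x * g2 x)) \<le> \<epsilon> * (2 ^ ord_f * A * (M1 + M2))"
proof -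
  have sm: "smooth g1" "smooth g2" using g by (auto simp: test_fun_def)
  have "test_fun (\<lambda>x. g1 x - g2 x)"
    using test_fun_add[OF g(1) test_fun_cmult[OF g(2), of "-1"]] by simp
  then have t: "test_fun (\<lambda>x. h x * (g1 x - g2 x))" by (rule test_fun_mult[OF h(1)])
  have "dbound ord_f (2 ^ ord_f * A * (M1 + M2)) (\<lambda>x. kwt x * 1) (\<lambda>x. h x * (g1 x - g2 x))"
    using h sm g by (intro dbound_mult dbound_diff smooth_diff)
  then have "norm (f (\<lambda>x. h x * (g1 x - g2 x))) \<le> \<epsilon> * (2 ^ ord_f * A * (M1 + M2))"
    using eq by (intro R t) auto
  moreover have "f (\<lambda>x. h x * g1 x - h x * g2 x) = f (\<lambda>x. h x * g1 x) - f (\<lambda>x. h x * g2 x)"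
    by (intro f_test_diff test_fun_mult h g)
  ultimately show ?thesis by (simp add: right_diff_distrib)
qed

lemma approx_unit_bounded:
  assumes "approx_unit \<eta>"
  shows "\<exists>M. \<forall>k. C_norm m (\<eta> k) \<le> M"
  using assms unfolding approx_unit_def by blast

text \<open>Two approximate units that both equal \<open>1\<close> on a large ball give nearly the same value, by the
  smallness of \<open>f\<close> far out. This proves at once that the limit exists and that it is the same for
  all approximate units, as the definition of the total mass demands.\<close>
lemma mass_limit:
  assumes "admissible h" "approx_unit \<eta>"
  shows "(\<lambda>k. f (\<lambda>x. h x * \<eta> k x)) \<longlonglongrightarrow> mass h"
proof -
  obtain A where h: "smooth h" "dbound ord_f A kwt h" using assms(1) by (auto simp: admissible_def)
  have A0: "0 \<le> A" by (rule dbound_kwt_nonneg[OF h(2)])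
  have close: "\<forall>\<^sub>F k in sequentially. \<forall>\<^sub>F l in sequentially.
      norm (f (\<lambda>x. h x * \<eta> k x) - f (\<lambda>x. h x * \<eta>' l x)) < e"
    if au: "approx_unit \<eta>" "approx_unit \<eta>'" "0 < e" for \<eta> \<eta>' and e :: real
  proof -
    obtain M where M: "\<And>k. C_norm ord_f (\<eta> k) \<le> M" using approx_unit_bounded[OF au(1)] by blast
    obtain M' where M': "\<And>k. C_norm ord_f (\<eta>' k) \<le> M'" using approx_unit_bounded[OF au(2)] by blast
    have t: "test_fun (\<eta> k)" "test_fun (\<eta>' k)" for k using au by (auto simp: approx_unit_def)
    have w: "dbound ord_f M (\<lambda>_. 1) (\<eta> k)" "dbound ord_f M' (\<lambda>_. 1) (\<eta>' k)" for k
      using dbound_mono[OF test_fun_dbound_C_norm[OF t(1)]] M dbound_mono[OF test_fun_dbound_C_norm[OF t(2)]] M' by auto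
    have nn: "0 \<le> M + M'"
      using C_norm_nonneg[OF t(1)] C_norm_nonneg[OF t(2)] M M' by (meson add_nonneg_nonneg order_trans)
    let ?K = "2 ^ ord_f * A * (M + M')"
    have K: "0 \<le> ?K" using A0 nn by simp
    define \<epsilon> where "\<epsilon> = e / (?K + 1)"
    have eps: "0 < \<epsilon>" using \<open>0 < e\<close> K by (simp add: \<epsilon>_def)
    obtain R where R: "\<And>h A. test_fun h \<Longrightarrow> (\<forall>x. norm x < R \<longrightarrow> h x = 0) \<Longrightarrow> dbound ord_f A kwt h \<Longrightarrow> norm (f h) \<le> \<epsilon> * A"
      using f_tail[OF eps] by blast
    have less: "\<epsilon> * ?K < e"
    proof -
      have "\<epsilon> * ?K < \<epsilon> * (?K + 1)" using eps by (intro mult_strict_left_mono) auto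
      also have "\<dots> = e" using K by (simp add: \<epsilon>_def)
      finally show ?thesis .
    qed
    have ev: "\<forall>\<^sub>F k in sequentially. \<forall>x\<in>cball 0 R. \<eta> k x = 1" "\<forall>\<^sub>F k in sequentially. \<forall>x\<in>cball 0 R. \<eta>' k x = 1"
      using au by (auto simp: approx_unit_def)
    show ?thesis
      using ev(1)
    proof eventually_elim
      case (elim k)
      note k = elim
      show ?case using ev(2)
      proof eventually_elim
        case (elim l)
        have "norm (f (\<lambda>x. h x * \<eta> k x) - f (\<lambda>x. h x * \<eta>' l x)) \<le> \<epsilon> * ?K"
          using k elim by (intro f_cutoff_diff[OF h t w R]) auto
        then show ?case using less by linarith
      qed
    qed
  qed
  let ?s = "\<lambda>k. f (\<lambda>x. h x * cutoff (real k + 1) x)"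
  have "Cauchy ?s"
  proof (rule metric_CauchyI)
    fix e :: real assume "0 < e"
    from close[OF approx_unit_cutoff approx_unit_cutoff half_gt_zero[OF this]]
    obtain k where "\<forall>\<^sub>F l in sequentially. norm (?s k - ?s l) < e / 2"
      using eventually_happens[of _ sequentially] by auto
    then obtain N where N: "\<And>l. N \<le> l \<Longrightarrow> norm (?s k - ?s l) < e / 2"
      by (auto simp: eventually_sequentially)
    show "\<exists>M. \<forall>m\<ge>M. \<forall>n\<ge>M. dist (?s m) (?s n) < e"
    proof (intro exI[of _ N] allI impI)
      fix m n assume "N \<le> m" "N \<le> n"
      from N[OF this(1)] N[OF this(2)] show "dist (?s m) (?s n) < e"
        unfolding dist_norm[symmetric] by (rule dist_triangle_half_r)
    qed
  qed
  then obtain L where L: "?s \<longlonglongrightarrow> L"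
    using Cauchy_convergent convergent_def by blast
  have all: "(\<lambda>k. f (\<lambda>x. h x * \<eta> k x)) \<longlonglongrightarrow> L" if \<eta>: "approx_unit \<eta>" for \<eta>
  proof (rule tendstoI)
    fix e :: real assume "0 < e"
    from close[OF \<eta> approx_unit_cutoff half_gt_zero[OF this]]
    show "\<forall>\<^sub>F k in sequentially. dist (f (\<lambda>x. h x * \<eta> k x)) L < e"
    proof eventually_elim
      case (elim k)
      have "norm (f (\<lambda>x. h x * \<eta> k x) - L) \<le> e / 2"
      proof (rule tendsto_upperbound)
        show "(\<lambda>l. norm (f (\<lambda>x. h x * \<eta> k x) - ?s l)) \<longlonglongrightarrow> norm (f (\<lambda>x. h x * \<eta> k x) - L)"
          by (intro tendsto_intros L)
        show "\<forall>\<^sub>F l in sequentially. norm (f (\<lambda>x. h x * \<eta> k x) - ?s l) \<le> e / 2"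
          using elim by eventually_elim simp
      qed simp
      then show ?case using \<open>0 < e\<close> by (simp add: dist_norm)
    qed
  qed
  have "mass h = L"
    unfolding mass_def dist_total_def dist_mult_def
  proof (rule the_equality)
    show "\<forall>\<eta>. approx_unit \<eta> \<longrightarrow> (\<lambda>k. f (\<lambda>x. h x * \<eta> k x)) \<longlonglongrightarrow> L" using all by blast
    fix L' assume "\<forall>\<eta>. approx_unit \<eta> \<longrightarrow> (\<lambda>k. f (\<lambda>x. h x * \<eta> k x)) \<longlonglongrightarrow> L'"
    then have "?s \<longlonglongrightarrow> L'" using approx_unit_cutoff by blast
    then show "L' = L" using L LIMSEQ_unique by blast
  qed
  then show ?thesis using all[OF assms(2)] by simp
qed

lemma mass_limit_cutoff: "admissible h \<Longrightarrow> (\<lambda>k. f (\<lambda>x. h x * cutoff (real k + 1) x)) \<longlonglongrightarrow> mass h"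
  by (rule mass_limit[OF _ approx_unit_cutoff])

definition const_mass :: real where "const_mass = const_f * (2 ^ ord_f * cutoff_bound ord_f)"

lemma dbound_mult_cutoff:
  assumes "smooth h" "dbound m A w h" "1 \<le> R"
  shows "dbound m (2 ^ m * A * cutoff_bound m) w (\<lambda>x. h x * cutoff R x)"
  using dbound_mult[OF assms(1) cutoff_smooth assms(2) dbound_cutoff[OF assms(3)]] by simp

lemma mass_bound:
  assumes h: "smooth h" "dbound ord_f A kwt h"
  shows "norm (mass h) \<le> const_mass * A"
proof (rule Lim_norm_ubound[OF _ mass_limit_cutoff[OF admissibleI[OF h]]])
  show "\<forall>\<^sub>F k in sequentially. norm (f (\<lambda>x. h x * cutoff (real k + 1) x)) \<le> const_mass * A"
  proof (rule always_eventually, rule allI)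
    fix k
    have "norm (f (\<lambda>x. h x * cutoff (real k + 1) x)) \<le> const_f * (2 ^ ord_f * A * cutoff_bound ord_f)"
      by (intro const_f(2) test_fun_mult h cutoff_test_fun dbound_mult_cutoff) auto
    then show "norm (f (\<lambda>x. h x * cutoff (real k + 1) x)) \<le> const_mass * A" by (simp add: const_mass_def mult_ac)
  qed
qed simp

lemma admissible_add: "admissible h \<Longrightarrow> admissible k \<Longrightarrow> admissible (\<lambda>x. h x + k x)"
  unfolding admissible_def using smooth_add dbound_add by blast

lemma admissible_cmult: "admissible h \<Longrightarrow> admissible (\<lambda>x. c * h x)"
  unfolding admissible_def using smooth_cmult dbound_cmult by blast

lemma mass_add:
  assumes "admissible h" "admissible k"
  shows "mass (\<lambda>x. h x + k x) = mass h + mass k"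
proof (rule LIMSEQ_unique[OF mass_limit_cutoff[OF admissible_add[OF assms]]])
  have "f (\<lambda>x. (h x + k x) * cutoff (real i + 1) x) = f (\<lambda>x. h x * cutoff (real i + 1) x) + f (\<lambda>x. k x * cutoff (real i + 1) x)" for i
  proof -
    have "f (\<lambda>x. h x * cutoff (real i + 1) x + k x * cutoff (real i + 1) x) = f (\<lambda>x. h x * cutoff (real i + 1) x) + f (\<lambda>x. k x * cutoff (real i + 1) x)"
      using assms by (intro f_add test_fun_schwartz test_fun_mult cutoff_test_fun) (auto simp: admissible_def)
    then show ?thesis by (simp add: distrib_right)
  qed
  then show "(\<lambda>i. f (\<lambda>x. (h x + k x) * cutoff (real i + 1) x)) \<longlonglongrightarrow> mass h + mass k"
    using tendsto_add[OF mass_limit_cutoff[OF assms(1)] mass_limit_cutoff[OF assms(2)]] by simp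
qed

lemma mass_cmult:
  assumes "admissible h"
  shows "mass (\<lambda>x. c * h x) = c * mass h"
proof (rule LIMSEQ_unique[OF mass_limit_cutoff[OF admissible_cmult[OF assms]]])
  have "f (\<lambda>x. (c * h x) * cutoff (real i + 1) x) = c * f (\<lambda>x. h x * cutoff (real i + 1) x)" for i
  proof -
    have "f (\<lambda>x. c * (h x * cutoff (real i + 1) x)) = c * f (\<lambda>x. h x * cutoff (real i + 1) x)"
      using assms by (intro f_cmult test_fun_schwartz test_fun_mult cutoff_test_fun) (auto simp: admissible_def)
    then show ?thesis by (simp add: mult.assoc)
  qed
  then show "(\<lambda>i. f (\<lambda>x. (c * h x) * cutoff (real i + 1) x)) \<longlonglongrightarrow> c * mass h"
    using tendsto_mult_left[OF mass_limit_cutoff[OF assms]] by simp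
qed

lemma admissible_diff: "admissible h \<Longrightarrow> admissible k \<Longrightarrow> admissible (\<lambda>x. h x - k x)"
  using admissible_add[of h "\<lambda>x. -1 * k x"] admissible_cmult[of k "-1"] by simp

lemma mass_diff: "admissible h \<Longrightarrow> admissible k \<Longrightarrow> mass (\<lambda>x. h x - k x) = mass h - mass k"
  using mass_add[of h "\<lambda>x. -1 * k x"] admissible_cmult[of k "-1"] mass_cmult[of k "-1"] by simp

lemma admissible_zero: "admissible (\<lambda>x. 0)"
  unfolding admissible_def using smooth_const dbound_zero[of 1 kwt] kwt_nonneg by auto

lemma mass_sum:
  assumes "finite V" "\<And>v. v \<in> V \<Longrightarrow> admissible (h v)"
  shows "admissible (\<lambda>x. \<Sum>v\<in>V. h v x) \<and> mass (\<lambda>x. \<Sum>v\<in>V. h v x) = (\<Sum>v\<in>V. mass (h v))"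
  using assms
proof (induction V rule: finite_induct)
  case empty
  then show ?case using admissible_zero mass_cmult[OF admissible_zero, of 0] by simp
next
  case (insert v V)
  then show ?case using admissible_add[of "h v" "\<lambda>x. \<Sum>v\<in>V. h v x"] mass_add[of "h v" "\<lambda>x. \<Sum>v\<in>V. h v x"] by auto
qed

lemma mass_tail:
  assumes e: "0 < \<epsilon>"
  shows "\<exists>R\<ge>1. \<forall>h A. smooth h \<longrightarrow> dbound ord_f A kwt h \<longrightarrow> (\<forall>x. norm x < R \<longrightarrow> h x = 0) \<longrightarrow> norm (mass h) \<le> \<epsilon> * A"
proof -
  let ?K = "2 ^ ord_f * cutoff_bound ord_f"
  have K: "0 \<le> ?K" using cutoff_bound_nonneg by simp
  define \<epsilon>' where "\<epsilon>' = \<epsilon> / (?K + 1)"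
  have e': "0 < \<epsilon>'" using e K by (simp add: \<epsilon>'_def)
  have eK: "\<epsilon>' * ?K \<le> \<epsilon>"
    using e K by (simp add: \<epsilon>'_def field_simps)
  obtain R where R: "1 \<le> R" "\<And>h A. test_fun h \<Longrightarrow> (\<forall>x. norm x < R \<longrightarrow> h x = 0) \<Longrightarrow> dbound ord_f A kwt h \<Longrightarrow> norm (f h) \<le> \<epsilon>' * A"
    using f_tail[OF e'] by blast
  have "norm (mass h) \<le> \<epsilon> * A" if h: "smooth h" "dbound ord_f A kwt h" and z: "\<And>x. norm x < R \<Longrightarrow> h x = 0" for h A
  proof (rule Lim_norm_ubound[OF _ mass_limit_cutoff[OF admissibleI[OF h]]])
    show "\<forall>\<^sub>F k in sequentially. norm (f (\<lambda>x. h x * cutoff (real k + 1) x)) \<le> \<epsilon> * A"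
    proof (rule always_eventually, rule allI)
      fix k
      have "norm (f (\<lambda>x. h x * cutoff (real k + 1) x)) \<le> \<epsilon>' * (2 ^ ord_f * A * cutoff_bound ord_f)"
        using z by (intro R(2) test_fun_mult h cutoff_test_fun dbound_mult_cutoff) auto
      also have "\<dots> = (\<epsilon>' * ?K) * A" by (simp add: mult_ac)
      also have "\<dots> \<le> \<epsilon> * A" using eK dbound_kwt_nonneg[OF h(2)] by (rule mult_right_mono)
      finally show "norm (f (\<lambda>x. h x * cutoff (real k + 1) x)) \<le> \<epsilon> * A" .
    qed
  qed simp
  then show ?thesis using R(1) by blast
qed

text \<open>The continuity of the extension that takes the place of dominated convergence: a uniform bound
  in the weight \<open>kwt\<close>, together with uniform convergence. Near the origin the second implies
  convergence in the weight, and far out the first makes the mass small.\<close>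
lemma mass_null_sequence:
  assumes h: "\<And>k. smooth (h k)" "\<And>k. dbound ord_f A kwt (h k)" "\<And>k. dbound ord_f (d k) (\<lambda>_. 1) (h k)" and d: "d \<longlonglongrightarrow> 0"
  shows "(\<lambda>k::nat. mass (h k)) \<longlonglongrightarrow> 0"
proof (rule tendstoI)
  fix e :: real assume e: "0 < e"
  have A0: "0 \<le> A" by (rule dbound_kwt_nonneg[OF h(2)])
  let ?a = "real DIM('a) + 2 * \<beta>"
  let ?K = "A + 2 ^ ord_f * A * cutoff_bound ord_f"
  have K: "0 \<le> ?K" using A0 cutoff_bound_nonneg by simp
  define \<epsilon> where "\<epsilon> = (e / 2) / (?K + 1)"
  have eps: "0 < \<epsilon>" using e K by (simp add: \<epsilon>_def)
  have eK: "\<epsilon> * ?K < e / 2"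
  proof -
    have "\<epsilon> * ?K < \<epsilon> * (?K + 1)" using eps by (intro mult_strict_left_mono) auto
    also have "\<dots> = e / 2"
    proof -
      have "a / b * b = a" if "b \<noteq> 0" for a b :: real using that by simp
      moreover have "?K + 1 \<noteq> 0" using K by linarith
      ultimately show ?thesis unfolding \<epsilon>_def by blast
    qed
    finally show ?thesis .
  qed
  obtain R where R: "1 \<le> R" "\<And>h A. smooth h \<Longrightarrow> dbound ord_f A kwt h \<Longrightarrow> (\<forall>x. norm x < R \<longrightarrow> h x = 0) \<Longrightarrow> norm (mass h) \<le> \<epsilon> * A"
    using mass_tail[OF eps] by blast
  let ?D = "\<lambda>k. 2 ^ ord_f * d k * cutoff_bound ord_f * (1 + 3 * R) powr ?a"
  have near: "dbound ord_f (?D k) kwt (\<lambda>x. h k x * cutoff R x)" for k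
  proof -
    have "dbound ord_f (2 ^ ord_f * d k * cutoff_bound ord_f) (\<lambda>x. if x \<in> - cball 0 (3 * R) then 0 else 1) (\<lambda>x. h k x * cutoff R x)"
      using R(1) by (intro dbound_vanish_open dbound_mult_cutoff h) (auto simp: cutoff_zero)
    then show ?thesis
    proof (rule dbound_mono)
      fix x :: 'a
      have d0: "0 \<le> 2 ^ ord_f * d k * cutoff_bound ord_f"
        using order_trans[OF norm_ge_zero dbound_bound[OF h(3)]] cutoff_bound_nonneg by simp
      show "2 ^ ord_f * d k * cutoff_bound ord_f * (if x \<in> - cball 0 (3 * R) then 0 else 1) \<le> ?D k * kwt x"
      proof (cases "norm x \<le> 3 * R")
        case True
        have "(1 + norm x) powr ?a \<le> (1 + 3 * R) powr ?a"
          using True beta_pos by (intro powr_mono2) auto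
        then have "1 \<le> (1 + 3 * R) powr ?a * kwt x"
          using add_pos_nonneg[OF zero_less_one norm_ge_zero[of x]]
          unfolding kwt_def wt_def by (simp only: powr_minus) (simp add: field_simps)
        from mult_left_mono[OF this d0] True show ?thesis by (simp add: mult.assoc)
      next
        case False
        then show ?thesis using d0 kwt_nonneg[of x] by (auto intro!: mult_nonneg_nonneg)
      qed
    qed
  qed
  have "(\<lambda>k. const_mass * ?D k) \<longlonglongrightarrow> const_mass * (2 ^ ord_f * 0 * cutoff_bound ord_f * (1 + 3 * R) powr ?a)"
    by (intro tendsto_intros d)
  then have "\<forall>\<^sub>F k in sequentially. const_mass * ?D k < e / 2"
    using e by (intro order_tendstoD(2)) auto
  then show "\<forall>\<^sub>F k in sequentially. dist (mass (h k)) 0 < e"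
  proof eventually_elim
    case (elim k)
    have w: "dbound ord_f (2 ^ ord_f * A * cutoff_bound ord_f) kwt (\<lambda>x. h k x * cutoff R x)"
      by (intro dbound_mult_cutoff h R)
    have s: "smooth (\<lambda>x. h k x * cutoff R x)" by (intro smooth_mult h cutoff_smooth)
    have "mass (h k) = mass (\<lambda>x. (h k x - h k x * cutoff R x) + h k x * cutoff R x)" by simp
    also have "\<dots> = mass (\<lambda>x. h k x - h k x * cutoff R x) + mass (\<lambda>x. h k x * cutoff R x)"
      by (intro mass_add admissible_diff admissibleI[OF h(1) h(2)] admissibleI[OF s w])
    finally have "norm (mass (h k)) \<le> norm (mass (\<lambda>x. h k x - h k x * cutoff R x)) + norm (mass (\<lambda>x. h k x * cutoff R x))"
      by (simp add: norm_triangle_ineq)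
    also have "\<dots> \<le> \<epsilon> * ?K + const_mass * ?D k"
    proof (rule add_mono)
      show "norm (mass (\<lambda>x. h k x - h k x * cutoff R x)) \<le> \<epsilon> * ?K"
        using R(1) by (intro R(2) smooth_diff dbound_diff h s w) (auto simp: cutoff_one)
      show "norm (mass (\<lambda>x. h k x * cutoff R x)) \<le> const_mass * ?D k"
        by (rule mass_bound[OF s near])
    qed
    also have "\<dots> < e" using eK elim by linarith
    finally show ?case by simp
  qed
qed

text \<open>For a Schwartz function the error of truncation at radius \<open>k\<close> is \<open>O(1/k)\<close> in every seminorm, since
  one power of the weight can be given away.\<close>
lemma mass_schwartz:
  assumes h: "schwartz h"
  shows "admissible h" "mass h = f h"
proof -
  have sm: "smooth h" and w: "\<And>m N. \<exists>A. dbound m A (wt (real N)) h"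
    using h by (auto simp: schwartz_iff_dbound)
  obtain N0 :: nat where N0: "real DIM('a) + 2 * \<beta> \<le> real N0" using real_arch_simple by blast
  obtain A where A: "dbound ord_f A (wt (real N0)) h" using w by blast
  have A0: "0 \<le> A" by (rule weight_bound_nonneg[OF dbound_bound[OF A]])
  have "dbound ord_f A kwt h"
    using A by (rule dbound_mono) (auto simp: kwt_def intro!: mult_left_mono wt_antimono N0 A0)
  then show a: "admissible h" by (rule admissibleI[OF sm])
  obtain C N where C: "\<And>\<psi>. schwartz \<psi> \<Longrightarrow> norm (f \<psi>) \<le> C * schwartz_norm N \<psi>"
    using f_tempered by (auto simp: tempered_def)
  obtain B where B: "dbound N B (wt (real (Suc N))) h" using w by blast
  have B0: "0 \<le> B" by (rule weight_bound_nonneg[OF dbound_bound[OF B]])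
  let ?K = "B + 2 ^ N * B * cutoff_bound N"
  have K0: "0 \<le> ?K" using B0 cutoff_bound_nonneg by simp
  have "(\<lambda>k. f (\<lambda>x. h x * cutoff (real k + 1) x)) \<longlonglongrightarrow> f h"
  proof (rule Lim_transform_bound[of _ "\<lambda>k. \<bar>C\<bar> * (?K / (real k + 1))", THEN LIM_zero_cancel])
    show "\<forall>\<^sub>F k in sequentially. norm (f (\<lambda>x. h x * cutoff (real k + 1) x) - f h) \<le> norm (\<bar>C\<bar> * (?K / (real k + 1)))"
    proof (rule always_eventually, rule allI)
      fix k
      let ?g = "\<lambda>x. h x - h x * cutoff (real k + 1) x"
      have t: "test_fun (\<lambda>x. h x * cutoff (real k + 1) x)" by (intro test_fun_mult sm cutoff_test_fun) simp
      have sg: "smooth ?g" by (intro smooth_diff smooth_mult sm cutoff_smooth)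
      have wg: "\<exists>A. dbound m A (wt (real N')) ?g" for m N'
      proof -
        obtain A where "dbound m A (wt (real N')) h" using w by blast
        then have "dbound m (A + 2 ^ m * A * cutoff_bound m) (wt (real N')) ?g"
          by (intro dbound_diff smooth_mult sm cutoff_smooth dbound_mult_cutoff) auto
        then show ?thesis by blast
      qed
      then have sch: "schwartz ?g" using sg by (auto simp: schwartz_iff_dbound)
      have "dbound N ?K (wt (real (Suc N))) ?g"
        by (intro dbound_diff smooth_mult sm cutoff_smooth dbound_mult_cutoff B) auto
      then have "dbound N ?K (\<lambda>x. if x \<in> ball 0 (real k + 1) then 0 else wt (real (Suc N)) x) ?g"
        by (rule dbound_vanish_open) (auto simp: cutoff_one)
      then have "dbound N (?K / (real k + 1)) (wt (real N)) ?g"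
      proof (rule dbound_mono)
        fix x :: 'a
        show "?K * (if x \<in> ball 0 (real k + 1) then 0 else wt (real (Suc N)) x) \<le> ?K / (real k + 1) * wt (real N) x"
        proof (cases "norm x < real k + 1")
          case True
          then show ?thesis using K0 less_imp_le[OF wt_pos[of "real N" x]] by (auto intro!: mult_nonneg_nonneg divide_nonneg_nonneg)
        next
          case False
          have "wt (real (Suc N)) x = wt (real N) x * wt 1 x"
            using wt_add[of "real N" 1 x] by (simp add: add.commute)
          also have "wt 1 x \<le> 1 / (real k + 1)"
            using False add_pos_nonneg[OF zero_less_one norm_ge_zero[of x]]
            by (simp add: wt_def powr_minus field_simps)
          finally have "wt (real (Suc N)) x \<le> wt (real N) x * (1 / (real k + 1))"
            using less_imp_le[OF wt_pos[of "real N" x]] by (simp add: mult_left_mono)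
          from mult_left_mono[OF this K0] False show ?thesis by (simp add: mult_ac)
        qed
      qed
      then have "schwartz_norm N ?g \<le> ?K / (real k + 1)" by (rule schwartz_norm_le)
      then have "\<bar>C\<bar> * schwartz_norm N ?g \<le> \<bar>C\<bar> * (?K / (real k + 1))" by (intro mult_left_mono) auto
      moreover have "norm (f ?g) \<le> \<bar>C\<bar> * schwartz_norm N ?g"
        using C[OF sch] schwartz_norm_nonneg[OF sch, of N] by (meson abs_ge_self mult_right_mono order_trans)
      moreover have "f ?g = f h - f (\<lambda>x. h x * cutoff (real k + 1) x)"
        by (intro f_diff h test_fun_schwartz t test_fun_cmult)
      ultimately have "norm (f h - f (\<lambda>x. h x * cutoff (real k + 1) x)) \<le> \<bar>C\<bar> * (?K / (real k + 1))"
        by (simp only:)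
      also have "\<dots> = norm (\<bar>C\<bar> * (?K / (real k + 1)))"
      proof -
        have "0 \<le> \<bar>C\<bar> * (?K / (real k + 1))"
          by (rule mult_nonneg_nonneg[OF _ divide_nonneg_nonneg[OF K0]]) auto
        then show ?thesis by (simp only: real_norm_def abs_of_nonneg)
      qed
      finally show "norm (f (\<lambda>x. h x * cutoff (real k + 1) x) - f h) \<le> norm (\<bar>C\<bar> * (?K / (real k + 1)))"
        by (simp only: norm_minus_commute)
    qed
    have "(\<lambda>k. \<bar>C\<bar> * (?K * (1 / real (Suc k)))) \<longlonglongrightarrow> \<bar>C\<bar> * (?K * 0)"
      by (intro tendsto_intros lim_inverse_n'[THEN LIMSEQ_Suc])
    then show "(\<lambda>k. \<bar>C\<bar> * (?K / (real k + 1))) \<longlonglongrightarrow> 0"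
      by (simp add: add.commute)
  qed
  then show "mass h = f h" using mass_limit_cutoff[OF a] LIMSEQ_unique by blast
qed

end

section \<open>The semigroup law for distributions\<close>

lemma simple_function_integral:
  fixes \<theta> :: "'a::euclidean_space \<Rightarrow> complex"
  assumes \<theta>: "integrable lborel \<theta>" and g: "simple_function lborel g"
  shows "(\<integral>y. \<theta> y * F (g y) \<partial>lborel) = (\<Sum>v\<in>range g. (\<integral>y. indicator (g -` {v}) y *\<^sub>R \<theta> y \<partial>lborel) * F v)"
proof -
  have fin: "finite (range g)" using g by (simp add: simple_function_def)
  have sets: "g -` {v} \<in> sets lborel" for v
    using simple_functionD(2)[OF g, of "{v}"] by simp
  have int: "integrable lborel (\<lambda>y. indicator (g -` {v}) y *\<^sub>R \<theta> y)" for v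
    by (rule integrable_mult_indicator[OF sets \<theta>])
  have "\<theta> y * F (g y) = (\<Sum>v\<in>range g. (indicator (g -` {v}) y *\<^sub>R \<theta> y) * F v)" for y
  proof -
    have "(\<Sum>v\<in>range g. (indicator (g -` {v}) y *\<^sub>R \<theta> y) * F v) = (\<Sum>v\<in>range g. if v = g y then \<theta> y * F v else 0)"
      by (intro sum.cong) (auto simp: indicator_def)
    also have "\<dots> = \<theta> y * F (g y)" using fin by simp
    finally show ?thesis by simp
  qed
  then have "(\<integral>y. \<theta> y * F (g y) \<partial>lborel) = (\<integral>y. (\<Sum>v\<in>range g. (indicator (g -` {v}) y *\<^sub>R \<theta> y) * F v) \<partial>lborel)"
    by simp
  also have "\<dots> = (\<Sum>v\<in>range g. (\<integral>y. (indicator (g -` {v}) y *\<^sub>R \<theta> y) * F v \<partial>lborel))"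
    by (intro Bochner_Integration.integral_sum integrable_mult_left int)
  also have "\<dots> = (\<Sum>v\<in>range g. (\<integral>y. indicator (g -` {v}) y *\<^sub>R \<theta> y \<partial>lborel) * F v)"
    by (simp only: integral_mult_left_zero)
  finally show ?thesis .
qed

context heat_data
begin

text \<open>The heat extension of \<open>f\<close>.\<close>
definition u :: "real \<Rightarrow> 'a \<Rightarrow> complex" where "u s = frac_heat \<beta> s f"

lemma u_eq: "0 < s \<Longrightarrow> u s y = mass (\<lambda>z. ckern s (z - y))"
  by (simp add: u_def frac_heat_def dist_conv_def mass_def heat_kernel_eq_kern ckern_def kern_minus_commute[of s y])

lemma dbound_kwt_shift:
  assumes "smooth k" "dbound m A kwt (k :: 'a \<Rightarrow> complex)"
  shows "dbound m (A * (1 + norm v) powr (real DIM('a) + 2 * \<beta>)) kwt (\<lambda>z. k (z - v))"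
proof -
  have "dbound m A (\<lambda>y. kwt (y + (- v))) (\<lambda>y. k (y + (- v)))" by (rule dbound_translate[OF assms])
  then have "dbound m A (\<lambda>y. kwt (y - v)) (\<lambda>y. k (y - v))" by simp
  then show ?thesis
  proof (rule dbound_mono)
    fix x :: 'a
    show "A * kwt (x - v) \<le> A * (1 + norm v) powr (real DIM('a) + 2 * \<beta>) * kwt x"
      using mult_left_mono[OF kwt_peetre[of x v] dbound_kwt_nonneg[OF assms(2)]] by (simp add: mult.assoc)
  qed
qed

lemma smooth_shift: "smooth k \<Longrightarrow> smooth (\<lambda>z::'a. k (z - v))"
  using smooth_affine[of k 1 "- v"] by simp

lemma admissible_ckern_shift:
  assumes "0 < s"
  shows "admissible (\<lambda>z. ckern s (z - y))"
proof -
  obtain A where "dbound ord_f A kwt (ckern s :: 'a \<Rightarrow> complex)" using dbound_ckern[OF assms] by blast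
  from dbound_kwt_shift[OF smooth_ckern[OF assms] this]
  show ?thesis by (rule admissibleI[OF smooth_shift[OF smooth_ckern[OF assms]]])
qed

lemma u_lipschitz:
  assumes s: "0 < s"
  shows "\<exists>K. \<forall>y'. norm (y' - y) \<le> 1 \<longrightarrow> norm (u s y' - u s y) \<le> K * norm (y' - y)"
proof -
  obtain A where A: "0 \<le> A" "dbound (Suc ord_f) A kwt (ckern s :: 'a \<Rightarrow> complex)" using dbound_ckern[OF s] by blast
  have "norm (u s y' - u s y) \<le> (const_mass * (real DIM('a) * A * 2 powr (real DIM('a) + 2 * \<beta>) * (1 + norm y) powr (real DIM('a) + 2 * \<beta>))) * norm (y' - y)"
    if y': "norm (y' - y) \<le> 1" for y'
  proof -
    let ?h = "y - y'"
    have h: "norm ?h \<le> 1" using y' by (simp add: norm_minus_commute)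
    let ?D = "\<lambda>z. ckern s (z + ?h) - ckern s z"
    have "dbound ord_f (real DIM('a) * A * 2 powr (real DIM('a) + 2 * \<beta>) * norm ?h) kwt ?D"
    proof (rule dbound_translate_diff[OF smooth_ckern[OF s] A(2) _ A(1)])
      fix z v :: 'a assume v: "norm v \<le> norm ?h"
      have "kwt (z - (- v)) \<le> (1 + norm (- v)) powr (real DIM('a) + 2 * \<beta>) * kwt z" by (rule kwt_peetre)
      also have "\<dots> \<le> 2 powr (real DIM('a) + 2 * \<beta>) * kwt z"
        using v h beta_pos by (intro mult_right_mono powr_mono2 kwt_nonneg) auto
      finally show "kwt (z + v) \<le> 2 powr (real DIM('a) + 2 * \<beta>) * kwt z" by simp
    qed
    moreover have sD: "smooth ?D"
      using smooth_affine[OF smooth_ckern[OF s], of 1 ?h] by (intro smooth_diff smooth_ckern s) simp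
    ultimately have "dbound ord_f (real DIM('a) * A * 2 powr (real DIM('a) + 2 * \<beta>) * norm ?h * (1 + norm y) powr (real DIM('a) + 2 * \<beta>)) kwt (\<lambda>z. ?D (z - y))"
      by (intro dbound_kwt_shift)
    then have "norm (mass (\<lambda>z. ?D (z - y))) \<le> const_mass * (real DIM('a) * A * 2 powr (real DIM('a) + 2 * \<beta>) * norm ?h * (1 + norm y) powr (real DIM('a) + 2 * \<beta>))"
      by (rule mass_bound[OF smooth_shift[OF sD]])
    moreover have "mass (\<lambda>z. ?D (z - y)) = u s y' - u s y"
      using mass_diff[OF admissible_ckern_shift[OF s, of y'] admissible_ckern_shift[OF s, of y]] by (simp add: u_eq[OF s])
    ultimately show ?thesis by (simp add: mult_ac norm_minus_commute)
  qed
  then show ?thesis by blast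
qed

lemma u_continuous:
  assumes s: "0 < s"
  shows "continuous_on S (u s)"
proof (rule continuous_at_imp_continuous_on, rule ballI)
  fix y
  obtain K where K: "\<And>y'. norm (y' - y) \<le> 1 \<Longrightarrow> norm (u s y' - u s y) \<le> K * norm (y' - y)"
    using u_lipschitz[OF s, of y] by blast
  have "((\<lambda>y'. u s y' - u s y) \<longlongrightarrow> 0) (at y)"
  proof (rule Lim_null_comparison)
    show "\<forall>\<^sub>F y' in at y. norm (u s y' - u s y) \<le> K * norm (y' - y)"
      unfolding eventually_at by (rule exI[of _ 1]) (auto simp: dist_norm intro: K)
    show "((\<lambda>y'. K * norm (y' - y)) \<longlongrightarrow> 0) (at y)"
      by (auto intro!: tendsto_eq_intros)
  qed
  then show "isCont (u s) y" by (simp add: isCont_def LIM_zero_cancel)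
qed

lemma u_measurable:
  assumes "0 < s" shows "u s \<in> borel_measurable borel"
  by (rule borel_measurable_continuous_onI[OF u_continuous[OF assms]])

text \<open>If a simple function \<open>F\<close> replaces the identity, both sides are finite sums, equal by linearity.
  As \<open>F\<close> tends to the identity, the left-hand side converges by dominated convergence and the
  right-hand side by \<open>mass_null_sequence\<close>.\<close>
lemma pairing_compact:
  assumes s: "0 < s" and \<theta>[measurable]: "\<theta> \<in> borel_measurable borel"
    and B: "\<And>y. norm (\<theta> y) \<le> B" and R: "\<And>y. R < norm y \<Longrightarrow> \<theta> y = 0" "0 \<le> R"
  shows "integrable lborel \<theta>" "(\<integral>y. \<theta> y * u s y \<partial>lborel) = mass (conv \<theta> (\<lambda>y. y) (ckern s))"
proof -
  have le: "norm (\<theta> y) \<le> B * indicator (cball 0 R) y" for y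
    using B[of y] R(1)[of y] by (cases "R < norm y") (auto simp: indicator_def)
  have icb: "integrable lborel (\<lambda>y::'a. C * indicator (cball 0 R) y :: real)" for C
    by (intro integrable_mult_right integrable_real_indicator emeasure_lborel_cball_finite) simp
  show \<theta>i: "integrable lborel \<theta>"
    by (rule Bochner_Integration.integrable_bound[OF icb[of B]])
       (auto intro!: AE_I2 order_trans[OF le] simp: indicator_def R not_le)
  obtain F where F: "\<And>i. simple_function lborel (F i)" "\<And>y. (\<lambda>i. F i y) \<longlonglongrightarrow> (y::'a)"
      "\<And>i y. dist (F i y) 0 \<le> 2 * dist y 0"
    using borel_measurable_implies_sequence_metric[of "\<lambda>y::'a. y" lborel 0] by auto
  have Fn: "norm (F i y) \<le> 2 * norm y" for i y using F(3)[of i y] by simp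
  have Fm[measurable]: "F i \<in> borel_measurable borel" for i
    using borel_measurable_simple_function[OF F(1)] by simp
  obtain A where A: "0 \<le> A" "dbound (Suc ord_f) A kwt (ckern s :: 'a \<Rightarrow> complex)" using dbound_ckern[OF s] by blast
  have A': "dbound ord_f A kwt (ckern s :: 'a \<Rightarrow> complex)" by (rule dbound_SucD[OF A(2)])
  have A1: "dbound (Suc ord_f) A (\<lambda>_. 1) (ckern s :: 'a \<Rightarrow> complex)"
    by (rule dbound_mono[OF A(2)]) (use A(1) in \<open>simp add: mult_left_le kwt_le_1\<close>)
  have bs: "bsmooth (ckern s :: 'a \<Rightarrow> complex)" by (rule bsmooth_ckern[OF s])
  let ?B = "(1 + 2 * R) powr (real DIM('a) + 2 * \<beta>) * (\<integral>y. norm (\<theta> y) \<partial>lborel)"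
  have wconv: "dbound ord_f (A * ?B) kwt (conv \<theta> g (ckern s))"
    if g[measurable]: "g \<in> borel_measurable borel" and gn: "\<And>y. norm (g y) \<le> 2 * norm y" for g
  proof (rule dbound_conv[OF \<theta>i g bs A' A(1)])
    fix z :: 'a
    have pw: "norm (\<theta> y) * kwt (z - g y) \<le> norm (\<theta> y) * ((1 + 2 * R) powr (real DIM('a) + 2 * \<beta>) * kwt z)" for y
    proof (cases "R < norm y")
      case False
      have "kwt (z - g y) \<le> (1 + norm (g y)) powr (real DIM('a) + 2 * \<beta>) * kwt z" by (rule kwt_peetre)
      also have "\<dots> \<le> (1 + 2 * R) powr (real DIM('a) + 2 * \<beta>) * kwt z"
        using gn[of y] False beta_pos by (intro mult_right_mono powr_mono2 kwt_nonneg) auto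
      finally show ?thesis by (intro mult_left_mono) auto
    qed (simp add: R)
    have i: "integrable lborel (\<lambda>y. norm (\<theta> y) * ((1 + 2 * R) powr (real DIM('a) + 2 * \<beta>) * kwt z))"
      using \<theta>i by auto
    show 1: "integrable lborel (\<lambda>y. norm (\<theta> y) * kwt (z - g y))"
      by (rule Bochner_Integration.integrable_bound[OF i])
         (use pw in \<open>auto simp: abs_mult kwt_nonneg\<close>)
    have "(\<integral>y. norm (\<theta> y) * kwt (z - g y) \<partial>lborel) \<le> (\<integral>y. norm (\<theta> y) * ((1 + 2 * R) powr (real DIM('a) + 2 * \<beta>) * kwt z) \<partial>lborel)"
      by (rule integral_mono[OF 1 i pw])
    then show "(\<integral>y. norm (\<theta> y) * kwt (z - g y) \<partial>lborel) \<le> ?B * kwt z"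
      by (simp add: mult_ac)
  qed
  have wid: "dbound ord_f (A * ?B) kwt (conv \<theta> (\<lambda>y. y) (ckern s))" by (rule wconv) auto
  have wF: "dbound ord_f (A * ?B) kwt (conv \<theta> (F i) (ckern s))" for i by (rule wconv[OF Fm Fn])
  have sid: "smooth (conv \<theta> (\<lambda>y. y) (ckern s))" by (rule smooth_conv[OF \<theta>i _ bs]) simp
  have sF: "smooth (conv \<theta> (F i) (ckern s))" for i by (rule smooth_conv[OF \<theta>i Fm bs])
  have EF: "mass (conv \<theta> (F i) (ckern s)) = (\<integral>y. \<theta> y * u s (F i y) \<partial>lborel)" for i
  proof -
    let ?c = "\<lambda>v. \<integral>y. indicator (F i -` {v}) y *\<^sub>R \<theta> y \<partial>lborel"
    have fin: "finite (range (F i))" using F(1)[of i] by (simp add: simple_function_def)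
    have "conv \<theta> (F i) (ckern s) = (\<lambda>z. \<Sum>v\<in>range (F i). ?c v * ckern s (z - v))"
      unfolding conv_def by (rule ext) (rule simple_function_integral[OF \<theta>i F(1)])
    then have "mass (conv \<theta> (F i) (ckern s)) = mass (\<lambda>z. \<Sum>v\<in>range (F i). ?c v * ckern s (z - v))"
      by (rule arg_cong)
    also have "\<dots> = (\<Sum>v\<in>range (F i). mass (\<lambda>z. ?c v * ckern s (z - v)))"
      using mass_sum[OF fin, of "\<lambda>v z. ?c v * ckern s (z - v)"] admissible_cmult[OF admissible_ckern_shift[OF s]] by blast
    also have "\<dots> = (\<Sum>v\<in>range (F i). ?c v * u s v)"
      by (intro sum.cong refl) (simp only: mass_cmult[OF admissible_ckern_shift[OF s]] u_eq[OF s])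
    also have "\<dots> = (\<integral>y. \<theta> y * u s (F i y) \<partial>lborel)"
      by (rule simple_function_integral[OF \<theta>i F(1), symmetric])
    finally show ?thesis .
  qed
  have [measurable]: "u s \<in> borel_measurable borel" by (rule u_measurable[OF s])
  have "bounded (u s ` cball 0 (2 * R))"
    by (intro compact_imp_bounded compact_continuous_image u_continuous s) simp
  then obtain M where "\<forall>y\<in>cball 0 (2 * R). norm (u s y) \<le> M" by (auto simp: bounded_iff)
  then have M: "norm (u s y) \<le> M" if "norm y \<le> 2 * R" for y using that by simp
  have M0: "0 \<le> M" using M[of 0] R(2) norm_ge_zero order_trans by (metis norm_zero mult_nonneg_nonneg zero_le_numeral)
  have lim1: "(\<lambda>i. \<integral>y. \<theta> y * u s (F i y) \<partial>lborel) \<longlonglongrightarrow> (\<integral>y. \<theta> y * u s y \<partial>lborel)"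
  proof (rule integral_dominated_convergence[where w = "\<lambda>y. norm (\<theta> y) * M"])
    show "AE y in lborel. (\<lambda>i. \<theta> y * u s (F i y)) \<longlonglongrightarrow> \<theta> y * u s y"
    proof (rule AE_I2)
      fix y
      have "isCont (u s) y" using u_continuous[OF s, of UNIV] by (simp add: continuous_on_eq_continuous_at)
      from isCont_tendsto_compose[OF this F(2)]
      show "(\<lambda>i. \<theta> y * u s (F i y)) \<longlonglongrightarrow> \<theta> y * u s y" by (intro tendsto_intros)
    qed
    show "AE y in lborel. norm (\<theta> y * u s (F i y)) \<le> norm (\<theta> y) * M" for i
    proof (rule AE_I2)
      fix y
      show "norm (\<theta> y * u s (F i y)) \<le> norm (\<theta> y) * M"
      proof (cases "R < norm y")
        case False
        then have "norm (u s (F i y)) \<le> M" using Fn[of i y] by (intro M) linarith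
        then show ?thesis by (simp add: norm_mult mult_left_mono)
      qed (simp add: R)
    qed
  qed (use \<theta>i in auto)
  let ?d = "\<lambda>i. \<integral>y. norm (\<theta> y) * norm (y - F i y) \<partial>lborel"
  have dom: "norm (norm (\<theta> y) * norm (y - F i y)) \<le> norm (\<theta> y) * (3 * R)" for i y
  proof (cases "R < norm y")
    case False
    have "norm (y - F i y) \<le> norm y + norm (F i y)" by (rule norm_triangle_ineq4)
    then have "norm (y - F i y) \<le> 3 * R" using False Fn[of i y] by linarith
    then show ?thesis by (simp add: mult_left_mono)
  qed (simp add: R)
  have di: "integrable lborel (\<lambda>y. norm (\<theta> y) * norm (y - F i y))" for i
  proof (rule Bochner_Integration.integrable_bound[of _ "\<lambda>y. norm (\<theta> y) * (3 * R)"])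
    show "integrable lborel (\<lambda>y. norm (\<theta> y) * (3 * R))" using \<theta>i by auto
    show "AE y in lborel. norm (norm (\<theta> y) * norm (y - F i y)) \<le> norm (norm (\<theta> y) * (3 * R))"
      using dom R(2) by (auto intro!: AE_I2 order_trans[OF _ abs_ge_self])
  qed measurable
  have d0: "?d \<longlonglongrightarrow> 0"
  proof -
    have "?d \<longlonglongrightarrow> (\<integral>y. norm (\<theta> y) * 0 \<partial>lborel)"
    proof (rule integral_dominated_convergence[where w = "\<lambda>y. norm (\<theta> y) * (3 * R)"])
      show "AE y in lborel. (\<lambda>i. norm (\<theta> y) * norm (y - F i y)) \<longlonglongrightarrow> norm (\<theta> y) * 0"
      proof (rule AE_I2)
        fix y
        have "(\<lambda>i. norm (y - F i y)) \<longlonglongrightarrow> norm (y - y)" by (intro tendsto_intros F(2))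
        then show "(\<lambda>i. norm (\<theta> y) * norm (y - F i y)) \<longlonglongrightarrow> norm (\<theta> y) * 0"
          by (intro tendsto_intros) simp
      qed
      show "AE y in lborel. norm (norm (\<theta> y) * norm (y - F i y)) \<le> norm (\<theta> y) * (3 * R)" for i
        by (rule AE_I2) (rule dom)
    qed (use \<theta>i in auto)
    then show ?thesis by simp
  qed
  have lim2: "(\<lambda>i. mass (\<lambda>z. conv \<theta> (\<lambda>y. y) (ckern s) z - conv \<theta> (F i) (ckern s) z)) \<longlonglongrightarrow> 0"
  proof (rule mass_null_sequence)
    show "smooth (\<lambda>z. conv \<theta> (\<lambda>y. y) (ckern s) z - conv \<theta> (F i) (ckern s) z)" for i
      by (rule smooth_diff[OF sid sF])
    show "dbound ord_f (A * ?B + A * ?B) kwt (\<lambda>z. conv \<theta> (\<lambda>y. y) (ckern s) z - conv \<theta> (F i) (ckern s) z)" for i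
      by (rule dbound_diff[OF sid sF wid wF])
    show "dbound ord_f (real DIM('a) * A * ?d i) (\<lambda>_. 1) (\<lambda>z. conv \<theta> (\<lambda>y. y) (ckern s) z - conv \<theta> (F i) (ckern s) z)" for i
      by (rule dbound_conv_diff[OF \<theta>i Fm bs A1 di])
    show "(\<lambda>i. real DIM('a) * A * ?d i) \<longlonglongrightarrow> 0"
      using tendsto_mult_left[OF d0, of "real DIM('a) * A"] by simp
  qed
  have "mass (\<lambda>z. conv \<theta> (\<lambda>y. y) (ckern s) z - conv \<theta> (F i) (ckern s) z) =
      mass (conv \<theta> (\<lambda>y. y) (ckern s)) - (\<integral>y. \<theta> y * u s (F i y) \<partial>lborel)" for i
    unfolding EF[symmetric] by (rule mass_diff[OF admissibleI[OF sid wid] admissibleI[OF sF wF]])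
  with lim2 have "(\<lambda>i. mass (conv \<theta> (\<lambda>y. y) (ckern s)) - (\<integral>y. \<theta> y * u s (F i y) \<partial>lborel)) \<longlonglongrightarrow> 0"
    by simp
  from tendsto_diff[OF tendsto_const[of "mass (conv \<theta> (\<lambda>y. y) (ckern s))"] this]
  have "(\<lambda>i. \<integral>y. \<theta> y * u s (F i y) \<partial>lborel) \<longlonglongrightarrow> mass (conv \<theta> (\<lambda>y. y) (ckern s))" by simp
  then show "(\<integral>y. \<theta> y * u s y \<partial>lborel) = mass (conv \<theta> (\<lambda>y. y) (ckern s))"
    using lim1 LIMSEQ_unique by blast
qed

lemma kwt_dominated_integrable:
  assumes [measurable]: "\<theta> \<in> borel_measurable borel" and B: "\<And>y::'a. norm (\<theta> y) \<le> B * kwt y"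
  shows "integrable lborel (\<theta> :: 'a \<Rightarrow> complex)"
proof (rule Bochner_Integration.integrable_bound[OF integrable_mult_right[OF kwt_integrable, of B]])
  show "AE y in lborel. norm (\<theta> y) \<le> norm (B * kwt y)"
    using B by (auto intro!: AE_I2 intro: order_trans[OF _ abs_ge_self])
qed measurable

text \<open>By duality: the integral of \<open>|u| kwt\<close> over a ball is the pairing of \<open>f\<close> with a convolution
  whose weighted norms do not depend on the ball.\<close>
lemma u_kwt_integrable:
  assumes s: "0 < s"
  shows "integrable lborel (\<lambda>y. norm (u s y) * kwt y)"
proof -
  note [measurable] = u_measurable[OF s]
  obtain K where K: "0 \<le> K" "\<And>\<theta> B. \<theta> \<in> borel_measurable borel \<Longrightarrow> (\<forall>y. norm (\<theta> y) \<le> B * kwt y) \<Longrightarrow>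
     dbound ord_f (K * B) kwt (conv \<theta> (\<lambda>y. y) (ckern s :: 'a \<Rightarrow> complex))"
    using dbound_conv_ckern[OF s] by blast
  have cnj_m [measurable]: "(\<lambda>y. cnj (u s y)) \<in> borel_measurable borel"
    by (intro borel_measurable_continuous_onI continuous_intros u_continuous s)
  have [measurable]: "cball (0::'a) (real N) \<in> sets borel" for N by simp
  let ?g = "\<lambda>N::nat. \<lambda>y. indicator (cball 0 (real N)) y * (norm (u s y) * kwt y)"
  have bound: "(\<integral>\<^sup>+y. ennreal (?g N y) \<partial>lborel) \<le> ennreal (const_mass * (K * 1))" for N
  proof -
    define \<theta> where "\<theta> y = of_real (indicator (cball 0 (real N)) y * kwt y) * (cnj (u s y) / of_real (norm (u s y)))" for y
    have \<theta>m: "\<theta> \<in> borel_measurable borel" unfolding \<theta>_def by measurable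
    have \<theta>b: "norm (\<theta> y) \<le> 1 * kwt y" for y
      using kwt_nonneg[of y] by (auto simp: \<theta>_def norm_mult norm_divide indicator_def)
    have \<theta>1: "norm (\<theta> y) \<le> 1" for y using \<theta>b[of y] kwt_le_1[of y] by linarith
    have \<theta>0: "\<theta> y = 0" if "real N < norm y" for y using that by (simp add: \<theta>_def)
    have prod: "\<theta> y * u s y = of_real (?g N y)" for y
    proof (cases "u s y = 0")
      case False
      have "cnj (u s y) / of_real (norm (u s y)) * u s y = of_real (norm (u s y))"
      proof -
        have "cnj (u s y) * u s y = of_real (norm (u s y)) * of_real (norm (u s y))"
          by (metis complex_norm_square mult.commute of_real_mult power2_eq_square)
        then show ?thesis using False by (simp add: field_simps)
      qed
      then show ?thesis unfolding \<theta>_def by (simp only: mult.assoc) (simp add: mult_ac)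
    qed simp
    have "integrable lborel \<theta>"
      by (rule pairing_compact(1)[OF s \<theta>m \<theta>1 \<theta>0 of_nat_0_le_iff])
    have pair: "(\<integral>y. \<theta> y * u s y \<partial>lborel) = mass (conv \<theta> (\<lambda>y. y) (ckern s))"
      by (rule pairing_compact(2)[OF s \<theta>m \<theta>1 \<theta>0 of_nat_0_le_iff])
    have sm: "smooth (conv \<theta> (\<lambda>y. y) (ckern s))"
      by (rule smooth_conv[OF \<open>integrable lborel \<theta>\<close> _ bsmooth_ckern[OF s]]) simp
    have "norm (mass (conv \<theta> (\<lambda>y. y) (ckern s))) \<le> const_mass * (K * 1)"
      using \<theta>b by (intro mass_bound[OF sm] K \<theta>m) auto
    then have le: "norm (\<integral>y. ?g N y \<partial>lborel) \<le> const_mass * (K * 1)"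
      unfolding pair[symmetric] prod by (simp only: integral_complex_of_real norm_of_real real_norm_def)
    have "bounded (u s ` cball 0 (real N))"
      by (intro compact_imp_bounded compact_continuous_image u_continuous s) simp
    then obtain M where "\<forall>y\<in>cball 0 (real N). norm (u s y) \<le> M" by (auto simp: bounded_iff)
    then have M: "norm (u s y) \<le> M" if "norm y \<le> real N" for y using that by simp
    have M0: "0 \<le> M" using M[of 0] norm_ge_zero order_trans by (metis norm_zero of_nat_0_le_iff)
    have "integrable lborel (?g N)"
    proof (rule Bochner_Integration.integrable_bound[OF integrable_mult_right[OF kwt_integrable, of M]])
      show "AE y in lborel. norm (?g N y) \<le> norm (M * kwt y)"
        using M M0 kwt_nonneg by (auto intro!: AE_I2 mult_right_mono simp: indicator_def abs_mult)
    qed measurable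
    then have "(\<integral>\<^sup>+y. ennreal (?g N y) \<partial>lborel) = ennreal (\<integral>y. ?g N y \<partial>lborel)"
      by (rule nn_integral_eq_integral) (auto simp: kwt_nonneg)
    also have "\<dots> \<le> ennreal (const_mass * (K * 1))" using le by (intro ennreal_leI) auto
    finally show ?thesis .
  qed
  have "(\<lambda>N. \<integral>\<^sup>+y. ennreal (?g N y) \<partial>lborel) \<longlonglongrightarrow> (\<integral>\<^sup>+y. ennreal (norm (u s y) * kwt y) \<partial>lborel)"
  proof (rule nn_integral_LIMSEQ)
    show "incseq (\<lambda>N y. ennreal (?g N y))"
      by (auto simp: incseq_def le_fun_def indicator_def intro!: ennreal_leI mult_nonneg_nonneg kwt_nonneg)
    show "(\<lambda>N. ennreal (?g N y)) \<longlonglongrightarrow> ennreal (norm (u s y) * kwt y)" for y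
    proof (rule tendsto_eventually)
      show "\<forall>\<^sub>F N in sequentially. ennreal (?g N y) = ennreal (norm (u s y) * kwt y)"
        using eventually_ge_at_top[of "nat \<lceil>norm y\<rceil>"]
      proof eventually_elim
        case (elim N)
        then have "norm y \<le> real N" by linarith
        then show ?case by simp
      qed
    qed
  qed auto
  then have "(\<integral>\<^sup>+y. ennreal (norm (u s y) * kwt y) \<partial>lborel) \<le> ennreal (const_mass * (K * 1))"
    by (rule LIMSEQ_le_const2) (use bound in auto)
  then have "(\<integral>\<^sup>+y. ennreal (norm (u s y) * kwt y) \<partial>lborel) < \<infinity>"
    by (rule le_less_trans) simp
  then show ?thesis
    by (intro integrableI_nonneg) (auto simp: kwt_nonneg)
qed

lemma pairing_integrable:
  assumes s: "0 < s" and \<theta>[measurable]: "\<theta> \<in> borel_measurable borel" and B: "\<And>y. norm (\<theta> y) \<le> B * kwt y"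
  shows "integrable lborel (\<lambda>y. \<theta> y * u s y)"
proof (rule Bochner_Integration.integrable_bound[OF integrable_mult_right[OF u_kwt_integrable[OF s], of B]])
  show "AE y in lborel. norm (\<theta> y * u s y) \<le> norm (B * (norm (u s y) * kwt y))"
  proof (rule AE_I2)
    fix y
    have "norm (\<theta> y) * norm (u s y) \<le> (B * kwt y) * norm (u s y)"
      using B[of y] by (rule mult_right_mono) simp
    also have "\<dots> \<le> \<bar>B * (norm (u s y) * kwt y)\<bar>" by (simp add: mult_ac)
    finally show "norm (\<theta> y * u s y) \<le> norm (B * (norm (u s y) * kwt y))"
      by (simp add: norm_mult)
  qed
qed (use u_measurable[OF s] in measurable)

text \<open>Truncation to balls reduces this to the case of compact support; integrability of \<open>|u| kwt\<close>
  gives the dominated convergence of the left-hand side.\<close>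
lemma pairing:
  assumes s: "0 < s" and \<theta>[measurable]: "\<theta> \<in> borel_measurable borel" and B: "\<And>y. norm (\<theta> y) \<le> B * kwt y"
  shows "(\<integral>y. \<theta> y * u s y \<partial>lborel) = mass (conv \<theta> (\<lambda>y. y) (ckern s))"
proof -
  note [measurable] = u_measurable[OF s]
  have B0: "0 \<le> B" using order_trans[OF norm_ge_zero B[of 0]] kwt_pos[of "0::'a"] by (simp add: zero_le_mult_iff)
  obtain K where K: "0 \<le> K" "\<And>\<theta> B. \<theta> \<in> borel_measurable borel \<Longrightarrow> (\<forall>y. norm (\<theta> y) \<le> B * kwt y) \<Longrightarrow>
     dbound ord_f (K * B) kwt (conv \<theta> (\<lambda>y. y) (ckern s :: 'a \<Rightarrow> complex))"
    using dbound_conv_ckern[OF s] by blast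
  have bs: "bsmooth (ckern s :: 'a \<Rightarrow> complex)" by (rule bsmooth_ckern[OF s])
  have id: "(\<lambda>y::'a. y) \<in> borel_measurable borel" by simp
  let ?t = "\<lambda>N::nat. \<lambda>y. indicator (cball 0 (real N)) y *\<^sub>R \<theta> y"
  have [measurable]: "cball (0::'a) (real N) \<in> sets borel" for N by simp
  have tm[measurable]: "?t N \<in> borel_measurable borel" for N by measurable
  have tb: "norm (?t N y) \<le> B * kwt y" for N y
    using B[of y] B0 kwt_nonneg[of y] by (auto simp: indicator_def)
  have tB: "norm (?t N y) \<le> B" for N y
    by (rule order_trans[OF tb]) (use mult_left_mono[OF kwt_le_1[of y] B0] in simp)
  have t0: "?t N y = 0" if "real N < norm y" for N y using that by simp
  have ti: "integrable lborel (?t N)" for N by (rule kwt_dominated_integrable[OF tm tb])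
  have \<theta>i: "integrable lborel \<theta>" by (rule kwt_dominated_integrable[OF \<theta> B])
  have pN: "(\<integral>y. ?t N y * u s y \<partial>lborel) = mass (conv (?t N) (\<lambda>y. y) (ckern s))" for N
    by (rule pairing_compact(2)[OF s tm tB t0 of_nat_0_le_iff])
  have tlim: "(\<lambda>N. ?t N y) \<longlonglongrightarrow> \<theta> y" for y
  proof (rule tendsto_eventually)
    show "\<forall>\<^sub>F N in sequentially. ?t N y = \<theta> y"
      using eventually_ge_at_top[of "nat \<lceil>norm y\<rceil>"]
    proof eventually_elim
      case (elim N)
      then have "norm y \<le> real N" by linarith
      then show ?case by simp
    qed
  qed
  have lim1: "(\<lambda>N. \<integral>y. ?t N y * u s y \<partial>lborel) \<longlonglongrightarrow> (\<integral>y. \<theta> y * u s y \<partial>lborel)"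
  proof (rule integral_dominated_convergence[where w = "\<lambda>y. B * (norm (u s y) * kwt y)"])
    show "AE y in lborel. (\<lambda>N. ?t N y * u s y) \<longlonglongrightarrow> \<theta> y * u s y"
      by (intro AE_I2 tendsto_mult tlim tendsto_const)
    show "AE y in lborel. norm (?t N y * u s y) \<le> B * (norm (u s y) * kwt y)" for N
    proof (rule AE_I2)
      fix y
      have "norm (?t N y) * norm (u s y) \<le> (B * kwt y) * norm (u s y)"
        by (rule mult_right_mono[OF tb norm_ge_zero])
      then show "norm (?t N y * u s y) \<le> B * (norm (u s y) * kwt y)"
        by (simp only: norm_mult mult_ac)
    qed
    show "integrable lborel (\<lambda>y. B * (norm (u s y) * kwt y))"
      by (intro integrable_mult_right u_kwt_integrable s)
  qed measurable
  obtain A where A: "0 \<le> A" "dbound ord_f A kwt (ckern s :: 'a \<Rightarrow> complex)" using dbound_ckern[OF s] by blast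
  have A1: "dbound ord_f A (\<lambda>_. 1) (ckern s :: 'a \<Rightarrow> complex)"
    by (rule dbound_mono[OF A(2)]) (use A(1) in \<open>simp add: mult_left_le kwt_le_1\<close>)
  let ?r = "\<lambda>N y. \<theta> y - ?t N y"
  have rb: "norm (?r N y) \<le> B * kwt y" for N y
    using B[of y] B0 kwt_nonneg[of y] by (auto simp: indicator_def)
  have rm[measurable]: "?r N \<in> borel_measurable borel" for N by measurable
  have ri: "integrable lborel (?r N)" for N by (rule kwt_dominated_integrable[OF rm rb])
  have split: "conv (?r N) (\<lambda>y. y) (ckern s) z = conv \<theta> (\<lambda>y. y) (ckern s) z - conv (?t N) (\<lambda>y. y) (ckern s) z" for N z
    unfolding conv_def using conv_integrable[OF \<theta>i id bs, of z] conv_integrable[OF ti[of N] id bs, of z]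
    by (subst Bochner_Integration.integral_diff[symmetric]) (auto simp: left_diff_distrib)
  let ?d = "\<lambda>N. \<integral>y. norm (?r N y) \<partial>lborel"
  have d0: "?d \<longlonglongrightarrow> 0"
  proof -
    have "?d \<longlonglongrightarrow> (\<integral>y. norm (0::complex) \<partial>(lborel :: 'a measure))"
    proof (rule integral_dominated_convergence[where w = "\<lambda>y. B * kwt y"])
      show "AE y in lborel. (\<lambda>N. norm (?r N y)) \<longlonglongrightarrow> norm (0::complex)"
      proof (rule AE_I2)
        fix y
        have "(\<lambda>N. norm (?r N y)) \<longlonglongrightarrow> norm (\<theta> y - \<theta> y)" by (intro tendsto_intros tlim)
        then show "(\<lambda>N. norm (?r N y)) \<longlonglongrightarrow> norm (0::complex)" by simp
      qed
      show "AE y in lborel. norm (norm (?r N y)) \<le> B * kwt y" for N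
        unfolding real_norm_def abs_norm_cancel by (rule AE_I2) (rule rb)
      show "integrable lborel (\<lambda>y::'a. B * kwt y)" by (intro integrable_mult_right kwt_integrable)
    qed measurable
    then show ?thesis by simp
  qed
  have lim2: "(\<lambda>N. mass (conv (?r N) (\<lambda>y. y) (ckern s))) \<longlonglongrightarrow> 0"
  proof (rule mass_null_sequence)
    show "smooth (conv (?r N) (\<lambda>y. y) (ckern s))" for N by (rule smooth_conv[OF ri id bs])
    show "dbound ord_f (K * B) kwt (conv (?r N) (\<lambda>y. y) (ckern s))" for N
      using rb by (intro K rm) auto
    show "dbound ord_f (A * ?d N) (\<lambda>_. 1) (conv (?r N) (\<lambda>y. y) (ckern s))" for N
      by (rule dbound_conv[OF ri id bs A1 A(1)]) (use integrable_norm[OF ri[of N]] in auto)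
    show "(\<lambda>N. A * ?d N) \<longlonglongrightarrow> 0"
      using tendsto_mult_left[OF d0, of A] by simp
  qed
  have a\<theta>: "admissible (conv \<theta> (\<lambda>y. y) (ckern s))"
    using B by (intro admissibleI[OF smooth_conv[OF \<theta>i id bs] K(2)[OF \<theta>]]) auto
  have at: "admissible (conv (?t N) (\<lambda>y. y) (ckern s))" for N
    using tb by (intro admissibleI[OF smooth_conv[OF ti id bs] K(2)[OF tm]]) auto
  have "mass (conv (?r N) (\<lambda>y. y) (ckern s)) = mass (conv \<theta> (\<lambda>y. y) (ckern s)) - (\<integral>y. ?t N y * u s y \<partial>lborel)" for N
  proof -
    have "conv (?r N) (\<lambda>y. y) (ckern s) = (\<lambda>z. conv \<theta> (\<lambda>y. y) (ckern s) z - conv (?t N) (\<lambda>y. y) (ckern s) z)"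
      by (rule ext) (rule split)
    then show ?thesis using mass_diff[OF a\<theta> at] pN by simp
  qed
  with lim2 have "(\<lambda>N. mass (conv \<theta> (\<lambda>y. y) (ckern s)) - (\<integral>y. ?t N y * u s y \<partial>lborel)) \<longlonglongrightarrow> 0" by simp
  from tendsto_diff[OF tendsto_const[of "mass (conv \<theta> (\<lambda>y. y) (ckern s))"] this]
  have "(\<lambda>N. \<integral>y. ?t N y * u s y \<partial>lborel) \<longlonglongrightarrow> mass (conv \<theta> (\<lambda>y. y) (ckern s))" by simp
  then show ?thesis using lim1 LIMSEQ_unique by blast
qed

lemma ckern_shift_bound:
  assumes "0 < t"
  shows "\<exists>B. \<forall>y. norm (ckern t (x - y)) \<le> B * kwt (y::'a)"
proof -
  obtain A where A: "0 \<le> A" "dbound 0 A kwt (ckern t :: 'a \<Rightarrow> complex)" using dbound_ckern[OF assms] by blast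
  have "norm (ckern t (x - y)) \<le> (A * (1 + norm x) powr (real DIM('a) + 2 * \<beta>)) * kwt y" for y
  proof -
    have "norm (ckern t (x - y)) \<le> A * kwt (x - y)" using dbound_bound[OF A(2)] .
    also have "kwt (x - y) \<le> (1 + norm x) powr (real DIM('a) + 2 * \<beta>) * kwt y"
      using kwt_peetre[of y x] by (simp add: kwt_minus_commute)
    finally show ?thesis using A(1) by (simp add: mult.assoc mult_left_mono)
  qed
  then show ?thesis by blast
qed

lemma ckern_measurable [measurable]: "ckern t \<in> borel_measurable borel"
  unfolding ckern_def by measurable

text \<open>The pairing with a translate of the kernel at time \<open>t - s\<close>, whose convolution with the
  kernel at time \<open>s\<close> is a translate of the kernel at time \<open>t\<close>.\<close>
lemma u_semigroup:
  assumes s: "0 < s" and st: "s < t"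
  shows "u t x = (\<integral>y. ckern (t - s) (x - y) * u s y \<partial>lborel)"
    and "integrable lborel (\<lambda>y. ckern (t - s) (x - y) * u s y)"
proof -
  have t: "0 < t" and ts: "0 < t - s" using s st by auto
  obtain B where B: "\<And>y. norm (ckern (t - s) (x - y)) \<le> B * kwt y" using ckern_shift_bound[OF ts] by blast
  have m: "(\<lambda>y. ckern (t - s) (x - y)) \<in> borel_measurable borel" by measurable
  show "integrable lborel (\<lambda>y. ckern (t - s) (x - y) * u s y)"
    by (rule pairing_integrable[OF s m B])
  have "conv (\<lambda>y. ckern (t - s) (x - y)) (\<lambda>y. y) (ckern s) = (\<lambda>z. ckern t (z - x))"
  proof
    fix z
    show "conv (\<lambda>y. ckern (t - s) (x - y)) (\<lambda>y. y) (ckern s) z = ckern t (z - x)"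
      using kern_convolution[OF s ts, of z x]
      by (simp add: conv_def ckern_def mult.commute kern_minus_commute[of t z x])
  qed
  then show "u t x = (\<integral>y. ckern (t - s) (x - y) * u s y \<partial>lborel)"
    by (simp add: pairing[OF s m B] u_eq[OF t])
qed

end

section \<open>The pointwise estimate for the heat extension\<close>

context fractional begin

lemma kwt_antimono: "norm x \<le> norm y \<Longrightarrow> kwt y \<le> kwt x" for x y :: "'a::euclidean_space"
  unfolding kwt_def wt_def using beta_pos by (intro powr_mono2') (auto simp: add_pos_nonneg)

lemma kwt_scaled_integral:
  assumes r: "0 < r"
  shows "(\<integral>\<^sup>+v. ennreal (kwt ((1 / r) *\<^sub>R (v::'a))) \<partial>lborel) =
     ennreal (r ^ DIM('a) * (\<integral>v. kwt v \<partial>(lborel :: 'a::euclidean_space measure)))"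
proof -
  have "(\<integral>\<^sup>+v. ennreal (kwt ((1 / r) *\<^sub>R (v::'a))) \<partial>lborel) =
     ennreal (\<bar>r\<bar> ^ DIM('a)) * (\<integral>\<^sup>+v. ennreal (kwt ((1 / r) *\<^sub>R (0 + r *\<^sub>R (v::'a)))) \<partial>lborel)"
    using r by (intro lborel_nn_integral_affine) auto
  also have "(\<integral>\<^sup>+v. ennreal (kwt ((1 / r) *\<^sub>R (0 + r *\<^sub>R (v::'a)))) \<partial>lborel) = (\<integral>\<^sup>+v. ennreal (kwt (v::'a)) \<partial>lborel)"
    using r by simp
  also have "\<dots> = ennreal (\<integral>v. kwt v \<partial>(lborel :: 'a measure))"
    by (rule nn_integral_eq_integral[OF kwt_integrable]) (auto simp: kwt_nonneg)
  finally show ?thesis using r by (simp add: ennreal_mult' )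
qed

text \<open>At times comparable to \<open>r powr (2 * \<beta>)\<close> the kernel is dominated by an average, over balls
  of radius \<open>r\<close>, of its rescaled majorant; this replaces summation over a lattice of balls.\<close>
lemma kern_average:
  "\<exists>C>0. \<forall>r>0. \<forall>\<tau> z. r powr (2 * \<beta>) / 2 \<le> \<tau> \<longrightarrow> \<tau> \<le> r powr (2 * \<beta>) \<longrightarrow>
     ennreal (kern \<tau> (z::'a::euclidean_space)) \<le>
     ennreal (C / (r ^ DIM('a) * r ^ DIM('a))) *
       (\<integral>\<^sup>+v. ennreal (kwt ((1 / r) *\<^sub>R v)) * (if norm (z - v) < r then 1 else 0) \<partial>lborel)"
proof -
  let ?n = "real DIM('a)"
  let ?a = "?n + 2 * \<beta>"
  obtain C0 where C0: "0 \<le> C0" "\<And>t x. 0 < t \<Longrightarrow>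
      kern t (x::'a) \<le> C0 * t powr (- (?n / (2 * \<beta>))) * kwt (t powr (- 1 / (2 * \<beta>)) *\<^sub>R x)"
    using kern_upper[where 'a = 'a] by blast
  define \<omega> where "\<omega> = unit_ball_vol ?n"
  have \<omega>: "0 < \<omega>" by (simp add: \<omega>_def)
  let ?D = "(C0 + 1) * 2 powr (?n / (2 * \<beta>)) * 2 powr ?a"
  have D: "0 < ?D" using C0(1) by simp
  have "ennreal (kern \<tau> z) \<le> ennreal (?D / \<omega> / (r ^ DIM('a) * r ^ DIM('a))) *
       (\<integral>\<^sup>+v. ennreal (kwt ((1 / r) *\<^sub>R v)) * (if norm (z - v) < r then 1 else 0) \<partial>lborel)"
    if r: "0 < r" and \<tau>: "r powr (2 * \<beta>) / 2 \<le> \<tau>" "\<tau> \<le> r powr (2 * \<beta>)" for r \<tau> and z :: 'a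
  proof -
    have R: "0 < r powr (2 * \<beta>)" using r by simp
    have \<tau>0: "0 < \<tau>" using R \<tau>(1) by linarith
    have rn: "0 < r ^ DIM('a)" using r by simp
    have t1: "\<tau> powr (- (?n / (2 * \<beta>))) \<le> 2 powr (?n / (2 * \<beta>)) / r ^ DIM('a)"
    proof -
      have "\<tau> powr (- (?n / (2 * \<beta>))) \<le> (r powr (2 * \<beta>) / 2) powr (- (?n / (2 * \<beta>)))"
        using \<tau> R beta_pos by (intro powr_mono2') auto
      also have "\<dots> = (r powr (2 * \<beta>)) powr (- (?n / (2 * \<beta>))) * 2 powr (?n / (2 * \<beta>))"
        by (simp add: powr_divide powr_minus_divide)
      also have "(r powr (2 * \<beta>)) powr (- (?n / (2 * \<beta>))) = r powr (- ?n)"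
        using beta_pos by (simp add: powr_powr)
      also have "r powr (- ?n) = 1 / r ^ DIM('a)"
        using r by (simp add: powr_minus powr_realpow field_simps)
      finally show ?thesis by simp
    qed
    have t2: "kwt (\<tau> powr (- 1 / (2 * \<beta>)) *\<^sub>R z) \<le> kwt ((1 / r) *\<^sub>R z)"
    proof (rule kwt_antimono)
      have "1 / r = (r powr (2 * \<beta>)) powr (- 1 / (2 * \<beta>))"
        using r beta_pos by (simp add: powr_powr powr_minus field_simps)
      also have "\<dots> \<le> \<tau> powr (- 1 / (2 * \<beta>))"
        using \<tau> \<tau>0 beta_pos by (intro powr_mono2') auto
      finally have *: "1 / r \<le> \<tau> powr (- 1 / (2 * \<beta>))" .
      show "norm ((1 / r) *\<^sub>R z) \<le> norm (\<tau> powr (- 1 / (2 * \<beta>)) *\<^sub>R z)"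
        using r mult_right_mono[OF * norm_ge_zero[of z]] by simp
    qed
    let ?wz = "kwt ((1 / r) *\<^sub>R z)"
    have k: "kern \<tau> z \<le> (C0 + 1) * (2 powr (?n / (2 * \<beta>)) / r ^ DIM('a)) * ?wz"
      using t1 t2 C0 rn
      by (intro order_trans[OF C0(2)[OF \<tau>0]] mult_mono mult_nonneg_nonneg) (auto simp: kwt_nonneg)
    have low: "2 powr (- ?a) * ?wz \<le> kwt ((1 / r) *\<^sub>R v)" if v: "norm (z - v) < r" for v
    proof -
      have "norm v \<le> norm z + r" using v norm_triangle_sub[of v z] by (simp add: norm_minus_commute)
      then have "(1 / r) * norm v \<le> (1 / r) * (norm z + r)" using r by (intro mult_left_mono) auto
      then have "1 + norm ((1 / r) *\<^sub>R v) \<le> 2 * (1 + norm ((1 / r) *\<^sub>R z))"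
      proof -
        have "(1 / r) * (norm z + r) = (1 / r) * norm z + 1" using r by (simp add: field_simps)
        moreover have "0 \<le> (1 / r) * norm z" using r by simp
        moreover have "norm ((1 / r) *\<^sub>R v) = (1 / r) * norm v" "norm ((1 / r) *\<^sub>R z) = (1 / r) * norm z"
          using r by simp_all
        moreover have "1 + a \<le> 2 * (1 + b)" if "a \<le> c" "c = b + 1" "0 \<le> b" for a b c :: real
          using that by (simp add: distrib_left)
        ultimately show ?thesis
          using \<open>(1 / r) * norm v \<le> (1 / r) * (norm z + r)\<close> by metis
      qed
      then have "(2 * (1 + norm ((1 / r) *\<^sub>R z))) powr (- ?a) \<le> (1 + norm ((1 / r) *\<^sub>R v)) powr (- ?a)"
        using beta_pos by (intro powr_mono2' add_pos_nonneg) auto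
      moreover have "(2 * (1 + norm ((1 / r) *\<^sub>R z))) powr (- ?a) = 2 powr (- ?a) * ?wz"
        unfolding kwt_def wt_def by (rule powr_mult)
      ultimately show ?thesis by (simp add: kwt_def wt_def)
    qed
    have "ennreal (2 powr (- ?a) * ?wz * (\<omega> * r ^ DIM('a))) = ennreal (2 powr (- ?a) * ?wz) * emeasure lborel (ball z r)"
      using r \<omega> by (simp add: emeasure_ball \<omega>_def ennreal_mult' kwt_nonneg)
    also have "\<dots> = (\<integral>\<^sup>+v. ennreal (2 powr (- ?a) * ?wz) * indicator (ball z r) v \<partial>lborel)"
      by (simp add: nn_integral_cmult_indicator)
    also have "\<dots> \<le> (\<integral>\<^sup>+v. ennreal (kwt ((1 / r) *\<^sub>R v)) * (if norm (z - v) < r then 1 else 0) \<partial>lborel)"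
      using low by (intro nn_integral_mono) (auto simp: indicator_def dist_norm intro!: ennreal_leI)
    finally have I: "ennreal (2 powr (- ?a) * ?wz * (\<omega> * r ^ DIM('a))) \<le>
      (\<integral>\<^sup>+v. ennreal (kwt ((1 / r) *\<^sub>R v)) * (if norm (z - v) < r then 1 else 0) \<partial>lborel)" .
    have "(C0 + 1) * (2 powr (?n / (2 * \<beta>)) / r ^ DIM('a)) * ?wz =
       ?D / \<omega> / (r ^ DIM('a) * r ^ DIM('a)) * (2 powr (- ?a) * ?wz * (\<omega> * r ^ DIM('a)))"
    proof -
      have "c * (q / n) * w = c * q * p / l / (n * n) * (inverse p * w * (l * n))"
        if "n \<noteq> 0" "l \<noteq> 0" "p \<noteq> 0" for c q n w p l :: real
        using that by (simp add: field_simps)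
      moreover have "r ^ DIM('a) \<noteq> 0" "\<omega> \<noteq> 0" "2 powr ?a \<noteq> 0" using r \<omega> by simp_all
      ultimately show ?thesis unfolding powr_minus by blast
    qed
    then have "ennreal (kern \<tau> z) \<le> ennreal (?D / \<omega> / (r ^ DIM('a) * r ^ DIM('a)) * (2 powr (- ?a) * ?wz * (\<omega> * r ^ DIM('a))))"
      using k by (intro ennreal_leI) simp
    also have "\<dots> = ennreal (?D / \<omega> / (r ^ DIM('a) * r ^ DIM('a))) * ennreal (2 powr (- ?a) * ?wz * (\<omega> * r ^ DIM('a)))"
      using D \<omega> rn by (intro ennreal_mult') (auto intro!: divide_nonneg_nonneg less_imp_le)
    also have "\<dots> \<le> ennreal (?D / \<omega> / (r ^ DIM('a) * r ^ DIM('a))) *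
      (\<integral>\<^sup>+v. ennreal (kwt ((1 / r) *\<^sub>R v)) * (if norm (z - v) < r then 1 else 0) \<partial>lborel)"
      by (rule mult_left_mono[OF I]) simp
    finally show ?thesis .
  qed
  then show ?thesis using D \<omega> by (intro exI[of _ "?D / \<omega>"]) auto
qed

definition avg_const :: "'a::euclidean_space itself \<Rightarrow> real" where
  "avg_const _ = (SOME C. C > 0 \<and> (\<forall>r>0. \<forall>\<tau> z. r powr (2 * \<beta>) / 2 \<le> \<tau> \<longrightarrow> \<tau> \<le> r powr (2 * \<beta>) \<longrightarrow>
     ennreal (kern \<tau> (z::'a)) \<le>
     ennreal (C / (r ^ DIM('a) * r ^ DIM('a))) *
       (\<integral>\<^sup>+v. ennreal (kwt ((1 / r) *\<^sub>R v)) * (if norm (z - v) < r then 1 else 0) \<partial>lborel)))"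

lemma avg_const:
  "0 < avg_const TYPE('a::euclidean_space)"
  "0 < r \<Longrightarrow> r powr (2 * \<beta>) / 2 \<le> \<tau> \<Longrightarrow> \<tau> \<le> r powr (2 * \<beta>) \<Longrightarrow>
     ennreal (kern \<tau> (z::'a)) \<le>
     ennreal (avg_const TYPE('a) / (r ^ DIM('a) * r ^ DIM('a))) *
       (\<integral>\<^sup>+v. ennreal (kwt ((1 / r) *\<^sub>R v)) * (if norm (z - v) < r then 1 else 0) \<partial>lborel)"
  using someI_ex[OF kern_average[where 'a = 'a]] unfolding avg_const_def by blast+

end

context heat_data begin

text \<open>Jensen's inequality for the square, from \<open>2 * c * |u| \<le> c\<^sup>2 + |u|\<^sup>2\<close> where \<open>c\<close> is the mean of
  \<open>|u|\<close> with respect to the kernel.\<close>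
lemma u_jensen:
  assumes s: "0 < s" "s < t"
  shows "ennreal ((norm (u t x))\<^sup>2) \<le> (\<integral>\<^sup>+y. ennreal (kern (t - s) (x - y)) * ennreal ((norm (u s y))\<^sup>2) \<partial>lborel)"
proof (cases "(\<integral>\<^sup>+y. ennreal (kern (t - s) (x - y)) * ennreal ((norm (u s y))\<^sup>2) \<partial>lborel) = \<infinity>")
  case False
  note [measurable] = u_measurable[OF s(1)]
  let ?k = "\<lambda>y. kern (t - s) (x - y)"
  have k1: "integrable lborel ?k" "(\<integral>y. ?k y \<partial>lborel) = 1"
    using s lborel_integrable_reflect[OF kern_fourier(2)[of "t - s"], of x] lborel_integral_reflect[of "kern (t - s)" x]
      kern_integral_1[of "t - s", where 'a = 'a] by auto
  define c where "c = (\<integral>y. ?k y * norm (u s y) \<partial>lborel)"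
  have i1: "integrable lborel (\<lambda>y. ?k y * norm (u s y))"
    using integrable_norm[OF u_semigroup(2)[OF s, of x]] by (simp add: ckern_def norm_mult kern_nonneg)
  have "norm (u t x) \<le> (\<integral>y. norm (ckern (t - s) (x - y) * u s y) \<partial>lborel)"
    unfolding u_semigroup(1)[OF s, of x] by (rule integral_norm_bound)
  then have uc: "norm (u t x) \<le> c" by (simp add: c_def ckern_def norm_mult kern_nonneg)
  have c0: "0 \<le> c" by (rule order_trans[OF norm_ge_zero uc])
  have eq: "ennreal (?k y) * ennreal ((norm (u s y))\<^sup>2) = ennreal (?k y * (norm (u s y))\<^sup>2)" for y
    by (simp add: ennreal_mult' kern_nonneg)
  have i2: "integrable lborel (\<lambda>y. ?k y * (norm (u s y))\<^sup>2)"
    using False unfolding eq by (intro integrableI_nonneg) (auto simp: kern_nonneg less_top)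
  have "2 * c * c = (\<integral>y. 2 * c * (?k y * norm (u s y)) \<partial>lborel)"
    by (simp add: c_def)
  also have "\<dots> \<le> (\<integral>y. c\<^sup>2 * ?k y + ?k y * (norm (u s y))\<^sup>2 \<partial>lborel)"
  proof (rule integral_mono)
    fix y
    have "2 * c * norm (u s y) \<le> c\<^sup>2 + (norm (u s y))\<^sup>2"
      using zero_le_power2[of "c - norm (u s y)"] by (simp add: power2_eq_square algebra_simps)
    from mult_left_mono[OF this kern_nonneg[of "t - s" "x - y"]]
    show "2 * c * (?k y * norm (u s y)) \<le> c\<^sup>2 * ?k y + ?k y * (norm (u s y))\<^sup>2"
      by (simp add: algebra_simps)
  qed (use i1 i2 k1 in auto)
  also have "\<dots> = c\<^sup>2 + (\<integral>y. ?k y * (norm (u s y))\<^sup>2 \<partial>lborel)"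
    using i2 k1 by simp
  finally have "c\<^sup>2 \<le> (\<integral>y. ?k y * (norm (u s y))\<^sup>2 \<partial>lborel)" by (simp add: power2_eq_square)
  moreover have "(norm (u t x))\<^sup>2 \<le> c\<^sup>2" using uc by (intro power_mono) auto
  ultimately have "ennreal ((norm (u t x))\<^sup>2) \<le> ennreal (\<integral>y. ?k y * (norm (u s y))\<^sup>2 \<partial>lborel)"
    by (intro ennreal_leI) linarith
  also have "\<dots> = (\<integral>\<^sup>+y. ennreal (?k y) * ennreal ((norm (u s y))\<^sup>2) \<partial>lborel)"
    unfolding eq by (rule nn_integral_eq_integral[OF i2, symmetric]) (auto simp: kern_nonneg)
  finally show ?thesis .
qed simp

definition local_energy :: "real \<Rightarrow> real \<Rightarrow> 'a \<Rightarrow> ennreal" where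
  "local_energy e r x0 = ennreal (r powr - real DIM('a)) *
     (\<integral>\<^sup>+ s \<in> {0<..<r powr (2 * \<beta>)}. (\<integral>\<^sup>+ y \<in> ball x0 r.
        ennreal (s powr e * (norm (frac_heat \<beta> s f y))\<^sup>2) \<partial>lborel) \<partial>lborel)"

text \<open>Beyond a fixed time the semigroup law exhibits \<open>u\<close> as an integral of a jointly measurable
  function.\<close>
lemma u_joint_measurable:
  assumes "0 < s0"
  shows "\<exists>U. (\<lambda>(s, y). U s y) \<in> borel_measurable (borel \<Otimes>\<^sub>M borel) \<and> (\<forall>s y. s0 < s \<longrightarrow> U s y = u s y)"
proof (intro exI conjI allI impI)
  note [measurable] = u_measurable[OF assms]
  show "(\<lambda>(s, y). \<integral>z. complex_of_real (kern (s - s0) (y - z)) * u s0 z \<partial>lborel) \<in> borel_measurable (borel \<Otimes>\<^sub>M borel)"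
    unfolding kern_def by measurable
  show "(\<integral>z. complex_of_real (kern (s - s0) (y - z)) * u s0 z \<partial>lborel) = u s y" if "s0 < s" for s y
    using u_semigroup(1)[OF assms that, of y] by (simp add: ckern_def)
qed

text \<open>For \<open>t / 4 < s < t / 2\<close> the time \<open>t - s\<close> is comparable to \<open>t\<close>, so \<open>kern_average\<close> applies to the
  kernel in Jensen's inequality, and \<open>s powr (p - 1)\<close> is at least a multiple of \<open>t powr (p - 1)\<close>.
  Integrating over \<open>s\<close> and exchanging the integrals leaves, for every centre \<open>x - v\<close>, a local energy
  weighted by the integrable function \<open>kwt (v / r)\<close>.\<close>
lemma energy_estimate:
  assumes r: "0 < r" and p: "0 \<le> p"
  defines "t \<equiv> r powr (2 * \<beta>)"
  shows "ennreal ((1/2) * (1/4) powr p * t powr p * (norm (u t x))\<^sup>2) \<le>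
     ennreal (avg_const TYPE('a) * (\<integral>v. kwt v \<partial>(lborel :: 'a measure))) * (SUP x0. local_energy (p - 1) r x0)"
proof -
  have t: "0 < t" using r by (simp add: t_def)
  let ?n = "DIM('a)"
  let ?rn = "r ^ ?n"
  have rn: "0 < ?rn" using r by simp
  let ?CA = "avg_const TYPE('a)"
  have CA: "0 < ?CA" by (rule avg_const)
  \<comment> \<open>Any positive time below \<open>t / 4\<close> would serve as starting time for the measurable version.\<close>
  obtain U where U[measurable]: "(\<lambda>(s, y). U s y) \<in> borel_measurable (borel \<Otimes>\<^sub>M borel)"
    and Ueq: "\<And>s y. t / 8 < s \<Longrightarrow> U s y = u s y"
    using u_joint_measurable[of "t / 8"] t by auto
  have U2[measurable]: "(\<lambda>x. U (g x) (h x)) \<in> borel_measurable M"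
    if [measurable]: "g \<in> borel_measurable M" "h \<in> borel_measurable M" for g h and M :: "'b measure"
    using measurable_compose[OF measurable_Pair[OF that] U] by simp
  define G where "G s y = ennreal (s powr (p - 1) * (norm (U s y))\<^sup>2)" for s y
  have G[measurable]: "(\<lambda>x. G (g x) (h x)) \<in> borel_measurable M"
    if [measurable]: "g \<in> borel_measurable M" "h \<in> borel_measurable M" for g h and M :: "'b measure"
    unfolding G_def by measurable
  define W where "W v = ennreal (kwt ((1 / r) *\<^sub>R (v::'a)))" for v
  have W[measurable]: "W \<in> borel_measurable borel" unfolding W_def by measurable
  define D where "D v y = (if norm (x - y - v) < r then 1 else 0 :: ennreal)" for v y
  have D[measurable]: "(\<lambda>x. D (g x) (h x)) \<in> borel_measurable M"
    if [measurable]: "g \<in> borel_measurable M" "h \<in> borel_measurable M" for g h and M :: "'b measure"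
    unfolding D_def by measurable
  define K where "K = ennreal (?CA / (?rn * ?rn))"
  define S where "S = (SUP x0. local_energy (p - 1) r x0)"
  define A where "A = {t/4<..<t/2}"
  have A[measurable]: "A \<in> sets borel" by (simp add: A_def)
  define H where "H s v = (\<integral>\<^sup>+y. D v y * G s y \<partial>lborel)" for s v
  have Hm[measurable]: "(\<lambda>(s, v). H s v) \<in> borel_measurable (borel \<Otimes>\<^sub>M borel)"
    unfolding H_def by measurable
  have H2[measurable]: "(\<lambda>x. H (g x) (h x)) \<in> borel_measurable M"
    if [measurable]: "g \<in> borel_measurable M" "h \<in> borel_measurable M" for g h and M :: "'b measure"
    using measurable_compose[OF measurable_Pair[OF that] Hm] by simp
  have single: "ennreal ((t/4) powr p * (2 / t) * (norm (u t x))\<^sup>2) \<le> K * (\<integral>\<^sup>+v. W v * H s v \<partial>lborel)"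
    if s: "s \<in> A" for s
  proof -
    have s': "t / 4 < s" "s < t / 2" "0 < s" "s < t" using s t by (auto simp: A_def)
    have "(t/4) powr p * (2 / t) \<le> s powr p * (1 / s)"
      using s' t p by (intro mult_mono powr_mono2) (auto simp: field_simps)
    also have "\<dots> = s powr (p - 1)" using s' by (simp add: powr_diff)
    finally have "ennreal ((t/4) powr p * (2 / t) * (norm (u t x))\<^sup>2) \<le> ennreal (s powr (p - 1) * (norm (u t x))\<^sup>2)"
      by (intro ennreal_leI mult_right_mono) auto
    also have "\<dots> = ennreal (s powr (p - 1)) * ennreal ((norm (u t x))\<^sup>2)"
      by (simp add: ennreal_mult')
    also have "\<dots> \<le> ennreal (s powr (p - 1)) * (\<integral>\<^sup>+y. ennreal (kern (t - s) (x - y)) * ennreal ((norm (u s y))\<^sup>2) \<partial>lborel)"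
      by (rule mult_left_mono[OF u_jensen[OF s'(3,4)]]) simp
    also have "\<dots> = (\<integral>\<^sup>+y. ennreal (kern (t - s) (x - y)) * G s y \<partial>lborel)"
      using Ueq[of s] s' t u_measurable[OF s'(3)]
      by (subst nn_integral_cmult[symmetric]) (auto simp: G_def ennreal_mult' mult_ac)
    also have "\<dots> \<le> (\<integral>\<^sup>+y. (K * (\<integral>\<^sup>+v. W v * D v y \<partial>lborel)) * G s y \<partial>lborel)"
    proof (intro nn_integral_mono mult_right_mono)
      fix y
      show "ennreal (kern (t - s) (x - y)) \<le> K * (\<integral>\<^sup>+v. W v * D v y \<partial>lborel)"
        unfolding K_def W_def D_def using s' by (intro avg_const(2)[OF r]) (auto simp: t_def)
    qed simp
    also have "\<dots> = (\<integral>\<^sup>+y. K * (\<integral>\<^sup>+v. W v * (D v y * G s y) \<partial>lborel) \<partial>lborel)"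
    proof (rule nn_integral_cong)
      fix y
      have "(\<integral>\<^sup>+v. (W v * D v y) * G s y \<partial>lborel) = (\<integral>\<^sup>+v. W v * D v y \<partial>lborel) * G s y"
        by (rule nn_integral_multc) measurable
      then show "K * (\<integral>\<^sup>+v. W v * D v y \<partial>lborel) * G s y = K * (\<integral>\<^sup>+v. W v * (D v y * G s y) \<partial>lborel)"
        by (simp only: mult.assoc)
    qed
    also have "\<dots> = K * (\<integral>\<^sup>+y. (\<integral>\<^sup>+v. W v * (D v y * G s y) \<partial>lborel) \<partial>lborel)"
      by (rule nn_integral_cmult) measurable
    also have "(\<integral>\<^sup>+y. (\<integral>\<^sup>+v. W v * (D v y * G s y) \<partial>lborel) \<partial>lborel) = (\<integral>\<^sup>+v. (\<integral>\<^sup>+y. W v * (D v y * G s y) \<partial>lborel) \<partial>lborel)"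
      by (rule lborel_pair.Fubini') measurable
    also have "\<dots> = (\<integral>\<^sup>+v. W v * H s v \<partial>lborel)"
      unfolding H_def by (intro nn_integral_cong nn_integral_cmult) measurable
    finally show ?thesis .
  qed
  have energy: "(\<integral>\<^sup>+s. indicator A s * H s v \<partial>lborel) \<le> ennreal ?rn * S" for v
  proof -
    have "(\<integral>\<^sup>+s. indicator A s * H s v \<partial>lborel) \<le>
      (\<integral>\<^sup>+ s \<in> {0<..<r powr (2 * \<beta>)}. (\<integral>\<^sup>+ y \<in> ball (x - v) r.
        ennreal (s powr (p - 1) * (norm (frac_heat \<beta> s f y))\<^sup>2) \<partial>lborel) \<partial>lborel)"
    proof (rule nn_integral_mono)
      fix s :: real
      show "indicator A s * H s v \<le> (\<integral>\<^sup>+ y \<in> ball (x - v) r.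
        ennreal (s powr (p - 1) * (norm (frac_heat \<beta> s f y))\<^sup>2) \<partial>lborel) * indicator {0<..<r powr (2 * \<beta>)} s"
      proof (cases "s \<in> A")
        case True
        then have s': "t / 8 < s" "s \<in> {0<..<r powr (2 * \<beta>)}"
          using t by (auto simp: A_def t_def)
        have "H s v = (\<integral>\<^sup>+ y \<in> ball (x - v) r. ennreal (s powr (p - 1) * (norm (frac_heat \<beta> s f y))\<^sup>2) \<partial>lborel)"
          unfolding H_def
        proof (rule nn_integral_cong)
          fix y
          have "x - y - v = x - v - y" by simp
          then have "D v y = (if norm (x - v - y) < r then 1 else 0)" by (simp only: D_def)
          then show "D v y * G s y = ennreal (s powr (p - 1) * (norm (frac_heat \<beta> s f y))\<^sup>2) * indicator (ball (x - v) r) y"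
            using Ueq[OF s'(1), of y] by (simp add: G_def u_def dist_norm indicator_def)
        qed
        then show ?thesis using True s' by simp
      qed simp
    qed
    also have "\<dots> = ennreal ?rn * local_energy (p - 1) r (x - v)"
    proof -
      have "ennreal ?rn * ennreal (r powr - real ?n) = 1"
        using r by (simp add: ennreal_mult'[symmetric] powr_minus powr_realpow)
      then show ?thesis by (simp add: local_energy_def mult.assoc[symmetric])
    qed
    also have "\<dots> \<le> ennreal ?rn * S"
      unfolding S_def by (intro mult_left_mono SUP_upper) auto
    finally show ?thesis .
  qed
  have "ennreal ((1/2) * (1/4) powr p * t powr p * (norm (u t x))\<^sup>2) =
     ennreal ((t/4) powr p * (2 / t) * (norm (u t x))\<^sup>2) * emeasure lborel A"
  proof -
    have "emeasure lborel A = ennreal (t / 4)" using t by (simp add: A_def)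
    moreover have "(1/2) * (1/4) powr p * t powr p * (norm (u t x))\<^sup>2 = ((t/4) powr p * (2 / t) * (norm (u t x))\<^sup>2) * (t / 4)"
      using t by (simp add: powr_divide field_simps)
    moreover have "0 \<le> t / 4" using t by simp
    ultimately show ?thesis by (simp only: ennreal_mult'')
  qed
  also have "\<dots> = (\<integral>\<^sup>+s. ennreal ((t/4) powr p * (2 / t) * (norm (u t x))\<^sup>2) * indicator A s \<partial>lborel)"
    by (simp add: nn_integral_cmult_indicator)
  also have "\<dots> \<le> (\<integral>\<^sup>+s. K * (\<integral>\<^sup>+v. W v * (indicator A s * H s v) \<partial>lborel) \<partial>lborel)"
  proof (rule nn_integral_mono)
    fix s :: real
    show "ennreal ((t/4) powr p * (2 / t) * (norm (u t x))\<^sup>2) * indicator A s \<le> K * (\<integral>\<^sup>+v. W v * (indicator A s * H s v) \<partial>lborel)"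
      using single[of s] by (cases "s \<in> A") auto
  qed
  also have "\<dots> = K * (\<integral>\<^sup>+s. (\<integral>\<^sup>+v. W v * (indicator A s * H s v) \<partial>lborel) \<partial>lborel)"
    by (rule nn_integral_cmult) measurable
  also have "(\<integral>\<^sup>+s. (\<integral>\<^sup>+v. W v * (indicator A s * H s v) \<partial>lborel) \<partial>lborel) = (\<integral>\<^sup>+v. (\<integral>\<^sup>+s. W v * (indicator A s * H s v) \<partial>lborel) \<partial>lborel)"
    by (rule lborel_pair.Fubini') measurable
  also have "\<dots> = (\<integral>\<^sup>+v. W v * (\<integral>\<^sup>+s. indicator A s * H s v \<partial>lborel) \<partial>lborel)"
    by (intro nn_integral_cong nn_integral_cmult) measurable
  also have "K * \<dots> \<le> K * (\<integral>\<^sup>+v. W v * (ennreal ?rn * S) \<partial>lborel)"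
    by (intro mult_left_mono nn_integral_mono energy) auto
  also have "\<dots> = K * (ennreal (?rn * (\<integral>v. kwt v \<partial>(lborel :: 'a measure))) * (ennreal ?rn * S))"
    unfolding kwt_scaled_integral[OF r, symmetric] W_def by (subst nn_integral_multc) auto
  also have "\<dots> = (K * ennreal (?rn * (\<integral>v. kwt v \<partial>(lborel :: 'a measure))) * ennreal ?rn) * S"
    by (simp only: mult.assoc)
  also have "K * ennreal (?rn * (\<integral>v. kwt v \<partial>(lborel :: 'a measure))) * ennreal ?rn = ennreal (?CA * (\<integral>v. kwt v \<partial>(lborel :: 'a measure)))"
  proof -
    have i0: "0 \<le> (\<integral>v. kwt v \<partial>(lborel :: 'a measure))" by (intro Bochner_Integration.integral_nonneg kwt_nonneg)
    have "K * ennreal (?rn * (\<integral>v. kwt v \<partial>(lborel :: 'a measure))) * ennreal ?rn =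
      ennreal (?CA / (?rn * ?rn) * (?rn * (\<integral>v. kwt v \<partial>(lborel :: 'a measure))) * ?rn)"
    proof -
      have "ennreal a * ennreal b * ennreal c = ennreal (a * b * c)" if "0 \<le> a" "0 \<le> b" "0 \<le> c" for a b c
        using that by (simp add: ennreal_mult)
      moreover have "0 \<le> ?CA / (?rn * ?rn)" using CA rn by simp
      moreover have "0 \<le> ?rn * (\<integral>v. kwt v \<partial>(lborel :: 'a measure))" using i0 rn by simp
      ultimately show ?thesis using rn unfolding K_def by simp
    qed
    also have "?CA / (?rn * ?rn) * (?rn * (\<integral>v. kwt v \<partial>(lborel :: 'a measure))) * ?rn = ?CA * (\<integral>v. kwt v \<partial>(lborel :: 'a measure))"
      using r by simp
    finally show ?thesis .
  qed
  finally show ?thesis unfolding S_def .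
qed

end

lemma ennsqrt_mono: "a \<le> b \<Longrightarrow> ennsqrt a \<le> ennsqrt b"
  by (auto simp: ennsqrt_def top_unique less_top intro!: ennreal_leI enn2real_mono)

lemma ennsqrt_le_ennreal:
  assumes "ennsqrt a \<le> ennreal c" "0 \<le> c"
  shows "a \<le> ennreal (c\<^sup>2)"
proof (cases a)
  case (real b)
  then have "sqrt b \<le> c" using assms by (simp add: ennsqrt_def)
  then have "b \<le> c\<^sup>2" using real(1) by (simp add: sqrt_le_D)
  then show ?thesis using real by (simp add: ennreal_leI)
qed (use assms in \<open>simp add: ennsqrt_def top_unique\<close>)

context fractional begin

text \<open>The square root of \<open>energy_estimate\<close> with \<open>p = \<zeta> / \<beta>\<close>, for which \<open>t powr p = (r powr \<zeta>)\<^sup>2\<close>.\<close>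
theorem heat_pointwise_bound:
  assumes zeta: "0 \<le> \<zeta>"
  shows "\<exists>C>0. \<forall>(f :: 'a::euclidean_space functional) cut r x. heat_data \<beta> f cut \<longrightarrow> 0 < r \<longrightarrow>
     ennreal (r powr \<zeta> * norm (frac_heat \<beta> (r powr (2 * \<beta>)) f x)) \<le>
     ennreal C * (SUP x0. ennsqrt (heat_data.local_energy \<beta> f ((\<zeta> - \<beta>) / \<beta>) r x0))"
proof -
  define p where "p = \<zeta> / \<beta>"
  have p: "0 \<le> p" "(\<zeta> - \<beta>) / \<beta> = p - 1" using zeta beta_pos by (auto simp: p_def field_simps)
  let ?c = "(1/2) * (1/4) powr p :: real"
  have c: "0 < ?c" by simp
  let ?I = "\<integral>v. kwt v \<partial>(lborel :: 'a measure)"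
  define C1 where "C1 = avg_const TYPE('a) * ?I / ?c"
  have C1: "0 \<le> C1"
    unfolding C1_def using avg_const(1)[where 'a = 'a] c
    by (intro divide_nonneg_pos mult_nonneg_nonneg Bochner_Integration.integral_nonneg kwt_nonneg) auto
  have "ennreal (r powr \<zeta> * norm (frac_heat \<beta> (r powr (2 * \<beta>)) f x)) \<le>
     ennreal (sqrt C1 + 1) * (SUP x0. ennsqrt (heat_data.local_energy \<beta> f ((\<zeta> - \<beta>) / \<beta>) r x0))"
    if hd: "heat_data \<beta> f cut" and r: "0 < r" for f :: "'a functional" and cut r x
  proof -
    interpret heat_data \<beta> f cut by fact
    let ?t = "r powr (2 * \<beta>)"
    let ?N = "norm (frac_heat \<beta> ?t f x)"
    have tp: "?t powr p = (r powr \<zeta>)\<^sup>2"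
      using r beta_pos by (simp add: powr_powr p_def power2_eq_square flip: powr_add)
    have est: "ennreal (?c * (r powr \<zeta> * ?N)\<^sup>2) \<le> ennreal (avg_const TYPE('a) * ?I) * (SUP x0. local_energy (p - 1) r x0)"
    proof -
      have "(1/2) * (1/4) powr p * ?t powr p * ?N\<^sup>2 = ?c * (r powr \<zeta> * ?N)\<^sup>2"
        by (simp only: tp power_mult_distrib mult.assoc)
      then show ?thesis using energy_estimate[OF r p(1), of x] by (simp only: u_def)
    qed
    let ?S = "SUP x0. ennsqrt (local_energy ((\<zeta> - \<beta>) / \<beta>) r x0)"
    show ?thesis
    proof (cases ?S)
      case (real \<sigma>)
      have le: "local_energy (p - 1) r x0 \<le> ennreal (\<sigma>\<^sup>2)" for x0
      proof (rule ennsqrt_le_ennreal[OF _ real(1)])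
        have "ennsqrt (local_energy (p - 1) r x0) \<le> ?S" unfolding p(2) by (rule SUP_upper) simp
        then show "ennsqrt (local_energy (p - 1) r x0) \<le> ennreal \<sigma>" using real(2) by simp
      qed
      have "ennreal (?c * (r powr \<zeta> * ?N)\<^sup>2) \<le> ennreal (avg_const TYPE('a) * ?I) * ennreal (\<sigma>\<^sup>2)"
        by (rule order_trans[OF est]) (intro mult_left_mono SUP_least le, simp)
      also have "\<dots> = ennreal (avg_const TYPE('a) * ?I * \<sigma>\<^sup>2)"
        by (simp add: ennreal_mult'')
      finally have "?c * (r powr \<zeta> * ?N)\<^sup>2 \<le> avg_const TYPE('a) * ?I * \<sigma>\<^sup>2"
        using avg_const(1)[where 'a = 'a]
        by (subst (asm) ennreal_le_iff) (auto intro!: mult_nonneg_nonneg Bochner_Integration.integral_nonneg kwt_nonneg)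
      then have "(r powr \<zeta> * ?N)\<^sup>2 \<le> C1 * \<sigma>\<^sup>2"
        using c by (simp add: C1_def field_simps)
      also have "\<dots> = (sqrt C1 * \<sigma>)\<^sup>2" using C1 by (simp add: power_mult_distrib)
      finally have "r powr \<zeta> * ?N \<le> sqrt C1 * \<sigma>"
        by (rule power2_le_imp_le) (use C1 real(1) in simp)
      also have "\<dots> \<le> (sqrt C1 + 1) * \<sigma>" using real(1) by (intro mult_right_mono) auto
      finally have "ennreal (r powr \<zeta> * ?N) \<le> ennreal ((sqrt C1 + 1) * \<sigma>)" by (rule ennreal_leI)
      also have "\<dots> = ennreal (sqrt C1 + 1) * ennreal \<sigma>" using real(1) by (simp add: ennreal_mult'')
      finally show ?thesis using real(2) by simp
    next
      case top
      have "0 < sqrt C1 + 1" using C1 by (simp add: add_nonneg_pos)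
      then have "ennreal (sqrt C1 + 1) \<noteq> 0" by simp
      then show ?thesis unfolding top by (simp add: ennreal_mult_top)
    qed
  qed
  note main = this
  show ?thesis
  proof (intro exI[of _ "sqrt C1 + 1"] conjI allI impI)
    show "0 < sqrt C1 + 1" using C1 by (simp add: add_nonneg_pos)
  qed (rule main)
qed

end

section \<open>Fourier transforms of test functions\<close>

lemma test_fun_support:
  assumes "test_fun F"
  obtains R where "0 \<le> R" "\<And>x. R < norm x \<Longrightarrow> F x = 0"
proof -
  obtain R where R: "\<And>x. F x \<noteq> 0 \<Longrightarrow> norm x \<le> R"
    using assms by (auto simp: test_fun_def bounded_iff)
  show ?thesis
  proof (rule that[of "max R 0"])
    show "F x = 0" if "max R 0 < norm x" for x
      using R[of x] that by (cases "F x = 0") auto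
  qed simp
qed

lemma bounded_support_integrable:
  fixes F :: "'a::euclidean_space \<Rightarrow> complex"
  assumes [measurable]: "F \<in> borel_measurable borel" and B: "\<And>x. norm (F x) \<le> B" and R: "\<And>x. R < norm x \<Longrightarrow> F x = 0"
  shows "integrable lborel F"
proof (rule Bochner_Integration.integrable_bound)
  show "integrable lborel (\<lambda>y::'a. B * indicator (cball 0 R) y :: real)"
    by (intro integrable_mult_right integrable_real_indicator emeasure_lborel_cball_finite) simp
  show "AE y in lborel. norm (F y) \<le> norm (B * indicator (cball 0 R) y :: real)"
    using B R by (auto intro!: AE_I2 intro: order_trans[OF _ abs_ge_self] simp: indicator_def not_le)
qed measurable

lemma test_fun_measurable: "test_fun F \<Longrightarrow> F \<in> borel_measurable borel"
  by (simp add: test_fun_def smooth_measurable)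

lemma test_fun_bounded:
  assumes "test_fun F" obtains B where "0 \<le> B" "\<And>x. norm (F x) \<le> B"
proof -
  obtain B where "dbound 0 B (\<lambda>_. 1) F" using test_fun_dbound[OF assms] by blast
  then have B: "norm (F x) \<le> B" for x by simp
  show ?thesis by (rule that[OF order_trans[OF norm_ge_zero B] B])
qed

lemma test_fun_integrable:
  assumes "test_fun F"
  shows "integrable lborel F"
proof -
  obtain R where R: "\<And>x. R < norm x \<Longrightarrow> F x = 0" using test_fun_support[OF assms] by blast
  obtain B where B: "\<And>x. norm (F x) \<le> B" using test_fun_bounded[OF assms] by blast
  show ?thesis by (rule bounded_support_integrable[OF test_fun_measurable[OF assms] B R])
qed

lemma integral_pd_eq_0:
  fixes G :: "'a::euclidean_space \<Rightarrow> complex"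
  assumes G: "test_fun G" and b: "b \<in> Basis"
  shows "(\<integral>y. pd b G y \<partial>lborel) = 0"
proof -
  obtain A where A: "dbound 2 A (\<lambda>_. 1) G" using test_fun_dbound[OF G] by blast
  have A0: "0 \<le> A" using order_trans[OF norm_ge_zero dbound_bound[OF A]] by simp
  obtain R where R: "0 \<le> R" "\<And>x. R < norm x \<Longrightarrow> G x = 0" using test_fun_support[OF G] by blast
  obtain R' where R': "0 \<le> R'" "\<And>x. R' < norm x \<Longrightarrow> pd b G x = 0"
    using test_fun_support[OF test_fun_pd[OF G b]] by blast
  let ?Q = "max R R' + 1"
  let ?V = "measure lborel (cball (0::'a) ?Q)"
  let ?K = "(real DIM('a))\<^sup>2 * A * ?V"
  have Gs: "smooth G" using G by (simp add: test_fun_def)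
  have iG: "integrable lborel G" and ip: "integrable lborel (pd b G)"
    using G test_fun_pd[OF G b] by (auto intro: test_fun_integrable)
  have bound: "norm (\<integral>y. pd b G y \<partial>lborel) \<le> ?K * h" if h: "0 < h" "h \<le> 1" for h
  proof -
    have ih: "integrable lborel (\<lambda>y. G (y + h *\<^sub>R b))"
      using lborel_integrable_affine[of 1 G "h *\<^sub>R b"] iG by (simp add: add.commute)
    have eqh: "(\<integral>y. G (y + h *\<^sub>R b) \<partial>lborel) = integral\<^sup>L lborel G"
      using lborel_integral_affine[of 1 G "h *\<^sub>R b"] test_fun_measurable[OF G] by (simp add: add.commute)
    have taylor: "norm (G (y + h *\<^sub>R b) - G y - of_real h * pd b G y) \<le> (real DIM('a))\<^sup>2 * A * h\<^sup>2" for y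
    proof -
      have "(\<Sum>c\<in>Basis. of_real ((h *\<^sub>R b) \<bullet> c) * pd c G y) = (\<Sum>c\<in>Basis. if c = b then of_real h * pd c G y else 0)"
        using b by (intro sum.cong) (auto simp: inner_Basis)
      also have "\<dots> = of_real h * pd b G y" using b by simp
      finally show ?thesis
        using smooth_taylor2[OF Gs A, of y "h *\<^sub>R b"] b by simp
    qed
    have pw: "norm (G (y + h *\<^sub>R b) - G y - of_real h * pd b G y) \<le> ((real DIM('a))\<^sup>2 * A * h\<^sup>2) * indicator (cball (0::'a) ?Q) y" for y
    proof (cases "norm y \<le> ?Q")
      case False
      have "norm y \<le> norm (y + h *\<^sub>R b) + norm (h *\<^sub>R b)" using norm_triangle_ineq4[of "y + h *\<^sub>R b" "h *\<^sub>R b"] by simp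
      then have "norm y \<le> norm (y + h *\<^sub>R b) + 1" using h b by simp
      then have "R < norm (y + h *\<^sub>R b)" "R < norm y" "R' < norm y" using False by auto
      then show ?thesis using R R' A0 by (auto intro!: mult_nonneg_nonneg simp: indicator_def)
    qed (use taylor in simp)
    have "of_real h * (\<integral>y. pd b G y \<partial>lborel) = - (\<integral>y. G (y + h *\<^sub>R b) - G y - of_real h * pd b G y \<partial>lborel)"
      using iG ip ih eqh by simp
    then have "norm (of_real h * (\<integral>y. pd b G y \<partial>lborel)) = norm (\<integral>y. G (y + h *\<^sub>R b) - G y - of_real h * pd b G y \<partial>lborel)"
      by simp
    also have "\<dots> \<le> (\<integral>y. ((real DIM('a))\<^sup>2 * A * h\<^sup>2) * indicator (cball (0::'a) ?Q) y \<partial>lborel)"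
    proof (rule Bochner_Integration.integral_norm_bound_integral)
      show "integrable lborel (\<lambda>y::'a. ((real DIM('a))\<^sup>2 * A * h\<^sup>2) * indicator (cball (0::'a) ?Q) y :: real)"
        by (intro integrable_mult_right integrable_real_indicator emeasure_lborel_cball_finite) simp
    qed (use iG ip ih pw in auto)
    also have "\<dots> = ((real DIM('a))\<^sup>2 * A * h\<^sup>2) * ?V" by simp
    finally have "h * norm (\<integral>y. pd b G y \<partial>lborel) \<le> h * (?K * h)"
      using h by (simp add: norm_mult power2_eq_square mult_ac)
    then show ?thesis using h by simp
  qed
  have "norm (\<integral>y. pd b G y \<partial>lborel) \<le> 0"
  proof (rule tendsto_lowerbound)
    show "((\<lambda>h. ?K * h) \<longlongrightarrow> 0) (at_right 0)" by (auto intro!: tendsto_eq_intros)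
    show "\<forall>\<^sub>F h in at_right 0. norm (\<integral>y. pd b G y \<partial>lborel) \<le> ?K * h"
      using bound by (auto simp: eventually_at_right_field intro!: exI[of _ 1])
  qed simp
  then show ?thesis by simp
qed

lemma cis_inner_has_derivative:
  "((\<lambda>x. cis (- (x \<bullet> \<xi>))) has_derivative (\<lambda>h. - \<i> * of_real (h \<bullet> \<xi>) * cis (- (x \<bullet> \<xi>)))) (at x)"
proof -
  have 1: "((\<lambda>x. - \<i> * complex_of_real (x \<bullet> \<xi>)) has_derivative (\<lambda>h. - \<i> * complex_of_real (h \<bullet> \<xi>))) (at x)"
    by (intro has_derivative_mult_right inner_has_derivative_complex)
  have 2: "(exp has_derivative (\<lambda>h. exp (- \<i> * complex_of_real (x \<bullet> \<xi>)) * h)) (at (- \<i> * complex_of_real (x \<bullet> \<xi>)))"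
    using DERIV_exp by (simp only: has_field_derivative_def)
  have "((\<lambda>x. exp (- \<i> * complex_of_real (x \<bullet> \<xi>))) has_derivative
     (\<lambda>h. exp (- \<i> * complex_of_real (x \<bullet> \<xi>)) * (- \<i> * complex_of_real (h \<bullet> \<xi>)))) (at x)"
    by (rule has_derivative_compose[OF 1 2])
  then show ?thesis by (simp add: cis_conv_exp mult_ac)
qed

lemma smooth_cis: "smooth (\<lambda>x. cis (- (x \<bullet> \<xi>)))"
proof -
  have "cm_on m UNIV (\<lambda>x. exp ((- \<i>) * complex_of_real (x \<bullet> \<xi>)))" for m
    by (intro cm_on_exp cm_on_mult cm_on_const cm_on_inner) auto
  then show ?thesis by (simp add: smooth_iff_cm_on cis_conv_exp)
qed

lemma fourier_pd:
  assumes F: "test_fun F" and b: "b \<in> Basis"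
  shows "fourier (pd b F) \<xi> = \<i> * of_real (\<xi> \<bullet> b) * fourier F \<xi>"
proof -
  let ?e = "\<lambda>x. cis (- (x \<bullet> \<xi>))"
  have t: "test_fun (\<lambda>x. ?e x * F x)" by (rule test_fun_mult[OF smooth_cis F])
  have Fs: "smooth F" using F by (simp add: test_fun_def)
  have "pd b (\<lambda>x. ?e x * F x) x = - \<i> * of_real (\<xi> \<bullet> b) * (?e x * F x) + ?e x * pd b F x" for x
    using pd_mult[OF smooth_differentiable[OF smooth_cis] smooth_differentiable[OF Fs], of b \<xi> x]
      pd_eq[OF cis_inner_has_derivative, of b \<xi> x] by (simp add: inner_commute mult_ac)
  then have "0 = (\<integral>x. - \<i> * of_real (\<xi> \<bullet> b) * (?e x * F x) + ?e x * pd b F x \<partial>lborel)"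
    using integral_pd_eq_0[OF t b] by simp
  also have "\<dots> = - \<i> * of_real (\<xi> \<bullet> b) * fourier F \<xi> + fourier (pd b F) \<xi>"
    unfolding fourier_def
    using test_fun_integrable[OF t] test_fun_integrable[OF test_fun_mult[OF smooth_cis test_fun_pd[OF F b]]]
    by (subst Bochner_Integration.integral_add) auto
  finally show ?thesis by (simp add: algebra_simps)
qed

lemma fourier_bound: "norm (fourier F \<xi>) \<le> (\<integral>x. norm (F x) \<partial>lborel)"
  unfolding fourier_def by (rule order_trans[OF integral_norm_bound]) (simp add: norm_mult)

lemma fourier_decay_l1:
  assumes "test_fun (F :: 'a::euclidean_space \<Rightarrow> complex)"
  shows "\<exists>A. \<forall>\<xi>. (1 + (\<Sum>b\<in>Basis. \<bar>\<xi> \<bullet> b\<bar>)) ^ N * norm (fourier F \<xi>) \<le> A"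
  using assms
proof (induction N arbitrary: F)
  case 0
  then show ?case using fourier_bound by auto
next
  case (Suc N)
  obtain A where A: "\<And>\<xi>. (1 + (\<Sum>b\<in>Basis. \<bar>\<xi> \<bullet> b\<bar>)) ^ N * norm (fourier F \<xi>) \<le> A"
    using Suc.IH[OF Suc.prems] by blast
  have "\<forall>b\<in>Basis. \<exists>B. \<forall>\<xi>. (1 + (\<Sum>b\<in>Basis. \<bar>\<xi> \<bullet> b\<bar>)) ^ N * norm (fourier (pd b F) \<xi>) \<le> B"
    using Suc.IH test_fun_pd[OF Suc.prems] by blast
  then obtain B where B: "\<And>b \<xi>. b \<in> Basis \<Longrightarrow> (1 + (\<Sum>b\<in>Basis. \<bar>\<xi> \<bullet> b\<bar>)) ^ N * norm (fourier (pd b F) \<xi>) \<le> B b"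
    by metis
  have "(1 + (\<Sum>b\<in>Basis. \<bar>\<xi> \<bullet> b\<bar>)) ^ Suc N * norm (fourier F \<xi>) \<le> A + (\<Sum>b\<in>Basis. B b)" for \<xi>
  proof -
    let ?q = "(1 + (\<Sum>b\<in>Basis. \<bar>\<xi> \<bullet> b\<bar>)) ^ N"
    have "(1 + (\<Sum>b\<in>Basis. \<bar>\<xi> \<bullet> b\<bar>)) ^ Suc N * norm (fourier F \<xi>) =
      ?q * norm (fourier F \<xi>) + (\<Sum>b\<in>Basis. ?q * (\<bar>\<xi> \<bullet> b\<bar> * norm (fourier F \<xi>)))"
      by (simp add: sum_distrib_left sum_distrib_right algebra_simps)
    also have "\<dots> = ?q * norm (fourier F \<xi>) + (\<Sum>b\<in>Basis. ?q * norm (fourier (pd b F) \<xi>))"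
      by (intro arg_cong2[of _ _ _ _ "(+)"] sum.cong refl) (simp add: fourier_pd[OF Suc.prems] norm_mult)
    also have "\<dots> \<le> A + (\<Sum>b\<in>Basis. B b)"
      by (intro add_mono A sum_mono B)
    finally show ?thesis .
  qed
  then show ?case by blast
qed

lemma fourier_decay:
  assumes "test_fun (F :: 'a::euclidean_space \<Rightarrow> complex)"
  shows "\<exists>A. \<forall>\<xi>. norm (fourier F \<xi>) \<le> A * wt (real N) \<xi>"
proof -
  obtain A where A: "\<And>\<xi>. (1 + (\<Sum>b\<in>Basis. \<bar>\<xi> \<bullet> b\<bar>)) ^ N * norm (fourier F \<xi>) \<le> A"
    using fourier_decay_l1[OF assms] by blast
  have "(1 + norm \<xi>) ^ N * norm (fourier F \<xi>) \<le> A" for \<xi>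
  proof (rule order_trans[OF mult_right_mono A])
    show "(1 + norm \<xi>) ^ N \<le> (1 + (\<Sum>b\<in>Basis. \<bar>\<xi> \<bullet> b\<bar>)) ^ N"
      using norm_le_l1[of \<xi>] by (intro power_mono) auto
  qed simp
  then show ?thesis unfolding wt_power_le by blast
qed

lemma fourier_has_derivative:
  assumes F: "test_fun F"
  shows "(fourier F has_derivative (\<lambda>h. \<Sum>b\<in>Basis. of_real (h \<bullet> b) * fourier (\<lambda>x. (- \<i>) * (of_real (x \<bullet> b) * F x)) \<xi>)) (at \<xi>)"
proof -
  let ?F = "\<lambda>b x. (- \<i>) * (of_real (x \<bullet> b) * F x)"
  have lin: "bounded_linear (\<lambda>h. \<Sum>b\<in>Basis. of_real (h \<bullet> b) * fourier (?F b) \<xi>)"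
    by (intro bounded_linear_sum bounded_linear_mult_const has_derivative_bounded_linear[OF inner_has_derivative_complex])
  have tF: "test_fun (?F b)" for b
    by (intro test_fun_mult smooth_const smooth_inner F)
  have te: "integrable lborel (\<lambda>x. cis (- (x \<bullet> \<xi>)) * G x)" if "test_fun G" for G \<xi>
    by (intro test_fun_integrable test_fun_mult smooth_cis that)
  obtain R where R: "0 \<le> R" "\<And>x. R < norm x \<Longrightarrow> F x = 0" using test_fun_support[OF F] by blast
  let ?C = "R\<^sup>2 * (\<integral>x. norm (F x) \<partial>lborel)"
  have rem: "norm (fourier F \<eta> - fourier F \<xi> - (\<Sum>b\<in>Basis. of_real ((\<eta> - \<xi>) \<bullet> b) * fourier (?F b) \<xi>)) \<le> ?C * (norm (\<eta> - \<xi>))\<^sup>2" for \<eta>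
  proof -
    let ?a = "\<lambda>x. - (x \<bullet> (\<eta> - \<xi>))"
    let ?r = "\<lambda>x. cis (?a x) - 1 - \<i> * of_real (?a x)"
    have sum: "(\<Sum>b\<in>Basis. of_real ((\<eta> - \<xi>) \<bullet> b) * ?F b x) = \<i> * of_real (?a x) * F x" for x
    proof -
      have "x \<bullet> (\<eta> - \<xi>) = (\<Sum>b\<in>Basis. (x \<bullet> b) * ((\<eta> - \<xi>) \<bullet> b))" by (rule euclidean_inner)
      then have "complex_of_real (x \<bullet> (\<eta> - \<xi>)) = (\<Sum>b\<in>Basis. of_real (x \<bullet> b) * of_real ((\<eta> - \<xi>) \<bullet> b))" by simp
      then have "\<i> * of_real (?a x) * F x = (\<Sum>b\<in>Basis. of_real (x \<bullet> b) * of_real ((\<eta> - \<xi>) \<bullet> b)) * (- \<i> * F x)"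
        by simp
      also have "\<dots> = (\<Sum>b\<in>Basis. of_real ((\<eta> - \<xi>) \<bullet> b) * ?F b x)"
        unfolding sum_distrib_right by (intro sum.cong refl) simp
      finally show ?thesis by simp
    qed
    have "fourier F \<eta> - fourier F \<xi> - (\<Sum>b\<in>Basis. of_real ((\<eta> - \<xi>) \<bullet> b) * fourier (?F b) \<xi>) =
      (\<integral>x. cis (- (x \<bullet> \<eta>)) * F x - cis (- (x \<bullet> \<xi>)) * F x - (\<Sum>b\<in>Basis. of_real ((\<eta> - \<xi>) \<bullet> b) * (cis (- (x \<bullet> \<xi>)) * ?F b x)) \<partial>lborel)"
      unfolding fourier_def using te[OF F] te[OF tF]
      by (simp only: Bochner_Integration.integral_diff Bochner_Integration.integral_sum Bochner_Integration.integrable_diff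
          Bochner_Integration.integrable_sum integrable_mult_right integral_mult_right_zero)
    also have "\<dots> = (\<integral>x. cis (- (x \<bullet> \<xi>)) * F x * ?r x \<partial>lborel)"
    proof (rule Bochner_Integration.integral_cong[OF refl])
      fix x
      have "cis (- (x \<bullet> \<eta>)) = cis (- (x \<bullet> \<xi>)) * cis (?a x)" by (simp add: cis_mult inner_diff_right)
      moreover have "(\<Sum>b\<in>Basis. of_real ((\<eta> - \<xi>) \<bullet> b) * (cis (- (x \<bullet> \<xi>)) * ?F b x)) = cis (- (x \<bullet> \<xi>)) * (\<i> * of_real (?a x) * F x)"
        unfolding sum[symmetric] sum_distrib_left by (intro sum.cong refl) (simp only: mult_ac)
      ultimately show "cis (- (x \<bullet> \<eta>)) * F x - cis (- (x \<bullet> \<xi>)) * F x - (\<Sum>b\<in>Basis. of_real ((\<eta> - \<xi>) \<bullet> b) * (cis (- (x \<bullet> \<xi>)) * ?F b x)) =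
        cis (- (x \<bullet> \<xi>)) * F x * ?r x"
        by (simp add: algebra_simps)
    qed
    also have "norm \<dots> \<le> (\<integral>x. (R\<^sup>2 * (norm (\<eta> - \<xi>))\<^sup>2) * norm (F x) \<partial>lborel)"
    proof (rule Bochner_Integration.integral_norm_bound_integral)
      have Fm[measurable]: "F \<in> borel_measurable borel" by (rule test_fun_measurable[OF F])
      show le: "norm (cis (- (x \<bullet> \<xi>)) * F x * ?r x) \<le> (R\<^sup>2 * (norm (\<eta> - \<xi>))\<^sup>2) * norm (F x)" for x
      proof (cases "norm x \<le> R")
        case True
        have "norm (?r x) \<le> (?a x)\<^sup>2"
        proof -
          have "norm (iexp (?a x) - (\<Sum>k\<le>1. (\<i> * of_real (?a x)) ^ k / fact k)) \<le> \<bar>?a x\<bar> ^ Suc 1 / fact (Suc 1)"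
            by (rule iexp_approx1)
          then have "norm (?r x) \<le> (?a x)\<^sup>2 / 2"
            by (simp add: cis_conv_exp power2_eq_square abs_mult_self_eq algebra_simps)
          then show ?thesis using zero_le_power2[of "?a x"] by linarith
        qed
        also have "\<dots> \<le> (R * norm (\<eta> - \<xi>))\<^sup>2"
        proof -
          have "\<bar>?a x\<bar> \<le> norm x * norm (\<eta> - \<xi>)" using Cauchy_Schwarz_ineq2[of x "\<eta> - \<xi>"] by simp
          also have "\<dots> \<le> R * norm (\<eta> - \<xi>)" using True by (rule mult_right_mono) simp
          finally have "\<bar>?a x\<bar>\<^sup>2 \<le> (R * norm (\<eta> - \<xi>))\<^sup>2" by (intro power_mono) auto
          then show ?thesis by simp
        qed
        finally have "norm (F x) * norm (?r x) \<le> norm (F x) * (R * norm (\<eta> - \<xi>))\<^sup>2" by (rule mult_left_mono) simp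
        then show ?thesis by (simp add: norm_mult power_mult_distrib mult_ac)
      qed (simp add: R)
      show i: "integrable lborel (\<lambda>x. (R\<^sup>2 * (norm (\<eta> - \<xi>))\<^sup>2) * norm (F x))"
        by (intro integrable_mult_right integrable_norm test_fun_integrable F)
      show "integrable lborel (\<lambda>x. cis (- (x \<bullet> \<xi>)) * F x * ?r x)"
        by (rule Bochner_Integration.integrable_bound[OF i])
           (measurable, use le in \<open>auto intro!: AE_I2 intro: order_trans[OF _ abs_ge_self]\<close>)
    qed
    also have "\<dots> = ?C * (norm (\<eta> - \<xi>))\<^sup>2" by simp
    finally show ?thesis .
  qed
  show ?thesis by (rule has_derivative_quadratic_remainder[OF lin rem])
qed

lemma pd_fourier:
  assumes "test_fun F" "b \<in> Basis"
  shows "pd b (fourier F) = fourier (\<lambda>x. (- \<i>) * (of_real (x \<bullet> b) * F x))"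
  by (rule ext) (rule pd_eq_coefficient[OF fourier_has_derivative[OF assms(1)] assms(2)])

lemma smooth_fourier:
  assumes "test_fun F"
  shows "smooth (fourier F)"
proof (rule smooth_coinduct[where P = "\<lambda>g. \<exists>F. test_fun F \<and> g = fourier F"])
  show "g differentiable (at x)" if "\<exists>F. test_fun F \<and> g = fourier F" for g x
    using that fourier_has_derivative unfolding differentiable_def by blast
  show "\<exists>F. test_fun F \<and> pd b g = fourier F" if g: "\<exists>F. test_fun F \<and> g = fourier F" and b: "b \<in> Basis" for g b
  proof -
    obtain F where F: "test_fun F" "g = fourier F" using g by blast
    have "test_fun (\<lambda>x. (- \<i>) * (of_real (x \<bullet> b) * F x))"
      by (intro test_fun_mult smooth_const smooth_inner F)
    then show ?thesis using pd_fourier[OF F(1) b] F(2) by blast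
  qed
qed (use assms in blast)

lemma dbound_fourier:
  assumes "test_fun F"
  shows "\<exists>A. dbound m A (wt (real N)) (fourier F)"
  using assms
proof (induction m arbitrary: F)
  case 0
  then show ?case using fourier_decay by auto
next
  case (Suc m)
  show ?case
  proof (rule dbound_Suc_exI)
    show "\<exists>A. \<forall>x. norm (fourier F x) \<le> A * wt (real N) x" by (rule fourier_decay[OF Suc.prems])
    show "\<exists>A. dbound m A (wt (real N)) (pd b (fourier F))" if "b \<in> Basis" for b
      unfolding pd_fourier[OF Suc.prems that]
      by (intro Suc.IH test_fun_mult smooth_const smooth_inner Suc.prems)
  qed (rule less_imp_le[OF wt_pos])
qed

lemma fourier_scale:
  fixes F :: "'a::euclidean_space \<Rightarrow> complex"
  assumes c: "0 < c" and [measurable]: "F \<in> borel_measurable borel"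
  shows "fourier (\<lambda>\<xi>. F (c *\<^sub>R \<xi>)) x = of_real ((1 / c) ^ DIM('a)) * fourier F ((1 / c) *\<^sub>R x)"
proof -
  have "fourier (\<lambda>\<xi>. F (c *\<^sub>R \<xi>)) x = \<bar>1 / c\<bar> ^ DIM('a) *\<^sub>R
      (\<integral>\<xi>. cis (- ((0 + (1 / c) *\<^sub>R \<xi>) \<bullet> x)) * F (c *\<^sub>R (0 + (1 / c) *\<^sub>R \<xi>)) \<partial>lborel)"
    unfolding fourier_def using c by (intro lborel_integral_affine) auto
  also have "(\<integral>\<xi>. cis (- ((0 + (1 / c) *\<^sub>R \<xi>) \<bullet> x)) * F (c *\<^sub>R (0 + (1 / c) *\<^sub>R \<xi>)) \<partial>lborel) = fourier F ((1 / c) *\<^sub>R x)"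
    unfolding fourier_def using c by simp
  finally show ?thesis using c by (simp add: scaleR_conv_of_real)
qed

text \<open>The scaling invariance that makes the bounds for the blocks uniform in \<open>j\<close>.\<close>
lemma fourier_scale_L1:
  fixes F :: "'a::euclidean_space \<Rightarrow> complex"
  assumes c: "0 < c" and F: "test_fun F"
  shows "(\<integral>x. norm (fourier (\<lambda>\<xi>. F (c *\<^sub>R \<xi>)) x) \<partial>lborel) = (\<integral>x. norm (fourier F x) \<partial>lborel)"
proof -
  have m[measurable]: "fourier F \<in> borel_measurable borel" by (rule smooth_measurable[OF smooth_fourier[OF F]])
  have "(\<integral>x. norm (fourier F x) \<partial>lborel) = \<bar>1 / c\<bar> ^ DIM('a) *\<^sub>R (\<integral>x. norm (fourier F (0 + (1 / c) *\<^sub>R x)) \<partial>lborel)"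
    using c by (intro lborel_integral_affine) auto
  also have "\<dots> = (\<integral>x. (1 / c) ^ DIM('a) * norm (fourier F ((1 / c) *\<^sub>R x)) \<partial>lborel)"
    using c by simp
  also have "\<dots> = (\<integral>x. norm (fourier (\<lambda>\<xi>. F (c *\<^sub>R \<xi>)) x) \<partial>lborel)"
  proof -
    have "norm (complex_of_real ((1 / c) ^ DIM('a))) = (1 / c) ^ DIM('a)"
      using c by (simp only: norm_of_real) simp
    then show ?thesis
      unfolding fourier_scale[OF c test_fun_measurable[OF F]] norm_mult by simp
  qed
  finally show ?thesis by simp
qed

section \<open>Cutoffs and multipliers from the dyadic partition\<close>

lemma dyadic_test_fun:
  assumes "dyadic_partition \<phi>"
  shows "test_fun \<phi>"
  using assms unfolding dyadic_partition_def test_fun_def by (auto simp: bounded_iff)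

text \<open>In this annulus only the pieces with \<open>j = 1\<close> and \<open>j = 2\<close> of the partition are nonzero.\<close>
lemma dyadic_sum_two:
  assumes \<phi>: "dyadic_partition \<phi>" and \<xi>: "2 < norm \<xi>" "norm \<xi> < 4"
  shows "\<phi> ((1/2) *\<^sub>R \<xi>) + \<phi> ((1/4) *\<^sub>R \<xi>) = 1"
proof -
  let ?g = "\<lambda>j::int. \<phi> ((2 powi (- j)) *\<^sub>R \<xi>)"
  have "\<xi> \<noteq> 0" using \<xi> by auto
  then have s: "(?g has_sum 1) UNIV" using \<phi> by (auto simp: dyadic_partition_def)
  have z: "?g j = 0" if "j \<notin> {1, 2}" for j
  proof (rule ccontr)
    assume "?g j \<noteq> 0"
    then have "1 / 2 \<le> norm ((2 powi (- j)) *\<^sub>R \<xi>) \<and> norm ((2 powi (- j)) *\<^sub>R \<xi>) \<le> 2"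
      using \<phi> by (auto simp: dyadic_partition_def)
    then have n: "1 / 2 \<le> 2 powi (- j) * norm \<xi>" "2 powi (- j) * norm \<xi> \<le> 2" by auto
    have "j \<le> 0 \<or> 3 \<le> j" using that by auto
    then show False
    proof
      assume "j \<le> 0"
      then have "(2::real) powi 0 \<le> 2 powi (- j)" by (intro power_int_increasing) auto
      then have "1 * norm \<xi> \<le> 2 powi (- j) * norm \<xi>" by (intro mult_right_mono) auto
      then show False using n \<xi> by linarith
    next
      assume "3 \<le> j"
      then have "(2::real) powi (- j) \<le> 2 powi (- 3)" by (intro power_int_increasing) auto
      then have "2 powi (- j) \<le> (1 / 8 :: real)" by (simp add: power_int_minus)
      then have "2 powi (- j) * norm \<xi> \<le> 1 / 8 * norm \<xi>" by (intro mult_right_mono) auto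
      then show False using n \<xi> by linarith
    qed
  qed
  have "(?g has_sum 1) {1, 2}"
  proof -
    have "(?g has_sum 1) UNIV \<longleftrightarrow> (?g has_sum 1) {1, 2}"
      by (rule has_sum_cong_neutral) (use z in auto)
    with s show ?thesis by simp
  qed
  then have "(\<Sum>j\<in>{1, 2}. ?g j) = 1"
    by (simp only: has_sum_finite_iff finite.intros)
  then show ?thesis by (simp add: power_int_minus)
qed

text \<open>Inside the ball of radius \<open>4\<close>, away from the origin, this is the sum of the pieces with
  \<open>j \<le> 0\<close>, written as a finite expression that is smooth at the origin too.\<close>
definition dyadic_cut :: "('a::euclidean_space \<Rightarrow> complex) \<Rightarrow> 'a \<Rightarrow> complex" where
  "dyadic_cut \<phi> \<xi> = (if norm \<xi> < 4 then 1 - \<phi> ((1/2) *\<^sub>R \<xi>) - \<phi> ((1/4) *\<^sub>R \<xi>) else 0)"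

lemma dyadic_cut:
  assumes \<phi>: "dyadic_partition \<phi>"
  shows "smooth (dyadic_cut \<phi>)" "norm \<xi> < 1 \<Longrightarrow> dyadic_cut \<phi> \<xi> = 1" "2 < norm \<xi> \<Longrightarrow> dyadic_cut \<phi> \<xi> = 0"
proof -
  have sm: "smooth \<phi>" using \<phi> by (simp add: dyadic_partition_def)
  have z: "\<phi> \<xi> = 0" if "norm \<xi> < 1/2" for \<xi>
    using \<phi> that unfolding dyadic_partition_def by (meson not_le)
  show far: "dyadic_cut \<phi> \<xi> = 0" if "2 < norm \<xi>" for \<xi>
    using dyadic_sum_two[OF \<phi> that] by (simp add: dyadic_cut_def algebra_simps)
  show "dyadic_cut \<phi> \<xi> = 1" if "norm \<xi> < 1"
    using z[of "(1/2) *\<^sub>R \<xi>"] z[of "(1/4) *\<^sub>R \<xi>"] that by (simp add: dyadic_cut_def)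
  let ?g = "\<lambda>\<xi>. 1 - \<phi> ((1/2) *\<^sub>R \<xi>) - \<phi> ((1/4) *\<^sub>R \<xi>)"
  have sg: "smooth ?g"
    using smooth_affine[OF sm, of "1/2" 0] smooth_affine[OF sm, of "1/4" 0]
    by (intro smooth_diff smooth_const) auto
  show "smooth (dyadic_cut \<phi>)"
  proof (rule smooth_local)
    fix x :: 'a
    show "\<exists>U g. open U \<and> x \<in> U \<and> smooth g \<and> (\<forall>y\<in>U. g y = dyadic_cut \<phi> y)"
    proof (cases "norm x < 4")
      case True
      then show ?thesis using sg by (intro exI[of _ "ball 0 4"] exI[of _ ?g]) (auto simp: dyadic_cut_def)
    next
      case False
      then show ?thesis using far smooth_const[of 0]
        by (intro exI[of _ "- cball 0 2"] exI[of _ "\<lambda>_. 0"]) auto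
    qed
  qed
qed

lemma cm_on_powr:
  "cm_on m (- {0}) (\<lambda>\<xi>::'a::euclidean_space. complex_of_real ((\<xi> \<bullet> \<xi>) powr a))"
proof (induction m arbitrary: a)
  case (Suc m)
  have D: "((\<lambda>\<xi>. complex_of_real ((\<xi> \<bullet> \<xi>) powr a)) has_derivative
      (\<lambda>h. of_real (a * (x \<bullet> x) powr (a - 1) * (2 * (x \<bullet> h))))) (at x)" if "x \<noteq> 0" for x :: 'a
  proof -
    have 1: "((\<lambda>x. x \<bullet> x) has_derivative (\<lambda>h. 2 * (x \<bullet> h))) (at x)"
      by (auto intro!: derivative_eq_intros simp: inner_commute)
    have "((\<lambda>y. y powr a) has_real_derivative a * (x \<bullet> x) powr (a - 1)) (at (x \<bullet> x))"
      using that by (intro has_real_derivative_powr) simp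
    then have 2: "((\<lambda>y. y powr a) has_derivative (\<lambda>y. a * (x \<bullet> x) powr (a - 1) * y)) (at (x \<bullet> x))"
      by (simp only: has_field_derivative_def)
    from has_derivative_of_real[OF has_derivative_compose[OF 1 2]] show ?thesis .
  qed
  have "cm_on m (- {0}) (pd b (\<lambda>\<xi>::'a. complex_of_real ((\<xi> \<bullet> \<xi>) powr a)))" for b
  proof (rule cm_on_cong_open)
    show "cm_on m (- {0}) (\<lambda>\<xi>::'a. of_real (2 * a) * (complex_of_real (\<xi> \<bullet> b) * of_real ((\<xi> \<bullet> \<xi>) powr (a - 1))))"
      by (intro cm_on_mult cm_on_const cm_on_inner Suc.IH) auto
    show "of_real (2 * a) * (complex_of_real (x \<bullet> b) * of_real ((x \<bullet> x) powr (a - 1))) =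
        pd b (\<lambda>\<xi>. complex_of_real ((\<xi> \<bullet> \<xi>) powr a)) x" if "x \<in> - {0}" for x :: 'a
      using that by (subst pd_eq[OF D]) (auto simp: mult_ac)
  qed auto
  then show ?case using D by (auto simp: differentiable_def)
qed auto

lemma norm_powr_eq: "norm \<xi> powr (2 * \<beta>) = (\<xi> \<bullet> \<xi>) powr \<beta>"
proof (cases "\<xi> = 0")
  case False
  then show ?thesis
    by (simp add: powr_powr[symmetric] power2_norm_eq_inner[symmetric])
qed simp

definition heat_inverse_symbol :: "real \<Rightarrow> ('a::euclidean_space \<Rightarrow> complex) \<Rightarrow> 'a \<Rightarrow> complex" where
  "heat_inverse_symbol \<beta> \<phi> \<xi> = \<phi> \<xi> * exp (of_real (norm \<xi> powr (2 * \<beta>)))"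

text \<open>The origin, where \<open>norm \<xi> powr (2 * \<beta>)\<close> is not smooth, lies outside the support of \<open>\<phi>\<close>.\<close>
lemma heat_inverse_symbol_test_fun:
  fixes \<phi> :: "'a::euclidean_space \<Rightarrow> complex"
  assumes \<phi>: "dyadic_partition \<phi>"
  shows "test_fun (heat_inverse_symbol \<beta> \<phi>)"
  unfolding test_fun_def
proof
  have z: "\<phi> \<xi> = 0" if "norm \<xi> < 1/2" for \<xi>
    using \<phi> that unfolding dyadic_partition_def by (meson not_le)
  show "smooth (heat_inverse_symbol \<beta> \<phi>)"
    unfolding smooth_iff_cm_on
  proof
    fix m
    have 1: "cm_on m (- {0}) (heat_inverse_symbol \<beta> \<phi>)"
      unfolding heat_inverse_symbol_def norm_powr_eq
      using \<phi> by (intro cm_on_mult cm_on_exp cm_on_powr) (auto simp: dyadic_partition_def smooth_iff_cm_on intro: cm_on_subset)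
    have 2: "cm_on m (ball 0 (1/2)) (heat_inverse_symbol \<beta> \<phi>)"
      by (rule cm_on_cong_open[OF _ _ cm_on_const[of m _ 0]]) (auto simp: heat_inverse_symbol_def z)
    show "cm_on m UNIV (heat_inverse_symbol \<beta> \<phi>)"
    proof (rule cm_on_UN)
      fix x :: 'a
      show "\<exists>U. x \<in> U \<and> cm_on m U (heat_inverse_symbol \<beta> \<phi>)"
      proof (cases "x = 0")
        case True
        then show ?thesis using 2 by (intro exI[of _ "ball 0 (1/2)"]) auto
      next
        case False
        then show ?thesis using 1 by (intro exI[of _ "- {0}"]) auto
      qed
    qed
  qed
  show "bounded {x. heat_inverse_symbol \<beta> \<phi> x \<noteq> 0}"
    using \<phi> by (auto simp: bounded_iff heat_inverse_symbol_def dyadic_partition_def)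
qed

section \<open>Littlewood-Paley blocks in terms of the heat extension\<close>

lemma test_fun_scale:
  assumes c: "0 < c" and F: "test_fun F"
  shows "test_fun (\<lambda>\<xi>. F (c *\<^sub>R \<xi>))"
proof -
  obtain R where R: "\<And>x. R < norm x \<Longrightarrow> F x = 0" using test_fun_support[OF F] by blast
  have "norm x \<le> R / c" if "F (c *\<^sub>R x) \<noteq> 0" for x
    using R[of "c *\<^sub>R x"] that c by (simp add: field_simps not_less[symmetric]) (use not_less in blast)
  then show ?thesis
    using smooth_affine[of F c 0] F unfolding test_fun_def by (auto simp: bounded_iff)
qed

lemma wt_0: "wt 0 x = 1"
  using wt_pos[of 0 x] by (simp add: wt_def split: if_splits)

lemma sigma_finite_lborel': "sigma_finite_measure (lborel :: 'a::euclidean_space measure)" ..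

text \<open>The number \<open>c\<close> stands for \<open>1 / 2 ^ j\<close>, the length scale of the block. The kernel \<open>heat_block_kernel\<close>
  undoes the heat flow up to \<open>block_time\<close> on the frequencies of the block, so that the block is the
  convolution of \<open>u block_time\<close> with it.\<close>
locale dyadic_data = heat_data \<beta> f "dyadic_cut \<phi>" for \<beta> and f :: "'a::euclidean_space functional" and \<phi> +
  fixes c :: real
  assumes dyadic: "dyadic_partition \<phi>" and c_pos: "0 < c"
begin

definition "fourier_const = complex_of_real ((2 * pi) ^ DIM('a))"
definition "block_symbol \<xi> = \<phi> (c *\<^sub>R \<xi>)"
definition "heat_block_symbol \<xi> = heat_inverse_symbol \<beta> \<phi> (c *\<^sub>R \<xi>)"
definition "block_kernel x = (1 / fourier_const) * fourier block_symbol x"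
definition "heat_block_kernel x = (1 / fourier_const) * fourier heat_block_symbol x"
definition "block_time = c powr (2 * \<beta>)"

lemma block_time_pos: "0 < block_time" using c_pos by (simp add: block_time_def)

lemma test_block_symbol: "test_fun block_symbol"
  unfolding block_symbol_def[abs_def] by (rule test_fun_scale[OF c_pos dyadic_test_fun[OF dyadic]])

lemma test_heat_block_symbol: "test_fun heat_block_symbol"
  unfolding heat_block_symbol_def[abs_def] by (rule test_fun_scale[OF c_pos heat_inverse_symbol_test_fun[OF dyadic]])

lemma heat_block_symbol_mult_heat: "heat_block_symbol \<xi> * of_real (exp (- block_time * norm \<xi> powr (2 * \<beta>))) = block_symbol \<xi>"
proof -
  have "norm (c *\<^sub>R \<xi>) powr (2 * \<beta>) = block_time * norm \<xi> powr (2 * \<beta>)"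
    using c_pos by (simp add: block_time_def powr_mult)
  then have "heat_block_symbol \<xi> * of_real (exp (- block_time * norm \<xi> powr (2 * \<beta>))) =
     block_symbol \<xi> * (exp (of_real (block_time * norm \<xi> powr (2 * \<beta>))) * exp (of_real (- block_time * norm \<xi> powr (2 * \<beta>))))"
    by (simp only: heat_block_symbol_def block_symbol_def heat_inverse_symbol_def exp_of_real mult.assoc)
  also have "\<dots> = block_symbol \<xi>" by (simp add: exp_add[symmetric] del: of_real_mult of_real_minus flip: of_real_add)
  finally show ?thesis .
qed

lemma smooth_scaled_fourier: "test_fun F \<Longrightarrow> smooth (\<lambda>x. (1 / fourier_const) * fourier F x)"
  by (intro smooth_cmult smooth_fourier)

lemma dbound_scaled_fourier: "test_fun F \<Longrightarrow> \<exists>A. dbound m A (wt (real N)) (\<lambda>x. (1 / fourier_const) * fourier F x)"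
  using dbound_fourier[of F m N] dbound_cmult[OF smooth_fourier] by metis

lemma bsmooth_scaled_fourier: "test_fun F \<Longrightarrow> bsmooth (\<lambda>x. (1 / fourier_const) * fourier F x)"
  unfolding bsmooth_def
proof (intro conjI allI)
  assume F: "test_fun F"
  show "smooth (\<lambda>x. (1 / fourier_const) * fourier F x)" by (rule smooth_scaled_fourier[OF F])
  fix m
  obtain A where "dbound m A (wt (real 0)) (\<lambda>x. (1 / fourier_const) * fourier F x)" using dbound_scaled_fourier[OF F] by blast
  then show "\<exists>A. dbound m A (\<lambda>_. 1) (\<lambda>x. (1 / fourier_const) * fourier F x)"
    by (intro exI[of _ A]) (erule dbound_mono, simp add: wt_0)
qed

lemma block_kernel_props: "smooth block_kernel" "\<exists>A. dbound m A (wt (real N)) block_kernel" "bsmooth block_kernel"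
  unfolding block_kernel_def[abs_def]
  by (rule smooth_scaled_fourier[OF test_block_symbol] dbound_scaled_fourier[OF test_block_symbol] bsmooth_scaled_fourier[OF test_block_symbol])+

lemma heat_block_kernel_props: "smooth heat_block_kernel" "\<exists>A. dbound m A (wt (real N)) heat_block_kernel" "bsmooth heat_block_kernel"
  unfolding heat_block_kernel_def[abs_def]
  by (rule smooth_scaled_fourier[OF test_heat_block_symbol] dbound_scaled_fourier[OF test_heat_block_symbol] bsmooth_scaled_fourier[OF test_heat_block_symbol])+

lemma decay_exponent: obtains N :: nat where "real DIM('a) + 2 * \<beta> \<le> real N" "M \<le> N"
proof -
  obtain N :: nat where "real DIM('a) + 2 * \<beta> \<le> real N" using real_arch_simple by blast
  then have "real DIM('a) + 2 * \<beta> \<le> real (max M N)" by simp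
  then show ?thesis using that[of "max M N"] by simp
qed

lemma dbound_kwt_of_wt:
  assumes "\<And>m N. \<exists>A. dbound m A (wt (real N)) (h :: 'a \<Rightarrow> complex)"
  shows "\<exists>A. dbound m A kwt h"
proof -
  obtain N :: nat where N: "real DIM('a) + 2 * \<beta> \<le> real N" using decay_exponent by blast
  obtain A where A: "dbound m A (wt (real N)) h" using assms by blast
  have A0: "0 \<le> A" by (rule weight_bound_nonneg[OF dbound_bound[OF A]])
  show ?thesis
    by (rule exI[of _ A], rule dbound_mono[OF A]) (auto simp: kwt_def intro!: mult_left_mono wt_antimono N A0)
qed

lemma schwartz_measurable: "schwartz \<eta> \<Longrightarrow> \<eta> \<in> borel_measurable borel" for \<eta> :: "'a \<Rightarrow> complex"
  by (simp add: schwartz_def smooth_measurable)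

lemma schwartz_wt: "schwartz \<eta> \<Longrightarrow> \<exists>B. \<forall>y. norm (\<eta> y) \<le> B * wt (real N) y" for \<eta> :: "'a \<Rightarrow> complex"
  unfolding schwartz_iff_dbound using dbound_bound by metis

lemma schwartz_integrable: "schwartz \<eta> \<Longrightarrow> integrable lborel \<eta>" for \<eta> :: "'a \<Rightarrow> complex"
proof -
  assume s: "schwartz \<eta>"
  obtain A where "dbound 0 A kwt \<eta>" using dbound_kwt_of_wt[of \<eta> 0] s by (auto simp: schwartz_iff_dbound)
  then have "norm (\<eta> y) \<le> A * kwt y" for y by simp
  from kwt_dominated_integrable[OF schwartz_measurable[OF s] this] show ?thesis .
qed

lemma multiplier_eq_conv:
  assumes \<eta>: "schwartz \<eta>"
  shows "fourier (\<lambda>\<xi>. block_symbol \<xi> * inv_fourier \<eta> \<xi>) = conv \<eta> (\<lambda>y. y) block_kernel"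
proof
  fix x
  have int: "integrable (lborel \<Otimes>\<^sub>M lborel) (\<lambda>(\<xi>, z). block_symbol \<xi> * \<eta> z * (cis (- (\<xi> \<bullet> x)) * cis (\<xi> \<bullet> z)))"
    by (rule integrable_product_bounded[OF sigma_finite_lborel' sigma_finite_lborel' test_fun_integrable[OF test_block_symbol] schwartz_integrable[OF \<eta>], where B = 1])
       (auto simp: norm_mult)
  have "fourier (\<lambda>\<xi>. block_symbol \<xi> * inv_fourier \<eta> \<xi>) x = (\<integral>\<xi>. (1 / fourier_const) * (\<integral>z. block_symbol \<xi> * \<eta> z * (cis (- (\<xi> \<bullet> x)) * cis (\<xi> \<bullet> z)) \<partial>lborel) \<partial>lborel)"
    unfolding fourier_def inv_fourier_def
  proof (rule Bochner_Integration.integral_cong[OF refl])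
    fix \<xi>
    have "(\<integral>z. block_symbol \<xi> * \<eta> z * (cis (- (\<xi> \<bullet> x)) * cis (\<xi> \<bullet> z)) \<partial>lborel) = (block_symbol \<xi> * cis (- (\<xi> \<bullet> x))) * (\<integral>z. cis (\<xi> \<bullet> z) * \<eta> z \<partial>lborel)"
      by (subst integral_mult_right_zero[symmetric]) (simp only: mult_ac)
    then show "cis (- (\<xi> \<bullet> x)) * (block_symbol \<xi> * ((\<integral>z. cis (\<xi> \<bullet> z) * \<eta> z \<partial>lborel) / (2 * pi) ^ DIM('a))) =
      (1 / fourier_const) * (\<integral>z. block_symbol \<xi> * \<eta> z * (cis (- (\<xi> \<bullet> x)) * cis (\<xi> \<bullet> z)) \<partial>lborel)"
      by (simp add: fourier_const_def)
  qed
  also have "\<dots> = (1 / fourier_const) * (\<integral>\<xi>. (\<integral>z. block_symbol \<xi> * \<eta> z * (cis (- (\<xi> \<bullet> x)) * cis (\<xi> \<bullet> z)) \<partial>lborel) \<partial>lborel)"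
    by (rule integral_mult_right_zero)
  also have "(\<integral>\<xi>. (\<integral>z. block_symbol \<xi> * \<eta> z * (cis (- (\<xi> \<bullet> x)) * cis (\<xi> \<bullet> z)) \<partial>lborel) \<partial>lborel) =
    (\<integral>z. (\<integral>\<xi>. block_symbol \<xi> * \<eta> z * (cis (- (\<xi> \<bullet> x)) * cis (\<xi> \<bullet> z)) \<partial>lborel) \<partial>lborel)"
    by (rule lborel_pair.Fubini_integral[OF int, symmetric])
  also have "\<dots> = (\<integral>z. \<eta> z * fourier block_symbol (x - z) \<partial>lborel)"
  proof (rule Bochner_Integration.integral_cong[OF refl])
    fix z
    have "block_symbol \<xi> * \<eta> z * (cis (- (\<xi> \<bullet> x)) * cis (\<xi> \<bullet> z)) = \<eta> z * (cis (- (\<xi> \<bullet> (x - z))) * block_symbol \<xi>)" for \<xi>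
      by (simp add: cis_mult inner_diff_right)
    then show "(\<integral>\<xi>. block_symbol \<xi> * \<eta> z * (cis (- (\<xi> \<bullet> x)) * cis (\<xi> \<bullet> z)) \<partial>lborel) = \<eta> z * fourier block_symbol (x - z)"
      unfolding fourier_def by (simp only: integral_mult_right_zero)
  qed
  also have "(1 / fourier_const) * \<dots> = conv \<eta> (\<lambda>y. y) block_kernel x"
    unfolding conv_def block_kernel_def by (subst integral_mult_right_zero[symmetric]) (simp only: mult_ac)
  finally show "fourier (\<lambda>\<xi>. block_symbol \<xi> * inv_fourier \<eta> \<xi>) x = conv \<eta> (\<lambda>y. y) block_kernel x" .
qed

lemma heat_block_kernel_ckern_conv:
  "(\<integral>y. heat_block_kernel (y - v) * ckern block_time (z - y) \<partial>lborel) = block_kernel (z - v)"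
proof -
  have kci: "integrable lborel (\<lambda>y. ckern block_time (z - y))"
    unfolding ckern_def by (intro integrable_of_real lborel_integrable_reflect kern_fourier block_time_pos)
  have int: "integrable (lborel \<Otimes>\<^sub>M lborel) (\<lambda>(\<xi>, y). heat_block_symbol \<xi> * ckern block_time (z - y) * cis (- (\<xi> \<bullet> (y - v))))"
    by (rule integrable_product_bounded[OF sigma_finite_lborel' sigma_finite_lborel' test_fun_integrable[OF test_heat_block_symbol] kci, where B = 1])
       (auto simp: norm_mult)
  have inner: "(\<integral>y. heat_block_symbol \<xi> * ckern block_time (z - y) * cis (- (\<xi> \<bullet> (y - v))) \<partial>lborel) = cis (- (\<xi> \<bullet> (z - v))) * block_symbol \<xi>" for \<xi>
  proof -
    have "(\<integral>y. heat_block_symbol \<xi> * ckern block_time (z - y) * cis (- (\<xi> \<bullet> (y - v))) \<partial>lborel) =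
      (\<integral>y. (\<lambda>w. (heat_block_symbol \<xi> * cis (- (\<xi> \<bullet> (z - v)))) * (cis (w \<bullet> \<xi>) * of_real (kern block_time w))) (z - y) \<partial>lborel)"
    proof (rule Bochner_Integration.integral_cong[OF refl])
      fix y
      have "cis (- (\<xi> \<bullet> (y - v))) = cis (- (\<xi> \<bullet> (z - v))) * cis ((z - y) \<bullet> \<xi>)"
        by (simp add: cis_mult inner_diff_right inner_diff_left inner_commute)
      then show "heat_block_symbol \<xi> * ckern block_time (z - y) * cis (- (\<xi> \<bullet> (y - v))) =
         (\<lambda>w. (heat_block_symbol \<xi> * cis (- (\<xi> \<bullet> (z - v)))) * (cis (w \<bullet> \<xi>) * of_real (kern block_time w))) (z - y)"
        by (simp add: ckern_def)
    qed
    also have "\<dots> = (\<integral>w. (heat_block_symbol \<xi> * cis (- (\<xi> \<bullet> (z - v)))) * (cis (w \<bullet> \<xi>) * of_real (kern block_time w)) \<partial>lborel)"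
      by (rule lborel_integral_reflect) measurable
    also have "\<dots> = (heat_block_symbol \<xi> * cis (- (\<xi> \<bullet> (z - v)))) * of_real (exp (- block_time * norm \<xi> powr (2 * \<beta>)))"
      by (simp only: integral_mult_right_zero kern_fourier[OF block_time_pos])
    also have "\<dots> = cis (- (\<xi> \<bullet> (z - v))) * block_symbol \<xi>"
      by (subst heat_block_symbol_mult_heat[of \<xi>, symmetric]) (simp only: mult_ac)
    finally show ?thesis .
  qed
  have "(\<integral>y. heat_block_kernel (y - v) * ckern block_time (z - y) \<partial>lborel) = (\<integral>y. (1 / fourier_const) * (\<integral>\<xi>. heat_block_symbol \<xi> * ckern block_time (z - y) * cis (- (\<xi> \<bullet> (y - v))) \<partial>lborel) \<partial>lborel)"
  proof (rule Bochner_Integration.integral_cong[OF refl])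
    fix y
    have "(\<integral>\<xi>. heat_block_symbol \<xi> * ckern block_time (z - y) * cis (- (\<xi> \<bullet> (y - v))) \<partial>lborel) = ckern block_time (z - y) * (\<integral>\<xi>. cis (- (\<xi> \<bullet> (y - v))) * heat_block_symbol \<xi> \<partial>lborel)"
      by (subst integral_mult_right_zero[symmetric]) (simp only: mult_ac)
    then show "heat_block_kernel (y - v) * ckern block_time (z - y) = (1 / fourier_const) * (\<integral>\<xi>. heat_block_symbol \<xi> * ckern block_time (z - y) * cis (- (\<xi> \<bullet> (y - v))) \<partial>lborel)"
      by (simp add: heat_block_kernel_def fourier_def)
  qed
  also have "\<dots> = (1 / fourier_const) * (\<integral>y. (\<integral>\<xi>. heat_block_symbol \<xi> * ckern block_time (z - y) * cis (- (\<xi> \<bullet> (y - v))) \<partial>lborel) \<partial>lborel)"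
    by (rule integral_mult_right_zero)
  also have "(\<integral>y. (\<integral>\<xi>. heat_block_symbol \<xi> * ckern block_time (z - y) * cis (- (\<xi> \<bullet> (y - v))) \<partial>lborel) \<partial>lborel) =
    (\<integral>\<xi>. (\<integral>y. heat_block_symbol \<xi> * ckern block_time (z - y) * cis (- (\<xi> \<bullet> (y - v))) \<partial>lborel) \<partial>lborel)"
    by (rule lborel_pair.Fubini_integral[OF int])
  also have "\<dots> = fourier block_symbol (z - v)" by (simp only: inner fourier_def)
  finally show ?thesis by (simp only: block_kernel_def)
qed

definition "block_fun v = (\<integral>y. heat_block_kernel (y - v) * u block_time y \<partial>lborel)"

text \<open>The left-hand side is \<open>f\<close> applied to the convolution of \<open>\<eta>\<close> with \<open>block_kernel\<close>. As \<open>block_kernel\<close> is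
  itself the convolution of \<open>heat_block_kernel\<close> with the heat kernel, the lemma \<open>pairing\<close> moves
  the heat kernel over to \<open>f\<close>.\<close>
lemma block_pairing:
  assumes \<eta>: "schwartz \<eta>"
  shows "f (fourier (\<lambda>\<xi>. block_symbol \<xi> * inv_fourier \<eta> \<xi>)) = (\<integral>v. block_fun v * \<eta> v \<partial>lborel)"
proof -
  note \<eta>m[measurable] = schwartz_measurable[OF \<eta>]
  note um[measurable] = u_measurable[OF block_time_pos]
  have Km[measurable]: "heat_block_kernel \<in> borel_measurable borel" using heat_block_kernel_props(1) by (rule smooth_measurable)
  have id: "(\<lambda>y::'a. y) \<in> borel_measurable borel" by simp
  note \<eta>i = schwartz_integrable[OF \<eta>]
  let ?h = "conv \<eta> (\<lambda>y. y) block_kernel"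
  let ?\<theta> = "conv \<eta> (\<lambda>y. y) heat_block_kernel"
  have sch: "schwartz ?h"
    unfolding schwartz_iff_dbound
  proof (intro conjI allI)
    show "smooth ?h" by (rule smooth_conv[OF \<eta>i id block_kernel_props(3)])
    fix m N
    obtain N' where N': "real DIM('a) + 2 * \<beta> \<le> real N'" "N \<le> N'" using decay_exponent by blast
    obtain A where A: "dbound m A (wt (real N')) block_kernel" using block_kernel_props(2) by blast
    obtain B where B: "\<And>y. norm (\<eta> y) \<le> B * wt (real N') y" using schwartz_wt[OF \<eta>] by blast
    obtain K where K: "dbound m K (wt (real N')) ?h"
      using dbound_conv_wt[OF N'(1) block_kernel_props(3) A] \<eta>m B by blast
    have K0: "0 \<le> K" by (rule weight_bound_nonneg[OF dbound_bound[OF K]])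
    have "dbound m K (wt (real N)) ?h"
      by (rule dbound_mono[OF K]) (use N'(2) in \<open>auto intro!: mult_left_mono wt_antimono K0\<close>)
    then show "\<exists>A. dbound m A (wt (real N)) ?h" by blast
  qed
  have \<theta>m: "?\<theta> \<in> borel_measurable borel"
    by (rule smooth_measurable[OF smooth_conv[OF \<eta>i id heat_block_kernel_props(3)]])
  obtain AK where AK: "dbound 0 AK kwt heat_block_kernel" using dbound_kwt_of_wt[OF heat_block_kernel_props(2)] by blast
  have AK0: "0 \<le> AK" by (rule dbound_kwt_nonneg[OF AK])
  obtain B\<eta> where B\<eta>: "\<And>y. norm (\<eta> y) \<le> B\<eta> * kwt y"
    using dbound_kwt_of_wt[of \<eta> 0] \<eta> by (auto simp: schwartz_iff_dbound)
  obtain B where B: "dbound 0 B kwt ?\<theta>"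
    using dbound_conv_wt[OF order_refl heat_block_kernel_props(3) AK[unfolded kwt_def]] \<eta>m B\<eta> unfolding kwt_def by blast
  have \<theta>B: "norm (?\<theta> y) \<le> B * kwt y" for y by (rule dbound_bound[OF B])
  have kci: "integrable lborel (\<lambda>y. ckern block_time (z - y))" for z :: 'a
    unfolding ckern_def by (intro integrable_of_real lborel_integrable_reflect kern_fourier block_time_pos)
  obtain M where M: "\<And>x. norm (heat_block_kernel x) \<le> M"
    using heat_block_kernel_props(3) unfolding bsmooth_def by (metis mult_1_right dbound_bound)
  have h_eq: "conv ?\<theta> (\<lambda>y. y) (ckern block_time) = ?h"
  proof
    fix z
    have int: "integrable (lborel \<Otimes>\<^sub>M lborel) (\<lambda>(v, y). \<eta> v * ckern block_time (z - y) * heat_block_kernel (y - v))"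
      by (rule integrable_product_bounded[OF sigma_finite_lborel' sigma_finite_lborel' \<eta>i kci, where B = M])
         (use M in auto)
    have "conv ?\<theta> (\<lambda>y. y) (ckern block_time) z = (\<integral>y. (\<integral>v. \<eta> v * ckern block_time (z - y) * heat_block_kernel (y - v) \<partial>lborel) \<partial>lborel)"
      unfolding conv_def
      by (intro Bochner_Integration.integral_cong refl)
         (subst integral_mult_left_zero[symmetric], simp only: mult_ac)
    also have "\<dots> = (\<integral>v. (\<integral>y. \<eta> v * ckern block_time (z - y) * heat_block_kernel (y - v) \<partial>lborel) \<partial>lborel)"
      by (rule lborel_pair.Fubini_integral[OF int])
    also have "\<dots> = (\<integral>v. \<eta> v * (\<integral>y. heat_block_kernel (y - v) * ckern block_time (z - y) \<partial>lborel) \<partial>lborel)"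
      by (intro Bochner_Integration.integral_cong refl)
         (subst integral_mult_right_zero[symmetric], simp only: mult_ac)
    also have "\<dots> = ?h z" by (simp only: heat_block_kernel_ckern_conv conv_def)
    finally show "conv ?\<theta> (\<lambda>y. y) (ckern block_time) z = ?h z" .
  qed
  have "f (fourier (\<lambda>\<xi>. block_symbol \<xi> * inv_fourier \<eta> \<xi>)) = mass ?h"
    by (simp only: multiplier_eq_conv[OF \<eta>] mass_schwartz(2)[OF sch])
  also have "\<dots> = (\<integral>y. ?\<theta> y * u block_time y \<partial>lborel)"
    by (simp only: h_eq[symmetric] pairing[OF block_time_pos \<theta>m \<theta>B])
  also have "\<dots> = (\<integral>y. (\<integral>v. \<eta> v * heat_block_kernel (y - v) * u block_time y \<partial>lborel) \<partial>lborel)"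
    unfolding conv_def by (simp only: integral_mult_left_zero)
  also have "\<dots> = (\<integral>v. (\<integral>y. \<eta> v * heat_block_kernel (y - v) * u block_time y \<partial>lborel) \<partial>lborel)"
  proof (rule lborel_pair.Fubini_integral)
    \<comment> \<open>The weights make both outer factors integrable: \<open>\<eta>\<close> absorbs the factor that Peetre's inequality
       costs, and \<open>kwt\<close> makes \<open>u\<close> integrable.\<close>
    let ?a = "real DIM('a) + 2 * \<beta>"
    let ?p = "\<lambda>v::'a. complex_of_real ((1 + norm v) powr ?a)"
    have p0: "?p v \<noteq> 0" for v
      using add_pos_nonneg[OF zero_less_one norm_ge_zero[of v]] by simp
    have w0: "complex_of_real (kwt y) \<noteq> 0" for y :: 'a
      using kwt_pos[of y] by simp
    have f1: "integrable lborel (\<lambda>v. \<eta> v * ?p v)"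
    proof -
      obtain N where N: "2 * ?a \<le> real N" using real_arch_simple by blast
      obtain B where B: "\<And>y. norm (\<eta> y) \<le> B * wt (real N) y" using schwartz_wt[OF \<eta>] by blast
      have B0: "0 \<le> B" by (rule weight_bound_nonneg[OF B])
      show ?thesis
      proof (rule kwt_dominated_integrable[where B = B])
        fix v
        have "norm (\<eta> v * ?p v) \<le> (B * wt (real N) v) * (1 + norm v) powr ?a"
          using B[of v] by (simp add: norm_mult mult_right_mono)
        also have "\<dots> = B * wt (real N - ?a) v"
          unfolding wt_def by (simp add: mult.assoc flip: powr_add)
        also have "\<dots> \<le> B * kwt v"
          unfolding kwt_def using N by (intro mult_left_mono wt_antimono B0) auto
        finally show "norm (\<eta> v * ?p v) \<le> B * kwt v" .
      qed measurable
    qed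
    have f2: "integrable lborel (\<lambda>y. of_real (kwt y) * u block_time y)"
      by (rule Bochner_Integration.integrable_bound[OF u_kwt_integrable[OF block_time_pos]])
         (auto simp: norm_mult kwt_nonneg)
    have "integrable (lborel \<Otimes>\<^sub>M lborel) (\<lambda>(v, y). (\<eta> v * ?p v) * (of_real (kwt y) * u block_time y) * (heat_block_kernel (y - v) / (?p v * of_real (kwt y))))"
    proof (rule integrable_product_bounded[OF sigma_finite_lborel' sigma_finite_lborel' f1 f2, where B = AK])
      fix v y :: 'a
      have "norm (heat_block_kernel (y - v)) \<le> AK * kwt (y - v)" by (rule dbound_bound[OF AK])
      also have "\<dots> \<le> AK * ((1 + norm v) powr ?a * kwt y)" by (intro mult_left_mono kwt_peetre AK0)
      finally show "norm (heat_block_kernel (y - v) / (?p v * of_real (kwt y))) \<le> AK"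
        using kwt_pos[of y] add_pos_nonneg[OF zero_less_one norm_ge_zero[of v]]
        by (simp add: norm_divide norm_mult pos_divide_le_eq)
    qed measurable
    then show "integrable (lborel \<Otimes>\<^sub>M lborel) (\<lambda>(v, y). \<eta> v * heat_block_kernel (y - v) * u block_time y)"
      using p0 w0 by (rule_tac Bochner_Integration.integrable_cong[THEN iffD1, rotated 2]) (auto simp: field_simps)
  qed
  also have "\<dots> = (\<integral>v. block_fun v * \<eta> v \<partial>lborel)"
    unfolding block_fun_def
    by (intro Bochner_Integration.integral_cong refl)
       (subst integral_mult_left_zero[symmetric], simp only: mult_ac)
  finally show ?thesis .
qed

lemma block_measurable: "block_fun \<in> borel_measurable borel"
proof -
  note [measurable] = u_measurable[OF block_time_pos]
  have [measurable]: "heat_block_kernel \<in> borel_measurable borel" using heat_block_kernel_props(1) by (rule smooth_measurable)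
  show ?thesis unfolding block_fun_def by measurable
qed

lemma block_bound:
  assumes M: "\<And>y. norm (u block_time y) \<le> M"
  shows "norm (block_fun v) \<le> (\<integral>x. norm (fourier (heat_inverse_symbol \<beta> \<phi>) x) \<partial>lborel) / (2 * pi) ^ DIM('a) * M"
proof -
  note [measurable] = u_measurable[OF block_time_pos]
  have Km[measurable]: "heat_block_kernel \<in> borel_measurable borel" using heat_block_kernel_props(1) by (rule smooth_measurable)
  obtain AK where AK: "dbound 0 AK kwt heat_block_kernel" using dbound_kwt_of_wt[OF heat_block_kernel_props(2)] by blast
  have Ki: "integrable lborel heat_block_kernel" by (rule kwt_dominated_integrable[OF Km dbound_bound[OF AK]])
  have Ki': "integrable lborel (\<lambda>y. heat_block_kernel (y - v))"
    using lborel_integrable_affine[of 1 heat_block_kernel "- v"] Ki by simp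
  have n: "norm (heat_block_kernel (y - v) * u block_time y) \<le> norm (heat_block_kernel (y - v)) * M" for y
    using M by (simp add: norm_mult mult_left_mono)
  have i: "integrable lborel (\<lambda>y. norm (heat_block_kernel (y - v)) * M)" using Ki' by auto
  have i2: "integrable lborel (\<lambda>y. heat_block_kernel (y - v) * u block_time y)"
    by (rule Bochner_Integration.integrable_bound[OF i])
       (use n in \<open>auto intro!: AE_I2 intro: order_trans[OF _ abs_ge_self]\<close>)
  have "norm (block_fun v) \<le> (\<integral>y. norm (heat_block_kernel (y - v)) * M \<partial>lborel)"
    unfolding block_fun_def by (rule Bochner_Integration.integral_norm_bound_integral[OF i2 i n])
  also have "\<dots> = (\<integral>y. norm (heat_block_kernel (y - v)) \<partial>lborel) * M" by simp
  also have "(\<integral>y. norm (heat_block_kernel (y - v)) \<partial>lborel) = (\<integral>y. norm (heat_block_kernel y) \<partial>lborel)"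
    using lborel_integral_affine[of 1 "\<lambda>y. norm (heat_block_kernel y)" "- v"] by simp
  also have "\<dots> = (\<integral>y. norm (fourier heat_block_symbol y) \<partial>lborel) / (2 * pi) ^ DIM('a)"
    by (simp add: heat_block_kernel_def fourier_const_def norm_mult norm_divide norm_power)
  also have "(\<integral>y. norm (fourier heat_block_symbol y) \<partial>lborel) = (\<integral>x. norm (fourier (heat_inverse_symbol \<beta> \<phi>) x) \<partial>lborel)"
    unfolding heat_block_symbol_def[abs_def] by (rule fourier_scale_L1[OF c_pos heat_inverse_symbol_test_fun[OF dyadic]])
  finally show ?thesis .
qed

lemma dyadic_block_bound:
  assumes c: "c = 2 powi (- j)" and M: "\<And>y. norm (u block_time y) \<le> M"
  shows "dist_Linf_norm (dyadic_block \<phi> j f) \<le>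
    ennreal ((\<integral>x. norm (fourier (heat_inverse_symbol \<beta> \<phi>) x) \<partial>lborel) / (2 * pi) ^ DIM('a) * M)"
proof -
  have "dist_Linf_norm (dyadic_block \<phi> j f) \<le> Linf_norm block_fun"
    unfolding dist_Linf_norm_def
  proof (rule INF_lower, rule CollectI, intro conjI allI impI)
    show "block_fun \<in> borel_measurable lborel" using block_measurable by simp
    fix \<eta> :: "'a \<Rightarrow> complex" assume "schwartz \<eta>"
    from block_pairing[OF this] show "dyadic_block \<phi> j f \<eta> = (\<integral>x. block_fun x * \<eta> x \<partial>lborel)"
      by (simp add: dyadic_block_def dist_inv_fourier_def dist_mult_def dist_fourier_def block_symbol_def c[symmetric])
  qed
  also have "\<dots> \<le> ennreal ((\<integral>x. norm (fourier (heat_inverse_symbol \<beta> \<phi>) x) \<partial>lborel) / (2 * pi) ^ DIM('a) * M)"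
    unfolding Linf_norm_def
    using block_measurable block_bound[OF M] by (intro esssup_I AE_I2 ennreal_leI) auto
  finally show ?thesis .
qed

end

section \<open>The embedding\<close>

lemma Linf_norm_bound:
  assumes a: "0 < a" and F: "F \<in> borel_measurable borel" and le: "\<And>x. ennreal (a * norm (F x)) \<le> X"
  shows "ennreal a * Linf_norm F \<le> X"
proof (cases X)
  case (real q)
  have "norm (F x) \<le> q / a" for x
    using le[of x] real a by (simp add: pos_le_divide_eq mult.commute)
  then have "Linf_norm F \<le> ennreal (q / a)"
    unfolding Linf_norm_def using F by (intro esssup_I AE_I2 ennreal_leI) auto
  then have "ennreal a * Linf_norm F \<le> ennreal a * ennreal (q / a)" by (rule mult_left_mono) simp
  also have "\<dots> = ennreal (a * (q / a))" using a by (intro ennreal_mult'[symmetric]) simp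
  also have "\<dots> = X" using a real by simp
  finally show ?thesis .
qed simp

theorem mainTheorem5:
  fixes \<beta> \<zeta> :: real and \<phi> :: "real ^ 'n \<Rightarrow> complex"
  assumes "1 / 2 < \<beta>" and "\<beta> < 1"
    and "0 \<le> \<zeta>" and "\<zeta> \<le> real CARD('n) / 2"
    and "dyadic_partition \<phi>"
  shows "(\<exists>C>0::real. \<forall>(f :: (real ^ 'n) functional) r.
            tempered f \<longrightarrow> heat_defined \<beta> f \<longrightarrow> 0 < r \<longrightarrow>
            ennreal (r powr \<zeta>) * Linf_norm (frac_heat \<beta> (r powr (2 * \<beta>)) f)
            \<le> ennreal C * (SUP x0. ennsqrt (ennreal (r powr - real CARD('n)) *
                (\<integral>\<^sup>+ s \<in> {0<..<r powr (2 * \<beta>)}. (\<integral>\<^sup>+ x \<in> cball x0 r.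
                   ennreal (s powr ((\<zeta> - \<beta>) / \<beta>) * (norm (frac_heat \<beta> s f x))\<^sup>2)
                 \<partial>lborel) \<partial>lborel))))
       \<and> (bmo_space \<beta> \<zeta> :: (real ^ 'n) functional set) \<subseteq> besov_space \<phi> (- \<zeta>)
       \<and> (\<exists>C>0::real. \<forall>f \<in> (bmo_space \<beta> \<zeta> :: (real ^ 'n) functional set).
            besov_norm \<phi> (- \<zeta>) f \<le> ennreal C * bmo_norm \<beta> \<zeta> f)"
proof -
  interpret fractional \<beta> by standard (use assms in auto)
  let ?e = "(\<zeta> - \<beta>) / \<beta>"
  let ?cut = "dyadic_cut \<phi>"
  have dim: "DIM(real ^ 'n) = CARD('n)" by simp
  have hd: "heat_data \<beta> f ?cut" if "tempered f" "heat_defined \<beta> f" for f :: "(real ^ 'n) functional"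
  proof unfold_locales
    show "dyadic_cut \<phi> x = 0" if "3 < norm x" for x
      using that by (intro dyadic_cut(3)[OF assms(5)]) simp
  qed (use that dyadic_cut[OF assms(5)] in auto)
  obtain C where C: "0 < C" "\<And>(f :: (real ^ 'n) functional) cut r x. heat_data \<beta> f cut \<Longrightarrow> 0 < r \<Longrightarrow>
     ennreal (r powr \<zeta> * norm (frac_heat \<beta> (r powr (2 * \<beta>)) f x)) \<le>
     ennreal C * (SUP x0. ennsqrt (heat_data.local_energy \<beta> f ?e r x0))"
    using heat_pointwise_bound[OF assms(3), where 'a = "real ^ 'n"] by blast
  define L where "L = (\<integral>x. norm (fourier (heat_inverse_symbol \<beta> \<phi>) x) \<partial>lborel) / (2 * pi) ^ CARD('n)"
  have L: "0 \<le> L" unfolding L_def by (intro divide_nonneg_nonneg Bochner_Integration.integral_nonneg) auto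
  have part1: "ennreal (r powr \<zeta>) * Linf_norm (frac_heat \<beta> (r powr (2 * \<beta>)) f)
            \<le> ennreal C * (SUP x0. ennsqrt (ennreal (r powr - real CARD('n)) *
                (\<integral>\<^sup>+ s \<in> {0<..<r powr (2 * \<beta>)}. (\<integral>\<^sup>+ x \<in> cball x0 r.
                   ennreal (s powr ?e * (norm (frac_heat \<beta> s f x))\<^sup>2)
                 \<partial>lborel) \<partial>lborel)))" (is "_ \<le> ennreal C * (SUP x0. ennsqrt (?I x0))")
    if f: "tempered f" "heat_defined \<beta> f" and r: "0 < r" for f :: "(real ^ 'n) functional" and r
  proof -
    interpret heat_data \<beta> f ?cut by (rule hd[OF f])
    have "local_energy ?e r x0 \<le> ?I x0" for x0
      unfolding local_energy_def dim
      by (intro mult_left_mono nn_integral_mono mult_right_mono) (auto simp: indicator_def)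
    then have "(SUP x0. ennsqrt (local_energy ?e r x0)) \<le> (SUP x0. ennsqrt (?I x0))"
      by (intro SUP_mono' ennsqrt_mono)
    then have "ennreal C * (SUP x0. ennsqrt (local_energy ?e r x0)) \<le> ennreal C * (SUP x0. ennsqrt (?I x0))"
      by (rule mult_left_mono) simp
    then show ?thesis
      using r u_measurable[of "r powr (2 * \<beta>)"] C(2)[OF hd[OF f] r]
      by (intro Linf_norm_bound) (auto simp: u_def intro: order_trans)
  qed
  \<comment> \<open>The summand \<open>1\<close> only makes the constant positive.\<close>
  have part2: "besov_norm \<phi> (- \<zeta>) f \<le> ennreal (L * C + 1) * bmo_norm \<beta> \<zeta> f"
    if f: "f \<in> bmo_space \<beta> \<zeta>" for f :: "(real ^ 'n) functional"
  proof -
    have f': "tempered f" "heat_defined \<beta> f" "bmo_norm \<beta> \<zeta> f < \<infinity>" using f by (auto simp: bmo_space_def)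
    interpret heat_data \<beta> f ?cut by (rule hd[OF f'(1,2)])
    obtain b where b: "0 \<le> b" "bmo_norm \<beta> \<zeta> f = ennreal b" using f'(3) by (cases "bmo_norm \<beta> \<zeta> f") auto
    have energy_le: "ennsqrt (local_energy ?e r x0) \<le> bmo_norm \<beta> \<zeta> f" if "0 < r" for r x0
      unfolding bmo_norm_def local_energy_def dim
      using that by (intro ennsqrt_mono SUP_upper2[of "(x0, r)"]) auto
    have u_le: "norm (u (r powr (2 * \<beta>)) x) \<le> C * b * r powr (- \<zeta>)" if r: "0 < r" for r x
    proof -
      have "ennreal (r powr \<zeta> * norm (u (r powr (2 * \<beta>)) x)) \<le> ennreal C * (SUP x0. ennsqrt (local_energy ?e r x0))"
        unfolding u_def by (rule C(2)[OF hd[OF f'(1,2)] r])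
      also have "\<dots> \<le> ennreal C * bmo_norm \<beta> \<zeta> f"
        by (intro mult_left_mono SUP_least energy_le r) simp
      also have "\<dots> = ennreal (C * b)" using C(1) b by (simp add: ennreal_mult')
      finally have "r powr \<zeta> * norm (u (r powr (2 * \<beta>)) x) \<le> C * b"
        using C(1) b(1) by simp
      then show ?thesis using r by (simp add: powr_minus field_simps)
    qed
    have block_le: "ennreal (2 powr (- \<zeta> * real_of_int j)) * dist_Linf_norm (dyadic_block \<phi> j f) \<le> ennreal (L * C * b)" for j
    proof -
      let ?c = "2 powi (- j) :: real"
      interpret dyadic_data \<beta> f \<phi> ?c
        by unfold_locales (use assms(5) in auto)
      have "dist_Linf_norm (dyadic_block \<phi> j f) \<le> ennreal (L * (C * b * ?c powr (- \<zeta>)))"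
        unfolding L_def dim[symmetric]
        by (rule dyadic_block_bound[OF refl]) (unfold block_time_def, rule u_le, simp)
      then have "ennreal (2 powr (- \<zeta> * real_of_int j)) * dist_Linf_norm (dyadic_block \<phi> j f) \<le>
        ennreal (2 powr (- \<zeta> * real_of_int j)) * ennreal (L * (C * b * ?c powr (- \<zeta>)))"
        by (rule mult_left_mono) simp
      also have "\<dots> = ennreal (2 powr (- \<zeta> * real_of_int j) * (L * (C * b * ?c powr (- \<zeta>))))"
        by (rule ennreal_mult'[symmetric]) simp
      also have "2 powr (- \<zeta> * real_of_int j) * (L * (C * b * ?c powr (- \<zeta>))) = L * C * b"
      proof -
        have "?c = 2 powr (- real_of_int j)" using powr_real_of_int'[of 2 "- j"] by simp
        then have "?c powr (- \<zeta>) = 2 powr (\<zeta> * real_of_int j)" by (simp add: powr_powr mult.commute)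
        then have "2 powr (- \<zeta> * real_of_int j) * ?c powr (- \<zeta>) = 1" by (simp flip: powr_add)
        then show ?thesis by (simp add: mult_ac)
      qed
      finally show ?thesis .
    qed
    have "besov_norm \<phi> (- \<zeta>) f \<le> ennreal (L * C * b)"
      unfolding besov_norm_def by (intro SUP_least block_le)
    also have "\<dots> \<le> ennreal ((L * C + 1) * b)"
      using b(1) by (intro ennreal_leI mult_right_mono) auto
    also have "\<dots> = ennreal (L * C + 1) * bmo_norm \<beta> \<zeta> f"
      using L C(1) b by (simp add: ennreal_mult')
    finally show ?thesis .
  qed
  have LC: "0 < L * C + 1" using L C(1) by (simp add: add_nonneg_pos)
  have part3: "bmo_space \<beta> \<zeta> \<subseteq> besov_space \<phi> (- \<zeta>)"
  proof
    fix f :: "(real ^ 'n) functional" assume f: "f \<in> bmo_space \<beta> \<zeta>"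
    have "ennreal (L * C + 1) * bmo_norm \<beta> \<zeta> f < \<infinity>"
      using f by (simp add: bmo_space_def ennreal_mult_less_top)
    with part2[OF f] have "besov_norm \<phi> (- \<zeta>) f < \<infinity>" by (rule le_less_trans)
    then show "f \<in> besov_space \<phi> (- \<zeta>)" using f by (simp add: bmo_space_def besov_space_def)
  qed
  show ?thesis
    using C(1) LC part1 part2 part3 by blast
qed

end
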